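(* Let $\mathbb{K}=\mathbb{C}((\hslash))$, let $\mathfrak{g}$ be the split simple Lie algebra over $\mathbb{K}$ of type $B_n$, $C_n$ or $D_n$ with corresponding group $G$, and let $r$ be an $r$-matrix from the Belavin--Drinfeld list with admissible triple $(\Gamma_1,\Gamma_2,\tau)$, such that $r$ and $r^{21}$ are conjugate by an element of $G(\overline{\mathbb{K}})$ and the triple is one of the following: $\Gamma_1=\Gamma_2=\emptyset$ (any of the types; in this case $r$ is the Drinfeld--Jimbo $r$-matrix $r_{DJ}$), or, for type $D_n$ with $n$ odd: (1) $\Gamma_1=\{\alpha_{n-1}\}$, $\tau(\alpha_{n-1})=\alpha_n$; (2) $\Gamma_1=\{\alpha_n\}$, $\tau(\alpha_n)=\alpha_{n-1}$; (3) $\Gamma_1=\{\alpha_{n-1},\alpha_k\}$, $\tau(\alpha_{n-1})=\alpha_k$, $\tau(\alpha_k)=\alpha_n$, for some $k\notin\{n-1,n\}$; (4) $\Gamma_1=\{\alpha_n,\alpha_k\}$, $\tau(\alpha_n)=\alpha_k$, $\tau(\alpha_k)=\alpha_{n-1}$, for some $k\notin\{n-1,n\}$. Then $|\overline{H}^1_{BD}(G,r)|=1$ if $r=r_{DJ}$ (that is, $\Gamma_1=\Gamma_2=\emptyset$), and $|\overline{H}^1_{BD}(G,r)|=2$ if $r\ne r_{DJ}$.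
   Context: Setting. $\overline{\mathbb{K}}$ is an algebraic closure of $\mathbb{K}$. $\mathfrak{g}$ is assumed simple (so $n\ge 3$ for $D_n$). Put $M=2n+1$ for $B_n$ and $M=2n$ for $C_n, D_n$. $B$ is the $M\times M$ matrix with $1$'s on the antidiagonal and $0$ elsewhere for $B_n, D_n$; for $C_n$ it has $1$'s on the upper half of the antidiagonal, $-1$'s on the lower half and $0$ elsewhere. $G=\{X\in SL(M): XBX^T=B\}$, $\mathfrak{g}=\{X: XB+BX^T=0\}$. $H\subset G$ is the subgroup of diagonal matrices and $\mathfrak{h}\subset\mathfrak{g}$ the subalgebra of diagonal matrices. Elements of $H$ are $(d_1,\dots,d_n):=\mathrm{diag}(d_1,\dots,d_n,1,d_n^{-1},\dots,d_1^{-1})$ for $B_n$ and $(d_1,\dots,d_n):=\mathrm{diag}(d_1,\dots,d_n,d_n^{-1},\dots,d_1^{-1})$ for $C_n,D_n$. The simple roots $\alpha_1,\dots,\alpha_n$ correspond to the characters $e^{\alpha_i}(d_1,\dots,d_n)=d_id_{i+1}^{-1}$ for $i<n$, and $e^{\alpha_n}(d_1,\dots,d_n)=d_n$ for $B_n$, $d_n^2$ for $C_n$, $d_{n-1}d_n$ for $D_n$. Belavin--Drinfeld list. An admissible triple $(\Gamma_1,\Gamma_2,\tau)$ consists of subsets $\Gamma_1,\Gamma_2$ of the set of simple roots and an isometric bijection $\tau:\Gamma_1\to\Gamma_2$ such that for every $\alpha\in\Gamma_1$ there is $k\ge 1$ with $\tau^k(\alpha)\notin\Gamma_1$. A Belavin--Drinfeld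 $r$-matrix for this triple is $$r=r_0+\sum_{\alpha>0}e_{-\alpha}\otimes e_\alpha+\sum_{\alpha\in \mathrm{Span}(\Gamma_1)^+}\sum_{k\ge1}e_{-\alpha}\wedge e_{\tau^k(\alpha)}\in\mathfrak{g}(\overline{\mathbb{K}})\otimes\mathfrak{g}(\overline{\mathbb{K}}),$$ where $\mathrm{Span}(\Gamma_1)^+$ is the set of positive roots that are integer combinations of $\Gamma_1$, $\tau$ is extended linearly, only defined $\tau^k(\alpha)$ occur, $a\wedge b=a\otimes b-b\otimes a$, the root vectors satisfy $K(e_\alpha,e_{-\alpha})=1$ ($K$ the Killing form) and are compatible with the Lie algebra isomorphism given by $e_{\pm\alpha}\mapsto e_{\pm\tau(\alpha)}$, $\alpha\in\Gamma_1$, and $r_0\in\mathfrak{h}\otimes\mathfrak{h}$ satisfies $r_0+r_0^{21}=\sum t_k\otimes t_k$ ($t_k$ an orthonormal basis of $\mathfrak{h}$) and $(\tau(\alpha)\otimes\mathrm{id}+\mathrm{id}\otimes\alpha)r_0=0$ for all $\alpha\in\Gamma_1$. $r^{21}$ is $r$ with tensor factors swapped. Twisted cohomology. $C(r)=\{X\in G(\overline{\mathbb{K}}): \mathrm{Ad}_X r=r\}$, where $\mathrm{Ad}_X$ acts on tensors as $\mathrm{Ad}_X\otimes\mathrm{Ad}_X$. Fix $\sigma_0\in\mathrm{Gal}(\overline{\mathbb{K}}/\mathbb{K})$ with $\sigma_0(\sqrt\hslash)=-\sqrt\hslash$. A twisted Belavin--Drinfeld cocycle for $r$ is $X\in G(\overline{\mathbb{K}})$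 such that $X^{-1}\sigma(X)\in C(r)$ for all $\sigma\in\mathrm{Gal}(\overline{\mathbb{K}}/\mathbb{K}[\sqrt\hslash])$ and $\mathrm{Ad}_{X^{-1}\sigma_0(X)}r=r^{21}$. (This does not depend on the choice of $\sigma_0$.) Two twisted cocycles $X_1,X_2$ are equivalent if $X_1=QX_2C$ for some $Q\in G(\mathbb{K})$, $C\in C(r)$. $\overline{H}^1_{BD}(G,r)$ is the set of equivalence classes of twisted cocycles.
   Formalization: The root vectors e_α are required to lie in the split Lie algebra over K (entries in K), not merely in g over the algebraic closure; rescaling them by scalars outside K in cases (3) and (4) can leave no twisted cocycles, so the claim would fail. r_0 may still have coefficients in the closure. *)

theory Defs
  imports
    "HOL-Computational_Algebra.Formal_Laurent_Series"
    "HOL-Algebra.Algebraic_Closure_Type"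
    "Jordan_Normal_Form.Determinant"
    "Jordan_Normal_Form.Gauss_Jordan_Elimination"
begin

datatype classical_type = Type_B | Type_C | Type_D

fun msize :: "classical_type \<Rightarrow> nat \<Rightarrow> nat" where
  "msize Type_B n = 2 * n + 1"
| "msize Type_C n = 2 * n"
| "msize Type_D n = 2 * n"

text \<open>Matrix indices start at 0, so that the antidiagonal is \<^term>\<open>i + j = M - 1\<close>. For type C the
  upper half of the antidiagonal consists of the rows \<^term>\<open>i < n\<close>.\<close>

definition form_mat :: "classical_type \<Rightarrow> nat \<Rightarrow> 'a :: comm_ring_1 mat" where
  "form_mat ty n = mat (msize ty n) (msize ty n) (\<lambda>(i, j).
     if i + j = msize ty n - 1 then (if ty = Type_C \<and> n \<le> i then - 1 else 1) else 0)"

definition classical_group :: "classical_type \<Rightarrow> nat \<Rightarrow> 'a :: comm_ring_1 mat set" where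
  "classical_group ty n = {x \<in> carrier_mat (msize ty n) (msize ty n).
     det x = 1 \<and> x * form_mat ty n * transpose_mat x = form_mat ty n}"

definition lie_alg :: "classical_type \<Rightarrow> nat \<Rightarrow> 'a :: comm_ring_1 mat set" where
  "lie_alg ty n = {x \<in> carrier_mat (msize ty n) (msize ty n).
     x * form_mat ty n + form_mat ty n * transpose_mat x = 0\<^sub>m (msize ty n) (msize ty n)}"

definition cartan_subalg :: "classical_type \<Rightarrow> nat \<Rightarrow> 'a :: comm_ring_1 mat set" where
  "cartan_subalg ty n = {x \<in> lie_alg ty n. diagonal_mat x}"

definition lie_bracket :: "'a :: ring mat \<Rightarrow> 'a mat \<Rightarrow> 'a mat" where
  "lie_bracket x y = x * y - y * x"

definition Ad :: "'a :: field mat \<Rightarrow> 'a mat \<Rightarrow> 'a mat" where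
  "Ad x y = x * y * the (mat_inverse x)"

definition mat_lincomb :: "nat \<Rightarrow> nat \<Rightarrow> (nat \<Rightarrow> 'a) \<Rightarrow> (nat \<Rightarrow> 'a mat) \<Rightarrow> 'a :: comm_ring_1 mat" where
  "mat_lincomb M m c b = mat M M (\<lambda>(i, j). \<Sum>p<m. c p * b p $$ (i, j))"

definition mat_basis :: "nat \<Rightarrow> 'a :: comm_ring_1 mat set \<Rightarrow> nat \<Rightarrow> (nat \<Rightarrow> 'a mat) \<Rightarrow> bool" where
  "mat_basis M V m b \<longleftrightarrow>
     (\<forall>p<m. b p \<in> V) \<and>
     (\<forall>v\<in>V. \<exists>c. v = mat_lincomb M m c b) \<and>
     (\<forall>c. mat_lincomb M m c b = 0\<^sub>m M M \<longrightarrow> (\<forall>p<m. c p = 0))"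

text \<open>The trace of a linear endomorphism \<^term>\<open>f\<close> of a subspace \<^term>\<open>V\<close> of the square matrices of
  size \<^term>\<open>M\<close>, computed in any basis of \<^term>\<open>V\<close>.\<close>

definition endo_trace :: "nat \<Rightarrow> 'a :: comm_ring_1 mat set \<Rightarrow> ('a mat \<Rightarrow> 'a mat) \<Rightarrow> 'a" where
  "endo_trace M V f = (THE t. \<exists>m b c. mat_basis M V m b \<and>
     (\<forall>p<m. f (b p) = mat_lincomb M m (c p) b) \<and> t = (\<Sum>p<m. c p p))"

definition killing :: "classical_type \<Rightarrow> nat \<Rightarrow> 'a :: comm_ring_1 mat \<Rightarrow> 'a mat \<Rightarrow> 'a" where
  "killing ty n x y =
     endo_trace (msize ty n) (lie_alg ty n) (\<lambda>z. lie_bracket x (lie_bracket y z))"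

definition lie_subalg :: "classical_type \<Rightarrow> nat \<Rightarrow> 'a :: comm_ring_1 mat set \<Rightarrow> bool" where
  "lie_subalg ty n L \<longleftrightarrow> L \<subseteq> lie_alg ty n \<and> 0\<^sub>m (msize ty n) (msize ty n) \<in> L \<and>
     (\<forall>x\<in>L. \<forall>y\<in>L. x + y \<in> L \<and> lie_bracket x y \<in> L) \<and> (\<forall>c. \<forall>x\<in>L. c \<cdot>\<^sub>m x \<in> L)"

definition lie_generated :: "classical_type \<Rightarrow> nat \<Rightarrow> 'a :: comm_ring_1 mat set \<Rightarrow> 'a mat set" where
  "lie_generated ty n S = \<Inter>{L. lie_subalg ty n L \<and> S \<subseteq> L}"

definition lie_iso :: "('a :: comm_ring_1 mat \<Rightarrow> 'a mat) \<Rightarrow> 'a mat set \<Rightarrow> 'a mat set \<Rightarrow> bool" where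
  "lie_iso \<theta> L L' \<longleftrightarrow> bij_betw \<theta> L L' \<and>
     (\<forall>x\<in>L. \<forall>y\<in>L. \<theta> (x + y) = \<theta> x + \<theta> y \<and> \<theta> (lie_bracket x y) = lie_bracket (\<theta> x) (\<theta> y)) \<and>
     (\<forall>c. \<forall>x\<in>L. \<theta> (c \<cdot>\<^sub>m x) = c \<cdot>\<^sub>m \<theta> x)"

text \<open>A tensor in the tensor square of the matrix algebra is written in block form: the block
  \<^term>\<open>T $$ (i, j)\<close> is the second factor belonging to the matrix unit with index \<^term>\<open>(i, j)\<close> in
  the first factor. In particular, a linear map or functional \<^term>\<open>f\<close> acts on the second factor as
  \<^term>\<open>map_mat f\<close>.\<close>

type_synonym 'a tensor = "'a mat mat"

definition tensor :: "'a :: comm_ring_1 mat \<Rightarrow> 'a mat \<Rightarrow> 'a tensor" where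
  "tensor a b = map_mat (\<lambda>x. x \<cdot>\<^sub>m b) a"

definition wedge :: "'a :: comm_ring_1 mat \<Rightarrow> 'a mat \<Rightarrow> 'a tensor" where
  "wedge a b = tensor a b - tensor b a"

definition tensor_sum :: "nat \<Rightarrow> ('i \<Rightarrow> 'a tensor) \<Rightarrow> 'i set \<Rightarrow> 'a :: comm_ring_1 tensor" where
  "tensor_sum M f A =
     mat M M (\<lambda>(i, j). mat M M (\<lambda>(k, l). \<Sum>x\<in>A. f x $$ (i, j) $$ (k, l)))"

definition tensor_space :: "nat \<Rightarrow> 'a :: comm_ring_1 mat set \<Rightarrow> 'a mat set \<Rightarrow> 'a tensor set" where
  "tensor_space M V W = {tensor_sum M (\<lambda>p. tensor (a p) (b p)) {..<m} | (m :: nat) a b.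
     \<forall>p<m. a p \<in> V \<and> b p \<in> W}"

definition flip :: "'a tensor \<Rightarrow> 'a tensor" where
  "flip T = mat (dim_row T) (dim_row T) (\<lambda>(i, j). mat (dim_row T) (dim_row T) (\<lambda>(k, l).
     T $$ (k, l) $$ (i, j)))"

definition tensor_map :: "('a mat \<Rightarrow> 'a mat) \<Rightarrow> ('a mat \<Rightarrow> 'a mat) \<Rightarrow> 'a tensor \<Rightarrow> 'a tensor" where
  "tensor_map f g T = flip (map_mat f (flip (map_mat g T)))"

definition Ad_tensor :: "'a :: field mat \<Rightarrow> 'a tensor \<Rightarrow> 'a tensor" where
  "Ad_tensor x = tensor_map (Ad x) (Ad x)"

type_synonym K = "complex fls"
type_synonym Kbar = "complex fls alg_closure"

text \<open>Here \<^term>\<open>s\<close> stands for a square root of \<^term>\<open>to_ac fls_X\<close>.\<close>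

definition quad_ext :: "Kbar \<Rightarrow> Kbar set" where
  "quad_ext s = {to_ac a + to_ac b * s | a b. True}"

definition Gal :: "Kbar set \<Rightarrow> (Kbar \<Rightarrow> Kbar) set" where
  "Gal F = {\<sigma>. bij \<sigma> \<and> (\<forall>x y. \<sigma> (x + y) = \<sigma> x + \<sigma> y) \<and> (\<forall>x y. \<sigma> (x * y) = \<sigma> x * \<sigma> y) \<and>
     (\<forall>x\<in>F. \<sigma> x = x)}"

text \<open>The characters of the diagonal group that belong to the simple roots are \<open>d\<^sub>i / d\<^sub>i\<^sub>+\<^sub>1\<close> for
  \<open>i < n\<close> and \<open>d\<^sub>n\<close>, \<open>d\<^sub>n\<^sup>2\<close>, \<open>d\<^sub>n\<^sub>-\<^sub>1 d\<^sub>n\<close> in types B, C, D; a simple root is the differential of its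
  character, a functional on diagonal matrices.\<close>

definition simple_root :: "classical_type \<Rightarrow> nat \<Rightarrow> nat \<Rightarrow> 'a :: comm_ring_1 mat \<Rightarrow> 'a" where
  "simple_root ty n i h = (let \<epsilon> = (\<lambda>i. h $$ (i - 1, i - 1)) in
     if i < n then \<epsilon> i - \<epsilon> (i + 1)
     else (case ty of Type_B \<Rightarrow> \<epsilon> n | Type_C \<Rightarrow> 2 * \<epsilon> n | Type_D \<Rightarrow> \<epsilon> (n - 1) + \<epsilon> n))"

text \<open>An element of the root lattice is given by its family of integer coefficients with respect
  to the simple roots; the coefficients outside \<^term>\<open>{1..n}\<close> are 0. Sets of simple roots are sets
  of indices.\<close>

type_synonym lattice_elt = "nat \<Rightarrow> int"

definition root_fun :: "classical_type \<Rightarrow> nat \<Rightarrow> lattice_elt \<Rightarrow> 'a :: comm_ring_1 mat \<Rightarrow> 'a" where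
  "root_fun ty n \<alpha> h = (\<Sum>i=1..n. of_int (\<alpha> i) * simple_root ty n i h)"

definition simple_elt :: "nat \<Rightarrow> lattice_elt" where
  "simple_elt i = (\<lambda>j. if j = i then 1 else 0)"

definition root_space :: "classical_type \<Rightarrow> nat \<Rightarrow> lattice_elt \<Rightarrow> 'a :: comm_ring_1 mat set" where
  "root_space ty n \<alpha> = {x \<in> lie_alg ty n.
     \<forall>h\<in>cartan_subalg ty n. lie_bracket h x = root_fun ty n \<alpha> h \<cdot>\<^sub>m x}"

definition roots :: "classical_type \<Rightarrow> nat \<Rightarrow> lattice_elt set" where
  "roots ty n = {\<alpha>. (\<forall>i. i \<notin> {1..n} \<longrightarrow> \<alpha> i = 0) \<and> \<alpha> \<noteq> (\<lambda>_. 0) \<and>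
     (\<exists>x\<in>root_space ty n \<alpha>. x \<noteq> (0\<^sub>m (msize ty n) (msize ty n) :: Kbar mat))}"

definition pos_roots :: "classical_type \<Rightarrow> nat \<Rightarrow> lattice_elt set" where
  "pos_roots ty n = {\<alpha> \<in> roots ty n. \<forall>i. 0 \<le> \<alpha> i}"

definition lattice_span :: "nat set \<Rightarrow> lattice_elt set" where
  "lattice_span \<Gamma> = {\<alpha>. \<forall>i. i \<notin> \<Gamma> \<longrightarrow> \<alpha> i = 0}"

text \<open>The inner product on the dual of the Cartan subalgebra that is induced by the Killing
  form.\<close>

definition killing_dual :: "classical_type \<Rightarrow> nat \<Rightarrow> (Kbar mat \<Rightarrow> Kbar) \<Rightarrow> Kbar mat" where
  "killing_dual ty n \<phi> =
     (THE t. t \<in> cartan_subalg ty n \<and> (\<forall>h\<in>cartan_subalg ty n. killing ty n t h = \<phi> h))"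

definition root_inner :: "classical_type \<Rightarrow> nat \<Rightarrow> nat \<Rightarrow> nat \<Rightarrow> Kbar" where
  "root_inner ty n i j = killing ty n
     (killing_dual ty n (simple_root ty n i)) (killing_dual ty n (simple_root ty n j))"

text \<open>Only the values of \<^term>\<open>\<tau>\<close> on \<^term>\<open>\<Gamma>1\<close> matter: the least \<^term>\<open>k\<close> in the last condition
  only involves these.\<close>

definition admissible_triple ::
    "classical_type \<Rightarrow> nat \<Rightarrow> nat set \<Rightarrow> nat set \<Rightarrow> (nat \<Rightarrow> nat) \<Rightarrow> bool" where
  "admissible_triple ty n \<Gamma>1 \<Gamma>2 \<tau> \<longleftrightarrow>
     \<Gamma>1 \<subseteq> {1..n} \<and> \<Gamma>2 \<subseteq> {1..n} \<and> bij_betw \<tau> \<Gamma>1 \<Gamma>2 \<and>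
     (\<forall>i\<in>\<Gamma>1. \<forall>j\<in>\<Gamma>1. root_inner ty n (\<tau> i) (\<tau> j) = root_inner ty n i j) \<and>
     (\<forall>i\<in>\<Gamma>1. \<exists>k\<ge>1. (\<tau> ^^ k) i \<notin> \<Gamma>1)"

definition tau_lin :: "nat set \<Rightarrow> (nat \<Rightarrow> nat) \<Rightarrow> lattice_elt \<Rightarrow> lattice_elt" where
  "tau_lin \<Gamma>1 \<tau> \<alpha> = (\<lambda>j. \<Sum>i\<in>\<Gamma>1. \<alpha> i * simple_elt (\<tau> i) j)"

definition tau_exponents :: "nat set \<Rightarrow> (nat \<Rightarrow> nat) \<Rightarrow> lattice_elt \<Rightarrow> nat set" where
  "tau_exponents \<Gamma>1 \<tau> \<alpha> = {k. 1 \<le> k \<and> (\<forall>m<k. (tau_lin \<Gamma>1 \<tau> ^^ m) \<alpha> \<in> lattice_span \<Gamma>1)}"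

text \<open>The root vectors belong to the split Lie algebra over the base field, that is, their entries
  lie in \<^typ>\<open>K\<close>, whereas the coefficients of \<^term>\<open>r0\<close> below may lie in \<^typ>\<open>Kbar\<close>. Rescaling
  root vectors by elements of \<^typ>\<open>Kbar\<close> outside \<^typ>\<open>K\<close> can destroy all twisted cocycles.\<close>

definition root_vectors ::
    "classical_type \<Rightarrow> nat \<Rightarrow> nat set \<Rightarrow> nat set \<Rightarrow> (nat \<Rightarrow> nat) \<Rightarrow> (lattice_elt \<Rightarrow> Kbar mat) \<Rightarrow> bool" where
  "root_vectors ty n \<Gamma>1 \<Gamma>2 \<tau> e \<longleftrightarrow>
     (\<forall>\<alpha>\<in>roots ty n. e \<alpha> \<in> root_space ty n \<alpha> \<and> e \<alpha> \<in> map_mat to_ac ` (lie_alg ty n :: K mat set) \<and>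
        killing ty n (e \<alpha>) (e (- \<alpha>)) = 1) \<and>
     (\<exists>\<theta>. lie_iso \<theta>
            (lie_generated ty n (\<Union>i\<in>\<Gamma>1. {e (simple_elt i), e (- simple_elt i)}))
            (lie_generated ty n (\<Union>i\<in>\<Gamma>2. {e (simple_elt i), e (- simple_elt i)})) \<and>
          (\<forall>\<alpha>\<in>roots ty n \<inter> lattice_span \<Gamma>1. \<theta> (e \<alpha>) = e (tau_lin \<Gamma>1 \<tau> \<alpha>)))"

definition orthonormal_basis :: "classical_type \<Rightarrow> nat \<Rightarrow> (nat \<Rightarrow> Kbar mat) \<Rightarrow> bool" where
  "orthonormal_basis ty n t \<longleftrightarrow> mat_basis (msize ty n) (cartan_subalg ty n) n t \<and>
     (\<forall>k<n. \<forall>l<n. killing ty n (t k) (t l) = (if k = l then 1 else 0))"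

definition cartan_part ::
    "classical_type \<Rightarrow> nat \<Rightarrow> nat set \<Rightarrow> (nat \<Rightarrow> nat) \<Rightarrow> Kbar tensor \<Rightarrow> bool" where
  "cartan_part ty n \<Gamma>1 \<tau> r0 \<longleftrightarrow>
     r0 \<in> tensor_space (msize ty n) (cartan_subalg ty n) (cartan_subalg ty n) \<and>
     (\<exists>t. orthonormal_basis ty n t \<and>
        r0 + flip r0 = tensor_sum (msize ty n) (\<lambda>k. tensor (t k) (t k)) {..<n}) \<and>
     (\<forall>i\<in>\<Gamma>1. map_mat (simple_root ty n (\<tau> i)) (flip r0) + map_mat (simple_root ty n i) r0
        = 0\<^sub>m (msize ty n) (msize ty n))"

definition bd_r_matrix ::
    "classical_type \<Rightarrow> nat \<Rightarrow> nat set \<Rightarrow> nat set \<Rightarrow> (nat \<Rightarrow> nat) \<Rightarrow> Kbar tensor \<Rightarrow> bool" where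
  "bd_r_matrix ty n \<Gamma>1 \<Gamma>2 \<tau> r \<longleftrightarrow> admissible_triple ty n \<Gamma>1 \<Gamma>2 \<tau> \<and>
     (\<exists>e r0. root_vectors ty n \<Gamma>1 \<Gamma>2 \<tau> e \<and> cartan_part ty n \<Gamma>1 \<tau> r0 \<and>
        r = r0
          + tensor_sum (msize ty n) (\<lambda>\<alpha>. tensor (e (- \<alpha>)) (e \<alpha>)) (pos_roots ty n)
          + tensor_sum (msize ty n) (\<lambda>\<alpha>.
              tensor_sum (msize ty n) (\<lambda>k. wedge (e (- \<alpha>)) (e ((tau_lin \<Gamma>1 \<tau> ^^ k) \<alpha>)))
                (tau_exponents \<Gamma>1 \<tau> \<alpha>))
              (pos_roots ty n \<inter> lattice_span \<Gamma>1))"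

definition bd_centralizer :: "classical_type \<Rightarrow> nat \<Rightarrow> Kbar tensor \<Rightarrow> Kbar mat set" where
  "bd_centralizer ty n r = {x \<in> classical_group ty n. Ad_tensor x r = r}"

definition twisted_cocycles ::
    "classical_type \<Rightarrow> nat \<Rightarrow> Kbar \<Rightarrow> (Kbar \<Rightarrow> Kbar) \<Rightarrow> Kbar tensor \<Rightarrow> Kbar mat set" where
  "twisted_cocycles ty n s \<sigma>0 r = {x \<in> classical_group ty n.
     (\<forall>\<sigma>\<in>Gal (quad_ext s). the (mat_inverse x) * map_mat \<sigma> x \<in> bd_centralizer ty n r) \<and>
     Ad_tensor (the (mat_inverse x) * map_mat \<sigma>0 x) r = flip r}"

definition twisted_equiv ::
    "classical_type \<Rightarrow> nat \<Rightarrow> Kbar \<Rightarrow> (Kbar \<Rightarrow> Kbar) \<Rightarrow> Kbar tensor \<Rightarrow> (Kbar mat \<times> Kbar mat) set" where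
  "twisted_equiv ty n s \<sigma>0 r =
     {(g1, g2) \<in> twisted_cocycles ty n s \<sigma>0 r \<times> twisted_cocycles ty n s \<sigma>0 r.
        \<exists>q \<in> map_mat to_ac ` (classical_group ty n :: K mat set).
        \<exists>c \<in> bd_centralizer ty n r. g1 = q * g2 * c}"

definition twisted_cohomology ::
    "classical_type \<Rightarrow> nat \<Rightarrow> Kbar \<Rightarrow> (Kbar \<Rightarrow> Kbar) \<Rightarrow> Kbar tensor \<Rightarrow> Kbar mat set set" where
  "twisted_cohomology ty n s \<sigma>0 r = twisted_cocycles ty n s \<sigma>0 r // twisted_equiv ty n s \<sigma>0 r"

end

theory Submission
  imports Defs
begin

text \<open>Read \<open>r\<close> as an endomorphism of the matrix algebra, by contracting its second factor with the
  trace form. The strictly upper triangular elements of the Lie algebra are characterised by being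
  nilpotent and killed by a power of this endomorphism, and for \<open>r\<^sup>2\<^sup>1\<close> the same holds with lower in
  place of upper. So \<open>C(r)\<close> consists of diagonal matrices, and the elements that carry \<open>r\<close> to \<open>r\<^sup>2\<^sup>1\<close>
  are monomial for a fixed involution of the indices: the reversal, except that for \<open>D\<^sub>n\<close> with \<open>n\<close>
  odd the two middle indices are fixed.

  Isotropic vectors over \<open>L = K[\<surd>h]\<close> give a matrix \<open>J\<close> in \<open>G(L)\<close> for which the quotient of
  \<open>\<sigma>\<^sub>0(J)\<close> by \<open>J\<close> is monomial for this involution. Dividing the columns of a twisted cocycle by one of
  their entries, and using that every element of \<open>K\<close> is a norm from \<open>L\<close>, one writes each twisted
  cocycle as \<open>Q J D\<close> with \<open>Q\<close> in \<open>G(K)\<close> and \<open>D\<close> diagonal. In the Drinfeld-Jimbo case \<open>C(r)\<close> is the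
  whole diagonal group, so all cocycles are equivalent to \<open>J\<close>. For the triples of type \<open>D\<^sub>n\<close> the
  \<open>n\<close>-th entry of elements of \<open>C(r)\<close> is \<open>1\<close> or \<open>-1\<close>, so that the square of the \<open>n\<close>-th entry of \<open>D\<close>
  lies in \<open>K\<close>; the remaining conditions are again solved by norms, and the class of this square
  modulo squares, \<open>1\<close> or \<open>h\<close>, classifies the cocycles.\<close>

section \<open>Extending partial automorphisms to the algebraic closure\<close>

text \<open>In types B, C and D the longest element of the Weyl group is -1, except for D_n with n
  odd, where minus this element exchanges \<alpha>_{n-1} and \<alpha>_n. Matrices show the reason:
  in type D a monomial matrix for the full reversal that preserves the form has determinant (-1)^n,
  so for odd n it leaves the group unless the two middle indices stay in place. The contraction is
  useful because r is known only up to the choice of r_0 and of the root vectors. The triangular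
  information can be read off from parts of the endomorphism to which r_0 does not contribute. The
  arithmetic of K enters through two facts. Modulo squares K has the classes of 1 and h, which is
  where the number 2 comes from. And h is a norm from L, namely of i s, because -1 is a square of a
  complex number; thus every equation of the form N(f) = \<kappa> with nonzero \<kappa> in K can be
  solved. That the constants which occur do lie in K is due to the root vectors having entries in K.
  Descent from the closure to L and K rests on the fact that the fixed field of Gal(L) is L, for
  which automorphisms of the closure have to be built first.\<close>

definition partial_aut :: "'a :: field set \<Rightarrow> ('a \<times> 'a) set \<Rightarrow> bool" where
  "partial_aut L R \<longleftrightarrow> (\<forall>l\<in>L. (l, l) \<in> R) \<and>
     (\<forall>(a, b)\<in>R. \<forall>(c, d)\<in>R. (a + c, b + d) \<in> R \<and> (a * c, b * d) \<in> R) \<and>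
     (\<forall>b. (0, b) \<in> R \<longrightarrow> b = 0)"

lemma partial_autD:
  assumes "partial_aut L R"
  shows "l \<in> L \<Longrightarrow> (l, l) \<in> R"
    and "(a, b) \<in> R \<Longrightarrow> (c, d) \<in> R \<Longrightarrow> (a + c, b + d) \<in> R"
    and "(a, b) \<in> R \<Longrightarrow> (c, d) \<in> R \<Longrightarrow> (a * c, b * d) \<in> R"
    and "(0, b) \<in> R \<Longrightarrow> b = 0"
  using assms unfolding partial_aut_def by blast+

definition poly_pairs :: "('a :: field \<times> 'a) set \<Rightarrow> ('a poly \<times> 'a poly) set" where
  "poly_pairs R = {(p, q). \<forall>i. (coeff p i, coeff q i) \<in> R}"

text \<open>\<open>R\<close> is the graph of a ring homomorphism on a subring of the closure. As a
  relation it behaves well under unions of chains. Single-valuedness follows from the clause about 0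
  by subtraction, and the domain is automatically a field because every element is algebraic over
  the base.\<close>

locale alg_partial_aut =
  fixes L :: "'a :: field_char_0 alg_closure set" and R
  assumes base: "range to_ac \<subseteq> L"
    and pa: "partial_aut L R"
begin

lemma zero_mem: "(0, 0) \<in> R"
  using partial_autD(1)[OF pa, of 0] base by (metis rangeI subset_eq to_ac_0)

lemma one_mem: "(1, 1) \<in> R"
  using partial_autD(1)[OF pa, of 1] base by (metis rangeI subset_eq to_ac_1)

lemma uminus_mem: "(a, b) \<in> R \<Longrightarrow> (- a, - b) \<in> R"
proof -
  assume *: "(a, b) \<in> R"
  have "to_ac (-1) \<in> L" using base by blast
  from partial_autD(1)[OF pa this] have "(-1, -1) \<in> R" by simp
  from partial_autD(3)[OF pa this *] show ?thesis by simp
qed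

lemma diff_mem: "(a, b) \<in> R \<Longrightarrow> (c, d) \<in> R \<Longrightarrow> (a - c, b - d) \<in> R"
  using partial_autD(2)[OF pa, of a b "-c" "-d"] uminus_mem by auto

lemma single_valued: "(a, b) \<in> R \<Longrightarrow> (a, b') \<in> R \<Longrightarrow> b = b'"
  using diff_mem[of a b a b'] partial_autD(4)[OF pa, of "b - b'"] by auto

lemma sum_mem: "(\<And>i. i \<in> A \<Longrightarrow> (f i, g i) \<in> R) \<Longrightarrow> (sum f A, sum g A) \<in> R"
  by (induction A rule: infinite_finite_induct) (auto simp: zero_mem partial_autD[OF pa])

lemma poly_mem: "(a, b) \<in> R \<Longrightarrow> (poly (map_poly to_ac p) a, poly (map_poly to_ac p) b) \<in> R"
proof (induction p)
  case 0
  then show ?case by (simp add: zero_mem)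
next
  case (pCons c p)
  have "(to_ac c, to_ac c) \<in> R" using base by (auto intro: partial_autD[OF pa])
  with pCons show ?case by (auto simp: map_poly_pCons intro!: partial_autD[OF pa])
qed

text \<open>Divide an algebraic equation of \<open>a\<close> by the highest power of
  \<open>a\<close> that it contains: the constant term becomes nonzero, so the inverse of
  \<open>a\<close> is a polynomial in \<open>a\<close>, and \<open>R\<close> respects polynomials.
  The same equation at \<open>b\<close> shows that \<open>b\<close> is not 0.\<close>

lemma inverse_mem:
  assumes ab: "(a, b) \<in> R" and a: "a \<noteq> 0"
  shows "(inverse a, inverse b) \<in> R" "b \<noteq> 0"
proof -
  obtain p :: "'a poly" where "p \<noteq> 0" "poly (map_poly to_ac p) a = 0"
    using alg_closure_algebraic[of a] by blast
  hence "\<exists>c q. c \<noteq> 0 \<and> to_ac c + a * poly (map_poly to_ac q) a = 0"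
  proof (induction p)
    case 0
    then show ?case by simp
  next
    case (pCons c p)
    show ?case
    proof (cases "c = 0")
      case False
      with pCons show ?thesis by (auto simp: map_poly_pCons)
    next
      case True
      with pCons a show ?thesis by (auto simp: map_poly_pCons)
    qed
  qed
  then obtain c q where c: "c \<noteq> 0" and eq: "to_ac c + a * poly (map_poly to_ac q) a = 0"
    by blast
  let ?q = "\<lambda>x. poly (map_poly to_ac q) x"
  have q: "(?q a, ?q b) \<in> R" by (rule poly_mem[OF ab])
  have cR: "(to_ac x, to_ac x) \<in> R" for x using base by (auto intro: partial_autD[OF pa])
  have "(to_ac c + a * ?q a, to_ac c + b * ?q b) \<in> R"
    by (intro partial_autD(2,3)[OF pa] cR ab q)
  with eq have eq': "to_ac c + b * ?q b = 0" using partial_autD(4)[OF pa] by simp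
  with c show b: "b \<noteq> 0" by auto
  have "inverse a = - (to_ac (inverse c) * ?q a)" "inverse b = - (to_ac (inverse c) * ?q b)"
    using eq eq' a b c by (simp_all add: field_simps eq_neg_iff_add_eq_0)
  thus "(inverse a, inverse b) \<in> R"
    by (auto intro!: uminus_mem partial_autD(3)[OF pa] cR q simp del: to_ac_inverse)
qed

lemma pairs_arith:
  assumes "(p, p') \<in> poly_pairs R" "(q, q') \<in> poly_pairs R"
  shows "(p + q, p' + q') \<in> poly_pairs R" "(p - q, p' - q') \<in> poly_pairs R"
    "(p * q, p' * q') \<in> poly_pairs R"
  using assms unfolding poly_pairs_def
  by (auto simp: coeff_mult intro!: partial_autD[OF pa] diff_mem sum_mem)

lemma pairs_monom: "(a, b) \<in> R \<Longrightarrow> (monom a i, monom b i) \<in> poly_pairs R"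
  unfolding poly_pairs_def by (auto simp: zero_mem)

lemma zero_iff: "(a, b) \<in> R \<Longrightarrow> a = 0 \<longleftrightarrow> b = 0"
  using inverse_mem(2) partial_autD(4)[OF pa] by blast

lemma pairs_degree:
  assumes "(p, q) \<in> poly_pairs R"
  shows "degree p = degree q" "p = 0 \<longleftrightarrow> q = 0"
proof -
  have *: "coeff p i = 0 \<longleftrightarrow> coeff q i = 0" for i
    using assms zero_iff unfolding poly_pairs_def by auto
  thus "degree p = degree q" unfolding degree_def by simp
  show "p = 0 \<longleftrightarrow> q = 0" using * by (metis coeff_0 poly_eqI)
qed

text \<open>The polynomial \<open>p\<close> is a minimal polynomial of \<open>z\<close> over the domain of \<open>R\<close>, and \<open>p'\<close> its
  image under the partial automorphism.\<close>

definition min_pair :: "'a alg_closure \<Rightarrow> 'a alg_closure poly \<Rightarrow> 'a alg_closure poly \<Rightarrow> bool" where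
  "min_pair z p p' \<longleftrightarrow> (p, p') \<in> poly_pairs R \<and> p \<noteq> 0 \<and> poly p z = 0 \<and>
     (\<forall>(q, q')\<in>poly_pairs R. q \<noteq> 0 \<longrightarrow> poly q z = 0 \<longrightarrow> degree p \<le> degree q)"

lemma min_pair_exists: "\<exists>p p'. min_pair z p p'"
proof -
  let ?P = "\<lambda>x. x \<in> poly_pairs R \<and> fst x \<noteq> 0 \<and> poly (fst x) z = 0"
  obtain q :: "'a poly" where "q \<noteq> 0" "poly (map_poly to_ac q) z = 0"
    using alg_closure_algebraic[of z] by blast
  hence "?P (map_poly to_ac q, map_poly to_ac q)"
    using base by (auto simp: poly_pairs_def coeff_map_poly map_poly_eq_0_iff intro!: partial_autD[OF pa])
  from ex_has_least_nat[of ?P, OF this, of "degree \<circ> fst"]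
  have "\<exists>x. ?P x \<and> (\<forall>y. ?P y \<longrightarrow> degree (fst x) \<le> degree (fst y))" by simp
  then obtain x where "?P x" "\<And>y. ?P y \<Longrightarrow> degree (fst x) \<le> degree (fst y)" by blast
  moreover obtain p p' where "x = (p, p')" by fastforce
  ultimately have "min_pair z p p'" by (simp add: min_pair_def split_def)
  thus ?thesis by blast
qed

text \<open>Division with remainder, performed on both members of the pair at once: the quotients of
  the leading coefficients are again related by \<open>R\<close>, and minimality of the degree of
  \<open>p\<close> forces the last remainder to vanish.\<close>

lemma min_pair_dvd:
  assumes mp: "min_pair z p p'" and q: "(q, q') \<in> poly_pairs R" "poly q z = 0"
  shows "p' dvd q'"
  using q
proof (induction "degree q" arbitrary: q q' rule: less_induct)
  case less
  have p: "(p, p') \<in> poly_pairs R" "p \<noteq> 0" "poly p z = 0" using mp by (auto simp: min_pair_def)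
  show ?case
  proof (cases "q = 0")
    case True
    with pairs_degree[OF less(2)] show ?thesis by simp
  next
    case q0: False
    with mp less have dle: "degree p \<le> degree q" unfolding min_pair_def by auto
    define k where "k = degree q - degree p"
    define a a' where "a = lead_coeff q / lead_coeff p" and "a' = lead_coeff q' / lead_coeff p'"
    note dp = pairs_degree[OF p(1)] and dq = pairs_degree[OF less(2)]
    have aR: "(a, a') \<in> R"
    proof -
      have "(lead_coeff q, lead_coeff q') \<in> R" "(lead_coeff p, lead_coeff p') \<in> R"
        using p less(2) dp dq by (auto simp: poly_pairs_def)
      moreover have "lead_coeff p \<noteq> 0" using p by simp
      ultimately show ?thesis
        unfolding a_def a'_def divide_inverse by (metis partial_autD(3)[OF pa] inverse_mem(1))
    qed
    have a0: "a \<noteq> 0" "a' \<noteq> 0" using q0 p(2) dp dq unfolding a_def a'_def divide_eq_0_iff leading_coeff_0_iff by auto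
    let ?s = "monom a k * p" and ?s' = "monom a' k * p'"
    have s: "(?s, ?s') \<in> poly_pairs R" by (intro pairs_arith pairs_monom aR p)
    have ds: "degree ?s = degree q"
      using a0 p(2) dle by (simp add: degree_mult_eq degree_monom_eq k_def)
    have lc: "lead_coeff ?s = lead_coeff q"
      using p(2) a0 by (simp add: lead_coeff_mult degree_monom_eq) (simp add: a_def)
    have "p' dvd (q' - ?s')"
    proof (cases "q - ?s = 0")
      case True
      with pairs_degree[OF pairs_arith(2)[OF less(2) s]] show ?thesis by simp
    next
      case False
      have "degree (q - ?s) < degree q"
      proof (rule ccontr)
        assume "\<not> ?thesis"
        hence "degree (q - ?s) = degree q" using degree_diff_le[of q "degree q" ?s] ds by simp
        hence "lead_coeff (q - ?s) = 0" using lc ds by (simp only: coeff_diff) simp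
        with False show False by (simp only: leading_coeff_0_iff)
      qed
      with less(1)[OF this pairs_arith(2)[OF less(2) s]] less(3) p(3) show ?thesis by simp
    qed
    hence "p' dvd (q' - ?s') + ?s'" by (intro dvd_add) auto
    thus ?thesis by simp
  qed
qed

text \<open>The new graph consists of all pairs of values q(z), q'(z'). It respects 0 because q(z) =
  0 makes p' divide q', hence q'(z') = 0.\<close>

lemma extend:
  assumes mp: "min_pair z p p'" and z': "poly p' z' = 0"
  shows "\<exists>R'. partial_aut L R' \<and> R \<subseteq> R' \<and> (z, z') \<in> R'"
proof (intro exI conjI)
  let ?R = "(\<lambda>(q, q'). (poly q z, poly q' z')) ` poly_pairs R"
  have const: "(a, b) \<in> R \<Longrightarrow> (a, b) \<in> ?R" for a b
    using pairs_monom[of a b 0] by (force simp: monom_0)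
  thus "R \<subseteq> ?R" by auto
  have "(monom 1 1, monom 1 1) \<in> poly_pairs R" by (intro pairs_monom one_mem)
  thus "(z, z') \<in> ?R" by (force simp: poly_monom)
  show "partial_aut L ?R"
    unfolding partial_aut_def
  proof (intro conjI)
    show "\<forall>l\<in>L. (l, l) \<in> ?R" using const partial_autD(1)[OF pa] by blast
    show "\<forall>(a, b)\<in>?R. \<forall>(c, d)\<in>?R. (a + c, b + d) \<in> ?R \<and> (a * c, b * d) \<in> ?R"
    proof (clarify, goal_cases)
      case (1 _ _ p q _ _ r s)
      show ?case
        by (intro conjI; rule rev_image_eqI[OF pairs_arith(1)[OF 1]] rev_image_eqI[OF pairs_arith(3)[OF 1]]) simp_all
    qed
    show "\<forall>b. (0, b) \<in> ?R \<longrightarrow> b = 0"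
    proof (clarify, goal_cases)
      case (1 _ q q')
      hence "p' dvd q'" using min_pair_dvd[OF mp, of q q'] by auto
      with z' show ?case by (metis dvdE mult_zero_left poly_mult)
    qed
  qed
qed

end

text \<open>Zorn's lemma yields a maximal graph above \<open>R\<close>. It is total: the image of a
  minimal polynomial of z is not constant, so it has a root in the closure, and
  \<open>extend\<close> would otherwise enlarge the graph.\<close>

lemma partial_aut_extend_total:
  fixes L :: "'a :: field_char_0 alg_closure set"
  assumes base: "range to_ac \<subseteq> L" and pa: "partial_aut L R"
  shows "\<exists>\<sigma>. bij \<sigma> \<and> (\<forall>x y. \<sigma> (x + y) = \<sigma> x + \<sigma> y) \<and> (\<forall>x y. \<sigma> (x * y) = \<sigma> x * \<sigma> y) \<and>
     (\<forall>x\<in>L. \<sigma> x = x) \<and> (\<forall>(a, b)\<in>R. \<sigma> a = b)"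
proof -
  let ?A = "{S. partial_aut L S \<and> R \<subseteq> S}"
  have "\<exists>M\<in>?A. \<forall>S\<in>?A. M \<subseteq> S \<longrightarrow> S = M"
  proof (rule subset_Zorn_nonempty)
    show "?A \<noteq> {}" using pa by auto
  next
    fix C assume C: "C \<noteq> {}" "subset.chain ?A C"
    hence CA: "\<And>S. S \<in> C \<Longrightarrow> partial_aut L S \<and> R \<subseteq> S" and ch: "\<And>S T. S \<in> C \<Longrightarrow> T \<in> C \<Longrightarrow> S \<subseteq> T \<or> T \<subseteq> S"
      unfolding subset_chain_def by auto
    have "partial_aut L (\<Union>C)"
      unfolding partial_aut_def
    proof (intro conjI)
      show "\<forall>l\<in>L. (l, l) \<in> \<Union>C" using C(1) CA partial_autD(1) by blast
      have "(a + c, b + d) \<in> \<Union>C \<and> (a * c, b * d) \<in> \<Union>C"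
        if ab: "(a, b) \<in> S" "S \<in> C" and cd: "(c, d) \<in> T" "T \<in> C" for a b c d S T
      proof -
        from ch[OF ab(2) cd(2)] ab cd obtain U where "U \<in> C" "(a, b) \<in> U" "(c, d) \<in> U"
          by blast
        with CA partial_autD(2,3) show ?thesis by blast
      qed
      thus "\<forall>(a, b)\<in>\<Union>C. \<forall>(c, d)\<in>\<Union>C. (a + c, b + d) \<in> \<Union>C \<and> (a * c, b * d) \<in> \<Union>C"
        by blast
      show "\<forall>b. (0, b) \<in> \<Union>C \<longrightarrow> b = 0" using CA partial_autD(4) by blast
    qed
    with C CA show "\<Union>C \<in> ?A" by blast
  qed
  then obtain M where M: "partial_aut L M" "R \<subseteq> M" and max: "\<And>S. partial_aut L S \<Longrightarrow> M \<subseteq> S \<Longrightarrow> S = M"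
    by (smt (verit, best) mem_Collect_eq subset_trans)
  interpret alg_partial_aut L M by standard (use base M in auto)
  have "\<exists>z'. (z, z') \<in> M" for z
  proof -
    obtain p p' where mp: "min_pair z p p'" using min_pair_exists by blast
    note d = pairs_degree[of p p']
    have "degree p > 0"
    proof (rule ccontr)
      assume "\<not> ?thesis"
      then obtain c where "p = [:c:]" by (metis degree_eq_zeroE gr0I)
      with mp show False by (auto simp: min_pair_def)
    qed
    with d mp have "degree p' > 0" by (auto simp: min_pair_def)
    then obtain z' where "poly p' z' = 0" using alg_closed_imp_poly_has_root by blast
    from extend[OF mp this] max show ?thesis by blast
  qed
  then obtain \<sigma> where \<sigma>: "\<And>z. (z, \<sigma> z) \<in> M" by metis
  have eq: "(a, b) \<in> M \<Longrightarrow> \<sigma> a = b" for a b using single_valued \<sigma> by blast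
  have add: "\<sigma> (x + y) = \<sigma> x + \<sigma> y" and mult: "\<sigma> (x * y) = \<sigma> x * \<sigma> y" for x y
    using partial_autD(2,3)[OF M(1) \<sigma> \<sigma>] eq by blast+
  have fixes_L: "\<sigma> l = l" if "l \<in> L" for l using partial_autD(1)[OF M(1) that] eq by blast
  have inj: "inj \<sigma>"
  proof (rule injI)
    fix x y assume "\<sigma> x = \<sigma> y"
    hence "(x - y, 0) \<in> M" using diff_mem[OF \<sigma>[of x] \<sigma>[of y]] by simp
    thus "x = y" using zero_iff by fastforce
  qed
  \<comment> \<open>The injective map \<sigma> sends the finite set of roots of a polynomial over
    the base field into itself, hence onto itself.\<close>
  have "surj \<sigma>"
    unfolding surj_def
  proof
    fix y
    obtain p :: "'a poly" where p: "p \<noteq> 0" "poly (map_poly to_ac p) y = 0"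
      using alg_closure_algebraic[of y] by blast
    let ?S = "{x. poly (map_poly to_ac p) x = 0}"
    have fin: "finite ?S" using p(1) by (intro poly_roots_finite) (simp add: map_poly_eq_0_iff)
    have "\<sigma> ` ?S \<subseteq> ?S"
    proof clarify
      fix x assume "poly (map_poly to_ac p) x = 0"
      thus "poly (map_poly to_ac p) (\<sigma> x) = 0"
        using poly_mem[OF \<sigma>, of p x] by (auto intro: partial_autD(4)[OF M(1)])
    qed
    from endo_inj_surj[OF fin this inj_on_subset[OF inj subset_UNIV]] p show "\<exists>x. y = \<sigma> x" by blast
  qed
  with inj add mult fixes_L M(2) eq show ?thesis unfolding bij_def by (intro exI[of _ \<sigma>]) auto
qed

text \<open>The fixed field of \<open>Gal L\<close> is \<open>L\<close>. For y outside
  \<open>L\<close> the minimal polynomial has degree at least 2 and, in characteristic 0, a root z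
  other than y; the identity of \<open>L\<close> extends to an automorphism that sends y to
  z.\<close>

lemma moved_by_automorphism:
  assumes base: "range to_ac \<subseteq> L"
    and cl: "\<And>a b. a \<in> L \<Longrightarrow> b \<in> L \<Longrightarrow> a + b \<in> L \<and> a * b \<in> L" and y: "y \<notin> L"
  shows "\<exists>\<sigma>\<in>Gal L. \<sigma> y \<noteq> y"
proof -
  let ?R = "(\<lambda>l. (l, l)) ` L"
  have pa: "partial_aut L ?R" using cl unfolding partial_aut_def by auto
  interpret alg_partial_aut L ?R by standard (use base pa in auto)
  obtain p p' where mp: "min_pair y p p'" using min_pair_exists by blast
  have pp: "(p, p') \<in> poly_pairs ?R" and p: "p \<noteq> 0" "poly p y = 0" using mp by (auto simp: min_pair_def)
  have "coeff p' i = coeff p i" for i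
  proof -
    have "(coeff p i, coeff p' i) \<in> ?R" using pp by (simp add: poly_pairs_def)
    thus ?thesis by (elim imageE) simp
  qed
  hence [simp]: "p' = p" by (intro poly_eqI)
  obtain q where q: "p = [:- y, 1:] * q" using p(2) by (metis dvdE poly_eq_0_iff_dvd)
  have q0: "q \<noteq> 0" using p(1) q by auto
  have dp: "degree p = degree q + 1" unfolding q using q0 by (subst degree_mult_eq) auto
  \<comment> \<open>If \<open>p\<close> were linear, y would be a quotient of its coefficients, up
    to sign, and would lie in \<open>L\<close>.\<close>
  have "degree q > 0"
  proof (rule ccontr)
    assume "\<not> ?thesis"
    then obtain c where c: "q = [:c:]" by (metis degree_eq_zeroE gr0I)
    hence "p = [:- y * c, c:]" by (simp add: q)
    hence "coeff p 0 = - y * c" "coeff p 1 = c" by auto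
    moreover have "coeff p i \<in> L" for i
    proof -
      have "(coeff p i, coeff p i) \<in> ?R" using pp by (simp add: poly_pairs_def)
      thus ?thesis by (elim imageE) simp
    qed
    from this[of 0] this[of 1] have "coeff p 0 \<in> L" "coeff p 1 \<in> L" by auto
    ultimately have 1: "- y * c \<in> L" "c \<in> L" by simp_all
    have "c \<noteq> 0" using q0 c by auto
    hence "inverse c \<in> L" using inverse_mem[of c c] 1 by auto
    moreover have "-1 \<in> L" using uminus_mem[OF one_mem] by auto
    ultimately have "-1 * ((- y * c) * inverse c) \<in> L" using 1 cl by blast
    with \<open>c \<noteq> 0\<close> y show False by (simp add: field_simps)
  qed
  then obtain z where z: "poly q z = 0" using alg_closed_imp_poly_has_root by blast
  \<comment> \<open>A double root would also be a root of the derivative, which is nonzero, has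
    coefficients in \<open>L\<close> and has smaller degree than \<open>p\<close>.\<close>
  have "z \<noteq> y"
  proof
    assume "z = y"
    hence "poly (pderiv p) y = 0" using z unfolding q by (subst pderiv_mult) (simp add: pderiv_pCons)
    moreover have "pderiv p \<noteq> 0" using dp by (simp add: pderiv_eq_0_iff)
    moreover have nat: "(of_nat n, of_nat n) \<in> ?R" for n
    proof -
      have "to_ac (of_nat n) \<in> L" using base by blast
      thus ?thesis by simp
    qed
    have "(pderiv p, pderiv p) \<in> poly_pairs ?R"
    proof -
      have "(coeff (pderiv p) i, coeff (pderiv p) i) \<in> ?R" for i
        unfolding Polynomial.coeff_pderiv using pp nat[of "Suc i"]
        by (intro partial_autD(3)[OF pa]) (auto simp: poly_pairs_def)
      thus ?thesis by (simp add: poly_pairs_def)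
    qed
    ultimately have "degree p \<le> degree (pderiv p)" using mp by (auto simp: min_pair_def)
    with dp show False by (simp add: degree_pderiv)
  qed
  have "poly p' z = 0" using z q by simp
  from extend[OF mp this] obtain R' where R': "partial_aut L R'" "(y, z) \<in> R'" by blast
  obtain \<sigma> where \<sigma>: "bij \<sigma>" "\<forall>x y. \<sigma> (x + y) = \<sigma> x + \<sigma> y" "\<forall>x y. \<sigma> (x * y) = \<sigma> x * \<sigma> y"
    "\<forall>x\<in>L. \<sigma> x = x" "\<forall>(a, b)\<in>R'. \<sigma> a = b"
    using partial_aut_extend_total[OF base R'(1)] by (elim exE conjE)
  have "\<sigma> \<in> Gal L" unfolding Gal_def using \<sigma> by simp
  moreover have "\<sigma> y = z" using bspec[OF \<sigma>(5) R'(2)] by simp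
  ultimately show ?thesis using \<open>z \<noteq> y\<close> by blast
qed

section \<open>The quadratic extension\<close>

text \<open>A power series over the complex numbers with nonzero constant term has a square root, so
  only the parity of the order matters.\<close>

lemma fls_square_or_X_square:
  fixes c :: "complex fls"
  shows "\<exists>k. c = k ^ 2 \<or> c = fls_X * k ^ 2"
proof (cases "c = 0")
  case True
  thus ?thesis by (intro exI[of _ 0]) simp
next
  case False
  define u where "u = fls_base_factor_to_fps c"
  have u0: "u $ 0 \<noteq> 0" using False by (simp add: u_def fls_base_factor_to_fps_base)
  \<comment> \<open>The square root of \<open>u\<close>; \<open>csqrt\<close> supplies its constant
    term.\<close>
  define v where "v = fps_radical (\<lambda>_. csqrt) (Suc 1) u"
  have v: "v ^ 2 = u"
    using power_radical[of u "\<lambda>_. csqrt" 1] u0 by (simp add: v_def numeral_2_eq_2[symmetric])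
  have shift: "fls_shift (- (a + b)) (f * g) = fls_shift (- a) f * fls_shift (- b) g"
    for a b and f g :: "complex fls"
    by (simp add: fls_times_both_shifted_simp algebra_simps)
  have c: "c = fls_shift (- fls_subdegree c) (fps_to_fls v * fps_to_fls v)"
    using fls_conv_base_factor_to_fps_shift_subdegree[of c]
    unfolding u_def[symmetric] v[symmetric] power2_eq_square fls_times_fps_to_fls .
  show ?thesis
  proof (cases "even (fls_subdegree c)")
    case True
    then obtain m where m: "fls_subdegree c = m + m" by (metis evenE mult_2)
    have "c = (fls_shift (- m) (fps_to_fls v)) ^ 2"
      unfolding power2_eq_square shift[symmetric] m[symmetric] by (rule c)
    thus ?thesis by blast
  next
    case False
    then obtain m where m: "fls_subdegree c = 1 + (m + m)" by (metis oddE mult_2 add.commute)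
    have "c = fls_shift (- 1) 1 * (fls_shift (- m) (fps_to_fls v)) ^ 2"
      unfolding power2_eq_square shift[symmetric] mult_1_left m[symmetric] by (rule c)
    thus ?thesis by (metis fls_X_conv_shift_1)
  qed
qed

lemma fls_X_not_square: "fls_X \<noteq> (k :: complex fls) ^ 2"
proof
  assume *: "fls_X = k ^ 2"
  hence "k \<noteq> 0" by auto
  hence "fls_subdegree (k ^ 2) = 2 * fls_subdegree k" by (simp add: fls_subdegree_pow)
  with * have "1 = 2 * fls_subdegree k" by (metis fls_X_subdegree)
  thus False by presburger
qed

locale quadratic =
  fixes s :: Kbar and \<sigma>0 :: "Kbar \<Rightarrow> Kbar"
  assumes s: "s ^ 2 = to_ac fls_X" and \<sigma>0: "\<sigma>0 \<in> Gal (range to_ac)" and \<sigma>0_s: "\<sigma>0 s = - s"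
begin

abbreviation h :: Kbar where "h \<equiv> to_ac fls_X"
abbreviation L where "L \<equiv> quad_ext s"

lemma ss [simp]: "s * s = h" using s by (simp add: power2_eq_square)
lemma s_nz [simp]: "s \<noteq> 0" using s by auto

lemma GalD:
  assumes "\<sigma> \<in> Gal F"
  shows "bij \<sigma>" "\<sigma> (x + y) = \<sigma> x + \<sigma> y" "\<sigma> (x * y) = \<sigma> x * \<sigma> y" "x \<in> F \<Longrightarrow> \<sigma> x = x"
  using assms by (auto simp: Gal_def)

lemma L_base: "range to_ac \<subseteq> L"
proof clarify
  fix x show "to_ac x \<in> L" unfolding quad_ext_def by (rule CollectI, intro exI[of _ x] exI[of _ 0]) simp
qed

lemma L_arith: assumes "a \<in> L" "b \<in> L" shows "a + b \<in> L" "a * b \<in> L"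
proof -
  obtain x y z w where ab: "a = to_ac x + to_ac y * s" "b = to_ac z + to_ac w * s"
    using assms unfolding quad_ext_def by blast
  have "a + b = to_ac (x + z) + to_ac (y + w) * s" by (simp add: ab algebra_simps)
  thus "a + b \<in> L" unfolding quad_ext_def by blast
  have "a * b = to_ac x * to_ac z + to_ac y * to_ac w * (s * s) + (to_ac x * to_ac w + to_ac y * to_ac z) * s"
    by (simp add: ab algebra_simps del: ss)
  also have "\<dots> = to_ac (x * z + y * w * fls_X) + to_ac (x * w + y * z) * s"
    by simp
  finally show "a * b \<in> L" unfolding quad_ext_def by blast
qed

lemma s_in_L: "s \<in> L"
  unfolding quad_ext_def by (rule CollectI, intro exI[of _ 0] exI[of _ 1]) simp

lemma fixed_in_L: "(\<And>\<sigma>. \<sigma> \<in> Gal L \<Longrightarrow> \<sigma> x = x) \<Longrightarrow> x \<in> L"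
  using moved_by_automorphism[OF L_base conjI[OF L_arith]] by blast

lemma Gal_K_to_ac: "\<sigma> \<in> Gal (range to_ac) \<Longrightarrow> \<sigma> (to_ac x) = to_ac x"
  by (auto simp: Gal_def)

lemma Gal_L_K: "Gal L \<subseteq> Gal (range to_ac)"
  using L_base unfolding Gal_def by blast

lemma \<sigma>0_to_ac [simp]: "\<sigma>0 (to_ac x) = to_ac x" using Gal_K_to_ac[OF \<sigma>0] .

lemma fixed_in_K:
  assumes "x \<in> L" "\<sigma>0 x = x" shows "x \<in> range to_ac"
proof -
  obtain a b where x: "x = to_ac a + to_ac b * s" using assms unfolding quad_ext_def by blast
  have "\<sigma>0 x = to_ac a - to_ac b * s" using GalD[OF \<sigma>0] \<sigma>0_s by (simp add: x)
  hence "2 * to_ac b * s = 0" using assms(2) x by simp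
  hence "b = 0" by simp
  thus ?thesis using x by auto
qed

lemma \<sigma>0_\<sigma>0_L: assumes "x \<in> L" shows "\<sigma>0 (\<sigma>0 x) = x" "\<sigma>0 x \<in> L"
proof -
  obtain a b where x: "x = to_ac a + to_ac b * s" using assms unfolding quad_ext_def by blast
  have *: "\<sigma>0 x = to_ac a + to_ac (- b) * s" using GalD[OF \<sigma>0] \<sigma>0_s by (simp add: x)
  show "\<sigma>0 (\<sigma>0 x) = x" using GalD[OF \<sigma>0] \<sigma>0_s
    by (subst *, subst x) (simp del: to_ac_minus, simp)
  show "\<sigma>0 x \<in> L" unfolding * quad_ext_def by blast
qed

lemma Gal_field_hom:
  assumes "\<sigma> \<in> Gal F" "range to_ac \<subseteq> F"
  shows "\<sigma> 0 = 0" "\<sigma> 1 = 1" "\<sigma> (- x) = - \<sigma> x" "\<sigma> (x - y) = \<sigma> x - \<sigma> y" "\<sigma> (inverse x) = inverse (\<sigma> x)"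
    "\<sigma> (x / y) = \<sigma> x / \<sigma> y" "\<sigma> x = \<sigma> y \<longleftrightarrow> x = y" "\<sigma> x = 0 \<longleftrightarrow> x = 0"
proof -
  note G = GalD[OF assms(1)]
  show 0: "\<sigma> 0 = 0" using G(2)[of 0 0] by simp
  have "to_ac 1 \<in> F" using assms(2) by blast
  thus 1: "\<sigma> 1 = 1" using G(4) by simp
  show m: "\<sigma> (- x) = - \<sigma> x" for x using G(2)[of x "-x"] 0 by (simp add: eq_neg_iff_add_eq_0 add.commute)
  show "\<sigma> (x - y) = \<sigma> x - \<sigma> y" using G(2)[of x "-y"] m by simp
  show inj: "\<sigma> x = \<sigma> y \<longleftrightarrow> x = y" for x y using G(1) by (metis bij_def injD)
  show z: "\<sigma> x = 0 \<longleftrightarrow> x = 0" for x using inj[of x 0] 0 by simp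
  show i: "\<sigma> (inverse x) = inverse (\<sigma> x)" for x
  proof (cases "x = 0")
    case False
    have "\<sigma> x * \<sigma> (inverse x) = 1" using False by (simp flip: G(3) add: 1)
    thus ?thesis by (metis inverse_unique)
  qed (simp add: 0)
  show "\<sigma> (x / y) = \<sigma> x / \<sigma> y" by (simp add: divide_inverse G i)
qed

lemmas \<sigma>0_hom = GalD(2,3)[OF \<sigma>0] Gal_field_hom[OF \<sigma>0 subset_refl]

text \<open>The square k^2 is the norm of k, and h k^2 is the norm of i k s, because \<sigma>0
  changes the sign of s and i^2 = -1.\<close>

lemma norm_surj:
  assumes c: "c \<in> range to_ac" "c \<noteq> 0"
  shows "\<exists>d\<in>L. d \<noteq> 0 \<and> d * \<sigma>0 d = c"
proof -
  obtain c' where c': "c = to_ac c'" using c by auto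
  obtain k where "c' = k ^ 2 \<or> c' = fls_X * k ^ 2" using fls_square_or_X_square by blast
  thus ?thesis
  proof
    assume k: "c' = k ^ 2"
    show ?thesis
    proof (rule bexI[of _ "to_ac k"], intro conjI)
      show "to_ac k * \<sigma>0 (to_ac k) = c" by (simp add: c' k power2_eq_square)
    qed (use k c c' L_base in auto)
  next
    assume k: "c' = fls_X * k ^ 2"
    let ?i = "to_ac (fls_const \<i>) :: Kbar"
    have i: "?i * ?i = - 1"
      by (simp add: fls_const_mult_const flip: to_ac_mult)
    show ?thesis
    proof (rule bexI[of _ "to_ac (fls_const \<i> * k) * s"], intro conjI)
      have "to_ac (fls_const \<i> * k) * s * \<sigma>0 (to_ac (fls_const \<i> * k) * s)
          = - ((?i * ?i) * (to_ac k * to_ac k) * (s * s))"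
        using \<sigma>0_s by (simp add: \<sigma>0_hom del: ss)
      also have "\<dots> = c" unfolding i by (simp add: c' k power2_eq_square)
      finally show "to_ac (fls_const \<i> * k) * s * \<sigma>0 (to_ac (fls_const \<i> * k) * s) = c" .
      show "to_ac (fls_const \<i> * k) * s \<noteq> 0" using c c' k by auto
    qed (use L_arith L_base s_in_L in blast)
  qed
qed

text \<open>The elements of K are squares or h = s^2 times squares. These two alternatives for the
  square of a diagonal entry become the two cohomology classes.\<close>

lemma sqrt_of_K:
  assumes "d * d \<in> range to_ac"
  shows "d \<in> range to_ac \<or> d / s \<in> range to_ac"
proof -
  obtain c where c: "d * d = to_ac c" using assms by auto
  obtain k where "c = k ^ 2 \<or> c = fls_X * k ^ 2" using fls_square_or_X_square by blast
  thus ?thesis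
  proof
    assume "c = k ^ 2"
    hence "d ^ 2 = to_ac k ^ 2" using c by (simp add: power2_eq_square)
    hence "d = to_ac k \<or> d = to_ac (- k)" by (simp add: power2_eq_iff)
    thus ?thesis by blast
  next
    assume "c = fls_X * k ^ 2"
    hence "d * d = s * s * (to_ac k * to_ac k)" using c by (simp add: power2_eq_square)
    hence "(d / s) ^ 2 = to_ac k ^ 2" by (simp add: power2_eq_square field_simps del: ss)
    hence "d / s = to_ac k \<or> d / s = to_ac (- k)" by (simp add: power2_eq_iff)
    thus ?thesis by blast
  qed
qed

lemma s_notin_K: "s \<notin> range to_ac"
proof
  assume "s \<in> range to_ac"
  then obtain k where "s = to_ac k" by auto
  with s have "to_ac (k ^ 2) = to_ac fls_X" by simp
  thus False using fls_X_not_square[of k] by (metis to_ac_eq_iff)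
qed

end

section \<open>Matrices and tensors\<close>

lemma mat_inverse_det:
  fixes x :: "'a :: field mat"
  assumes x: "x \<in> carrier_mat m m" and det: "det x \<noteq> 0"
  shows "the (mat_inverse x) \<in> carrier_mat m m" "x * the (mat_inverse x) = 1\<^sub>m m"
    "the (mat_inverse x) * x = 1\<^sub>m m"
proof -
  have "x \<in> Units (ring_mat TYPE('a) m ())" using det_non_zero_imp_unit[OF x det] .
  with mat_inverse(1)[OF x, of "()"] obtain B where "mat_inverse x = Some B" by (cases "mat_inverse x") auto
  with mat_inverse(2)[OF x this] show "the (mat_inverse x) \<in> carrier_mat m m"
    "x * the (mat_inverse x) = 1\<^sub>m m" "the (mat_inverse x) * x = 1\<^sub>m m" by auto
qed

lemma mult_cancel_mat:
  "i \<in> carrier_mat m m \<Longrightarrow> x \<in> carrier_mat m m \<Longrightarrow> y \<in> carrier_mat m m \<Longrightarrow> i * x = 1\<^sub>m m \<Longrightarrow>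
    i * (x * y) = (y :: 'a :: comm_ring_1 mat)"
  using assoc_mult_mat[of i m m x m y m] by simp

lemma mat_inverse_eqI:
  fixes x :: "'a :: field mat"
  assumes x: "x \<in> carrier_mat m m" and y: "y \<in> carrier_mat m m" and xy: "x * y = 1\<^sub>m m"
  shows "the (mat_inverse x) = y" "y * x = 1\<^sub>m m" "det x \<noteq> 0"
proof -
  have "det x * det y = 1" using det_mult[OF x y] xy by simp
  thus d: "det x \<noteq> 0" by auto
  note i = mat_inverse_det[OF x d]
  have "the (mat_inverse x) = the (mat_inverse x) * (x * y)" using i xy by simp
  also have "\<dots> = y" by (rule mult_cancel_mat[OF i(1) x y i(3)])
  finally show "the (mat_inverse x) = y" .
  with i show "y * x = 1\<^sub>m m" by simp
qed

lemma mult_mat_entry: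
  "A \<in> carrier_mat m m \<Longrightarrow> B \<in> carrier_mat m m \<Longrightarrow> i < m \<Longrightarrow> j < m \<Longrightarrow>
     (A * B) $$ (i, j) = (\<Sum>k<m. A $$ (i, k) * B $$ (k, j))"
  by (simp add: scalar_prod_def lessThan_atLeast0)

lemma Ad_carrier: "x \<in> carrier_mat m m \<Longrightarrow> det x \<noteq> 0 \<Longrightarrow> a \<in> carrier_mat m m \<Longrightarrow> Ad x a \<in> carrier_mat m m"
  using mat_inverse_det[of x m] unfolding Ad_def by auto

lemma Ad_entry:
  assumes "x \<in> carrier_mat m m" "det x \<noteq> 0" "a \<in> carrier_mat m m" "i < m" "j < m"
  shows "Ad x a $$ (i, j) = (\<Sum>p<m. \<Sum>q<m. x $$ (i, p) * a $$ (p, q) * the (mat_inverse x) $$ (q, j))"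
proof -
  note i = mat_inverse_det[OF assms(1,2)]
  have "x * a \<in> carrier_mat m m" using assms by auto
  hence "Ad x a $$ (i, j) = (\<Sum>q<m. \<Sum>p<m. x $$ (i, p) * a $$ (p, q) * the (mat_inverse x) $$ (q, j))"
    unfolding Ad_def using assms i
    by (subst mult_mat_entry[of _ m]) (auto simp: mult_mat_entry[of x m a] sum_distrib_right simp del: index_mult_mat)
  thus ?thesis by (subst sum.swap)
qed

section \<open>The trace form and its invariance\<close>

definition trace_form :: "nat \<Rightarrow> 'a :: comm_ring_1 mat \<Rightarrow> 'a mat \<Rightarrow> 'a" where
  "trace_form m a b = (\<Sum>i<m. \<Sum>j<m. a $$ (i, j) * b $$ (j, i))"

lemma trace_form_commute: "trace_form m a b = trace_form m b a"
  unfolding trace_form_def by (subst sum.swap) (simp add: mult.commute)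

lemma trace_form_assoc:
  assumes "a \<in> carrier_mat m m" "b \<in> carrier_mat m m" "c \<in> carrier_mat m m"
  shows "trace_form m (a * b) c = trace_form m a (b * c)"
proof -
  have "trace_form m (a * b) c = (\<Sum>i<m. \<Sum>j<m. \<Sum>k<m. a $$ (i, k) * b $$ (k, j) * c $$ (j, i))"
    using assms by (simp add: trace_form_def mult_mat_entry[of _ m] sum_distrib_right del: index_mult_mat)
  also have "\<dots> = (\<Sum>i<m. \<Sum>k<m. \<Sum>j<m. a $$ (i, k) * b $$ (k, j) * c $$ (j, i))"
    by (intro sum.cong refl sum.swap)
  also have "\<dots> = trace_form m a (b * c)"
    using assms by (simp add: trace_form_def mult_mat_entry[of _ m] sum_distrib_left mult.assoc del: index_mult_mat)
  finally show ?thesis .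
qed

lemma trace_form_Ad:
  assumes x: "x \<in> carrier_mat m m" "det x \<noteq> 0" and a: "a \<in> carrier_mat m m" and b: "b \<in> carrier_mat m m"
  shows "trace_form m (Ad x a) (Ad x b) = trace_form m a b"
proof -
  let ?i = "the (mat_inverse x)"
  note i = mat_inverse_det[OF x]
  have "trace_form m (Ad x a) (Ad x b) = trace_form m (x * a) (?i * (x * b * ?i))"
    unfolding Ad_def using x a b i by (intro trace_form_assoc) auto
  also have "?i * (x * b * ?i) = b * ?i"
    using x b i assoc_mult_mat[of x m m b m ?i m] by (simp add: mult_cancel_mat[of _ m])
  also have "trace_form m (x * a) (b * ?i) = trace_form m b (?i * (x * a))"
    using x a b i by (subst trace_form_commute) (intro trace_form_assoc; auto)
  also have "?i * (x * a) = a" by (rule mult_cancel_mat[OF i(1) x(1) a i(3)])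
  finally show ?thesis by (simp add: trace_form_commute)
qed

section \<open>Tensors in block form and the action of Ad on them\<close>

definition tensor_carrier :: "nat \<Rightarrow> 'a tensor set" where
  "tensor_carrier m = {t \<in> carrier_mat m m. \<forall>i<m. \<forall>j<m. t $$ (i, j) \<in> carrier_mat m m}"

lemma tensor_carrierD:
  assumes "t \<in> tensor_carrier m"
  shows "t \<in> carrier_mat m m" "i < m \<Longrightarrow> j < m \<Longrightarrow> t $$ (i, j) \<in> carrier_mat m m"
  using assms by (auto simp: tensor_carrier_def)

lemma flip_carrier: "t \<in> tensor_carrier m \<Longrightarrow> flip t \<in> tensor_carrier m"
  by (auto simp: tensor_carrier_def flip_def)

lemma flip_entry: "t \<in> tensor_carrier m \<Longrightarrow> i < m \<Longrightarrow> j < m \<Longrightarrow> k < m \<Longrightarrow> l < m \<Longrightarrow>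
    flip t $$ (i, j) $$ (k, l) = t $$ (k, l) $$ (i, j)"
  by (auto simp: tensor_carrier_def flip_def)

lemma tensor_eqI:
  assumes "s \<in> tensor_carrier m" "t \<in> tensor_carrier m"
    "\<And>i j k l. i < m \<Longrightarrow> j < m \<Longrightarrow> k < m \<Longrightarrow> l < m \<Longrightarrow> s $$ (i, j) $$ (k, l) = t $$ (i, j) $$ (k, l)"
  shows "s = t"
proof (rule eq_matI)
  show "dim_row s = dim_row t" "dim_col s = dim_col t" using assms(1,2) by (auto simp: tensor_carrier_def)
  fix i j assume "i < dim_row t" "j < dim_col t"
  hence ij: "i < m" "j < m" using assms(2) by (auto simp: tensor_carrier_def)
  show "s $$ (i, j) = t $$ (i, j)"
    using tensor_carrierD(2)[OF assms(1) ij] tensor_carrierD(2)[OF assms(2) ij] ij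
    by (intro eq_matI) (auto intro!: assms(3))
qed

lemma map_Ad_carrier:
  "x \<in> carrier_mat m m \<Longrightarrow> det x \<noteq> 0 \<Longrightarrow> t \<in> tensor_carrier m \<Longrightarrow> map_mat (Ad x) t \<in> tensor_carrier m"
  using Ad_carrier[of x m] unfolding tensor_carrier_def by auto

lemma Ad_tensor_carrier:
  "x \<in> carrier_mat m m \<Longrightarrow> det x \<noteq> 0 \<Longrightarrow> t \<in> tensor_carrier m \<Longrightarrow> Ad_tensor x t \<in> tensor_carrier m"
  unfolding Ad_tensor_def tensor_map_def by (intro flip_carrier map_Ad_carrier)

lemma Ad_tensor_entry:
  assumes x: "x \<in> carrier_mat m m" "det x \<noteq> 0" and t: "t \<in> tensor_carrier m"
    and "i < m" "j < m" "k < m" "l < m"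
  shows "Ad_tensor x t $$ (i, j) $$ (k, l) =
    (\<Sum>p<m. \<Sum>q<m. x $$ (i, p) * Ad x (t $$ (p, q)) $$ (k, l) * the (mat_inverse x) $$ (q, j))"
proof -
  let ?t = "map_mat (Ad x) t"
  have t1: "?t \<in> tensor_carrier m" by (rule map_Ad_carrier[OF x t])
  have t2: "flip ?t \<in> tensor_carrier m" by (rule flip_carrier[OF t1])
  have "Ad_tensor x t $$ (i, j) $$ (k, l) = map_mat (Ad x) (flip ?t) $$ (k, l) $$ (i, j)"
    unfolding Ad_tensor_def tensor_map_def using assms
    by (intro flip_entry map_Ad_carrier flip_carrier) auto
  also have "\<dots> = Ad x (flip ?t $$ (k, l)) $$ (i, j)" using tensor_carrierD(1)[OF t2] assms by simp
  also have "\<dots> = (\<Sum>p<m. \<Sum>q<m. x $$ (i, p) * flip ?t $$ (k, l) $$ (p, q) * the (mat_inverse x) $$ (q, j))"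
    using assms tensor_carrierD[OF t2] by (intro Ad_entry) auto
  also have "\<dots> = (\<Sum>p<m. \<Sum>q<m. x $$ (i, p) * Ad x (t $$ (p, q)) $$ (k, l) * the (mat_inverse x) $$ (q, j))"
    using assms t1 tensor_carrierD[OF t] by (intro sum.cong refl) (simp add: flip_entry[of _ m])
  finally show ?thesis .
qed

text \<open>The endomorphism y \<mapsto> (id \<otimes> tr(. y)) t of the matrix algebra. The trace
  form is given by entries and is invariant under conjugation by all invertible matrices, which
  makes it more convenient here than the Killing form.\<close>

definition contract :: "nat \<Rightarrow> 'a :: comm_ring_1 tensor \<Rightarrow> 'a mat \<Rightarrow> 'a mat" where
  "contract m t y = mat m m (\<lambda>(i, j). trace_form m (t $$ (i, j)) y)"

lemma contract_carrier [simp]: "contract m t y \<in> carrier_mat m m"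
  by (simp add: contract_def)

text \<open>Invariance of the trace form lets Ad pass through the contraction. So an element that
  carries one tensor to another conjugates their endomorphisms, and with them the spaces that are
  killed by some power.\<close>

lemma contract_Ad_tensor:
  assumes x: "x \<in> carrier_mat m m" "det x \<noteq> 0" and t: "t \<in> tensor_carrier m" and y: "y \<in> carrier_mat m m"
  shows "contract m (Ad_tensor x t) (Ad x y) = Ad x (contract m t y)"
proof (rule eq_matI)
  show "dim_row (contract m (Ad_tensor x t) (Ad x y)) = dim_row (Ad x (contract m t y))"
    "dim_col (contract m (Ad_tensor x t) (Ad x y)) = dim_col (Ad x (contract m t y))"
    using Ad_carrier[OF x contract_carrier, of t y] by (auto simp: contract_def)
  fix i j assume "i < dim_row (Ad x (contract m t y))" "j < dim_col (Ad x (contract m t y))"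
  hence ij: "i < m" "j < m" using Ad_carrier[OF x contract_carrier, of t y] by auto
  let ?i = "the (mat_inverse x)" and ?A = "\<lambda>p q. Ad x (t $$ (p, q))"
  have swap: "(\<Sum>k<m. \<Sum>l<m. \<Sum>p<m. \<Sum>q<m. f k l p q) = (\<Sum>p<m. \<Sum>q<m. \<Sum>k<m. \<Sum>l<m. f k l p q)"
    for f :: "nat \<Rightarrow> nat \<Rightarrow> nat \<Rightarrow> nat \<Rightarrow> 'a"
  proof -
    have "(\<Sum>k<m. \<Sum>l<m. \<Sum>p<m. \<Sum>q<m. f k l p q) = (\<Sum>k<m. \<Sum>p<m. \<Sum>q<m. \<Sum>l<m. f k l p q)"
      by (subst (3) sum.swap, subst (2) sum.swap) simp
    also have "\<dots> = (\<Sum>p<m. \<Sum>q<m. \<Sum>k<m. \<Sum>l<m. f k l p q)"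
      by (subst sum.swap, subst (2) sum.swap) simp
    finally show ?thesis .
  qed
  have "contract m (Ad_tensor x t) (Ad x y) $$ (i, j) =
    (\<Sum>k<m. \<Sum>l<m. (\<Sum>p<m. \<Sum>q<m. x $$ (i, p) * ?A p q $$ (k, l) * ?i $$ (q, j)) * Ad x y $$ (l, k))"
    using ij by (simp add: contract_def trace_form_def Ad_tensor_entry[OF x t])
  also have "\<dots> = (\<Sum>k<m. \<Sum>l<m. \<Sum>p<m. \<Sum>q<m. (x $$ (i, p) * ?i $$ (q, j)) * (?A p q $$ (k, l) * Ad x y $$ (l, k)))"
    unfolding sum_distrib_right by (intro sum.cong refl) (simp add: mult_ac)
  also have "\<dots> = (\<Sum>p<m. \<Sum>q<m. \<Sum>k<m. \<Sum>l<m. (x $$ (i, p) * ?i $$ (q, j)) * (?A p q $$ (k, l) * Ad x y $$ (l, k)))"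
    by (rule swap)
  also have "\<dots> = (\<Sum>p<m. \<Sum>q<m. (x $$ (i, p) * ?i $$ (q, j)) * trace_form m (?A p q) (Ad x y))"
    by (simp add: trace_form_def sum_distrib_left)
  also have "\<dots> = (\<Sum>p<m. \<Sum>q<m. x $$ (i, p) * contract m t y $$ (p, q) * ?i $$ (q, j))"
    using tensor_carrierD[OF t] by (intro sum.cong refl) (simp add: contract_def trace_form_Ad[OF x _ y] algebra_simps)
  also have "\<dots> = Ad x (contract m t y) $$ (i, j)" using ij by (simp add: Ad_entry[OF x])
  finally show "contract m (Ad_tensor x t) (Ad x y) $$ (i, j) = Ad x (contract m t y) $$ (i, j)" .
qed

section \<open>Monomial matrices and their action on tensors\<close>

definition monomial_mat :: "nat \<Rightarrow> (nat \<Rightarrow> nat) \<Rightarrow> (nat \<Rightarrow> 'a :: zero) \<Rightarrow> 'a mat" where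
  "monomial_mat m \<pi> a = mat m m (\<lambda>(i, j). if i = \<pi> j then a j else 0)"

lemma monomial_carrier [simp]: "monomial_mat m \<pi> a \<in> carrier_mat m m"
  by (simp add: monomial_mat_def)

lemma mult_monomial:
  assumes "x \<in> carrier_mat m m" "i < m" "j < m" "\<pi> j < m"
  shows "(x * monomial_mat m \<pi> a) $$ (i, j) = x $$ (i, \<pi> j) * (a j :: 'a :: comm_ring_1)"
proof -
  have "(x * monomial_mat m \<pi> a) $$ (i, j) = (\<Sum>k<m. x $$ (i, k) * (if k = \<pi> j then a j else 0))"
    using assms by (simp add: mult_mat_entry[of _ m] monomial_mat_def del: index_mult_mat)
  also have "\<dots> = (\<Sum>k<m. if k = \<pi> j then x $$ (i, \<pi> j) * a j else 0)" by (intro sum.cong) auto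
  finally show ?thesis using assms by simp
qed

context
  fixes m :: nat and \<pi> :: "nat \<Rightarrow> nat" and a :: "nat \<Rightarrow> 'a :: field"
  assumes \<pi>: "\<And>i. i < m \<Longrightarrow> \<pi> i < m" "\<And>i. i < m \<Longrightarrow> \<pi> (\<pi> i) = i" and a: "\<And>i. i < m \<Longrightarrow> a i \<noteq> 0"
begin

lemma monomial_inverse:
  "the (mat_inverse (monomial_mat m \<pi> a)) = monomial_mat m \<pi> (\<lambda>i. 1 / a (\<pi> i))"
  "det (monomial_mat m \<pi> a) \<noteq> 0"
proof -
  have "monomial_mat m \<pi> a * monomial_mat m \<pi> (\<lambda>i. 1 / a (\<pi> i)) = 1\<^sub>m m"
  proof (rule eq_matI)
    fix i j assume "i < dim_row (1\<^sub>m m :: 'a mat)" "j < dim_col (1\<^sub>m m :: 'a mat)"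
    hence ij: "i < m" "j < m" by auto
    show "(monomial_mat m \<pi> a * monomial_mat m \<pi> (\<lambda>i. 1 / a (\<pi> i))) $$ (i, j) = 1\<^sub>m m $$ (i, j)"
      using ij \<pi> a
      by (subst mult_monomial) (auto simp: monomial_mat_def)
  qed (auto simp: monomial_mat_def)
  from mat_inverse_eqI[OF _ _ this] show "the (mat_inverse (monomial_mat m \<pi> a)) =
      monomial_mat m \<pi> (\<lambda>i. 1 / a (\<pi> i))" "det (monomial_mat m \<pi> a) \<noteq> 0" by simp_all
qed

lemma monomial_double_sum:
  assumes "i < m" "j < m"
  shows "(\<Sum>p<m. \<Sum>q<m. monomial_mat m \<pi> a $$ (\<pi> i, p) * f p q * the (mat_inverse (monomial_mat m \<pi> a)) $$ (q, \<pi> j))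
    = a i / a j * f i j"
proof -
  have inj: "\<pi> p = \<pi> q \<longleftrightarrow> p = q" if "p < m" "q < m" for p q using \<pi> that by metis
  have "(\<Sum>p<m. \<Sum>q<m. monomial_mat m \<pi> a $$ (\<pi> i, p) * f p q * the (mat_inverse (monomial_mat m \<pi> a)) $$ (q, \<pi> j))
    = (\<Sum>p<m. \<Sum>q<m. if p = i then if q = j then a i / a j * f i j else 0 else 0)"
    using assms \<pi>
    unfolding monomial_inverse by (intro sum.cong refl) (auto simp: monomial_mat_def inj)
  also have "\<dots> = (\<Sum>p<m. if p = i then a i / a j * f i j else 0)"
    using assms by (intro sum.cong) auto
  finally show ?thesis using assms by simp
qed

lemma Ad_tensor_monomial:
  assumes t: "t \<in> tensor_carrier m" and "i < m" "j < m" "k < m" "l < m"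
  shows "Ad_tensor (monomial_mat m \<pi> a) t $$ (\<pi> i, \<pi> j) $$ (\<pi> k, \<pi> l) =
    (a i * a k) / (a j * a l) * t $$ (i, j) $$ (k, l)"
proof -
  have "Ad_tensor (monomial_mat m \<pi> a) t $$ (\<pi> i, \<pi> j) $$ (\<pi> k, \<pi> l)
      = a i / a j * Ad (monomial_mat m \<pi> a) (t $$ (i, j)) $$ (\<pi> k, \<pi> l)"
    using assms \<pi> by (subst Ad_tensor_entry[OF _ _ t]) (auto simp: monomial_inverse(2) monomial_double_sum)
  also have "Ad (monomial_mat m \<pi> a) (t $$ (i, j)) $$ (\<pi> k, \<pi> l) = a k / a l * t $$ (i, j) $$ (k, l)"
    using assms \<pi> tensor_carrierD[OF t]
    by (subst Ad_entry[of _ m]) (auto simp: monomial_inverse(2) monomial_double_sum)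
  finally show ?thesis by simp
qed

text \<open>Reduces an equation between tensors to scalar equations for their coordinates. It serves
  diagonal matrices, with \<pi> the identity, as well as flipping elements, with \<pi> an involution
  of the indices.\<close>

lemma Ad_tensor_monomial_eq_iff:
  assumes t: "t \<in> tensor_carrier m" and t': "t' \<in> tensor_carrier m"
  shows "Ad_tensor (monomial_mat m \<pi> a) t = t' \<longleftrightarrow> (\<forall>i<m. \<forall>j<m. \<forall>k<m. \<forall>l<m.
    t' $$ (\<pi> i, \<pi> j) $$ (\<pi> k, \<pi> l) = (a i * a k) / (a j * a l) * t $$ (i, j) $$ (k, l))" (is "?l = ?r")
proof
  assume ?l thus ?r using Ad_tensor_monomial[OF t] by metis
next
  assume r: ?r
  show ?l
  proof (rule tensor_eqI[OF Ad_tensor_carrier t'])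
    fix i j k l assume *: "i < m" "j < m" "k < m" "l < m"
    hence **: "\<pi> i < m" "\<pi> j < m" "\<pi> k < m" "\<pi> l < m" using \<pi> by auto
    from r ** have "t' $$ (\<pi> (\<pi> i), \<pi> (\<pi> j)) $$ (\<pi> (\<pi> k), \<pi> (\<pi> l)) =
      (a (\<pi> i) * a (\<pi> k)) / (a (\<pi> j) * a (\<pi> l)) * t $$ (\<pi> i, \<pi> j) $$ (\<pi> k, \<pi> l)" by blast
    with Ad_tensor_monomial[OF t **] show
      "Ad_tensor (monomial_mat m \<pi> a) t $$ (i, j) $$ (k, l) = t' $$ (i, j) $$ (k, l)"
      using * by (simp add: \<pi>)
  qed (auto simp: monomial_inverse(2) t)
qed

end

section \<open>Classical groups and their roots\<close>

locale classical =
  fixes ty :: classical_type and n :: nat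
  assumes n_pos: "1 \<le> n" and n_D: "ty = Type_D \<Longrightarrow> 3 \<le> n"
begin

abbreviation M where "M \<equiv> msize ty n"

lemma M_cases: "M = 2 * n \<or> (ty = Type_B \<and> M = 2 * n + 1)"
  by (cases ty) auto

lemma M_simps: "ty = Type_B \<Longrightarrow> M = 2 * n + 1" "ty \<noteq> Type_B \<Longrightarrow> M = 2 * n" "2 * n \<le> M" "0 < M"
  using n_pos by (cases ty; auto)+

definition rv :: "nat \<Rightarrow> nat" where "rv i = M - 1 - i"

definition sg :: "nat \<Rightarrow> 'a :: comm_ring_1" where
  "sg i = (if ty = Type_C \<and> n \<le> i then - 1 else 1)"

lemma rv_lt [simp]: "i < M \<Longrightarrow> rv i < M" and rv_rv [simp]: "i < M \<Longrightarrow> rv (rv i) = i"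
  by (auto simp: rv_def)

lemma rv_less_rv [simp]: "i < M \<Longrightarrow> j < M \<Longrightarrow> rv i < rv j \<longleftrightarrow> j < i"
  by (auto simp: rv_def)

lemma rv_inj [simp]: "i < M \<Longrightarrow> j < M \<Longrightarrow> rv i = rv j \<longleftrightarrow> i = j"
  by (auto simp: rv_def)

lemma rv_eq_flip: "i < M \<Longrightarrow> j < M \<Longrightarrow> rv i = j \<longleftrightarrow> i = rv j"
  by (auto simp: rv_def)

lemma sg_sg [simp]: "sg i * sg i = (1 :: 'a :: comm_ring_1)" "sg i * (sg i * x) = (x :: 'a :: comm_ring_1)"
  by (auto simp: sg_def)

lemma sg_nz [simp]: "sg i \<noteq> (0 :: 'a :: field)" by (simp add: sg_def)

lemma sg_rv: "i < M \<Longrightarrow> sg (rv i) = (if ty = Type_C then - sg i else sg i :: 'a :: comm_ring_1)"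
  unfolding sg_def rv_def using M_simps by auto

lemma sg_cases: "(sg i :: 'a :: comm_ring_1) = 1 \<or> (sg i :: 'a) = - 1"
  by (simp add: sg_def)

lemma form_mat_monomial: "(form_mat ty n :: 'a :: comm_ring_1 mat) = monomial_mat M rv (\<lambda>j. sg (rv j))"
  by (rule eq_matI) (auto simp: form_mat_def monomial_mat_def rv_def sg_def)

lemma form_mat_carrier [simp]: "(form_mat ty n :: 'a :: comm_ring_1 mat) \<in> carrier_mat M M"
  by (simp add: form_mat_def)

lemma form_mat_dim [simp]:
  "dim_row (form_mat ty n :: 'a :: comm_ring_1 mat) = M" "dim_col (form_mat ty n :: 'a mat) = M"
  by (simp_all add: form_mat_def)

lemmas mat_assoc = assoc_mult_mat[of _ M M _ M _ M] mult_carrier_mat[of _ M M _ M]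

lemma sum_rv: "(\<Sum>k<M. f (rv k)) = (\<Sum>k<M. f k)"
  by (rule sum.reindex_bij_witness[of _ rv rv]) auto

lemma form_entry:
  assumes "(x :: 'a :: comm_ring_1 mat) \<in> carrier_mat M M" "y \<in> carrier_mat M M" "i < M" "j < M"
  shows "(x * form_mat ty n * transpose_mat y) $$ (i, j) = (\<Sum>k<M. x $$ (i, k) * sg k * y $$ (j, rv k))"
proof -
  have "(x * form_mat ty n * transpose_mat y) $$ (i, j) =
      (\<Sum>l<M. (x * form_mat ty n) $$ (i, l) * transpose_mat y $$ (l, j))"
    using assms by (intro mult_mat_entry) auto
  also have "\<dots> = (\<Sum>l<M. x $$ (i, rv l) * sg (rv l) * y $$ (j, l))"
    using assms unfolding form_mat_monomial by (intro sum.cong refl) (simp add: mult_monomial del: index_mult_mat(1))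
  also have "\<dots> = (\<Sum>l<M. x $$ (i, rv l) * sg (rv l) * y $$ (j, rv (rv l)))"
    by (intro sum.cong refl) simp
  also have "\<dots> = (\<Sum>k<M. x $$ (i, k) * sg k * y $$ (j, rv k))"
    by (rule sum_rv)
  finally show ?thesis .
qed

lemma form_mat_entry: "i < M \<Longrightarrow> j < M \<Longrightarrow>
    (form_mat ty n :: 'a :: comm_ring_1 mat) $$ (i, j) = (if j = rv i then sg i else 0)"
  unfolding form_mat_monomial by (auto simp: monomial_mat_def rv_def)

lemma group_iff:
  "(x :: 'a :: comm_ring_1 mat) \<in> classical_group ty n \<longleftrightarrow> x \<in> carrier_mat M M \<and> det x = 1 \<and>
     (\<forall>i<M. \<forall>j<M. (\<Sum>k<M. x $$ (i, k) * sg k * x $$ (j, rv k)) = (if j = rv i then sg i else 0))"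
proof -
  have "x * form_mat ty n * transpose_mat x = form_mat ty n \<longleftrightarrow>
     (\<forall>i<M. \<forall>j<M. (\<Sum>k<M. x $$ (i, k) * sg k * x $$ (j, rv k)) = (if j = rv i then sg i else 0))"
    (is "?A = ?B \<longleftrightarrow> ?r") if x: "x \<in> carrier_mat M M"
  proof
    assume eq: "?A = ?B"
    show ?r
    proof (intro allI impI)
      fix i j assume ij: "i < M" "j < M"
      show "(\<Sum>k<M. x $$ (i, k) * sg k * x $$ (j, rv k)) = (if j = rv i then sg i else 0)"
        unfolding form_entry[OF x x ij, symmetric] eq by (rule form_mat_entry[OF ij])
    qed
  next
    assume r: ?r
    show "?A = ?B"
    proof (rule eq_matI)
      fix i j assume "i < dim_row ?B" "j < dim_col ?B"
      hence ij: "i < M" "j < M" by auto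
      show "?A $$ (i, j) = ?B $$ (i, j)"
        unfolding form_entry[OF x x ij] form_mat_entry[OF ij] using r ij by blast
    qed (use x in auto)
  qed
  thus ?thesis unfolding classical_group_def by blast
qed

lemma lie_iff:
  "(x :: 'a :: comm_ring_1 mat) \<in> lie_alg ty n \<longleftrightarrow> x \<in> carrier_mat M M \<and>
     (\<forall>i<M. \<forall>j<M. x $$ (rv j, rv i) = - (sg i * sg j * x $$ (i, j)))"
proof -
  have "x * form_mat ty n + form_mat ty n * transpose_mat x = 0\<^sub>m M M \<longleftrightarrow>
     (\<forall>i<M. \<forall>j<M. x $$ (rv j, rv i) = - (sg i * sg j * x $$ (i, j)))"
    (is "?A = ?B \<longleftrightarrow> ?r") if x: "x \<in> carrier_mat M M"
  proof -
    have 1: "(1\<^sub>m M * form_mat ty n * transpose_mat x) $$ (i, j) = sg i * x $$ (j, rv i)" if "i < M" "j < M" for i j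
    proof -
      have "(1\<^sub>m M * form_mat ty n * transpose_mat x) $$ (i, j) = (\<Sum>k<M. (1\<^sub>m M) $$ (i, k) * sg k * x $$ (j, rv k))"
        using that x by (intro form_entry) auto
      also have "\<dots> = (\<Sum>k<M. if k = i then sg i * x $$ (j, rv i) else 0)"
        using that by (intro sum.cong) auto
      finally show ?thesis using that by simp
    qed
    have A: "?A $$ (i, j) = x $$ (i, rv j) * sg (rv j) + sg i * x $$ (j, rv i)" if "i < M" "j < M" for i j
    proof -
      have "(x * form_mat ty n) $$ (i, j) = x $$ (i, rv j) * sg (rv j)"
        unfolding form_mat_monomial using that x by (subst mult_monomial) auto
      moreover have "1\<^sub>m M * form_mat ty n = (form_mat ty n :: 'a mat)" by simp
      ultimately show ?thesis
        using 1[OF that] x that by (subst index_add_mat(1)) (simp_all del: index_mult_mat(1))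
    qed
    show ?thesis
    proof
      assume *: "?A = ?B"
      show ?r
      proof (intro allI impI)
        fix i j assume ij: "i < M" "j < M"
        have "x $$ (i, rv (rv j)) * sg (rv (rv j)) + sg i * x $$ (rv j, rv i) = 0"
          using A[of i "rv j"] ij unfolding * by simp
        hence "sg i * (x $$ (i, j) * sg j + sg i * x $$ (rv j, rv i)) = 0" using ij by simp
        hence "x $$ (rv j, rv i) + sg i * sg j * x $$ (i, j) = 0" by (simp add: algebra_simps)
        thus "x $$ (rv j, rv i) = - (sg i * sg j * x $$ (i, j))" by (simp add: eq_neg_iff_add_eq_0)
      qed
    next
      assume r: ?r
      show "?A = ?B"
      proof (rule eq_matI)
        fix i j assume "i < dim_row ?B" "j < dim_col ?B"
        hence ij: "i < M" "j < M" by auto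
        have "x $$ (rv (rv j), rv i) = - (sg i * sg (rv j) * x $$ (i, rv j))" using r ij rv_lt by blast
        with A[OF ij] ij show "?A $$ (i, j) = ?B $$ (i, j)"
          by (simp add: algebra_simps del: index_mult_mat(1) index_add_mat)
      qed (use x in auto)
    qed
  qed
  thus ?thesis unfolding lie_alg_def by blast
qed

lemma groupD:
  assumes "(x :: 'a :: comm_ring_1 mat) \<in> classical_group ty n"
  shows "x \<in> carrier_mat M M" "det x = 1" "x * form_mat ty n * transpose_mat x = form_mat ty n"
  using assms by (auto simp: classical_group_def)

lemma group_inverse:
  assumes "(x :: 'a :: field mat) \<in> classical_group ty n"
  shows "the (mat_inverse x) \<in> carrier_mat M M" "x * the (mat_inverse x) = 1\<^sub>m M"
    "the (mat_inverse x) * x = 1\<^sub>m M"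
  using mat_inverse_det[of x M] groupD[OF assms] by auto

lemma group_sum:
  "(x :: 'a :: comm_ring_1 mat) \<in> classical_group ty n \<Longrightarrow> i < M \<Longrightarrow> j < M \<Longrightarrow>
    (\<Sum>k<M. x $$ (i, k) * sg k * x $$ (j, rv k)) = (if j = rv i then sg i else 0)"
  unfolding group_iff by blast

lemma group_mult:
  assumes x: "(x :: 'a :: comm_ring_1 mat) \<in> classical_group ty n" and y: "y \<in> classical_group ty n"
  shows "x * y \<in> classical_group ty n"
proof -
  note c = groupD(1)[OF x] groupD(1)[OF y] form_mat_carrier[where 'a='a]
  let ?B = "form_mat ty n :: 'a mat"
  have "x * y * ?B * transpose_mat (x * y) = x * (y * ?B * transpose_mat y) * transpose_mat x"
    using c by (subst transpose_mult[OF c(1,2)]) (simp add: mat_assoc)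
  thus ?thesis using groupD[OF x] groupD[OF y] by (simp add: classical_group_def det_mult[of _ M])
qed

lemma group_inverse_in:
  assumes x: "(x :: 'a :: field mat) \<in> classical_group ty n"
  shows "the (mat_inverse x) \<in> classical_group ty n"
proof -
  let ?i = "the (mat_inverse x)" and ?B = "form_mat ty n :: 'a mat"
  note c = groupD(1)[OF x] form_mat_carrier[where 'a='a] and i = group_inverse[OF x]
  have T: "transpose_mat x * transpose_mat ?i = 1\<^sub>m M"
    using transpose_mult[OF i(1) c(1)] i(3) by simp
  have "?i * ?B * transpose_mat ?i = ?i * (x * ?B * transpose_mat x) * transpose_mat ?i"
    by (simp add: groupD(3)[OF x])
  also have "\<dots> = (?i * (x * ?B)) * (transpose_mat x * transpose_mat ?i)"
    using c i(1) by (simp add: mat_assoc)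
  also have "?i * (x * ?B) = ?B" by (rule mult_cancel_mat[OF i(1) c i(3)])
  finally have "?i * ?B * transpose_mat ?i = ?B" using T by simp
  moreover have "det ?i = 1" using det_mult[OF i(1) c(1)] i(3) groupD(2)[OF x] by simp
  ultimately show ?thesis using i(1) by (simp add: classical_group_def)
qed

lemma Ad_lie_alg:
  assumes x: "(x :: 'a :: field mat) \<in> classical_group ty n" and y: "y \<in> lie_alg ty n"
  shows "Ad x y \<in> lie_alg ty n"
proof -
  let ?i = "the (mat_inverse x)" and ?B = "form_mat ty n :: 'a mat" and ?t = transpose_mat
  note c = groupD(1)[OF x] form_mat_carrier[where 'a='a] and i = group_inverse[OF x]
  have yc: "y \<in> carrier_mat M M" and y0: "y * ?B + ?B * ?t y = 0\<^sub>m M M" using y by (auto simp: lie_alg_def)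
  have T: "?t x * ?t ?i = 1\<^sub>m M" using transpose_mult[OF i(1) c(1)] i(3) by simp
  have a: "?i * ?B = ?B * ?t x"
    using mult_cancel_mat[OF i(1) c(1) _ i(3), of "?B * ?t x"] c groupD(3)[OF x]
    by (simp add: mat_assoc)
  have b: "?B * ?t ?i = x * ?B"
  proof -
    have "?B * ?t ?i = x * ?B * ?t x * ?t ?i" by (simp add: groupD(3)[OF x])
    also have "\<dots> = x * ?B * (?t x * ?t ?i)" using c i(1) by (simp add: mat_assoc)
    finally show ?thesis using T c by simp
  qed
  have "Ad x y * ?B = x * y * (?i * ?B)"
    unfolding Ad_def using c i(1) yc by (simp add: mat_assoc)
  also have "\<dots> = x * (y * ?B) * ?t x"
    unfolding a using c yc by (simp add: mat_assoc)
  finally have 1: "Ad x y * ?B = x * (y * ?B) * ?t x" .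
  have "?B * ?t (Ad x y) = (?B * ?t ?i) * (?t y * ?t x)"
    unfolding Ad_def using c i(1) yc
    by (subst transpose_mult[of _ M M _ M], simp, simp, subst transpose_mult[of x M M y M])
       (auto simp: mat_assoc)
  also have "\<dots> = x * (?B * ?t y) * ?t x"
    unfolding b using c yc by (simp add: mat_assoc)
  finally have 2: "?B * ?t (Ad x y) = x * (?B * ?t y) * ?t x" .
  have "Ad x y * ?B + ?B * ?t (Ad x y) = x * (y * ?B + ?B * ?t y) * ?t x"
    unfolding 1 2 using c yc
    by (simp add: mult_add_distrib_mat[of _ M M _ M] add_mult_distrib_mat[of _ M M _ _ M] mult_carrier_mat[of _ M M _ M])
  also have "\<dots> = 0\<^sub>m M M" unfolding y0 using c by simp
  finally show ?thesis
    using Ad_carrier[OF c(1) _ yc] groupD(2)[OF x] by (simp add: lie_alg_def)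
qed

lemma group_hom:
  assumes x: "(x :: 'a :: comm_ring_1 mat) \<in> classical_group ty n" and f: "comm_ring_hom (f :: 'a \<Rightarrow> 'b :: comm_ring_1)"
  shows "map_mat f x \<in> classical_group ty n"
proof -
  interpret comm_ring_hom f by fact
  have sg: "f (sg i) = sg i" for i by (simp add: sg_def hom_distribs)
  have "(\<Sum>k<M. map_mat f x $$ (i, k) * sg k * map_mat f x $$ (j, rv k)) = (if j = rv i then sg i else 0)"
    if "i < M" "j < M" for i j
  proof -
    have "(\<Sum>k<M. map_mat f x $$ (i, k) * sg k * map_mat f x $$ (j, rv k)) = f (\<Sum>k<M. x $$ (i, k) * sg k * x $$ (j, rv k))"
      using that groupD(1)[OF x] by (simp add: hom_distribs sg)
    also have "\<dots> = f (if j = rv i then sg i else 0)" using x that unfolding group_iff by simp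
    finally show ?thesis using sg by simp
  qed
  moreover have "det (map_mat f x) = 1" using groupD(2)[OF x] by (simp add: hom_det)
  ultimately show ?thesis using groupD(1)[OF x] by (simp add: group_iff)
qed

lemma group_hom_iff:
  assumes f: "inj_comm_ring_hom (f :: 'a :: comm_ring_1 \<Rightarrow> 'b :: comm_ring_1)" and x: "x \<in> carrier_mat M M"
  shows "map_mat f x \<in> classical_group ty n \<longleftrightarrow> x \<in> classical_group ty n"
proof -
  interpret inj_comm_ring_hom f by fact
  have "x \<in> classical_group ty n" if *: "map_mat f x \<in> classical_group ty n"
  proof -
  have sg: "f (sg i) = sg i" for i by (simp add: sg_def hom_distribs)
  have "(\<Sum>k<M. x $$ (i, k) * sg k * x $$ (j, rv k)) = (if j = rv i then sg i else 0)" (is "?a = ?b")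
    if "i < M" "j < M" for i j
  proof -
    have "f (\<Sum>k<M. x $$ (i, k) * sg k * x $$ (j, rv k)) = (\<Sum>k<M. map_mat f x $$ (i, k) * sg k * map_mat f x $$ (j, rv k))"
      using that x by (simp add: hom_distribs sg)
    also have "\<dots> = (if j = rv i then sg i else 0)" by (rule group_sum[OF * that])
    also have "\<dots> = f (if j = rv i then sg i else 0)" by (simp add: sg)
    finally have "f (?a - ?b) = 0" unfolding hom_minus by simp
    thus ?thesis by simp
  qed
  moreover have "det x = 1"
  proof -
    have "f (det x) = 1" using groupD(2)[OF *] by (simp add: hom_det)
    thus ?thesis by simp
  qed
  ultimately show ?thesis using x unfolding group_iff by simp
  qed
  moreover have "map_mat f x \<in> classical_group ty n" if "x \<in> classical_group ty n"
    by (rule group_hom[OF that comm_ring_hom_axioms])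
  ultimately show ?thesis by (rule iffI)
qed

end

text \<open>Test the identity on the unit vectors at \<open>k1\<close>, ..., \<open>k4\<close>. An
  index with sign 0 carries no information; this is the middle index of type B. The condition
  \<open>ne\<close> says that the weight is not zero, since for weight zero the right-hand side
  could cancel at any index.\<close>

lemma signed_units:
  fixes s1 s2 s3 s4 :: int
  assumes eq: "\<And>c :: nat \<Rightarrow> int. s1 * c k1 - s2 * c k2 = s3 * c k3 - s4 * c k4"
    and s: "s1 \<in> {-1, 0, 1}" "s2 \<in> {-1, 0, 1}" "s3 \<in> {-1, 0, 1}" "s4 \<in> {-1, 0, 1}"
    and ne: "\<not> (s1 = s2 \<and> (s1 \<noteq> 0 \<longrightarrow> k1 = k2))"
  shows "(s3 = s1 \<and> (s3 \<noteq> 0 \<longrightarrow> k3 = k1) \<and> s4 = s2 \<and> (s4 \<noteq> 0 \<longrightarrow> k4 = k2)) \<or>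
    (s3 = - s2 \<and> (s3 \<noteq> 0 \<longrightarrow> k3 = k2) \<and> s4 = - s1 \<and> (s4 \<noteq> 0 \<longrightarrow> k4 = k1))"
proof -
  have e: "(if k1 = k then s1 else 0) - (if k2 = k then s2 else 0) =
      (if k3 = k then s3 else 0) - (if k4 = k then s4 else 0)" for k
    using eq[of "\<lambda>p. if p = k then 1 else 0"] by (auto split: if_splits)
  have b: "- 1 \<le> s1 \<and> s1 \<le> 1" "- 1 \<le> s2 \<and> s2 \<le> 1" "- 1 \<le> s3 \<and> s3 \<le> 1" "- 1 \<le> s4 \<and> s4 \<le> 1"
    using s by auto
  show ?thesis using e[of k1] e[of k2] e[of k3] e[of k4] ne b by (smt (z3))
qed

section \<open>Weights of matrix positions\<close>

context classical
begin

text \<open>The root vector of \<alpha>_q has an entry at position (\<open>ra q\<close>, q): a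
  simple root is a difference of two diagonal entries, where the diagonal is continued past the
  middle by antisymmetry. Only \<alpha>_n in type D skips an index, because (n-1, n) lies on the
  antidiagonal, which is zero in type D.\<close>

definition ra :: "nat \<Rightarrow> nat" where
  "ra q = (if ty = Type_D \<and> q = n then n - 2 else q - 1)"

definition antisym_fun :: "(nat \<Rightarrow> 'a :: comm_ring_1) \<Rightarrow> bool" where
  "antisym_fun v \<longleftrightarrow> (\<forall>i<M. v (rv i) = - v i)"

text \<open>The weight of the matrix unit at (i, j) under the Cartan subalgebra is \<alpha>: the
  diagonals of Cartan elements are exactly the antisymmetric functions.\<close>

definition matches :: "lattice_elt \<Rightarrow> nat \<Rightarrow> nat \<Rightarrow> bool" where
  "matches \<alpha> i j \<longleftrightarrow> (\<forall>v :: nat \<Rightarrow> Kbar. antisym_fun v \<longrightarrow>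
     v i - v j = (\<Sum>q=1..n. of_int (\<alpha> q) * (v (ra q) - v q)))"

definition diag_of :: "(nat \<Rightarrow> 'a :: zero) \<Rightarrow> 'a mat" where
  "diag_of v = monomial_mat M (\<lambda>i. i) v"

lemma diag_of_carrier [simp]: "diag_of v \<in> carrier_mat M M"
  and diag_of_entry: "i < M \<Longrightarrow> j < M \<Longrightarrow> diag_of v $$ (i, j) = (if i = j then v j else 0)"
  by (simp_all add: diag_of_def monomial_mat_def)

lemma ra_lt: "q \<in> {1..n} \<Longrightarrow> ra q < q" "q \<in> {1..n} \<Longrightarrow> ra q < M" "q \<in> {1..n} \<Longrightarrow> q < M \<or> (ty = Type_B \<and> q = n)"
  using M_simps n_D by (auto simp: ra_def)

lemma q_lt_M: "q \<in> {1..n} \<Longrightarrow> q < M"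
  using M_simps(3) n_pos by auto

lemma lie_entry: "(x :: 'a :: comm_ring_1 mat) \<in> lie_alg ty n \<Longrightarrow> i < M \<Longrightarrow> j < M \<Longrightarrow>
    x $$ (rv j, rv i) = - (sg i * sg j * x $$ (i, j))"
  unfolding lie_iff by blast

lemma antisym_diag:
  fixes h :: "'a :: comm_ring_1 mat"
  assumes h: "h \<in> cartan_subalg ty n"
  shows "antisym_fun (\<lambda>i. h $$ (i, i))"
  unfolding antisym_fun_def
proof (intro allI impI)
  fix i assume i: "i < M"
  have "h \<in> lie_alg ty n" using h by (simp add: cartan_subalg_def)
  from lie_entry[OF this i i] show "h $$ (rv i, rv i) = - h $$ (i, i)" by simp
qed

lemma cartan_entry: "(h :: 'a :: comm_ring_1 mat) \<in> cartan_subalg ty n \<Longrightarrow> i < M \<Longrightarrow> j < M \<Longrightarrow> i \<noteq> j \<Longrightarrow> h $$ (i, j) = 0"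
  by (auto simp: cartan_subalg_def diagonal_mat_def lie_alg_def)

lemma diag_of_cartan:
  fixes v :: "nat \<Rightarrow> 'a :: comm_ring_1"
  assumes "antisym_fun v" shows "diag_of v \<in> cartan_subalg ty n"
proof -
  have "diag_of v \<in> lie_alg ty n" unfolding lie_iff
  proof (intro conjI allI impI)
    fix i j assume ij: "i < M" "j < M"
    show "diag_of v $$ (rv j, rv i) = - (sg i * sg j * diag_of v $$ (i, j))"
      using ij assms by (cases "i = j") (auto simp: diag_of_entry antisym_fun_def)
  qed simp
  moreover have "diagonal_mat (diag_of v)" by (auto simp: diagonal_mat_def diag_of_def monomial_mat_def)
  ultimately show ?thesis by (simp add: cartan_subalg_def)
qed

lemma antisym_mid: "antisym_fun (v :: nat \<Rightarrow> 'a :: field_char_0) \<Longrightarrow> ty = Type_B \<Longrightarrow> v n = 0"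
proof -
  assume v: "antisym_fun v" and B: "ty = Type_B"
  have "rv n = n" "n < M" unfolding rv_def using M_simps(1)[OF B] by auto
  with v have "v n = - v n" unfolding antisym_fun_def by metis
  thus ?thesis by simp
qed

text \<open>One formula for all types: the diagonal entry at index n is 0 in type B and minus the
  entry at n-1 in types C and D, which produces \<epsilon>_n, 2 \<epsilon>_n and \<epsilon>_{n-1} +
  \<epsilon>_n.\<close>

lemma simple_root_eq:
  fixes h :: "'a :: field_char_0 mat"
  assumes h: "h \<in> cartan_subalg ty n" and q: "q \<in> {1..n}"
  shows "simple_root ty n q h = h $$ (ra q, ra q) - h $$ (q, q)"
proof (cases "q < n")
  case True
  thus ?thesis by (auto simp: simple_root_def ra_def Let_def)
next
  case False
  with q have q: "q = n" by auto
  note a = antisym_diag[OF h]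
  have rvn: "h $$ (n, n) = - h $$ (n - 1, n - 1)" if "ty \<noteq> Type_B"
  proof -
    have "rv (n - 1) = n" "n - 1 < M" using M_simps that n_pos by (auto simp: rv_def)
    thus ?thesis using a unfolding antisym_fun_def by metis
  qed
  show ?thesis
  proof (cases ty)
    case Type_B
    thus ?thesis using antisym_mid[OF a] unfolding q simple_root_def ra_def by simp
  next
    case Type_C
    thus ?thesis using rvn unfolding q simple_root_def ra_def by simp
  next
    case Type_D
    thus ?thesis using rvn unfolding q simple_root_def ra_def by (simp add: numeral_2_eq_2)
  qed
qed

lemma root_fun_eq:
  fixes h :: "'a :: field_char_0 mat"
  assumes h: "h \<in> cartan_subalg ty n"
  shows "root_fun ty n \<alpha> h = (\<Sum>q=1..n. of_int (\<alpha> q) * (h $$ (ra q, ra q) - h $$ (q, q)))"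
  unfolding root_fun_def using simple_root_eq[OF h] by (intro sum.cong) auto

lemma bracket_cartan:
  fixes h :: "'a :: field_char_0 mat"
  assumes h: "h \<in> cartan_subalg ty n" and x: "x \<in> carrier_mat M M" and ij: "i < M" "j < M"
  shows "lie_bracket h x $$ (i, j) = (h $$ (i, i) - h $$ (j, j)) * x $$ (i, j)"
proof -
  have hc: "h \<in> carrier_mat M M" using h by (auto simp: cartan_subalg_def lie_alg_def)
  have "(h * x) $$ (i, j) = (\<Sum>k<M. if k = i then h $$ (i, i) * x $$ (i, j) else 0)"
    using ij cartan_entry[OF h] by (subst mult_mat_entry[OF hc x ij]) (intro sum.cong, auto)
  moreover have "(x * h) $$ (i, j) = (\<Sum>k<M. if k = j then x $$ (i, j) * h $$ (j, j) else 0)"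
    using ij cartan_entry[OF h] by (subst mult_mat_entry[OF x hc ij]) (intro sum.cong, auto)
  ultimately show ?thesis
    using ij hc x unfolding lie_bracket_def
    by (subst index_minus_mat) (auto simp: algebra_simps simp del: index_mult_mat(1))
qed

lemma root_space_matches:
  assumes x: "(x :: Kbar mat) \<in> root_space ty n \<alpha>" and ij: "i < M" "j < M" and nz: "x $$ (i, j) \<noteq> 0"
  shows "matches \<alpha> i j"
  unfolding matches_def
proof (intro allI impI)
  fix v :: "nat \<Rightarrow> Kbar" assume v: "antisym_fun v"
  let ?h = "diag_of v"
  have h: "?h \<in> cartan_subalg ty n" using diag_of_cartan[OF v] .
  have xc: "x \<in> carrier_mat M M" using x by (auto simp: root_space_def lie_alg_def)
  have "lie_bracket ?h x = root_fun ty n \<alpha> ?h \<cdot>\<^sub>m x" using x h by (auto simp: root_space_def)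
  hence "lie_bracket ?h x $$ (i, j) = root_fun ty n \<alpha> ?h * x $$ (i, j)" using ij xc by simp
  with bracket_cartan[OF h xc ij] nz ij have "v i - v j = root_fun ty n \<alpha> ?h" by (simp add: diag_of_entry)
  also have "\<dots> = (\<Sum>q=1..n. of_int (\<alpha> q) * (v (ra q) - v q))"
    unfolding root_fun_eq[OF h] using ra_lt q_lt_M by (intro sum.cong refl) (simp add: diag_of_entry)
  finally show "v i - v j = (\<Sum>q=1..n. of_int (\<alpha> q) * (v (ra q) - v q))" .
qed

text \<open>The matrix unit at (i, j) plus its image under the involution whose fixed points form
  the Lie algebra. On the antidiagonal the two terms share a position; they cancel in types B and D
  and add up to 2 in type C.\<close>

definition emat :: "nat \<Rightarrow> nat \<Rightarrow> 'a :: comm_ring_1 mat" where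
  "emat i j = mat M M (\<lambda>(a, b). (if a = i \<and> b = j then 1 else 0)
     - (if a = rv j \<and> b = rv i then sg i * sg j else 0))"

lemma emat_carrier [simp]: "emat i j \<in> carrier_mat M M" by (simp add: emat_def)

lemma emat_dim [simp]: "dim_row (emat i j) = M" "dim_col (emat i j) = M" by (simp_all add: emat_def)

lemma emat_lie: "i < M \<Longrightarrow> j < M \<Longrightarrow> emat i j \<in> lie_alg ty n"
  unfolding lie_iff
proof (intro conjI allI impI)
  fix a b assume ij: "i < M" "j < M" and ab: "a < M" "b < M"
  have 1: "rv b = i \<and> rv a = j \<longleftrightarrow> a = rv j \<and> b = rv i" using ij ab by (auto simp: rv_eq_flip)
  have 2: "sg (rv i) * sg (rv j) = (sg i * sg j :: 'a)" using ij by (simp add: sg_rv)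
  let ?P = "a = i \<and> b = j" and ?Q = "a = rv j \<and> b = rv i"
  have 3: "rv b = rv j \<and> rv a = rv i \<longleftrightarrow> ?P" using ij ab by auto
  have A: "emat i j $$ (rv b, rv a) = ((if ?Q then 1 else 0) - (if ?P then sg i * sg j else 0) :: 'a)"
    by (simp only: emat_def index_mat(1)[OF rv_lt[OF ab(2)] rv_lt[OF ab(1)]] prod.case 1 3)
  have B: "emat i j $$ (a, b) = ((if ?P then 1 else 0) - (if ?Q then sg i * sg j else 0) :: 'a)"
    using ij ab by (simp add: emat_def)
  have C: "sg a * sg b = (sg i * sg j :: 'a)" if "?P \<or> ?Q" using that 2 by (auto simp: mult.commute)
  have D: "sg i * sg j * (sg i * sg j) = (1 :: 'a)" by (simp add: algebra_simps)
  have "(if Q then 1 else 0) - (if P then x else 0) = - (y * ((if P then 1 else 0) - (if Q then x else 0)))"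
    if "P \<or> Q \<Longrightarrow> y = x" "x * x = 1" for P Q and x y :: 'a
    using that by (cases P; cases Q) (simp_all add: algebra_simps)
  from this[OF C D] show "emat i j $$ (rv b, rv a) = - (sg a * sg b * emat i j $$ (a, b) :: 'a)"
    unfolding A B .
qed simp

lemma matches_diag:
  assumes "matches \<alpha> i j" and h: "(h :: Kbar mat) \<in> cartan_subalg ty n"
  shows "h $$ (i, i) - h $$ (j, j) = root_fun ty n \<alpha> h"
  using assms antisym_diag[OF h] unfolding matches_def root_fun_eq[OF h] by blast

lemma matches_arith:
  "matches \<alpha> i j \<Longrightarrow> matches \<beta> j k \<Longrightarrow> matches (\<lambda>q. \<alpha> q + \<beta> q) i k"
  "matches \<alpha> i j \<Longrightarrow> i < M \<Longrightarrow> j < M \<Longrightarrow> matches \<alpha> (rv j) (rv i)"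
  "matches \<alpha> i j \<Longrightarrow> matches (- \<alpha>) j i"
  "matches (\<lambda>_. 0) i i"
proof -
  assume *: "matches \<alpha> i j" "matches \<beta> j k"
  show "matches (\<lambda>q. \<alpha> q + \<beta> q) i k" unfolding matches_def
  proof (intro allI impI)
    fix v :: "nat \<Rightarrow> Kbar" assume "antisym_fun v"
    with * have "v i - v j = (\<Sum>q=1..n. of_int (\<alpha> q) * (v (ra q) - v q))"
      "v j - v k = (\<Sum>q=1..n. of_int (\<beta> q) * (v (ra q) - v q))" unfolding matches_def by blast+
    moreover have "v i - v k = (v i - v j) + (v j - v k)" by simp
    ultimately show "v i - v k = (\<Sum>q=1..n. of_int (\<alpha> q + \<beta> q) * (v (ra q) - v q))"
      by (simp only: sum.distrib[symmetric] of_int_add distrib_right)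
  qed
next
  assume "matches \<alpha> i j" "i < M" "j < M"
  thus "matches \<alpha> (rv j) (rv i)" unfolding matches_def antisym_fun_def by simp
next
  assume *: "matches \<alpha> i j"
  show "matches (- \<alpha>) j i" unfolding matches_def
  proof (intro allI impI)
    fix v :: "nat \<Rightarrow> Kbar" assume "antisym_fun v"
    with * have "v i - v j = (\<Sum>q=1..n. of_int (\<alpha> q) * (v (ra q) - v q))" unfolding matches_def by blast
    hence "v j - v i = - (\<Sum>q=1..n. of_int (\<alpha> q) * (v (ra q) - v q))" by (metis minus_diff_eq)
    thus "v j - v i = (\<Sum>q=1..n. of_int ((- \<alpha>) q) * (v (ra q) - v q))" by (simp add: sum_negf)
  qed
qed (simp add: matches_def)

lemma matches_simple: "q \<in> {1..n} \<Longrightarrow> matches (simple_elt q) (ra q) q"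
  unfolding matches_def
proof (intro allI impI)
  fix v :: "nat \<Rightarrow> Kbar" assume q: "q \<in> {1..n}"
  have "(\<Sum>p=1..n. of_int (simple_elt q p) * (v (ra p) - v p)) = (\<Sum>p=1..n. if p = q then v (ra q) - v q else 0)"
    by (intro sum.cong refl) (auto simp: simple_elt_def)
  thus "v (ra q) - v q = (\<Sum>p=1..n. of_int (simple_elt q p) * (v (ra p) - v p))"
    using q by simp
qed

lemma emat_root_space:
  assumes m: "matches \<alpha> i j" and ij: "i < M" "j < M"
  shows "(emat i j :: Kbar mat) \<in> root_space ty n \<alpha>"
  unfolding root_space_def
proof (intro CollectI conjI ballI)
  fix h :: "Kbar mat" assume h: "h \<in> cartan_subalg ty n"
  show "lie_bracket h (emat i j :: Kbar mat) = root_fun ty n \<alpha> h \<cdot>\<^sub>m emat i j"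
  proof (rule eq_matI)
    fix a b assume "a < dim_row (root_fun ty n \<alpha> h \<cdot>\<^sub>m emat i j)" "b < dim_col (root_fun ty n \<alpha> h \<cdot>\<^sub>m emat i j)"
    hence ab: "a < M" "b < M" by (auto simp: emat_def)
    have r: "h $$ (a, a) - h $$ (b, b) = root_fun ty n \<alpha> h" if "emat i j $$ (a, b) \<noteq> (0 :: Kbar)"
    proof -
      have "(a = i \<and> b = j) \<or> (a = rv j \<and> b = rv i)" using that ab by (auto simp: emat_def split: if_splits)
      thus ?thesis using matches_diag[OF m h] matches_diag[OF matches_arith(2)[OF m ij] h] by auto
    qed
    show "lie_bracket h (emat i j) $$ (a, b) = (root_fun ty n \<alpha> h \<cdot>\<^sub>m emat i j) $$ (a, b)"
      unfolding bracket_cartan[OF h emat_carrier ab] using r ab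
      by (cases "emat i j $$ (a, b) = (0 :: Kbar)") auto
  next
    have "h \<in> carrier_mat M M" using h by (auto simp: cartan_subalg_def lie_alg_def)
    thus "dim_row (lie_bracket h (emat i j)) = dim_row (root_fun ty n \<alpha> h \<cdot>\<^sub>m emat i j)"
      "dim_col (lie_bracket h (emat i j)) = dim_col (root_fun ty n \<alpha> h \<cdot>\<^sub>m emat i j)"
      by (auto simp: lie_bracket_def emat_def)
  qed
qed (rule emat_lie[OF ij])

text \<open>The antisymmetric vector with prescribed first n coordinates. Integer test vectors turn
  \<open>matches\<close> into identities between integers, so that arguments by order and by sign
  apply.\<close>

definition vv :: "(nat \<Rightarrow> int) \<Rightarrow> nat \<Rightarrow> int" where
  "vv c i = (if i < n then c i else if M - n \<le> i then - c (rv i) else 0)"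

lemma antisym_vv: "antisym_fun (\<lambda>i. of_int (vv c i) :: 'a :: comm_ring_1)"
  unfolding antisym_fun_def
proof (intro allI impI)
  fix i assume i: "i < M"
  have "vv c (rv i) = - vv c i" using i M_cases n_pos by (auto simp: vv_def rv_def)
  thus "(of_int (vv c (rv i)) :: 'a) = - of_int (vv c i)" by simp
qed

lemma matches_int:
  assumes "matches \<alpha> i j"
  shows "vv c i - vv c j = (\<Sum>q=1..n. \<alpha> q * (vv c (ra q) - vv c q))"
proof -
  have "(of_int (vv c i) - of_int (vv c j) :: Kbar) =
    (\<Sum>q=1..n. of_int (\<alpha> q) * (of_int (vv c (ra q)) - of_int (vv c q)))"
    using assms antisym_vv[of c, where 'a=Kbar] unfolding matches_def by blast
  hence "(of_int (vv c i - vv c j) :: Kbar) = of_int (\<Sum>q=1..n. \<alpha> q * (vv c (ra q) - vv c q))" by simp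
  thus ?thesis by (simp only: of_int_eq_iff)
qed

lemma matches_zero: "matches (\<lambda>_. 0) i j \<Longrightarrow> i < M \<Longrightarrow> j < M \<Longrightarrow> i = j"
proof -
  assume m: "matches (\<lambda>_. 0) i j" and ij: "i < M" "j < M"
  \<comment> \<open>Extended by antisymmetry, these heights decrease strictly along all M indices
    and so separate them.\<close>
  let ?c = "\<lambda>p. int n - int p"
  have "vv ?c i = vv ?c j" using matches_int[OF m, of ?c] by simp
  thus ?thesis using ij M_cases by (auto simp: vv_def rv_def split: if_splits)
qed

lemma height_strict:
  "i < M \<Longrightarrow> j < M \<Longrightarrow> vv (\<lambda>p. int n - int p) j < vv (\<lambda>p. int n - int p) i \<longleftrightarrow> i < j"
  using M_cases by (auto simp: vv_def rv_def)

text \<open>Every simple root has positive height, so a nonzero combination with nonnegative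
  coefficients has positive height too, and the height of position (i, j) is positive only above the
  diagonal.\<close>

lemma matches_pos:
  assumes m: "matches \<alpha> i j" and ij: "i < M" "j < M" and nn: "\<And>q. 0 \<le> \<alpha> q"
    and nz: "\<exists>q\<in>{1..n}. \<alpha> q \<noteq> 0"
  shows "i < j"
proof -
  let ?c = "\<lambda>p. int n - int p"
  have pos: "0 < vv ?c (ra q) - vv ?c q" if "q \<in> {1..n}" for q
    using height_strict[of "ra q" q] ra_lt(1,2)[OF that] q_lt_M[OF that] by simp
  obtain q where q: "q \<in> {1..n}" "\<alpha> q \<noteq> 0" using nz by blast
  have "0 < \<alpha> q * (vv ?c (ra q) - vv ?c q)" using q nn[of q] pos[OF q(1)] by simp
  also have "\<dots> \<le> (\<Sum>q=1..n. \<alpha> q * (vv ?c (ra q) - vv ?c q))"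
    using nn pos q by (intro member_le_sum mult_nonneg_nonneg) (auto intro: less_imp_le)
  also have "\<dots> = vv ?c i - vv ?c j" by (rule matches_int[OF m, symmetric])
  finally show ?thesis using height_strict[OF ij] by simp
qed

lemma vv_simps:
  assumes "p \<in> {1..n}"
  shows "vv c (ra p) = c (ra p)" "vv c p = (if p < n then c p else if ty = Type_B then 0 else - c (n - 1))"
proof -
  have "ra p < n" using ra_lt(1)[OF assms] assms by simp
  thus "vv c (ra p) = c (ra p)" by (simp add: vv_def)
  show "vv c p = (if p < n then c p else if ty = Type_B then 0 else - c (n - 1))"
    unfolding vv_def rv_def using M_simps n_pos assms by auto
qed

text \<open>A positive multiple of the q-th fundamental coweight. In coordinates it is (1, ..., 1,
  0, ..., 0) with q ones, except for q = n-1 in type D, where it is (1, ..., 1, -1). The factor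
  \<open>m\<close> is 1 or 2.\<close>

lemma coweight:
  assumes q: "q \<in> {1..n}"
  defines "c \<equiv> \<lambda>p. if ty = Type_D \<and> q = n - 1 \<and> p = n - 1 then - 1 else if p < q then 1 else 0 :: int"
  shows "\<exists>m>0. \<forall>p\<in>{1..n}. vv c (ra p) - vv c p = (if p = q then m else 0)"
proof -
  let ?m = "vv c (ra q) - vv c q"
  have "?m > 0" unfolding vv_simps[OF q] unfolding c_def ra_def using q n_D by auto
  moreover have "vv c (ra p) - vv c p = 0" if p: "p \<in> {1..n}" "p \<noteq> q" for p
  proof -
    have "c (p - 1) = c p" if "p < n"
      unfolding c_def using q p n_D that by auto
    moreover have "c (n - 1) = 0" if "p = n" "ty \<noteq> Type_D"
      unfolding c_def using q p n_D that by auto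
    moreover have "c (n - 2) + c (n - 1) = 0" if "p = n" "ty = Type_D"
      unfolding c_def using q p n_D that by (auto split: if_splits)
    moreover have "p < n \<or> p = n" using p by auto
    ultimately show ?thesis unfolding vv_simps[OF p(1)] unfolding ra_def by auto
  qed
  ultimately show ?thesis by (intro exI[of _ ?m]) auto
qed

lemma matches_unique:
  assumes "matches \<alpha> i j" "matches \<beta> i j" and supp: "\<And>q. q \<notin> {1..n} \<Longrightarrow> \<alpha> q = 0" "\<And>q. q \<notin> {1..n} \<Longrightarrow> \<beta> q = 0"
  shows "\<alpha> = \<beta>"
proof
  fix q show "\<alpha> q = \<beta> q"
  proof (cases "q \<in> {1..n}")
    case True
    obtain m c where m: "m > 0" "\<And>p. p \<in> {1..n} \<Longrightarrow> vv c (ra p) - vv c p = (if p = q then m else 0)"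
      using coweight[OF True] by blast
    have "(\<Sum>p=1..n. \<gamma> p * (vv c (ra p) - vv c p)) = \<gamma> q * m" for \<gamma> :: lattice_elt
    proof -
      have "(\<Sum>p=1..n. \<gamma> p * (vv c (ra p) - vv c p)) = (\<Sum>p=1..n. if p = q then \<gamma> q * m else 0)"
        using m(2) by (intro sum.cong refl) auto
      thus ?thesis using True by simp
    qed
    with matches_int[OF assms(1), of c] matches_int[OF assms(2), of c] m(1) show ?thesis by simp
  qed (simp add: supp)
qed

text \<open>A difference of signed coordinates that is not zero determines its two terms, so a
  nonzero weight belongs to a single position and its mirror image.\<close>

lemma matches_positions:
  assumes m: "matches \<alpha> i j" "matches \<alpha> a b" and lt: "i < M" "j < M" "a < M" "b < M" and ij: "i \<noteq> j"
  shows "(a = i \<and> b = j) \<or> (a = rv j \<and> b = rv i)"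
proof -
  \<comment> \<open>Index i stands for the coordinate \<open>ky i\<close> with sign
    \<open>sn i\<close>; the sign is 0 at the middle index of type B.\<close>
  define ky where "ky i = (if i < n then i else rv i)" for i
  define sn :: "nat \<Rightarrow> int" where "sn i = (if i < n then 1 else if M - n \<le> i then - 1 else 0)" for i
  have v: "vv c i = sn i * c (ky i)" for c i by (auto simp: vv_def sn_def ky_def)
  have eq: "sn i * c (ky i) - sn j * c (ky j) = sn a * c (ky a) - sn b * c (ky b)" for c
    using matches_int[OF m(1), of c] matches_int[OF m(2), of c] by (simp add: v)
  have same: "x = y" if "x < M" "y < M" "sn x = sn y" "sn x \<noteq> 0 \<Longrightarrow> ky x = ky y" for x y
    using that M_cases by (auto simp: sn_def ky_def rv_def split: if_splits)
  have opp: "x = rv y" if "x < M" "y < M" "sn x = - sn y" "sn x \<noteq> 0 \<Longrightarrow> ky x = ky y" for x y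
    using that M_cases by (auto simp: sn_def ky_def rv_def split: if_splits)
  have sn3: "sn x \<in> {-1, 0, 1}" for x by (auto simp: sn_def)
  have "\<not> (sn i = sn j \<and> (sn i \<noteq> 0 \<longrightarrow> ky i = ky j))" using same[OF lt(1,2)] ij by blast
  from signed_units[OF eq sn3 sn3 sn3 sn3 this]
  have "(sn a = sn i \<and> (sn a \<noteq> 0 \<longrightarrow> ky a = ky i) \<and> sn b = sn j \<and> (sn b \<noteq> 0 \<longrightarrow> ky b = ky j)) \<or>
    (sn a = - sn j \<and> (sn a \<noteq> 0 \<longrightarrow> ky a = ky j) \<and> sn b = - sn i \<and> (sn b \<noteq> 0 \<longrightarrow> ky b = ky i))" .
  thus ?thesis using same[OF lt(3,1)] same[OF lt(4,2)] opp[OF lt(3,2)] opp[OF lt(4,1)] by blast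
qed

end

text \<open>Induction over the positions that may carry nonzero entries: at a new position either
  all of \<open>V\<close> vanishes, or one matrix that does not vanish there complements the
  subspace that does. A basis is wanted because \<open>endo_trace\<close> is a description that
  ranges over bases.\<close>

lemma mat_basis_exists_on:
  fixes V :: "'a :: field mat set"
  assumes fin: "finite A"
    and carrier: "V \<subseteq> carrier_mat m m" and zero: "0\<^sub>m m m \<in> V"
    and lin: "\<And>x y c. x \<in> V \<Longrightarrow> y \<in> V \<Longrightarrow> x + c \<cdot>\<^sub>m y \<in> V"
    and supp: "\<And>x i j. x \<in> V \<Longrightarrow> i < m \<Longrightarrow> j < m \<Longrightarrow> (i, j) \<notin> A \<Longrightarrow> x $$ (i, j) = 0"
  shows "\<exists>k b. mat_basis m V k b"
  using fin carrier zero lin supp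
proof (induction A arbitrary: V rule: finite_induct)
  case empty
  have "mat_basis m V 0 (\<lambda>_. 0\<^sub>m m m)" unfolding mat_basis_def
  proof (intro conjI ballI allI impI)
    fix v assume v: "v \<in> V"
    have "v = mat_lincomb m 0 (\<lambda>_. 0) (\<lambda>_. 0\<^sub>m m m)"
      using empty(1,4) v by (intro eq_matI) (auto simp: mat_lincomb_def)
    thus "\<exists>c. v = mat_lincomb m 0 c (\<lambda>_. 0\<^sub>m m m)" by blast
  qed auto
  thus ?case by blast
next
  case (insert a A V)
  obtain p q where a: "a = (p, q)" by fastforce
  define V' where "V' = {v \<in> V. \<not> (p < m \<and> q < m \<and> v $$ (p, q) \<noteq> 0)}"
  have ent: "(x + c \<cdot>\<^sub>m y) $$ (i, j) = x $$ (i, j) + c * y $$ (i, j)"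
    if "x \<in> V" "y \<in> V" "i < m" "j < m" for x y c i j
    using that insert.prems(1) by auto
  have "\<exists>k b. mat_basis m V' k b"
  proof (rule insert.IH)
    show "V' \<subseteq> carrier_mat m m" "0\<^sub>m m m \<in> V'" using insert.prems(1,2) by (auto simp: V'_def)
    fix x y c assume xy: "x \<in> V'" "y \<in> V'"
    have V: "x \<in> V" "y \<in> V" using xy by (auto simp: V'_def)
    have "(x + c \<cdot>\<^sub>m y) $$ (p, q) = 0" if "p < m" "q < m"
      using ent[OF V that] xy that by (simp add: V'_def)
    thus "x + c \<cdot>\<^sub>m y \<in> V'" using insert.prems(3)[OF V] unfolding V'_def by blast
  next
    fix x i j assume x: "x \<in> V'" and ij: "i < m" "j < m" "(i, j) \<notin> A"
    show "x $$ (i, j) = 0"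
    proof (cases "(i, j) = (p, q)")
      case True thus ?thesis using x ij by (auto simp: V'_def)
    next
      case False thus ?thesis using insert.prems(4)[of x i j] x ij a by (auto simp: V'_def)
    qed
  qed
  then obtain k b where b: "mat_basis m V' k b" by blast
  show ?case
  proof (cases "V' = V")
    case True
    thus ?thesis using b by blast
  next
    case False
    then obtain w where w: "w \<in> V" "p < m" "q < m" "w $$ (p, q) \<noteq> 0" by (auto simp: V'_def)
    define b' where "b' = b(k := w)"
    have bV: "b i \<in> V" if "i < k" for i using b that by (auto simp: mat_basis_def V'_def)
    have bpq: "b i $$ (p, q) = 0" if "i < k" for i using b that w(2,3) by (auto simp: mat_basis_def V'_def)
    have lc: "mat_lincomb m (Suc k) c b' $$ (i, j) = mat_lincomb m k c b $$ (i, j) + c k * w $$ (i, j)"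
      if "i < m" "j < m" for c i j using that by (simp add: mat_lincomb_def b'_def)
    have "mat_basis m V (Suc k) b'" unfolding mat_basis_def
    proof (intro conjI ballI allI impI)
      fix i assume "i < Suc k" thus "b' i \<in> V" using bV w(1) by (auto simp: b'_def less_Suc_eq)
    next
      fix v assume v: "v \<in> V"
      let ?t = "v $$ (p, q) / w $$ (p, q)"
      let ?v = "v + (- ?t) \<cdot>\<^sub>m w"
      have "?v \<in> V'" using insert.prems(3)[OF v w(1), of "- ?t"] ent[OF v w(1-3)] w(4) by (simp add: V'_def)
      then obtain c where c: "?v = mat_lincomb m k c b" using b by (auto simp: mat_basis_def)
      have "v = mat_lincomb m (Suc k) (c(k := ?t)) b'"
      proof (rule eq_matI)
        fix i j assume "i < dim_row (mat_lincomb m (Suc k) (c(k := ?t)) b')" "j < dim_col (mat_lincomb m (Suc k) (c(k := ?t)) b')"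
        hence ij: "i < m" "j < m" by (auto simp: mat_lincomb_def)
        have "mat_lincomb m k (c(k := ?t)) b = mat_lincomb m k c b" by (simp add: mat_lincomb_def)
        thus "v $$ (i, j) = mat_lincomb m (Suc k) (c(k := ?t)) b' $$ (i, j)"
          using lc[OF ij, of "c(k := ?t)"] c ent[OF v w(1) ij, of "- ?t"] by simp
      qed (use v insert.prems(1) in \<open>auto simp: mat_lincomb_def\<close>)
      thus "\<exists>c. v = mat_lincomb m (Suc k) c b'" by blast
    next
      fix c i assume 0: "mat_lincomb m (Suc k) c b' = 0\<^sub>m m m" and i: "i < Suc k"
      have "mat_lincomb m k c b $$ (p, q) = 0" using w(2,3) bpq by (simp add: mat_lincomb_def)
      hence ck: "c k = 0" using lc[OF w(2,3), of c] 0 w by simp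
      have "mat_lincomb m k c b = 0\<^sub>m m m"
      proof (rule eq_matI)
        fix i j assume "i < dim_row (0\<^sub>m m m :: 'a mat)" "j < dim_col (0\<^sub>m m m :: 'a mat)"
        thus "mat_lincomb m k c b $$ (i, j) = 0\<^sub>m m m $$ (i, j)" using lc[of i j c] 0 ck by simp
      qed (auto simp: mat_lincomb_def)
      with b have "\<forall>p<k. c p = 0" by (auto simp: mat_basis_def)
      thus "c i = 0" using ck i by (auto simp: less_Suc_eq)
    qed
    thus ?thesis by blast
  qed
qed

section \<open>Roots and their positions\<close>

context classical
begin

lemma lie_alg_zero [simp]: "0\<^sub>m M M \<in> lie_alg ty n"
  by (auto simp: lie_iff)

lemma lie_alg_lin: "(x :: 'a :: comm_ring_1 mat) \<in> lie_alg ty n \<Longrightarrow> y \<in> lie_alg ty n \<Longrightarrow> x + c \<cdot>\<^sub>m y \<in> lie_alg ty n"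
  unfolding lie_iff by (auto simp: algebra_simps)

text \<open>In any basis the zero map has only zero coefficients, so 0 is the only candidate for the
  described trace, and since a basis exists it is attained. Together with K(e_\<alpha>,
  e_{-\<alpha>}) = 1 this will show that root vectors are nonzero.\<close>

lemma killing_zero: "killing ty n (0\<^sub>m M M) (y :: 'a :: field mat) = 0" if y: "y \<in> carrier_mat M M"
proof -
  let ?V = "lie_alg ty n :: 'a mat set"
  have "\<exists>k b. mat_basis M ?V k b"
  proof (rule mat_basis_exists_on[of "{..<M} \<times> {..<M}"])
    show "?V \<subseteq> carrier_mat M M" by (auto simp: lie_alg_def)
  qed (auto simp: lie_alg_lin)
  then obtain k b where kb: "mat_basis M ?V k b" by blast
  have 0: "lie_bracket (0\<^sub>m M M) (lie_bracket y z) = 0\<^sub>m M M" if z: "z \<in> carrier_mat M M" for z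
  proof -
    have "lie_bracket y z \<in> carrier_mat M M" unfolding lie_bracket_def
      by (intro minus_carrier_mat mult_carrier_mat[of _ M M _ M] y z)
    hence "0\<^sub>m M M * lie_bracket y z = 0\<^sub>m M M" "lie_bracket y z * 0\<^sub>m M M = 0\<^sub>m M M" by auto
    thus ?thesis unfolding lie_bracket_def[of "0\<^sub>m M M"] by (simp add: minus_r_inv_mat)
  qed
  show ?thesis unfolding killing_def endo_trace_def
  proof (rule the_equality)
    have "0\<^sub>m M M = mat_lincomb M k (\<lambda>_. 0) b" by (intro eq_matI) (auto simp: mat_lincomb_def)
    moreover have "b p \<in> carrier_mat M M" if "p < k" for p
      using kb that by (auto simp: mat_basis_def lie_alg_def)
    ultimately show "\<exists>m b c. mat_basis M ?V m b \<and>
        (\<forall>p<m. lie_bracket (0\<^sub>m M M) (lie_bracket y (b p)) = mat_lincomb M m (c p) b) \<and> 0 = (\<Sum>p<m. c p p)"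
      using kb 0 by (intro exI[of _ k] exI[of _ b] exI[of _ "\<lambda>_ _. 0"]) simp
  next
    fix t assume "\<exists>m b c. mat_basis M ?V m b \<and>
        (\<forall>p<m. lie_bracket (0\<^sub>m M M) (lie_bracket y (b p)) = mat_lincomb M m (c p) b) \<and> t = (\<Sum>p<m. c p p)"
    then obtain m b c where b: "mat_basis M ?V m b"
      and c: "\<And>p. p < m \<Longrightarrow> lie_bracket (0\<^sub>m M M) (lie_bracket y (b p)) = mat_lincomb M m (c p) b"
      and t: "t = (\<Sum>p<m. c p p)" by blast
    have "c p p = 0" if p: "p < m" for p
    proof -
      have "b p \<in> carrier_mat M M" using b p by (auto simp: mat_basis_def lie_alg_def)
      hence "mat_lincomb M m (c p) b = 0\<^sub>m M M" using c[OF p] 0 by simp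
      thus ?thesis using b p unfolding mat_basis_def by blast
    qed
    thus "t = 0" by (simp add: t)
  qed
qed

text \<open>The off-diagonal positions at which the Lie algebra has nonzero entries.\<close>

definition allowed :: "nat \<Rightarrow> nat \<Rightarrow> bool" where
  "allowed i j \<longleftrightarrow> i < M \<and> j < M \<and> i \<noteq> j \<and> (j = rv i \<longrightarrow> ty = Type_C)"

lemma allowedD: "allowed i j \<Longrightarrow> i < M" "allowed i j \<Longrightarrow> j < M" "allowed i j \<Longrightarrow> i \<noteq> j"
  by (auto simp: allowed_def)

lemma allowed_sym: "allowed i j \<Longrightarrow> allowed j i"
  by (auto simp: allowed_def rv_eq_flip)

lemma allowed_emat: "allowed i j \<Longrightarrow> emat i j $$ (i, j) \<noteq> (0 :: 'a :: field_char_0)"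
proof -
  assume a: "allowed i j"
  have *: "sg i * sg j = (- 1 :: 'a)" if "j = rv i"
  proof -
    have C: "ty = Type_C" and i: "i < M" using a that by (auto simp: allowed_def)
    have "sg j = (- sg i :: 'a)" unfolding that sg_rv[OF i] using C by (rule if_P)
    thus ?thesis by simp
  qed
  have ij: "i < M" "j < M" using a by (auto simp: allowed_def)
  define w where "w = (if i = rv j \<and> j = rv i then sg i * sg j else 0 :: 'a)"
  have "emat i j $$ (i, j) = 1 - w"
    unfolding emat_def w_def index_mat(1)[OF ij] by simp
  moreover have "w = 0 \<or> w = - 1"
  proof (cases "i = rv j \<and> j = rv i")
    case True
    have "w = sg i * sg j" unfolding w_def by (rule if_P[OF True])
    thus ?thesis using *[OF conjunct2[OF True]] by simp
  next
    case False
    have "w = 0" unfolding w_def by (rule if_not_P[OF False])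
    thus ?thesis ..
  qed
  ultimately show ?thesis by auto
qed

lemma lie_allowed:
  assumes x: "(x :: 'a :: field_char_0 mat) \<in> lie_alg ty n" and ij: "i < M" "j < M" "i \<noteq> j" "x $$ (i, j) \<noteq> 0"
  shows "allowed i j"
proof -
  have "ty = Type_C" if "j = rv i"
  proof (rule ccontr)
    assume C: "ty \<noteq> Type_C"
    hence "sg i = (1 :: 'a)" "sg j = (1 :: 'a)" by (simp_all add: sg_def)
    with lie_entry[OF x ij(1,2)] that ij(1) have "x $$ (i, j) = - x $$ (i, j)" by simp
    with ij(4) show False by simp
  qed
  with ij show ?thesis by (simp add: allowed_def)
qed

text \<open>Makes roots combinatorial. A nonzero entry of a root vector yields a position, and the
  weight of an allowed position has \<open>emat\<close> as root vector.\<close>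

lemma roots_iff: "\<alpha> \<in> roots ty n \<longleftrightarrow> (\<forall>q. q \<notin> {1..n} \<longrightarrow> \<alpha> q = 0) \<and> (\<exists>i j. allowed i j \<and> matches \<alpha> i j)"
proof
  assume "\<alpha> \<in> roots ty n"
  then obtain x where s: "\<forall>q. q \<notin> {1..n} \<longrightarrow> \<alpha> q = 0" and nz: "\<alpha> \<noteq> (\<lambda>_. 0)"
    and x: "x \<in> root_space ty n \<alpha>" "x \<noteq> (0\<^sub>m M M :: Kbar mat)" unfolding roots_def by blast
  have xl: "x \<in> lie_alg ty n" using x(1) by (simp add: root_space_def)
  hence "x \<in> carrier_mat M M" by (simp add: lie_alg_def)
  with x(2) obtain i j where ij: "i < M" "j < M" "x $$ (i, j) \<noteq> 0" by (metis carrier_matD eq_matI index_zero_mat)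
  have m: "matches \<alpha> i j" by (rule root_space_matches[OF x(1) ij])
  have "i \<noteq> j"
  proof
    assume "i = j"
    hence "\<alpha> = (\<lambda>_. 0)" using matches_unique[OF m, of "\<lambda>_. 0"] matches_arith(4)[of i] s by auto
    with nz show False by simp
  qed
  with s m lie_allowed[OF xl ij(1,2) _ ij(3)] show "(\<forall>q. q \<notin> {1..n} \<longrightarrow> \<alpha> q = 0) \<and> (\<exists>i j. allowed i j \<and> matches \<alpha> i j)"
    by blast
next
  assume "(\<forall>q. q \<notin> {1..n} \<longrightarrow> \<alpha> q = 0) \<and> (\<exists>i j. allowed i j \<and> matches \<alpha> i j)"
  then obtain i j where s: "\<forall>q. q \<notin> {1..n} \<longrightarrow> \<alpha> q = 0" and a: "allowed i j" and m: "matches \<alpha> i j" by blast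
  have "\<alpha> \<noteq> (\<lambda>_. 0)" using matches_zero[of i j] m allowedD[OF a] by auto
  moreover have "emat i j \<noteq> (0\<^sub>m M M :: Kbar mat)" using allowed_emat[OF a, where 'a=Kbar] allowedD[OF a] by auto
  ultimately show "\<alpha> \<in> roots ty n"
    unfolding roots_def using s emat_root_space[OF m] allowedD[OF a] by blast
qed

lemma neg_root: "\<alpha> \<in> roots ty n \<Longrightarrow> - \<alpha> \<in> roots ty n"
  unfolding roots_iff using allowed_sym matches_arith(3) by fastforce

lemma roots_supp: "\<alpha> \<in> roots ty n \<Longrightarrow> q \<notin> {1..n} \<Longrightarrow> \<alpha> q = 0"
  unfolding roots_iff by blast

lemma roots_unique: "\<alpha> \<in> roots ty n \<Longrightarrow> \<beta> \<in> roots ty n \<Longrightarrow> matches \<alpha> i j \<Longrightarrow> matches \<beta> i j \<Longrightarrow> \<alpha> = \<beta>"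
  using matches_unique roots_supp by blast

lemma finite_roots: "finite (roots ty n)"
proof -
  let ?f = "\<lambda>(i, j). THE \<alpha>. \<alpha> \<in> roots ty n \<and> matches \<alpha> i j"
  have "\<alpha> \<in> ?f ` ({..<M} \<times> {..<M})" if a: "\<alpha> \<in> roots ty n" for \<alpha>
  proof -
    obtain i j where ij: "allowed i j" "matches \<alpha> i j" using a unfolding roots_iff by blast
    have "?f (i, j) = \<alpha>" using a ij roots_unique by auto
    thus ?thesis using allowedD[OF ij(1)] by force
  qed
  thus ?thesis by (meson finite_SigmaI finite_imageI finite_lessThan finite_subset subsetI)
qed

lemma pos_rootsD: "\<alpha> \<in> pos_roots ty n \<Longrightarrow> \<alpha> \<in> roots ty n" "\<alpha> \<in> pos_roots ty n \<Longrightarrow> 0 \<le> \<alpha> q"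
  by (auto simp: pos_roots_def)

lemma finite_pos_roots: "finite (pos_roots ty n)"
  using finite_roots by (rule finite_subset[rotated]) (auto simp: pos_roots_def)

lemma pos_root_less:
  assumes a: "\<alpha> \<in> pos_roots ty n" and m: "matches \<alpha> i j" "i < M" "j < M"
  shows "i < j"
proof (rule matches_pos[OF m pos_rootsD(2)[OF a]])
  have "\<alpha> \<noteq> (\<lambda>_. 0)" using pos_rootsD(1)[OF a] by (simp add: roots_def)
  thus "\<exists>q\<in>{1..n}. \<alpha> q \<noteq> 0" using roots_supp[OF pos_rootsD(1)[OF a]] by blast
qed

definition nonneg_matches :: "nat \<Rightarrow> nat \<Rightarrow> bool" where
  "nonneg_matches i j \<longleftrightarrow> (\<exists>\<alpha>. (\<forall>q. 0 \<le> \<alpha> q) \<and> (\<forall>q. q \<notin> {1..n} \<longrightarrow> \<alpha> q = 0) \<and> matches \<alpha> i j)"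

lemma nonneg_refl: "nonneg_matches i i"
  unfolding nonneg_matches_def by (intro exI[of _ "\<lambda>_. 0"]) (auto simp: matches_arith(4))

lemma nonneg_trans: "nonneg_matches i j \<Longrightarrow> nonneg_matches j k \<Longrightarrow> nonneg_matches i k"
proof -
  assume "nonneg_matches i j" "nonneg_matches j k"
  then obtain \<alpha> \<beta> where "\<forall>q. 0 \<le> \<alpha> q" "\<forall>q. q \<notin> {1..n} \<longrightarrow> \<alpha> q = 0" "matches \<alpha> i j"
    "\<forall>q. 0 \<le> \<beta> q" "\<forall>q. q \<notin> {1..n} \<longrightarrow> \<beta> q = 0" "matches \<beta> j k" unfolding nonneg_matches_def by blast
  thus ?thesis unfolding nonneg_matches_def
    by (intro exI[of _ "\<lambda>q. \<alpha> q + \<beta> q"]) (auto simp: matches_arith(1))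
qed

lemma nonneg_rv: "nonneg_matches i j \<Longrightarrow> i < M \<Longrightarrow> j < M \<Longrightarrow> nonneg_matches (rv j) (rv i)"
  unfolding nonneg_matches_def using matches_arith(2) by blast

lemma nonneg_simple: "q \<in> {1..n} \<Longrightarrow> nonneg_matches (ra q) q"
  unfolding nonneg_matches_def using matches_simple
  by (intro exI[of _ "simple_elt q"]) (auto simp: simple_elt_def)

text \<open>Walk from i to j along simple roots. Up to the middle the indices are joined by single
  steps, beyond it by the mirror images of these steps. In type D the middle is crossed from n-2 to
  n or from n-1 to n+1; the step from n-1 to n, which does not exist, is the one on the
  antidiagonal.\<close>

lemma nonneg_less:
  assumes a: "allowed i j" and ij: "i < j"
  shows "nonneg_matches i j"
proof -
  \<comment> \<open>The last index that is reached from 0 by single steps; in type D the root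
    \<alpha>_n leads from n-2 to n.\<close>
  define n' where "n' = (if ty = Type_D then n - 1 else n)"
  have n'M: "n' < M" "n' \<le> n" using M_simps n_pos by (auto simp: n'_def)
  have A: "nonneg_matches i j" if "i \<le> j" "j \<le> n'" for i j
    using that
  proof (induction j rule: dec_induct)
    case base show ?case by (rule nonneg_refl)
  next
    case (step j)
    have "ra (Suc j) = j" unfolding ra_def using step n_D by (auto simp: n'_def)
    moreover have "nonneg_matches (ra (Suc j)) (Suc j)" using step n'M by (intro nonneg_simple) auto
    ultimately show ?case using step nonneg_trans by auto
  qed
  have B: "nonneg_matches i j" if "rv n' \<le> i" "i \<le> j" "j < M" for i j
  proof -
    have "rv j \<le> rv i" "rv i \<le> n'" using that n'M by (auto simp: rv_def)
    from nonneg_rv[OF A[OF this]] that show ?thesis by simp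
  qed
  have jM: "i < M" "j < M" "ty = Type_C \<or> j \<noteq> rv i" using a by (auto simp: allowed_def)
  show ?thesis
  proof (cases "ty = Type_D")
    case False
    have n': "n' = n" using False by (simp add: n'_def)
    have "rv n \<le> n" unfolding rv_def using M_simps by (cases "ty = Type_B") auto
    show ?thesis
    proof (cases "j \<le> n")
      case True thus ?thesis using A ij n' by simp
    next
      case j: False
      show ?thesis
      proof (cases "rv n \<le> i")
        case True thus ?thesis using B ij n' jM by simp
      next
        case False
        thus ?thesis using A[of i n] B[of n j] \<open>rv n \<le> n\<close> j jM n' nonneg_trans by auto
      qed
    qed
  next
    case D: True
    note n3 = n_D[OF D] and M = M_simps(2)[of] D
    have M: "M = 2 * n" using M_simps(2) D by auto
    have n': "n' = n - 1" "rv n' = n" unfolding n'_def rv_def using D n3 M by auto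
    have "ra n = n - 2" unfolding ra_def using D by simp
    hence base: "nonneg_matches (n - 2) n" using nonneg_simple[of n] n3 by simp
    have base': "nonneg_matches (n - 1) (n + 1)"
    proof -
      have "rv n = n - 1" "rv (n - 2) = n + 1" "n < M" "n - 2 < M" using n3 M by (auto simp: rv_def)
      thus ?thesis using nonneg_rv[OF base] by simp
    qed
    consider "j \<le> n - 1" | "n \<le> i" | "i \<le> n - 2" "n \<le> j" | "i = n - 1" "n + 1 \<le> j" | "i = n - 1" "j = n"
      by linarith
    thus ?thesis
    proof cases
      case 1 thus ?thesis using A ij n' by simp
    next
      case 2 thus ?thesis using B ij n' jM by simp
    next
      case 3
      have "nonneg_matches i (n - 2)" using 3 n' by (intro A) auto
      moreover have "nonneg_matches n j" using 3 n' jM by (intro B) auto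
      ultimately show ?thesis using base nonneg_trans by blast
    next
      case 4
      have "nonneg_matches (n + 1) j" using 4 n' jM by (intro B) auto
      thus ?thesis using base' nonneg_trans 4 by blast
    next
      case 5
      have "j = rv i" using 5 M n3 by (auto simp: rv_def)
      with jM(3) D show ?thesis by simp
    qed
  qed
qed

lemma pos_root_exists:
  assumes a: "allowed i j" and ij: "i < j"
  shows "\<exists>\<alpha>\<in>pos_roots ty n. matches \<alpha> i j"
  using nonneg_less[OF assms] a unfolding nonneg_matches_def pos_roots_def roots_iff by blast

end

section \<open>Elements that fix or flip the r-matrix\<close>

lemma trace_form_sum: "trace_form m a (mat m m (\<lambda>(i, j). \<Sum>x\<in>A. c x * b x $$ (i, j))) = (\<Sum>x\<in>A. c x * trace_form m a (b x))"
proof -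
  have "trace_form m a (mat m m (\<lambda>(i, j). \<Sum>x\<in>A. c x * b x $$ (i, j)))
    = (\<Sum>i<m. \<Sum>j<m. \<Sum>x\<in>A. c x * (a $$ (i, j) * b x $$ (j, i)))"
    by (simp add: trace_form_def sum_distrib_left mult_ac)
  also have "\<dots> = (\<Sum>i<m. \<Sum>x\<in>A. \<Sum>j<m. c x * (a $$ (i, j) * b x $$ (j, i)))"
    by (intro sum.cong refl sum.swap)
  also have "\<dots> = (\<Sum>x\<in>A. \<Sum>i<m. \<Sum>j<m. c x * (a $$ (i, j) * b x $$ (j, i)))"
    by (rule sum.swap)
  finally show ?thesis by (simp add: trace_form_def sum_distrib_left)
qed

lemma trace_form_linear:
  assumes "\<And>i j. i < m \<Longrightarrow> j < m \<Longrightarrow> a $$ (i, j) = b $$ (i, j) + c $$ (i, j) + (d $$ (i, j) - e $$ (i, j))"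
  shows "trace_form m x a = trace_form m x b + trace_form m x c + (trace_form m x d - trace_form m x e)"
  unfolding trace_form_def sum.distrib[symmetric] sum_subtractf[symmetric]
  by (intro sum.cong refl) (simp add: assms algebra_simps)

lemma trace_form_zero_right: "trace_form m a (0\<^sub>m m m) = 0"
  by (simp add: trace_form_def)

lemma sum_nonzero_ex: "sum f A \<noteq> 0 \<Longrightarrow> \<exists>x\<in>A. f x \<noteq> 0"
  by (meson sum.neutral)

lemma pow_mat_entry_graded:
  fixes y :: "'a :: comm_ring_1 mat" and g :: "nat \<Rightarrow> int"
  assumes y: "y \<in> carrier_mat m m" and gr: "\<And>i j. i < m \<Longrightarrow> j < m \<Longrightarrow> y $$ (i, j) \<noteq> 0 \<Longrightarrow> g i + 1 \<le> g j"
  shows "i < m \<Longrightarrow> j < m \<Longrightarrow> (y ^\<^sub>m k) $$ (i, j) \<noteq> 0 \<Longrightarrow> g i + int k \<le> g j"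
proof (induction k arbitrary: i j)
  case 0
  thus ?case using y by (auto split: if_splits)
next
  case (Suc k)
  have "(y ^\<^sub>m Suc k) $$ (i, j) = (\<Sum>l<m. (y ^\<^sub>m k) $$ (i, l) * y $$ (l, j))"
    using y Suc.prems by (simp add: mult_mat_entry[of _ m] del: index_mult_mat(1))
  with Suc.prems(3) have "(\<Sum>l<m. (y ^\<^sub>m k) $$ (i, l) * y $$ (l, j)) \<noteq> 0" by simp
  from sum_nonzero_ex[OF this] obtain l where "l < m" "(y ^\<^sub>m k) $$ (i, l) * y $$ (l, j) \<noteq> 0" by auto
  moreover from this have "(y ^\<^sub>m k) $$ (i, l) \<noteq> 0" "y $$ (l, j) \<noteq> 0" by auto
  ultimately have "g i + int k \<le> g l" "g l + 1 \<le> g j" using Suc.IH[of i l] gr[of l j] Suc.prems by simp_all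
  thus ?case by simp
qed

text \<open>Because the grading is injective, the matrix is triangular after a reordering of the
  indices, and the diagonal entries of its powers are the powers of its diagonal entries.\<close>

lemma nilpotent_graded_diag:
  fixes z :: "'a :: field mat" and g :: "nat \<Rightarrow> int"
  assumes z: "z \<in> carrier_mat m m" and gr: "\<And>i j. i < m \<Longrightarrow> j < m \<Longrightarrow> z $$ (i, j) \<noteq> 0 \<Longrightarrow> g i \<le> g j"
    and inj: "inj_on g {..<m}" and nil: "z ^\<^sub>m k = 0\<^sub>m m m" and i: "i < m"
  shows "z $$ (i, i) = 0"
proof -
  have "(z ^\<^sub>m k) $$ (i, i) = z $$ (i, i) ^ k \<and> (\<forall>i<m. \<forall>j<m. (z ^\<^sub>m k) $$ (i, j) \<noteq> 0 \<longrightarrow> g i \<le> g j)" for k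
  proof (induction k)
    case 0
    thus ?case using z i by auto
  next
    case (Suc k)
    have e: "(z ^\<^sub>m Suc k) $$ (a, b) = (\<Sum>l<m. (z ^\<^sub>m k) $$ (a, l) * z $$ (l, b))" if "a < m" "b < m" for a b
      using z that by (simp add: mult_mat_entry[of _ m] del: index_mult_mat(1))
    have "(z ^\<^sub>m Suc k) $$ (i, i) = (\<Sum>l<m. if l = i then z $$ (i, i) ^ Suc k else 0)"
      unfolding e[OF i i]
    proof (intro sum.cong refl)
      fix l assume l: "l \<in> {..<m}"
      show "(z ^\<^sub>m k) $$ (i, l) * z $$ (l, i) = (if l = i then z $$ (i, i) ^ Suc k else 0)"
      proof (cases "l = i")
        case False
        hence "g l \<noteq> g i" using inj l i by (auto dest: inj_onD)
        hence "\<not> (g i \<le> g l \<and> g l \<le> g i)" by simp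
        hence "(z ^\<^sub>m k) $$ (i, l) = 0 \<or> z $$ (l, i) = 0" using Suc gr[of l i] l i by blast
        with False show ?thesis by auto
      qed (use Suc in simp)
    qed
    moreover have "g a \<le> g b" if ab: "a < m" "b < m" "(z ^\<^sub>m Suc k) $$ (a, b) \<noteq> 0" for a b
    proof -
      have "(\<Sum>l<m. (z ^\<^sub>m k) $$ (a, l) * z $$ (l, b)) \<noteq> 0" using ab e[OF ab(1,2)] by simp
      from sum_nonzero_ex[OF this] obtain l where "l < m" "(z ^\<^sub>m k) $$ (a, l) * z $$ (l, b) \<noteq> 0" by auto
      moreover from this have "(z ^\<^sub>m k) $$ (a, l) \<noteq> 0" "z $$ (l, b) \<noteq> 0" by auto
      ultimately have "g a \<le> g l" "g l \<le> g b" using Suc gr[of l b] ab by blast+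
      thus ?thesis by simp
    qed
    ultimately show ?case using i by simp
  qed
  from this[of k] nil i have "z $$ (i, i) ^ k = 0" by simp
  thus ?thesis by simp
qed

context classical
begin

text \<open>The grading \<open>g\<close> is \<open>int\<close> for upper and \<open>- int\<close> for lower triangular matrices.\<close>

definition strict_tri :: "(nat \<Rightarrow> int) \<Rightarrow> 'a :: zero mat \<Rightarrow> bool" where
  "strict_tri g y \<longleftrightarrow> (\<forall>i<M. \<forall>j<M. y $$ (i, j) \<noteq> 0 \<longrightarrow> g i + 1 \<le> g j)"

end

text \<open>An abstraction of r that also covers its flip, where the grading changes sign,
  \<open>up\<close> and \<open>dn\<close> are exchanged and \<open>W\<close> is reversed. The set
  \<open>W\<close> lists the wedges; the rank \<open>\<rho>\<close>, which grows along
  \<open>W\<close>, is what makes them act nilpotently.\<close>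

locale triangular_tensor = classical +
  fixes g :: "nat \<Rightarrow> int" and P :: "'p set" and up dn :: "'p \<Rightarrow> Kbar mat"
    and W :: "('p \<times> 'p) set" and \<rho> :: "'p \<Rightarrow> int" and r0 r :: "Kbar tensor"
  assumes inj_g: "inj g"
    and finP: "finite P"
    and W: "W \<subseteq> P \<times> P" "\<And>a b. (a, b) \<in> W \<Longrightarrow> \<rho> a < \<rho> b"
    and carr: "\<And>a. a \<in> P \<Longrightarrow> up a \<in> carrier_mat M M" "\<And>a. a \<in> P \<Longrightarrow> dn a \<in> carrier_mat M M"
    and up: "\<And>a. a \<in> P \<Longrightarrow> strict_tri g (up a)"
    and dn: "\<And>a. a \<in> P \<Longrightarrow> strict_tri (\<lambda>i. - g i) (dn a)"
    and orth: "\<And>a b. a \<in> P \<Longrightarrow> b \<in> P \<Longrightarrow> a \<noteq> b \<Longrightarrow> trace_form M (dn a) (up b) = 0"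
    and pairing: "\<And>a. a \<in> P \<Longrightarrow> trace_form M (dn a) (up a) \<noteq> 0"
    and nondeg: "\<And>z i j. z \<in> lie_alg ty n \<Longrightarrow> (\<And>a. a \<in> P \<Longrightarrow> trace_form M (up a) z = 0) \<Longrightarrow>
      i < M \<Longrightarrow> j < M \<Longrightarrow> g j + 1 \<le> g i \<Longrightarrow> z $$ (i, j) = 0"
    and r_carrier: "r \<in> tensor_carrier M"
    and r0_diag: "\<And>i j k l. i < M \<Longrightarrow> j < M \<Longrightarrow> k < M \<Longrightarrow> l < M \<Longrightarrow> i \<noteq> j \<or> k \<noteq> l \<Longrightarrow> r0 $$ (i, j) $$ (k, l) = 0"
    and r_entry: "\<And>i j k l. i < M \<Longrightarrow> j < M \<Longrightarrow> k < M \<Longrightarrow> l < M \<Longrightarrow>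
      r $$ (i, j) $$ (k, l) = r0 $$ (i, j) $$ (k, l) + (\<Sum>a\<in>P. dn a $$ (i, j) * up a $$ (k, l))
        + (\<Sum>(a, b)\<in>W. dn a $$ (i, j) * up b $$ (k, l) - up b $$ (i, j) * dn a $$ (k, l))"
begin

abbreviation f where "f \<equiv> contract M r"

lemma finW: "finite W" using W(1) finP by (meson finite_SigmaI finite_subset)

lemma strict_triD: "strict_tri g' y \<Longrightarrow> i < M \<Longrightarrow> j < M \<Longrightarrow> \<not> g' i + 1 \<le> g' j \<Longrightarrow> y $$ (i, j) = 0"
  unfolding strict_tri_def by blast

lemma trace_tri:
  assumes "strict_tri g' x" "strict_tri g' y" shows "trace_form M x (y :: Kbar mat) = 0"
proof -
  have "x $$ (i, j) * y $$ (j, i) = 0" if "i < M" "j < M" for i j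
    using that strict_triD[OF assms(1), of i j] strict_triD[OF assms(2), of j i] by fastforce
  thus ?thesis unfolding trace_form_def by (intro sum.neutral ballI) auto
qed

lemma trace_diag:
  assumes "strict_tri g' x" "\<And>i j. i < M \<Longrightarrow> j < M \<Longrightarrow> i \<noteq> j \<Longrightarrow> d $$ (i, j) = (0 :: Kbar)"
  shows "trace_form M x d = 0"
proof -
  have "x $$ (i, j) * d $$ (j, i) = 0" if "i < M" "j < M" for i j
    using that strict_triD[OF assms(1), of i j] assms(2)[of j i] by (cases "i = j") auto
  thus ?thesis unfolding trace_form_def by (intro sum.neutral ballI) auto
qed

definition r0c :: "Kbar mat \<Rightarrow> Kbar mat" where
  "r0c y = mat M M (\<lambda>(i, j). \<Sum>k<M. \<Sum>l<M. r0 $$ (i, j) $$ (k, l) * y $$ (l, k))"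

lemma r0c_diag: "i < M \<Longrightarrow> j < M \<Longrightarrow> i \<noteq> j \<Longrightarrow> r0c y $$ (i, j) = 0"
  unfolding r0c_def by (auto simp: r0_diag intro!: sum.neutral)

lemma contract_entry:
  assumes ij: "i < M" "j < M"
  shows "f y $$ (i, j) = r0c y $$ (i, j) + (\<Sum>a\<in>P. trace_form M (up a) y * dn a $$ (i, j))
    + (\<Sum>(a, b)\<in>W. trace_form M (up b) y * dn a $$ (i, j) - trace_form M (dn a) y * up b $$ (i, j))"
proof -
  have sw: "(\<Sum>k<M. \<Sum>l<M. \<Sum>x\<in>A. h k l x) = (\<Sum>x\<in>A. \<Sum>k<M. \<Sum>l<M. h k l x)" for A and h :: "nat \<Rightarrow> nat \<Rightarrow> 'z \<Rightarrow> Kbar"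
  proof -
    have "(\<Sum>k<M. \<Sum>l<M. \<Sum>x\<in>A. h k l x) = (\<Sum>k<M. \<Sum>x\<in>A. \<Sum>l<M. h k l x)"
      by (intro sum.cong refl sum.swap)
    also have "\<dots> = (\<Sum>x\<in>A. \<Sum>k<M. \<Sum>l<M. h k l x)" by (rule sum.swap)
    finally show ?thesis .
  qed
  have "f y $$ (i, j) = (\<Sum>k<M. \<Sum>l<M. r $$ (i, j) $$ (k, l) * y $$ (l, k))"
    using ij by (simp add: contract_def trace_form_def)
  also have "\<dots> = (\<Sum>k<M. \<Sum>l<M. r0 $$ (i, j) $$ (k, l) * y $$ (l, k))
      + (\<Sum>k<M. \<Sum>l<M. \<Sum>a\<in>P. dn a $$ (i, j) * (up a $$ (k, l) * y $$ (l, k)))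
      + (\<Sum>k<M. \<Sum>l<M. \<Sum>x\<in>W. dn (fst x) $$ (i, j) * (up (snd x) $$ (k, l) * y $$ (l, k))
          - up (snd x) $$ (i, j) * (dn (fst x) $$ (k, l) * y $$ (l, k)))"
    unfolding sum.distrib[symmetric] using ij
    by (intro sum.cong refl) (simp add: r_entry algebra_simps sum_distrib_left sum_distrib_right split_def)
  also have "\<dots> = r0c y $$ (i, j) + (\<Sum>a\<in>P. trace_form M (up a) y * dn a $$ (i, j))
    + (\<Sum>x\<in>W. trace_form M (up (snd x)) y * dn (fst x) $$ (i, j) - trace_form M (dn (fst x)) y * up (snd x) $$ (i, j))"
    unfolding sw using ij
    by (simp add: r0c_def trace_form_def sum_subtractf sum_distrib_left[symmetric] sum_distrib_right mult.commute)
  finally show ?thesis by (simp add: split_def)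
qed

lemma trace_contract:
  "trace_form M x (f y) = trace_form M x (r0c y) + (\<Sum>a\<in>P. trace_form M (up a) y * trace_form M x (dn a))
    + (\<Sum>(a, b)\<in>W. trace_form M (up b) y * trace_form M x (dn a) - trace_form M (dn a) y * trace_form M x (up b))"
proof -
  let ?S = "mat M M (\<lambda>(i, j). \<Sum>a\<in>P. trace_form M (up a) y * dn a $$ (i, j))"
  let ?T = "mat M M (\<lambda>(i, j). \<Sum>x\<in>W. trace_form M (up (snd x)) y * dn (fst x) $$ (i, j))"
  let ?U = "mat M M (\<lambda>(i, j). \<Sum>x\<in>W. trace_form M (dn (fst x)) y * up (snd x) $$ (i, j))"
  have "trace_form M x (f y) = trace_form M x (r0c y) + trace_form M x ?S + (trace_form M x ?T - trace_form M x ?U)"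
    by (rule trace_form_linear) (simp add: contract_entry split_def sum_subtractf)
  thus ?thesis unfolding trace_form_sum by (simp add: split_def sum_subtractf)
qed

text \<open>Neither r_0 nor the second halves of the wedges contribute to the components measured by
  \<open>up\<close>: triangular matrices pair to 0 with diagonal ones and with those triangular in
  the same sense. What remains is unitriangular with respect to \<open>\<rho>\<close>, up to a
  nonzero scalar.\<close>

lemma trace_up_contract:
  assumes c: "c \<in> P"
  shows "trace_form M (up c) (f y) = trace_form M (dn c) (up c) *
    (trace_form M (up c) y + (\<Sum>b\<in>{b. (c, b) \<in> W}. trace_form M (up b) y))"
proof -
  have 1: "trace_form M (up c) (dn a) = (if a = c then trace_form M (dn c) (up c) else 0)" if "a \<in> P" for a
    using orth[OF that c] by (auto simp: trace_form_commute)
  have 2: "trace_form M (up c) (up b) = 0" if "b \<in> P" for b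
    by (rule trace_tri[OF up[OF c] up[OF that]])
  have 3: "trace_form M (up c) (r0c y) = 0" by (rule trace_diag[OF up[OF c] r0c_diag])
  have "(\<Sum>(a, b)\<in>W. trace_form M (up b) y * trace_form M (up c) (dn a) - trace_form M (dn a) y * trace_form M (up c) (up b))
    = (\<Sum>x\<in>W. if fst x = c then trace_form M (dn c) (up c) * trace_form M (up (snd x)) y else 0)"
    using W(1) 1 2 by (intro sum.cong refl) auto
  also have "\<dots> = (\<Sum>x\<in>{x\<in>W. fst x = c}. trace_form M (dn c) (up c) * trace_form M (up (snd x)) y)"
    using finW by (simp add: sum.inter_filter)
  also have "\<dots> = (\<Sum>b\<in>{b. (c, b) \<in> W}. trace_form M (dn c) (up c) * trace_form M (up b) y)"
    by (rule sum.reindex_bij_witness[of _ "\<lambda>b. (c, b)" snd]) auto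
  finally have 4: "(\<Sum>(a, b)\<in>W. trace_form M (up b) y * trace_form M (up c) (dn a) - trace_form M (dn a) y * trace_form M (up c) (up b))
    = (\<Sum>b\<in>{b. (c, b) \<in> W}. trace_form M (dn c) (up c) * trace_form M (up b) y)" .
  have "(\<Sum>a\<in>P. trace_form M (up a) y * trace_form M (up c) (dn a))
    = (\<Sum>a\<in>P. if a = c then trace_form M (dn c) (up c) * trace_form M (up c) y else 0)"
    using 1 by (intro sum.cong refl) auto
  hence "(\<Sum>a\<in>P. trace_form M (up a) y * trace_form M (up c) (dn a)) = trace_form M (dn c) (up c) * trace_form M (up c) y"
    using c finP by simp
  thus ?thesis unfolding trace_contract 3 4 by (simp add: sum_distrib_left algebra_simps)
qed

text \<open>A unitriangular map is injective: descending induction on \<open>\<rho>\<close>,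
  beginning at the largest rank, where no wedge contributes.\<close>

lemma up_zero_reflect:
  assumes z: "\<And>c. c \<in> P \<Longrightarrow> trace_form M (up c) (f y) = 0" and c: "c \<in> P"
  shows "trace_form M (up c) y = 0"
  using c
proof (induction "nat (Max (\<rho> ` P) - \<rho> c)" arbitrary: c rule: less_induct)
  case less
  have "trace_form M (up b) y = 0" if "(c, b) \<in> W" for b
  proof -
    have b: "b \<in> P" "\<rho> c < \<rho> b" using that W by auto
    have "\<rho> b \<le> Max (\<rho> ` P)" using b(1) finP by simp
    thus ?thesis using b less.prems by (intro less.hyps) auto
  qed
  hence "(\<Sum>b\<in>{b. (c, b) \<in> W}. trace_form M (up b) y) = 0" by (intro sum.neutral) auto
  with z[OF less.prems] pairing[OF less.prems] show ?case by (simp add: trace_up_contract[OF less.prems])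
qed

text \<open>Since the contraction is injective on the components measured by \<open>up\<close>,
  these vanish for a matrix that is killed by a power; by \<open>nondeg\<close> they detect the
  whole part opposite to the grading.\<close>

lemma killed_lower_zero:
  assumes z: "z \<in> lie_alg ty n" and k: "(f ^^ k) z = 0\<^sub>m M M"
    and ij: "i < M" "j < M" "g j + 1 \<le> g i"
  shows "z $$ (i, j) = 0"
proof (rule nondeg[OF z _ ij])
  fix a assume a: "a \<in> P"
  have "\<forall>a\<in>P. trace_form M (up a) y = 0" if "(f ^^ k) y = 0\<^sub>m M M" for y k
    using that
  proof (induction k arbitrary: y)
    case 0 thus ?case by (simp add: trace_form_zero_right)
  next
    case (Suc k)
    have "(f ^^ k) (f y) = 0\<^sub>m M M" using Suc.prems by (simp add: funpow_swap1)
    from Suc.IH[OF this] show ?case using up_zero_reflect by blast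
  qed
  with k a show "trace_form M (up a) z = 0" by blast
qed

text \<open>For strictly triangular y neither r_0 nor any pairing with \<open>up\<close>
  contributes. Only one half of each wedge is left; it takes the component at its first root to its
  second root, which has larger rank.\<close>

lemma contract_strict:
  assumes y: "strict_tri g y" and ij: "i < M" "j < M"
  shows "f y $$ (i, j) = - (\<Sum>(a, b)\<in>W. trace_form M (dn a) y * up b $$ (i, j))"
proof -
  have 0: "trace_form M (up b) y = 0" if "b \<in> P" for b by (rule trace_tri[OF up[OF that] y])
  have "r0c y $$ (i, j) = 0"
  proof -
    have "r0 $$ (i, j) $$ (k, l) * y $$ (l, k) = 0" if "k < M" "l < M" for k l
      using r0_diag[OF ij that] strict_triD[OF y, of l k] that by (cases "k = l") auto
    thus ?thesis using ij by (auto simp: r0c_def intro!: sum.neutral)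
  qed
  moreover have "(\<Sum>(a, b)\<in>W. trace_form M (up b) y * dn a $$ (i, j) - trace_form M (dn a) y * up b $$ (i, j))
     = - (\<Sum>(a, b)\<in>W. trace_form M (dn a) y * up b $$ (i, j))"
    unfolding sum_negf[symmetric] using W(1) 0 by (intro sum.cong refl) auto
  ultimately show ?thesis using 0 unfolding contract_entry[OF ij] by simp
qed

lemma strict_killed:
  assumes y: "strict_tri g y" and yc: "y \<in> carrier_mat M M"
  shows "\<exists>k. (f ^^ k) y = 0\<^sub>m M M"
proof (cases "P = {}")
  case True
  hence "f y = 0\<^sub>m M M" using contract_strict[OF y] W by (intro eq_matI) (auto simp: contract_def)
  thus ?thesis by (intro exI[of _ 1]) simp
next
  case False
  define lo hi where "lo = Min (\<rho> ` P)" and "hi = Max (\<rho> ` P)"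
  \<comment> \<open>\<open>T t y\<close> says that y has no component of rank below
    \<open>lo + t\<close>. One application of the contraction raises this bound by one, because
    along a wedge (a, b) a component at a only produces one at b.\<close>
  define T where "T t y \<longleftrightarrow> strict_tri g y \<and> (\<forall>a\<in>P. \<rho> a < lo + int t \<longrightarrow> trace_form M (dn a) y = 0)" for t y
  have step: "T (Suc t) (f y)" if "T t y" for t y
  proof -
    have y: "strict_tri g y" and t: "\<And>a. a \<in> P \<Longrightarrow> \<rho> a < lo + int t \<Longrightarrow> trace_form M (dn a) y = 0"
      using that by (auto simp: T_def)
    have fy: "f y = mat M M (\<lambda>(i, j). \<Sum>x\<in>W. (- trace_form M (dn (fst x)) y) * up (snd x) $$ (i, j))"
      using contract_strict[OF y] by (intro eq_matI) (auto simp: contract_def split_def sum_negf)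
    have "strict_tri g (f y)" unfolding strict_tri_def
    proof (intro allI impI)
      fix i j assume ij: "i < M" "j < M" "f y $$ (i, j) \<noteq> 0"
      hence "(\<Sum>(a, b)\<in>W. trace_form M (dn a) y * up b $$ (i, j)) \<noteq> 0"
        unfolding contract_strict[OF y ij(1,2)] by simp
      from sum_nonzero_ex[OF this] obtain x where x: "x \<in> W"
        "(case x of (a, b) \<Rightarrow> trace_form M (dn a) y * up b $$ (i, j)) \<noteq> 0" by blast
      hence "\<exists>x\<in>W. up (snd x) $$ (i, j) \<noteq> 0" by (intro bexI[of _ x]) (auto simp: split_def)
      then obtain b where "b \<in> P" "up b $$ (i, j) \<noteq> 0" using W(1) by force
      with up ij show "g i + 1 \<le> g j" unfolding strict_tri_def by blast
    qed
    moreover have "trace_form M (dn c) (f y) = 0" if c: "c \<in> P" "\<rho> c < lo + int (Suc t)" for c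
      unfolding fy trace_form_sum
    proof (intro sum.neutral ballI)
      fix x assume x: "x \<in> W"
      obtain a b where ab: "x = (a, b)" by fastforce
      have *: "a \<in> P" "b \<in> P" "\<rho> a < \<rho> b" using W x ab by auto
      show "- trace_form M (dn (fst x)) y * trace_form M (dn c) (up (snd x)) = 0"
      proof (cases "b = c")
        case True
        hence "trace_form M (dn a) y = 0" using * c by (intro t) auto
        thus ?thesis by (simp add: ab)
      next
        case False
        thus ?thesis using orth[OF c(1) *(2)] by (simp add: ab)
      qed
    qed
    ultimately show ?thesis by (simp add: T_def)
  qed
  have iter: "T t ((f ^^ t) y)" for t
  proof (induction t)
    case 0
    have "lo \<le> \<rho> a" if "a \<in> P" for a using that finP by (simp add: lo_def)
    thus ?case using y by (force simp: T_def)
  next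
    case (Suc t) thus ?case using step by simp
  qed
  \<comment> \<open>Beyond the highest rank no component is left, and one further application gives
    0.\<close>
  define t where "t = nat (hi - lo) + 1"
  have "\<rho> a < lo + int t" if "a \<in> P" for a
  proof -
    have "\<rho> a \<le> hi" using that finP by (simp add: hi_def)
    thus ?thesis by (simp add: t_def)
  qed
  with iter[of t] have *: "strict_tri g ((f ^^ t) y)" "\<And>a. a \<in> P \<Longrightarrow> trace_form M (dn a) ((f ^^ t) y) = 0"
    by (auto simp: T_def)
  have "(f ^^ Suc t) y = 0\<^sub>m M M"
  proof (rule eq_matI)
    fix i j assume "i < dim_row (0\<^sub>m M M :: Kbar mat)" "j < dim_col (0\<^sub>m M M :: Kbar mat)"
    hence ij: "i < M" "j < M" by auto
    have "(\<Sum>(a, b)\<in>W. trace_form M (dn a) ((f ^^ t) y) * up b $$ (i, j)) = 0"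
      using *(2) W(1) by (intro sum.neutral) auto
    thus "(f ^^ Suc t) y $$ (i, j) = 0\<^sub>m M M $$ (i, j)" using contract_strict[OF *(1) ij] ij by simp
  qed (auto simp: contract_def)
  thus ?thesis by blast
qed

end

lemma (in classical) Ad_pow:
  assumes x: "x \<in> classical_group ty n" and y: "(y :: 'a :: field mat) \<in> carrier_mat M M"
  shows "Ad x y ^\<^sub>m k = Ad x (y ^\<^sub>m k)"
proof -
  let ?i = "the (mat_inverse x)"
  note i = group_inverse[OF x] and xc = groupD(1)[OF x]
  show ?thesis
  proof (induction k)
    case 0
    thus ?case using i xc y by (simp add: Ad_def)
  next
    case (Suc k)
    have p: "y ^\<^sub>m k \<in> carrier_mat M M" using y by simp
    have "Ad x y ^\<^sub>m Suc k = (x * y ^\<^sub>m k * ?i) * (x * y * ?i)" using Suc by (simp add: Ad_def)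
    also have "\<dots> = x * (y ^\<^sub>m k * (?i * (x * (y * ?i))))" using i xc y p by (simp add: mat_assoc)
    also have "?i * (x * (y * ?i)) = y * ?i" using i xc y by (intro mult_cancel_mat[of _ M]) (auto simp: mat_assoc)
    also have "x * (y ^\<^sub>m k * (y * ?i)) = Ad x (y ^\<^sub>m Suc k)" using i xc y p by (simp add: Ad_def mat_assoc)
    finally show ?case .
  qed
qed

text \<open>The image of a strictly triangular matrix is killed by a power of the second
  contraction, which removes the part opposite to the grading, and it is nilpotent, which removes
  the diagonal.\<close>

lemma (in classical) Ad_strict_tri:
  assumes t1: "triangular_tensor ty n g1 P1 up1 dn1 W1 \<rho>1 r01 r1"
    and t2: "triangular_tensor ty n g2 P2 up2 dn2 W2 \<rho>2 r02 r2"
    and x: "x \<in> classical_group ty n" and Ad: "Ad_tensor x r1 = r2"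
    and y: "y \<in> lie_alg ty n" "strict_tri g1 y"
  shows "strict_tri g2 (Ad x y)"
proof -
  interpret t1: triangular_tensor ty n g1 P1 up1 dn1 W1 \<rho>1 r01 r1 by fact
  interpret t2: triangular_tensor ty n g2 P2 up2 dn2 W2 \<rho>2 r02 r2 by fact
  have xc: "x \<in> carrier_mat M M" "det x \<noteq> 0" using groupD[OF x] by auto
  have yc: "y \<in> carrier_mat M M" using y(1) by (simp add: lie_alg_def)
  let ?z = "Ad x y"
  have z: "?z \<in> lie_alg ty n" by (rule Ad_lie_alg[OF x y(1)])
  have zc: "?z \<in> carrier_mat M M" using z by (simp add: lie_alg_def)
  obtain k where k: "(t1.f ^^ k) y = 0\<^sub>m M M" using t1.strict_killed[OF y(2) yc] by blast
  have "(t2.f ^^ k) ?z = Ad x ((t1.f ^^ k) y)" for k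
  proof (induction k)
    case (Suc k)
    have "(t1.f ^^ k) y \<in> carrier_mat M M" using yc by (cases k) auto
    thus ?case using Suc contract_Ad_tensor[OF xc t1.r_carrier] Ad by simp
  qed simp
  moreover have "Ad x (0\<^sub>m M M) = 0\<^sub>m M M" using group_inverse[OF x] xc by (simp add: Ad_def)
  ultimately have k2: "(t2.f ^^ k) ?z = 0\<^sub>m M M" using k by simp
  have low: "?z $$ (i, j) = 0" if "i < M" "j < M" "g2 j + 1 \<le> g2 i" for i j
    by (rule t2.killed_lower_zero[OF z k2 that])
  \<comment> \<open>Each factor y raises the grading by at least 1, and the grading takes values
    between -b and b, so a product of 2b + 1 factors is 0.\<close>
  define b where "b = Max (insert 0 ((\<lambda>i. \<bar>g1 i\<bar>) ` {..<M}))"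
  have b: "\<bar>g1 i\<bar> \<le> b" if "i < M" for i unfolding b_def using that by (intro Max_ge) auto
  define l where "l = nat (2 * b + 1)"
  have "y ^\<^sub>m l = 0\<^sub>m M M"
  proof (rule eq_matI)
    fix i j assume "i < dim_row (0\<^sub>m M M :: Kbar mat)" "j < dim_col (0\<^sub>m M M :: Kbar mat)"
    hence ij: "i < M" "j < M" by auto
    have "\<not> g1 i + int l \<le> g1 j" using b[OF ij(1)] b[OF ij(2)] by (simp add: l_def)
    hence "(y ^\<^sub>m l) $$ (i, j) = 0"
      using pow_mat_entry_graded[OF yc, of g1 i j l] y(2) ij unfolding strict_tri_def by blast
    thus "(y ^\<^sub>m l) $$ (i, j) = 0\<^sub>m M M $$ (i, j)" using ij by simp
  qed (use yc in auto)
  hence nil: "?z ^\<^sub>m l = 0\<^sub>m M M"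
    using Ad_pow[OF x yc] \<open>Ad x (0\<^sub>m M M) = 0\<^sub>m M M\<close> by simp
  have inj: "inj_on g2 {..<M}" using t2.inj_g by (rule inj_on_subset) simp
  have diag: "?z $$ (i, i) = 0" if "i < M" for i
  proof (rule nilpotent_graded_diag[OF zc _ inj nil that])
    fix i j assume "i < M" "j < M" "?z $$ (i, j) \<noteq> 0"
    thus "g2 i \<le> g2 j" using low[of i j] by fastforce
  qed
  show ?thesis unfolding strict_tri_def
  proof (intro allI impI)
    fix i j assume ij: "i < M" "j < M" "?z $$ (i, j) \<noteq> 0"
    hence "i \<noteq> j" using diag by auto
    hence "g2 i \<noteq> g2 j" using t2.inj_g by (auto dest: injD)
    with low[of i j] ij show "g2 i + 1 \<le> g2 j" by fastforce
  qed
qed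

section \<open>The shape of elements that respect triangular matrices\<close>

context classical
begin

text \<open>In type D no root has position (n-1, n), so the two middle indices cannot be ordered by
  triangularity. A block of size 2 remains, which the form and the determinant have to
  settle.\<close>

definition in_block :: "nat \<Rightarrow> nat \<Rightarrow> bool" where
  "in_block a b \<longleftrightarrow> ty = Type_D \<and> a \<in> {n - 1, n} \<and> b \<in> {n - 1, n}"

lemma in_block_rv: "a < M \<Longrightarrow> in_block (rv a) b \<longleftrightarrow> in_block a b" "b < M \<Longrightarrow> in_block a (rv b) \<longleftrightarrow> in_block a b"
proof -
  have *: "rv c \<in> {n - 1, n} \<longleftrightarrow> c \<in> {n - 1, n}" if "c < M" "ty = Type_D" for c
    unfolding rv_def using that M_simps(2) n_pos by auto
  show "a < M \<Longrightarrow> in_block (rv a) b \<longleftrightarrow> in_block a b" "b < M \<Longrightarrow> in_block a (rv b) \<longleftrightarrow> in_block a b"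
    unfolding in_block_def using *[of a] *[of b] by blast+
qed

text \<open>Compare the entries at (a, j) in Y E = Z Y, where E is a root vector at (i, j) with i <
  j \<le> a. The left-hand side is a nonzero multiple of \<open>Y a i\<close>. On the right only
  rows c > a occur, and their entries in column j vanish by the induction, which runs from the last
  row upwards.\<close>

lemma tri_shape:
  fixes Y :: "nat \<Rightarrow> nat \<Rightarrow> 'a :: field_char_0"
  assumes Y: "\<And>i j. allowed i j \<Longrightarrow> i < j \<Longrightarrow> \<exists>z. (\<forall>a<M. \<forall>b<M. z a b \<noteq> 0 \<longrightarrow> a < b \<and> allowed a b) \<and>
      (\<forall>a<M. \<forall>b<M. (\<Sum>c<M. Y a c * emat i j $$ (c, b)) = (\<Sum>c<M. z a c * Y c b))"
    and a: "a < M" "i < a" "\<not> in_block a i"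
  shows "Y a i = 0"
  using a
proof (induction "M - a" arbitrary: a i rule: less_induct)
  case less
  \<comment> \<open>The nearest column to the right of i for which (i, j) can carry a root; this
    excludes (n-1, n) in type D.\<close>
  define j where "j = (if ty = Type_D \<and> i = n - 1 then n + 1 else i + 1)"
  have j: "i < j" "j \<le> a"
  proof -
    show "i < j" unfolding j_def by auto
    show "j \<le> a" using less.prems n_pos unfolding j_def in_block_def by auto
  qed
  have al: "allowed i j"
  proof -
    have "ty = Type_C" if "j = rv i"
    proof (cases ty)
      case Type_B
      thus ?thesis using that M_simps(1)[OF Type_B] j less.prems unfolding j_def rv_def by auto presburger
    next
      case Type_D
      have M: "M = 2 * n" using M_simps(2) Type_D by simp
      show ?thesis using that j less.prems n_D[OF Type_D] Type_D unfolding j_def rv_def M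
        by (cases "i = n - 1") auto
    qed simp
    thus ?thesis using j less.prems by (auto simp: allowed_def)
  qed
  obtain z where z: "\<And>a b. a < M \<Longrightarrow> b < M \<Longrightarrow> z a b \<noteq> 0 \<Longrightarrow> a < b \<and> allowed a b"
    and eq: "\<And>a b. a < M \<Longrightarrow> b < M \<Longrightarrow> (\<Sum>c<M. Y a c * emat i j $$ (c, b)) = (\<Sum>c<M. z a c * Y c b)"
    using Y[OF al j(1)] by blast
  have jM: "j < M" "i < M" using j less.prems by auto
  have "emat i j $$ (c, j) = (0 :: 'a)" if "c < M" "c \<noteq> i" for c
    using that jM by (auto simp: emat_def rv_eq_flip)
  hence "(\<Sum>c<M. Y a c * emat i j $$ (c, j)) = (\<Sum>c<M. if c = i then Y a i * emat i j $$ (i, j) else 0)"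
    by (intro sum.cong refl) auto
  hence "(\<Sum>c<M. Y a c * emat i j $$ (c, j)) = Y a i * emat i j $$ (i, j)" using jM by simp
  moreover have "(\<Sum>c<M. z a c * Y c j) = 0"
  proof (intro sum.neutral ballI)
    fix c assume c: "c \<in> {..<M}"
    show "z a c * Y c j = 0"
    proof (cases "z a c = 0")
      case False
      hence ac: "a < c" "allowed a c" using z[of a c] c less.prems by auto
      have "\<not> in_block c j"
      proof
        assume b: "in_block c j"
        hence D: "ty = Type_D" and "c = n" "a = n - 1" using ac j n_pos unfolding in_block_def by auto
        moreover have "n = rv (n - 1)" unfolding rv_def using M_simps(2) D n_pos by auto
        ultimately show False using ac(2) unfolding allowed_def by auto
      qed
      hence "Y c j = 0" using less.hyps[of c j] ac(1) j c by auto
      thus ?thesis by simp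
    qed simp
  qed
  ultimately have "Y a i * emat i j $$ (i, j) = 0" using eq[OF less.prems(1) jM(1)] by simp
  thus ?case using allowed_emat[OF al, where 'a='a] by simp
qed

text \<open>The relabellings \<open>p\<close> and \<open>q\<close>, each the identity or the
  reversal, reduce all combinations of upper and lower triangular matrices to the single case of
  \<open>tri_shape\<close>.\<close>

lemma conj_shape:
  fixes x :: "Kbar mat" and p q :: "nat \<Rightarrow> nat" and g1 g2 :: "nat \<Rightarrow> int"
  assumes x: "x \<in> classical_group ty n"
    and conj: "\<And>y. y \<in> lie_alg ty n \<Longrightarrow> strict_tri g1 y \<Longrightarrow> strict_tri g2 (Ad x y)"
    and p: "(p, g2) \<in> {(\<lambda>i. i, int), (rv, \<lambda>i. - int i)}"
    and q: "(q, g1) \<in> {(\<lambda>i. i, int), (rv, \<lambda>i. - int i)}"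
    and ab: "a < M" "b < a" "\<not> in_block a b"
  shows "x $$ (p a, q b) = 0"
proof (rule tri_shape[OF _ ab])
  note inv = group_inverse[OF x] and xc = groupD(1)[OF x]
  have pM: "\<And>a. a < M \<Longrightarrow> p a < M" "\<And>a. a < M \<Longrightarrow> p (p a) = a" using p by auto
  have qM: "\<And>a. a < M \<Longrightarrow> q a < M" "\<And>a. a < M \<Longrightarrow> q (q a) = a" using q by auto
  have gp: "g2 (p a) + 1 \<le> g2 (p b) \<longleftrightarrow> a < b" if "a < M" "b < M" for a b
    using p that by (auto simp: rv_def)
  have gq: "g1 (q a) + 1 \<le> g1 (q b) \<longleftrightarrow> a < b" if "a < M" "b < M" for a b
    using q that by (auto simp: rv_def)
  have reidx: "(\<Sum>c<M. h (p c)) = (\<Sum>c<M. h c)" "(\<Sum>c<M. h (q c)) = (\<Sum>c<M. h c)" for h :: "nat \<Rightarrow> Kbar"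
    using sum_rv[of h] p q by auto
  fix i j assume al: "allowed i j" and ij: "i < j"
  have iM: "i < M" "j < M" using allowedD[OF al] by auto
  let ?y = "emat (q i) (q j) :: Kbar mat"
  have ey: "?y $$ (q c, q b) = emat i j $$ (c, b)" if "c < M" "b < M" for c b
  proof -
    have eqs: "q c = q i \<longleftrightarrow> c = i" "q b = q j \<longleftrightarrow> b = j" using that iM qM by metis+
    have "(q c = rv (q j) \<and> q b = rv (q i)) \<longleftrightarrow> (c = rv j \<and> b = rv i)"
      using q that iM by auto
    moreover have "sg (q i) * sg (q j) = (sg i * sg j :: Kbar)" using q iM by (auto simp: sg_rv)
    ultimately show ?thesis using that iM qM eqs unfolding emat_def by simp
  qed
  have yl: "?y \<in> lie_alg ty n" using iM qM by (intro emat_lie) auto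
  have ys: "strict_tri g1 ?y" unfolding strict_tri_def
  proof (intro allI impI)
    fix a b assume ab: "a < M" "b < M" "?y $$ (a, b) \<noteq> 0"
    define a' b' where "a' = q a" and "b' = q b"
    have ab': "a = q a'" "b = q b'" "a' < M" "b' < M" using ab qM by (auto simp: a'_def b'_def)
    hence "emat i j $$ (a', b') \<noteq> (0 :: Kbar)" using ab(3) ey by metis
    hence "(a' = i \<and> b' = j) \<or> (a' = rv j \<and> b' = rv i)" using ab' by (auto simp: emat_def split: if_splits)
    hence "a' < b'" using ij iM by auto
    thus "g1 a + 1 \<le> g1 b" using gq[OF ab'(3,4)] ab' by simp
  qed
  let ?z = "Ad x ?y"
  have zs: "strict_tri g2 ?z" by (rule conj[OF yl ys])
  have zl: "?z \<in> lie_alg ty n" by (rule Ad_lie_alg[OF x yl])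
  have zc: "?z \<in> carrier_mat M M" using zl by (simp add: lie_alg_def)
  have comm: "x * ?y = ?z * x"
  proof -
    have "?z * x = x * ?y * (the (mat_inverse x) * x)" unfolding Ad_def using xc inv by (simp add: mat_assoc)
    thus ?thesis using inv xc by simp
  qed
  show "\<exists>z. (\<forall>a<M. \<forall>b<M. z a b \<noteq> 0 \<longrightarrow> a < b \<and> allowed a b) \<and>
      (\<forall>a<M. \<forall>b<M. (\<Sum>c<M. x $$ (p a, q c) * emat i j $$ (c, b)) = (\<Sum>c<M. z a c * x $$ (p c, q b)))"
  proof (intro exI[of _ "\<lambda>a b. ?z $$ (p a, p b)"] conjI allI impI)
    fix a b assume ab: "a < M" "b < M" and nz: "?z $$ (p a, p b) \<noteq> 0"
    show lt: "a < b" using zs nz gp[OF ab] pM ab unfolding strict_tri_def by blast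
    have "p a \<noteq> p b" using lt pM ab by (metis less_irrefl)
    hence "allowed (p a) (p b)" using lie_allowed[OF zl _ _ _ nz] pM ab by blast
    thus "allowed a b" using p ab unfolding allowed_def by auto
  next
    fix a b assume ab: "a < M" "b < M"
    have "(\<Sum>c<M. x $$ (p a, q c) * emat i j $$ (c, b)) = (\<Sum>c<M. x $$ (p a, q c) * ?y $$ (q c, q b))"
      using ab ey by (intro sum.cong refl) simp
    also have "\<dots> = (x * ?y) $$ (p a, q b)"
      using reidx(2)[of "\<lambda>c. x $$ (p a, c) * ?y $$ (c, q b)"] ab pM qM xc by (simp add: mult_mat_entry[of _ M] del: index_mult_mat(1))
    also have "\<dots> = (\<Sum>c<M. ?z $$ (p a, c) * x $$ (c, q b))"
      unfolding comm using ab pM qM xc zc by (intro mult_mat_entry) auto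
    also have "\<dots> = (\<Sum>c<M. ?z $$ (p a, p c) * x $$ (p c, q b))" by (rule reidx(1)[symmetric])
    finally show "(\<Sum>c<M. x $$ (p a, q c) * emat i j $$ (c, b)) = (\<Sum>c<M. ?z $$ (p a, p c) * x $$ (p c, q b))" .
  qed
qed

lemma prod_pairs:
  fixes f :: "nat \<Rightarrow> 'a :: comm_ring_1"
  assumes f: "\<And>i. i < M \<Longrightarrow> f i * f (rv i) = 1"
  shows "(\<Prod>i<M. f i) = (if ty = Type_B then f n else 1)"
proof -
  have lo: "(\<Prod>i<n. f i) * (\<Prod>i\<in>{M - n..<M}. f i) = 1"
  proof -
    have "(\<Prod>i\<in>{M - n..<M}. f i) = (\<Prod>i<n. f (rv i))"
      using M_simps(3,4) by (intro prod.reindex_bij_witness[of _ rv rv]) (auto simp: rv_def)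
    hence "(\<Prod>i<n. f i) * (\<Prod>i\<in>{M - n..<M}. f i) = (\<Prod>i<n. f i * f (rv i))" by (simp add: prod.distrib)
    also have "\<dots> = 1" using f M_simps(3) by (intro prod.neutral) auto
    finally show ?thesis .
  qed
  have dis: "{..<n} \<inter> {M - n..<M} = {}" using M_simps(3) by auto
  show ?thesis
  proof (cases "ty = Type_B")
    case True
    have M: "M = 2 * n + 1" by (rule M_simps(1)[OF True])
    have "{..<M} = insert n ({..<n} \<union> {M - n..<M})" using M by auto
    hence "(\<Prod>i<M. f i) = f n * ((\<Prod>i<n. f i) * (\<Prod>i\<in>{M - n..<M}. f i))"
      unfolding prod.union_disjoint[OF finite_lessThan finite_atLeastLessThan dis, symmetric]
      by (simp add: M)
    thus ?thesis using lo True by simp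
  next
    case False
    have M: "M = 2 * n" by (rule M_simps(2)[OF False])
    have "{..<M} = {..<n} \<union> {M - n..<M}" using M by auto
    hence "(\<Prod>i<M. f i) = (\<Prod>i<n. f i) * (\<Prod>i\<in>{M - n..<M}. f i)"
      using prod.union_disjoint[OF finite_lessThan finite_atLeastLessThan dis] by simp
    thus ?thesis using lo False by simp
  qed
qed

lemma det_diagonal:
  assumes "x \<in> carrier_mat m m" "\<And>i j. i < m \<Longrightarrow> j < m \<Longrightarrow> i \<noteq> j \<Longrightarrow> x $$ (i, j) = 0"
  shows "det x = (\<Prod>i<m. x $$ (i, i) :: 'a :: comm_ring_1)"
proof -
  have "upper_triangular x" using assms by (auto simp: upper_triangular_def)
  from det_upper_triangular[OF this assms(1)] show ?thesis
    using assms(1) by (simp add: prod_list_diag_prod lessThan_atLeast0)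
qed

definition torus :: "(nat \<Rightarrow> 'a :: comm_ring_1) \<Rightarrow> bool" where
  "torus d \<longleftrightarrow> (\<forall>i<M. d i * d (rv i) = 1) \<and> (ty = Type_B \<longrightarrow> d n = 1)"

lemma diag_of_group_iff: "(diag_of d :: 'a :: comm_ring_1 mat) \<in> classical_group ty n \<longleftrightarrow> torus d"
proof -
  have s: "(\<Sum>k<M. diag_of d $$ (i, k) * sg k * diag_of d $$ (j, rv k)) = (if j = rv i then sg i * (d i * d (rv i)) else 0)"
    if "i < M" "j < M" for i j
  proof -
    have "(\<Sum>k<M. diag_of d $$ (i, k) * sg k * diag_of d $$ (j, rv k))
      = (\<Sum>k<M. if k = i then (if j = rv i then sg i * (d i * d (rv i)) else 0) else 0)"
      using that by (intro sum.cong refl) (auto simp: diag_of_entry)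
    thus ?thesis using that by simp
  qed
  have det: "det (diag_of d) = (\<Prod>i<M. d i)"
    by (subst det_diagonal[of _ M]) (auto simp: diag_of_entry)
  show ?thesis
  proof
    assume x: "diag_of d \<in> classical_group ty n"
    have 1: "d i * d (rv i) = 1" if i: "i < M" for i
    proof -
      have "sg i * (d i * d (rv i)) = sg i" using group_sum[OF x i rv_lt[OF i]] s[OF i rv_lt[OF i]] by simp
      hence "sg i * (sg i * (d i * d (rv i))) = sg i * sg i" by simp
      thus ?thesis by (simp only: sg_sg)
    qed
    with prod_pairs[of d] det groupD(2)[OF x] show "torus d" unfolding torus_def by auto
  next
    assume t: "torus d"
    have "det (diag_of d) = 1" using prod_pairs[of d] t det unfolding torus_def by auto
    thus "diag_of d \<in> classical_group ty n" unfolding group_iff using s t by (auto simp: torus_def)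
  qed
qed

text \<open>In type D the middle block preserves a hyperbolic plane, so it is diagonal or
  antidiagonal. The antidiagonal alternative has determinant -1, and this is where the group being
  special orthogonal is decisive.\<close>

lemma block_diag_diagonal:
  fixes x :: "'a :: field_char_0 mat"
  assumes x: "x \<in> classical_group ty n"
    and z: "\<And>a b. a < M \<Longrightarrow> b < M \<Longrightarrow> a \<noteq> b \<Longrightarrow> \<not> in_block a b \<Longrightarrow> x $$ (a, b) = 0"
  shows "\<exists>d. torus d \<and> x = diag_of d"
proof -
  note xc = groupD(1)[OF x]
  have off: "x $$ (a, b) = 0" if ab: "a < M" "b < M" "a \<noteq> b" for a b
  proof (cases "in_block a b")
    case blk: True
    hence D: "ty = Type_D" by (simp add: in_block_def)
    have M: "M = 2 * n" using M_simps(2) D by simp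
    let ?u = "n - 1" and ?v = n
    have uv: "?u < M" "?v < M" "?u \<noteq> ?v" using M n_pos by auto
    have rvu: "rv ?u = ?v" "rv ?v = ?u" unfolding rv_def M using n_pos by auto
    have sg1: "sg k = (1 :: 'a)" for k unfolding sg_def using D by simp
    have row: "x $$ (c, k) = 0" if "c \<in> {?u, ?v}" "k < M" "k \<notin> {?u, ?v}" for c k
      using that uv by (intro z) (auto simp: in_block_def)
    have S: "(\<Sum>k<M. x $$ (c, k) * sg k * x $$ (e, rv k)) = x $$ (c, ?u) * x $$ (e, ?v) + x $$ (c, ?v) * x $$ (e, ?u)"
      if "c \<in> {?u, ?v}" for c e
    proof -
      have "(\<Sum>k<M. x $$ (c, k) * sg k * x $$ (e, rv k)) = (\<Sum>k\<in>{?u, ?v}. x $$ (c, k) * sg k * x $$ (e, rv k))"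
        using uv row[OF that] by (intro sum.mono_neutral_right) auto
      thus ?thesis using uv rvu sg1 by simp
    qed
    let ?p = "x $$ (?u, ?u)" and ?q = "x $$ (?u, ?v)" and ?r = "x $$ (?v, ?u)" and ?s = "x $$ (?v, ?v)"
    have "?p * ?q + ?q * ?p = 0" using S[of ?u ?u] group_sum[OF x uv(1,1)] rvu uv by simp
    hence pq: "?p * ?q = 0" by (simp add: mult.commute)
    have "?r * ?s + ?s * ?r = 0" using S[of ?v ?v] group_sum[OF x uv(2,2)] rvu uv by simp
    hence rs: "?r * ?s = 0" by (simp add: mult.commute)
    have psqr: "?p * ?s + ?q * ?r = 1" using S[of ?u ?v] group_sum[OF x uv(1,2)] rvu uv sg1 by simp
    have "?p \<noteq> 0"
    proof
      assume p: "?p = 0"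
      hence qr: "?q * ?r = 1" using psqr by simp
      hence s: "?s = 0" using rs by auto
      \<comment> \<open>Exchanging the two middle rows produces a diagonal matrix whose entries at
        mirror indices are inverse to each other, so its determinant is 1, while the exchange says
        -1.\<close>
      define w where "w = swaprows ?u ?v x"
      have wc: "w \<in> carrier_mat M M" using xc by (simp add: w_def)
      have went: "w $$ (i, j) = x $$ (if i = ?u then ?v else if i = ?v then ?u else i, j)" if "i < M" "j < M" for i j
        using that xc uv by (simp add: w_def)
      have "det w = - det x" unfolding w_def using det_swaprows[OF uv xc] by simp
      hence "det w = - 1" using groupD(2)[OF x] by simp
      moreover have "det w = (\<Prod>i<M. w $$ (i, i))"
      proof (rule det_diagonal[OF wc])
        fix i j assume ij: "i < M" "j < M" "i \<noteq> j"
        show "w $$ (i, j) = 0"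
          unfolding went[OF ij(1,2)] using ij uv p s row[of ?u j] row[of ?v j] z[of i j]
          by (auto simp: in_block_def)
      qed
      moreover have "(\<Prod>i<M. w $$ (i, i)) = 1"
      proof -
        have "w $$ (i, i) * w $$ (rv i, rv i) = 1" if i: "i < M" for i
        proof (cases "i \<in> {?u, ?v}")
          case True
          thus ?thesis using went uv rvu qr by (auto simp: mult.commute)
        next
          case False
          hence rvi: "rv i \<notin> {?u, ?v}" using rvu i by (metis insert_iff rv_rv singletonD)
          have "(\<Sum>k<M. x $$ (i, k) * sg k * x $$ (rv i, rv k)) = (\<Sum>k\<in>{i}. x $$ (i, k) * sg k * x $$ (rv i, rv k))"
            using i False z[of i] by (intro sum.mono_neutral_right) (auto simp: in_block_def)
          hence "x $$ (i, i) * x $$ (rv i, rv i) = 1" using group_sum[OF x i rv_lt[OF i]] sg1 by simp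
          thus ?thesis using went i False rvi by auto
        qed
        from prod_pairs[of "\<lambda>i. w $$ (i, i)", OF this] D show ?thesis by simp
      qed
      ultimately show False by simp
    qed
    hence q: "?q = 0" using pq by simp
    hence "?s \<noteq> 0" using psqr by auto
    hence "?r = 0" using rs by simp
    with q blk ab show ?thesis by (auto simp: in_block_def)
  qed (use z ab in blast)
  have "x = diag_of (\<lambda>i. x $$ (i, i))"
    using xc off by (intro eq_matI) (auto simp: diag_of_def monomial_mat_def)
  thus ?thesis using diag_of_group_iff x by metis
qed

end

section \<open>Pairing with root vectors, and swapping the tensor factors\<close>

context classical
begin

text \<open>A root vector lives on one position and its mirror image, and both contribute the same
  product. So the factor is 2, or 1 if the position is its own mirror image.\<close>

lemma trace_root:
  assumes x: "(x :: Kbar mat) \<in> root_space ty n \<alpha>" and m: "matches \<alpha> i j" "allowed i j"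
    and z: "z \<in> lie_alg ty n"
  shows "\<exists>c\<noteq>0. trace_form M x z = c * (x $$ (i, j) * z $$ (j, i))"
proof -
  have xl: "x \<in> lie_alg ty n" using x by (simp add: root_space_def)
  have ij: "i < M" "j < M" "i \<noteq> j" using allowedD[OF m(2)] by auto
  let ?A = "{(i, j), (rv j, rv i)}"
  have "trace_form M x z = (\<Sum>(a, b)\<in>{..<M} \<times> {..<M}. x $$ (a, b) * z $$ (b, a))"
    unfolding trace_form_def by (simp add: sum.cartesian_product)
  also have "\<dots> = (\<Sum>(a, b)\<in>?A. x $$ (a, b) * z $$ (b, a))"
  proof (intro sum.mono_neutral_right ballI)
    fix y assume y: "y \<in> {..<M} \<times> {..<M} - ?A"
    obtain a b where ab: "y = (a, b)" by fastforce
    have "x $$ (a, b) = 0"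
    proof (rule ccontr)
      assume "x $$ (a, b) \<noteq> 0"
      hence "matches \<alpha> a b" using root_space_matches[OF x] y ab by auto
      from matches_positions[OF m(1) this] ij y ab show False by auto
    qed
    thus "(case y of (a, b) \<Rightarrow> x $$ (a, b) * z $$ (b, a)) = 0" by (simp add: ab)
  qed (use ij in auto)
  finally have s: "trace_form M x z = (\<Sum>(a, b)\<in>?A. x $$ (a, b) * z $$ (b, a))" .
  have "x $$ (rv j, rv i) * z $$ (rv i, rv j) = x $$ (i, j) * z $$ (j, i)"
    using lie_entry[OF xl ij(1,2)] lie_entry[OF z ij(2,1)] by (simp add: algebra_simps)
  note sym = this
  show ?thesis
  proof (cases "(i, j) = (rv j, rv i)")
    case True
    have "?A = {(i, j)}" unfolding True[symmetric] by (rule insert_absorb2)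
    hence "trace_form M x z = x $$ (i, j) * z $$ (j, i)" unfolding s by simp
    thus ?thesis by (intro exI[of _ 1]) simp
  next
    case False
    have "trace_form M x z = x $$ (i, j) * z $$ (j, i) + x $$ (rv j, rv i) * z $$ (rv i, rv j)"
      unfolding s using False by (subst sum.insert) auto
    thus ?thesis using sym by (intro exI[of _ 2]) simp
  qed
qed

lemma in_root_lie: "x \<in> root_space ty n \<alpha> \<Longrightarrow> x \<in> lie_alg ty n" by (simp add: root_space_def)

lemma lie_carrier: "x \<in> lie_alg ty n \<Longrightarrow> x \<in> carrier_mat M M" by (simp add: lie_alg_def)

lemma Ad_tensor_flip:
  assumes x: "x \<in> carrier_mat M M" "det x \<noteq> 0" and t: "t \<in> tensor_carrier M"
  shows "Ad_tensor x (flip t) = flip (Ad_tensor x t)"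
proof (rule tensor_eqI[of _ M])
  have ft: "flip t \<in> tensor_carrier M" by (rule flip_carrier[OF t])
  have at: "Ad_tensor x t \<in> tensor_carrier M" by (rule Ad_tensor_carrier[OF x t])
  show "Ad_tensor x (flip t) \<in> tensor_carrier M" "flip (Ad_tensor x t) \<in> tensor_carrier M"
    using Ad_tensor_carrier[OF x ft] flip_carrier[OF at] by auto
  let ?i = "the (mat_inverse x)"
  have full: "Ad_tensor x s $$ (i, j) $$ (k, l) =
      (\<Sum>p<M. \<Sum>q<M. \<Sum>a<M. \<Sum>b<M. x $$ (i, p) * x $$ (k, a) * s $$ (p, q) $$ (a, b) * ?i $$ (b, l) * ?i $$ (q, j))"
    if s: "s \<in> tensor_carrier M" and lt: "i < M" "j < M" "k < M" "l < M" for s i j k l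
    unfolding Ad_tensor_entry[OF x s lt]
  proof (intro sum.cong refl)
    fix p q assume "p \<in> {..<M}" "q \<in> {..<M}"
    hence "s $$ (p, q) \<in> carrier_mat M M" using tensor_carrierD(2)[OF s] by auto
    thus "x $$ (i, p) * Ad x (s $$ (p, q)) $$ (k, l) * ?i $$ (q, j) =
      (\<Sum>a<M. \<Sum>b<M. x $$ (i, p) * x $$ (k, a) * s $$ (p, q) $$ (a, b) * ?i $$ (b, l) * ?i $$ (q, j))"
      using Ad_entry[OF x _ lt(3,4)] by (simp add: sum_distrib_left sum_distrib_right mult_ac)
  qed
  fix i j k l assume lt: "i < M" "j < M" "k < M" "l < M"
  have swap: "(\<Sum>p<M. \<Sum>q<M. \<Sum>a<M. \<Sum>b<M. h p q a b) = (\<Sum>a<M. \<Sum>b<M. \<Sum>p<M. \<Sum>q<M. h p q a b)"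
    for h :: "nat \<Rightarrow> nat \<Rightarrow> nat \<Rightarrow> nat \<Rightarrow> 'a"
  proof -
    have "(\<Sum>p<M. \<Sum>q<M. \<Sum>a<M. \<Sum>b<M. h p q a b) = (\<Sum>p<M. \<Sum>a<M. \<Sum>b<M. \<Sum>q<M. h p q a b)"
      by (subst (3) sum.swap, subst (2) sum.swap) simp
    also have "\<dots> = (\<Sum>a<M. \<Sum>b<M. \<Sum>p<M. \<Sum>q<M. h p q a b)"
      by (subst sum.swap, subst (2) sum.swap) simp
    finally show ?thesis .
  qed
  have "flip (Ad_tensor x t) $$ (i, j) $$ (k, l) = Ad_tensor x t $$ (k, l) $$ (i, j)"
    by (rule flip_entry[OF at lt])
  also have "\<dots> = (\<Sum>a<M. \<Sum>b<M. \<Sum>p<M. \<Sum>q<M. x $$ (k, p) * x $$ (i, a) * t $$ (p, q) $$ (a, b) * ?i $$ (b, j) * ?i $$ (q, l))"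
    unfolding full[OF t lt(3,4,1,2)] by (rule swap)
  also have "\<dots> = Ad_tensor x (flip t) $$ (i, j) $$ (k, l)"
    unfolding full[OF ft lt] by (intro sum.cong refl) (simp add: flip_entry[OF t] mult_ac)
  finally show "Ad_tensor x (flip t) $$ (i, j) $$ (k, l) = flip (Ad_tensor x t) $$ (i, j) $$ (k, l)" ..
qed

end

text \<open>The r-matrix in coordinates. The sums over \<alpha> and k are merged into one sum over a
  set \<open>W\<close> of pairs (\<alpha>, \<tau>^k \<alpha>), together with a rank
  \<open>\<rho>\<close> that grows along these pairs.\<close>

locale bd_data = classical +
  fixes e :: "lattice_elt \<Rightarrow> Kbar mat" and W :: "(lattice_elt \<times> lattice_elt) set"
    and \<rho> :: "lattice_elt \<Rightarrow> int" and r0 r :: "Kbar tensor"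
  assumes e_root: "\<And>\<alpha>. \<alpha> \<in> roots ty n \<Longrightarrow> e \<alpha> \<in> root_space ty n \<alpha>"
    and e_K: "\<And>\<alpha>. \<alpha> \<in> roots ty n \<Longrightarrow> e \<alpha> \<in> map_mat to_ac ` (lie_alg ty n :: K mat set)"
    and e_killing: "\<And>\<alpha>. \<alpha> \<in> roots ty n \<Longrightarrow> killing ty n (e \<alpha>) (e (- \<alpha>)) = 1"
    and W: "W \<subseteq> pos_roots ty n \<times> pos_roots ty n" "\<And>a b. (a, b) \<in> W \<Longrightarrow> \<rho> a < \<rho> b"
    and r_carrier: "r \<in> tensor_carrier M" and r0_carrier: "r0 \<in> tensor_carrier M"
    and r0_diag: "\<And>i j k l. i < M \<Longrightarrow> j < M \<Longrightarrow> k < M \<Longrightarrow> l < M \<Longrightarrow> i \<noteq> j \<or> k \<noteq> l \<Longrightarrow> r0 $$ (i, j) $$ (k, l) = 0"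
    and r_entry: "\<And>i j k l. i < M \<Longrightarrow> j < M \<Longrightarrow> k < M \<Longrightarrow> l < M \<Longrightarrow>
      r $$ (i, j) $$ (k, l) = r0 $$ (i, j) $$ (k, l) + (\<Sum>a\<in>pos_roots ty n. e (- a) $$ (i, j) * e a $$ (k, l))
        + (\<Sum>(a, b)\<in>W. e (- a) $$ (i, j) * e b $$ (k, l) - e b $$ (i, j) * e (- a) $$ (k, l))"
begin

lemma e_lie: "\<alpha> \<in> roots ty n \<Longrightarrow> e \<alpha> \<in> lie_alg ty n"
  using e_root by (simp add: root_space_def)

lemma e_carrier: "\<alpha> \<in> roots ty n \<Longrightarrow> e \<alpha> \<in> carrier_mat M M"
  using e_lie by (simp add: lie_alg_def)

lemma e_matches: "\<alpha> \<in> roots ty n \<Longrightarrow> i < M \<Longrightarrow> j < M \<Longrightarrow> e \<alpha> $$ (i, j) \<noteq> 0 \<Longrightarrow> matches \<alpha> i j"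
  using root_space_matches[OF e_root] .

lemma e_neg_matches: "\<alpha> \<in> roots ty n \<Longrightarrow> i < M \<Longrightarrow> j < M \<Longrightarrow> e (- \<alpha>) $$ (i, j) \<noteq> 0 \<Longrightarrow> matches \<alpha> j i"
  using matches_arith(3)[OF e_matches[OF neg_root, of \<alpha> i j]] by (simp add: fun_Compl_def)

text \<open>The normalisation K(e_\<alpha>, e_{-\<alpha>}) = 1 excludes e_\<alpha> = 0, and a
  nonzero root vector is nonzero at both positions of its weight, since they determine each
  other.\<close>

lemma e_nonzero:
  assumes a: "\<alpha> \<in> roots ty n" and m: "matches \<alpha> i j" "allowed i j"
  shows "e \<alpha> $$ (i, j) \<noteq> 0"
proof
  assume 0: "e \<alpha> $$ (i, j) = 0"
  have ij: "i < M" "j < M" "i \<noteq> j" using allowedD[OF m(2)] by auto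
  have "e \<alpha> = 0\<^sub>m M M"
  proof (rule eq_matI)
    fix p q assume "p < dim_row (0\<^sub>m M M :: Kbar mat)" "q < dim_col (0\<^sub>m M M :: Kbar mat)"
    hence pq: "p < M" "q < M" by auto
    have "e \<alpha> $$ (p, q) = 0"
    proof (rule ccontr)
      assume nz: "e \<alpha> $$ (p, q) \<noteq> 0"
      from matches_positions[OF m(1) e_matches[OF a pq nz] ij(1,2) pq ij(3)]
      have "p = rv j \<and> q = rv i" using nz 0 by auto
      with lie_entry[OF e_lie[OF a] ij(1,2)] 0 nz show False by simp
    qed
    thus "e \<alpha> $$ (p, q) = 0\<^sub>m M M $$ (p, q)" using pq by simp
  qed (use e_carrier[OF a] in auto)
  hence "killing ty n (0\<^sub>m M M) (e (- \<alpha>)) = 1" using e_killing[OF a] by simp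
  with killing_zero[OF e_carrier[OF neg_root[OF a]]] show False by simp
qed

lemma e_in_K: "\<alpha> \<in> roots ty n \<Longrightarrow> i < M \<Longrightarrow> j < M \<Longrightarrow> e \<alpha> $$ (i, j) \<in> range to_ac"
  using e_K[of \<alpha>] by (auto simp: lie_alg_def)

lemma trace_e_orth:
  assumes "\<alpha> \<in> roots ty n" "\<beta> \<in> roots ty n" "\<alpha> \<noteq> \<beta>"
  shows "trace_form M (e (- \<alpha>)) (e \<beta>) = 0"
  unfolding trace_form_def
proof (intro sum.neutral ballI)
  fix i j assume ij: "i \<in> {..<M}" "j \<in> {..<M}"
  show "e (- \<alpha>) $$ (i, j) * e \<beta> $$ (j, i) = 0"
  proof (rule ccontr)
    assume "\<not> ?thesis"
    hence "matches \<alpha> j i" "matches \<beta> j i"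
      using e_neg_matches[OF assms(1), of i j] e_matches[OF assms(2), of j i] ij by auto
    with roots_unique[OF assms(1,2)] assms(3) show False by blast
  qed
qed

lemma trace_e_pairing:
  assumes a: "\<alpha> \<in> roots ty n"
  shows "trace_form M (e (- \<alpha>)) (e \<alpha>) \<noteq> 0"
proof -
  obtain i j where ij: "allowed i j" "matches \<alpha> i j" using a unfolding roots_iff by blast
  obtain c where "c \<noteq> 0" "trace_form M (e \<alpha>) (e (- \<alpha>)) = c * (e \<alpha> $$ (i, j) * e (- \<alpha>) $$ (j, i))"
    using trace_root[OF e_root[OF a] ij(2,1) e_lie[OF neg_root[OF a]]] by blast
  with e_nonzero[OF a ij(2,1)] e_nonzero[OF neg_root[OF a] matches_arith(3)[OF ij(2)] allowed_sym[OF ij(1)]]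
  show ?thesis by (simp add: trace_form_commute)
qed

lemma e_pos_strict: "\<alpha> \<in> pos_roots ty n \<Longrightarrow> strict_tri int (e \<alpha>)"
  "\<alpha> \<in> pos_roots ty n \<Longrightarrow> strict_tri (\<lambda>i. - int i) (e (- \<alpha>))"
proof -
  assume a: "\<alpha> \<in> pos_roots ty n"
  show "strict_tri int (e \<alpha>)" unfolding strict_tri_def
    using pos_root_less[OF a e_matches[OF pos_rootsD(1)[OF a]]] by fastforce
  show "strict_tri (\<lambda>i. - int i) (e (- \<alpha>))" unfolding strict_tri_def
    using pos_root_less[OF a e_neg_matches[OF pos_rootsD(1)[OF a]]] by fastforce
qed

lemma tri: "triangular_tensor ty n int (pos_roots ty n) e (\<lambda>\<alpha>. e (- \<alpha>)) W \<rho> r0 r"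
proof (unfold_locales)
  show "strict_tri int (e \<alpha>)" "strict_tri (\<lambda>i. - int i) (e (- \<alpha>))" if "\<alpha> \<in> pos_roots ty n" for \<alpha>
    using e_pos_strict that by auto
  show "trace_form M (e (- \<alpha>)) (e \<beta>) = 0" if "\<alpha> \<in> pos_roots ty n" "\<beta> \<in> pos_roots ty n" "\<alpha> \<noteq> \<beta>" for \<alpha> \<beta>
    using trace_e_orth that pos_rootsD(1) by blast
  show "trace_form M (e (- \<alpha>)) (e \<alpha>) \<noteq> 0" if "\<alpha> \<in> pos_roots ty n" for \<alpha>
    using trace_e_pairing that pos_rootsD(1) by blast
  show "e \<alpha> \<in> carrier_mat M M" "e (- \<alpha>) \<in> carrier_mat M M" if "\<alpha> \<in> pos_roots ty n" for \<alpha>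
    using e_carrier neg_root pos_rootsD(1)[OF that] by auto
  fix z :: "Kbar mat" and i j
  assume z: "z \<in> lie_alg ty n" and 0: "\<And>\<alpha>. \<alpha> \<in> pos_roots ty n \<Longrightarrow> trace_form M (e \<alpha>) z = 0"
    and ij: "i < M" "j < M" "int j + 1 \<le> int i"
  show "z $$ (i, j) = 0"
  proof (rule ccontr)
    assume nz: "z $$ (i, j) \<noteq> 0"
    have al: "allowed j i" using lie_allowed[OF z ij(1,2) _ nz] ij(3) allowed_sym by auto
    then obtain \<alpha> where a: "\<alpha> \<in> pos_roots ty n" "matches \<alpha> j i" using pos_root_exists[of j i] ij(3) by auto
    obtain c where "c \<noteq> 0" "trace_form M (e \<alpha>) z = c * (e \<alpha> $$ (j, i) * z $$ (i, j))"
      using trace_root[OF e_root[OF pos_rootsD(1)[OF a(1)]] a(2) al z] by blast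
    with 0[OF a(1)] nz e_nonzero[OF pos_rootsD(1)[OF a(1)] a(2) al] show False by simp
  qed
next
  show "inj int" by simp
  show "finite (pos_roots ty n)" by (rule finite_pos_roots)
  show "W \<subseteq> pos_roots ty n \<times> pos_roots ty n" by (rule W(1))
  show "\<rho> a < \<rho> b" if "(a, b) \<in> W" for a b by (rule W(2)[OF that])
  show "r \<in> tensor_carrier M" by (rule r_carrier)
  show "r0 $$ (i, j) $$ (k, l) = 0" if "i < M" "j < M" "k < M" "l < M" "i \<noteq> j \<or> k \<noteq> l" for i j k l
    by (rule r0_diag[OF that])
  show "r $$ (i, j) $$ (k, l) = r0 $$ (i, j) $$ (k, l) + (\<Sum>a\<in>pos_roots ty n. e (- a) $$ (i, j) * e a $$ (k, l))
        + (\<Sum>(a, b)\<in>W. e (- a) $$ (i, j) * e b $$ (k, l) - e b $$ (i, j) * e (- a) $$ (k, l))"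
    if "i < M" "j < M" "k < M" "l < M" for i j k l
    by (rule r_entry[OF that])
qed

lemma tri_flip: "triangular_tensor ty n (\<lambda>i. - int i) (pos_roots ty n) (\<lambda>\<alpha>. e (- \<alpha>)) e (W\<inverse>) (\<lambda>\<alpha>. - \<rho> \<alpha>) (flip r0) (flip r)"
proof (unfold_locales)
  show "strict_tri (\<lambda>i. - (- int i)) (e \<alpha>)" "strict_tri (\<lambda>i. - int i) (e (- \<alpha>))" if "\<alpha> \<in> pos_roots ty n" for \<alpha>
    using e_pos_strict that by auto
  show "trace_form M (e \<alpha>) (e (- \<beta>)) = 0" if "\<alpha> \<in> pos_roots ty n" "\<beta> \<in> pos_roots ty n" "\<alpha> \<noteq> \<beta>" for \<alpha> \<beta>
    using trace_e_orth[of \<beta> \<alpha>] that pos_rootsD(1) by (auto simp: trace_form_commute)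
  show "trace_form M (e \<alpha>) (e (- \<alpha>)) \<noteq> 0" if "\<alpha> \<in> pos_roots ty n" for \<alpha>
    using trace_e_pairing[of \<alpha>] that pos_rootsD(1) by (auto simp: trace_form_commute)
  show "e \<alpha> \<in> carrier_mat M M" "e (- \<alpha>) \<in> carrier_mat M M" if "\<alpha> \<in> pos_roots ty n" for \<alpha>
    using e_carrier neg_root pos_rootsD(1)[OF that] by auto
  show "flip r \<in> tensor_carrier M" by (rule flip_carrier[OF r_carrier])
  show "flip r0 $$ (i, j) $$ (k, l) = 0" if "i < M" "j < M" "k < M" "l < M" "i \<noteq> j \<or> k \<noteq> l" for i j k l
    using flip_entry[OF r0_carrier that(1-4)] r0_diag[OF that(3,4,1,2)] that(5) by auto
  show "flip r $$ (i, j) $$ (k, l) = flip r0 $$ (i, j) $$ (k, l)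
      + (\<Sum>a\<in>pos_roots ty n. e a $$ (i, j) * e (- a) $$ (k, l))
      + (\<Sum>(a, b)\<in>W\<inverse>. e a $$ (i, j) * e (- b) $$ (k, l) - e (- b) $$ (i, j) * e a $$ (k, l))"
    if lt: "i < M" "j < M" "k < M" "l < M" for i j k l
  proof -
    have "(\<Sum>(a, b)\<in>W\<inverse>. e a $$ (i, j) * e (- b) $$ (k, l) - e (- b) $$ (i, j) * e a $$ (k, l))
      = (\<Sum>(a, b)\<in>W. e (- a) $$ (k, l) * e b $$ (i, j) - e b $$ (k, l) * e (- a) $$ (i, j))"
      by (rule sum.reindex_bij_witness[of _ "\<lambda>(a, b). (b, a)" "\<lambda>(a, b). (b, a)"]) (auto simp: mult.commute)
    moreover have "(\<Sum>a\<in>pos_roots ty n. e a $$ (i, j) * e (- a) $$ (k, l)) = (\<Sum>a\<in>pos_roots ty n. e (- a) $$ (k, l) * e a $$ (i, j))"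
      by (simp add: mult.commute)
    ultimately show ?thesis
      unfolding flip_entry[OF r_carrier lt] flip_entry[OF r0_carrier lt] using r_entry[OF lt(3,4,1,2)] by simp
  qed
  fix z :: "Kbar mat" and i j
  assume z: "z \<in> lie_alg ty n" and 0: "\<And>\<alpha>. \<alpha> \<in> pos_roots ty n \<Longrightarrow> trace_form M (e (- \<alpha>)) z = 0"
    and ij: "i < M" "j < M" "- int j + 1 \<le> - int i"
  show "z $$ (i, j) = 0"
  proof (rule ccontr)
    assume nz: "z $$ (i, j) \<noteq> 0"
    have al: "allowed i j" using lie_allowed[OF z ij(1,2) _ nz] ij(3) by auto
    then obtain \<alpha> where a: "\<alpha> \<in> pos_roots ty n" "matches \<alpha> i j" using pos_root_exists[of i j] ij(3) by auto
    note m = matches_arith(3)[OF a(2)] and na = neg_root[OF pos_rootsD(1)[OF a(1)]]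
    obtain c where "c \<noteq> 0" "trace_form M (e (- \<alpha>)) z = c * (e (- \<alpha>) $$ (j, i) * z $$ (i, j))"
      using trace_root[OF e_root[OF na] m allowed_sym[OF al] z] by blast
    with 0[OF a(1)] nz e_nonzero[OF na m allowed_sym[OF al]] show False by simp
  qed
next
  show "inj (\<lambda>i. - int i)" by (simp add: inj_def)
  show "finite (pos_roots ty n)" by (rule finite_pos_roots)
  show "W\<inverse> \<subseteq> pos_roots ty n \<times> pos_roots ty n" using W(1) by auto
  show "- \<rho> a < - \<rho> b" if "(a, b) \<in> W\<inverse>" for a b using W(2) that by simp
qed

lemma flip_flip_r: "flip (flip r) = r"
  using r_carrier flip_carrier by (intro tensor_eqI[of _ M]) (auto simp: flip_entry[of _ M])

text \<open>An element that fixes r also fixes its flip, so it is triangular in both directions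
  outside the middle block.\<close>

lemma centralizer_torus:
  assumes x: "x \<in> classical_group ty n" and Ad: "Ad_tensor x r = r"
  shows "\<exists>d. torus d \<and> x = diag_of d"
proof (rule block_diag_diagonal[OF x])
  have xc: "x \<in> carrier_mat M M" "det x \<noteq> 0" using groupD[OF x] by auto
  have Ad': "Ad_tensor x (flip r) = flip r" using Ad_tensor_flip[OF xc r_carrier] Ad by simp
  fix a b assume ab: "a < M" "b < M" "a \<noteq> b" "\<not> in_block a b"
  show "x $$ (a, b) = 0"
  proof (cases "b < a")
    case True
    have "x $$ ((\<lambda>i. i) a, (\<lambda>i. i) b) = 0"
      by (rule conj_shape[OF x Ad_strict_tri[OF tri tri x Ad]]) (use ab True in auto)
    thus ?thesis by simp
  next
    case False
    have "in_block (rv a) (rv b) \<Longrightarrow> in_block a b" using ab by (simp add: in_block_rv)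
    hence "x $$ (rv (rv a), rv (rv b)) = 0"
      by (intro conj_shape[OF x Ad_strict_tri[OF tri_flip tri_flip x Ad']]) (use ab False in auto)
    thus ?thesis using ab by simp
  qed
qed

text \<open>Such an element takes strictly upper to strictly lower triangular matrices and
  conversely, so outside the middle block only the antidiagonal survives.\<close>

lemma flipping_shape:
  assumes x: "x \<in> classical_group ty n" and Ad: "Ad_tensor x r = flip r"
    and ab: "a < M" "b < M" "b \<noteq> rv a" "\<not> in_block a b"
  shows "x $$ (a, b) = 0"
proof -
  have xc: "x \<in> carrier_mat M M" "det x \<noteq> 0" using groupD[OF x] by auto
  have Ad': "Ad_tensor x (flip r) = r" using Ad_tensor_flip[OF xc r_carrier] Ad flip_flip_r by simp
  have blk: "in_block (rv a) b \<Longrightarrow> in_block a b" "in_block a (rv b) \<Longrightarrow> in_block a b"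
    using ab by (simp_all add: in_block_rv)
  show ?thesis
  proof (cases "b < rv a")
    case True
    have "x $$ (rv (rv a), b) = 0"
      by (rule conj_shape[OF x Ad_strict_tri[OF tri tri_flip x Ad], where q = "\<lambda>i. i"]) (use ab True blk in auto)
    thus ?thesis using ab by simp
  next
    case False
    hence "rv b < a" using ab by (auto simp: rv_def)
    have "x $$ (a, rv (rv b)) = 0"
      by (rule conj_shape[OF x Ad_strict_tri[OF tri_flip tri x Ad'], where p = "\<lambda>i. i"]) (use ab \<open>rv b < a\<close> blk in auto)
    thus ?thesis using ab by simp
  qed
qed

text \<open>Positions determine roots, so a coordinate of r at positions of -\<alpha> and \<beta>
  isolates a single wedge. Its value is a product of two entries of root vectors and lies in K; this
  is how the rationality of the root vectors enters.\<close>

lemma r_W_entry: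
  assumes W1: "(\<alpha>, \<beta>) \<in> W" and m: "matches \<alpha> j i" "matches \<beta> k l" and al: "allowed j i" "allowed k l"
  shows "r $$ (i, j) $$ (k, l) = e (- \<alpha>) $$ (i, j) * e \<beta> $$ (k, l)" "r $$ (i, j) $$ (k, l) \<noteq> 0"
    "r $$ (i, j) $$ (k, l) \<in> range to_ac"
proof -
  have ab: "\<alpha> \<in> pos_roots ty n" "\<beta> \<in> pos_roots ty n" "\<alpha> \<noteq> \<beta>" using W(1) W(2)[OF W1] W1 by auto
  note ra = pos_rootsD(1)[OF ab(1)] and rb = pos_rootsD(1)[OF ab(2)]
  have lt: "i < M" "j < M" "k < M" "l < M" "i \<noteq> j" using allowedD[OF al(1)] allowedD[OF al(2)] by auto
  have ji: "j < i" using pos_root_less[OF ab(1) m(1) lt(2,1)] .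
  have dn: "e (- \<gamma>) $$ (i, j) = 0" if "\<gamma> \<in> pos_roots ty n" "\<gamma> \<noteq> \<alpha>" for \<gamma>
    using e_neg_matches[OF pos_rootsD(1)[OF that(1)] lt(1,2)] roots_unique[OF pos_rootsD(1)[OF that(1)] ra _ m(1)] that(2) by blast
  have up: "e \<gamma> $$ (k, l) = 0" if "\<gamma> \<in> pos_roots ty n" "\<gamma> \<noteq> \<beta>" for \<gamma>
    using e_matches[OF pos_rootsD(1)[OF that(1)] lt(3,4)] roots_unique[OF pos_rootsD(1)[OF that(1)] rb _ m(2)] that(2) by blast
  have up': "e \<gamma> $$ (i, j) = 0" if "\<gamma> \<in> pos_roots ty n" for \<gamma>
    using pos_root_less[OF that e_matches[OF pos_rootsD(1)[OF that] lt(1,2)]] lt ji by fastforce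
  \<comment> \<open>A term of the Drinfeld-Jimbo part would force \<alpha> = \<beta>, which the
    ranks exclude.\<close>
  have "(\<Sum>a\<in>pos_roots ty n. e (- a) $$ (i, j) * e a $$ (k, l)) = 0"
    using dn up ab by (intro sum.neutral) force
  moreover have "(\<Sum>(a, b)\<in>W. e (- a) $$ (i, j) * e b $$ (k, l) - e b $$ (i, j) * e (- a) $$ (k, l))
    = (\<Sum>x\<in>W. if x = (\<alpha>, \<beta>) then e (- \<alpha>) $$ (i, j) * e \<beta> $$ (k, l) else 0)"
  proof (intro sum.cong refl)
    fix x assume "x \<in> W"
    then obtain a b where x: "x = (a, b)" "a \<in> pos_roots ty n" "b \<in> pos_roots ty n" using W(1) by auto
    show "(case x of (a, b) \<Rightarrow> e (- a) $$ (i, j) * e b $$ (k, l) - e b $$ (i, j) * e (- a) $$ (k, l)) =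
      (if x = (\<alpha>, \<beta>) then e (- \<alpha>) $$ (i, j) * e \<beta> $$ (k, l) else 0)"
      using x dn[OF x(2)] up[OF x(3)] up'[OF x(3)] by auto
  qed
  moreover have "finite W" using W(1) finite_pos_roots by (meson finite_SigmaI finite_subset)
  ultimately show eq: "r $$ (i, j) $$ (k, l) = e (- \<alpha>) $$ (i, j) * e \<beta> $$ (k, l)"
    using r_entry[OF lt(1-4)] r0_diag[OF lt(1-4)] lt(5) W1 by simp
  show "r $$ (i, j) $$ (k, l) \<noteq> 0"
    unfolding eq using e_nonzero[OF neg_root[OF ra] matches_arith(3)[OF m(1)] allowed_sym[OF al(1)]] e_nonzero[OF rb m(2) al(2)]
    by simp
  have "e (- \<alpha>) $$ (i, j) \<in> range to_ac" "e \<beta> $$ (k, l) \<in> range to_ac"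
    using e_in_K neg_root[OF ra] rb lt by auto
  thus "r $$ (i, j) $$ (k, l) \<in> range to_ac" unfolding eq by (auto simp flip: to_ac_mult)
qed

lemma torus_nz: "torus d \<Longrightarrow> i < M \<Longrightarrow> d i \<noteq> (0 :: 'a :: field)"
  unfolding torus_def by force

lemma torus_ratio:
  assumes d: "torus d" and m: "matches \<alpha> i j" "matches \<alpha> a b" "i < M" "j < M" "a < M" "b < M" "i \<noteq> j"
  shows "d i / d j = (d a / d b :: 'a :: field)"
proof -
  have "d i * d (rv i) = 1" "d j * d (rv j) = 1" using d m by (auto simp: torus_def)
  hence "d (rv i) = 1 / d i" "d (rv j) = 1 / d j" using torus_nz[OF d] m by (auto simp: field_simps)
  with matches_positions[OF m] show ?thesis by auto
qed

text \<open>The tensor r_0 and the terms e_{-\<alpha>} \<otimes> e_\<alpha> have weight 0 and are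
  fixed by all diagonal group elements. A wedge is fixed exactly if the characters of its two roots
  agree at d.\<close>

lemma torus_centralizes_iff:
  assumes d: "torus d"
  shows "Ad_tensor (diag_of d) r = r \<longleftrightarrow>
    (\<forall>(\<alpha>, \<beta>)\<in>W. \<forall>i j k l. allowed i j \<longrightarrow> allowed k l \<longrightarrow> matches \<alpha> i j \<longrightarrow> matches \<beta> k l \<longrightarrow> d i / d j = d k / d l)"
    (is "?l \<longleftrightarrow> ?r")
proof -
  have nz: "d i \<noteq> 0" if "i < M" for i using torus_nz[OF d that] .
  have iff: "?l \<longleftrightarrow> (\<forall>i<M. \<forall>j<M. \<forall>k<M. \<forall>l<M. r $$ (i, j) $$ (k, l) \<noteq> 0 \<longrightarrow> d i * d k = d j * d l)"
  proof -
    have pt: "x = (d i * d k) / (d j * d l) * x \<longleftrightarrow> (x \<noteq> 0 \<longrightarrow> d i * d k = d j * d l)"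
      if "i < M" "j < M" "k < M" "l < M" for i j k l and x
      using nz that by (cases "x = 0") (auto simp: field_simps)
    have "?l \<longleftrightarrow> (\<forall>i<M. \<forall>j<M. \<forall>k<M. \<forall>l<M. r $$ (i, j) $$ (k, l) = (d i * d k) / (d j * d l) * r $$ (i, j) $$ (k, l))"
      unfolding diag_of_def using nz by (intro Ad_tensor_monomial_eq_iff r_carrier) auto
    thus ?thesis by (simp only: pt cong: imp_cong)
  qed
  show ?thesis
  proof
    assume ?l
    show ?r
    proof clarify
      fix \<alpha> \<beta> i j k l assume *: "(\<alpha>, \<beta>) \<in> W" "allowed i j" "allowed k l" "matches \<alpha> i j" "matches \<beta> k l"
      have lt: "i < M" "j < M" "k < M" "l < M" using allowedD *(2,3) by auto
      have "r $$ (j, i) $$ (k, l) \<noteq> 0" by (rule r_W_entry(2)[OF *(1,4,5,2,3)])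
      hence "d j * d k = d i * d l" using \<open>?l\<close> lt unfolding iff by blast
      thus "d i / d j = d k / d l" using nz lt by (simp add: field_simps)
    qed
  next
    assume r: ?r
    show ?l unfolding iff
    proof (intro allI impI)
      fix i j k l assume lt: "i < M" "j < M" "k < M" "l < M" and rnz: "r $$ (i, j) $$ (k, l) \<noteq> 0"
      have al: "allowed a b" if "e \<gamma> $$ (a, b) \<noteq> 0" "\<gamma> \<in> roots ty n" "a < M" "b < M" for \<gamma> a b
      proof -
        have "a \<noteq> b"
        proof
          assume "a = b"
          hence "\<gamma> = (\<lambda>_. 0)"
            using matches_unique[OF e_matches[OF that(2-4,1)], of "\<lambda>_. 0"] matches_arith(4) roots_supp[OF that(2)] by auto
          thus False using that(2) by (simp add: roots_def)
        qed
        thus ?thesis using lie_allowed[OF e_lie[OF that(2)] that(3,4)] that(1) by blast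
      qed
      consider "r0 $$ (i, j) $$ (k, l) \<noteq> 0" | "(\<Sum>a\<in>pos_roots ty n. e (- a) $$ (i, j) * e a $$ (k, l)) \<noteq> 0"
        | "(\<Sum>(a, b)\<in>W. e (- a) $$ (i, j) * e b $$ (k, l) - e b $$ (i, j) * e (- a) $$ (k, l)) \<noteq> 0"
        using rnz r_entry[OF lt] by force
      thus "d i * d k = d j * d l"
      proof cases
        case 1
        hence "i = j" "k = l" using r0_diag[OF lt] by auto
        thus ?thesis by simp
      next
        case 2
        from sum_nonzero_ex[OF this] obtain a where a: "a \<in> pos_roots ty n" "e (- a) $$ (i, j) \<noteq> 0" "e a $$ (k, l) \<noteq> 0" by auto
        note ra = pos_rootsD(1)[OF a(1)]
        have m: "matches a j i" "matches a k l" using e_neg_matches[OF ra lt(1,2) a(2)] e_matches[OF ra lt(3,4) a(3)] .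
        have "j \<noteq> i" using al[OF a(2) neg_root[OF ra] lt(1,2)] allowedD(3) by blast
        from torus_ratio[OF d m lt(2,1,3,4) this] show ?thesis using nz lt by (simp add: field_simps)
      next
        case 3
        from sum_nonzero_ex[OF this] obtain a b where ab: "(a, b) \<in> W"
          "e (- a) $$ (i, j) * e b $$ (k, l) - e b $$ (i, j) * e (- a) $$ (k, l) \<noteq> 0" by auto
        have ra: "a \<in> roots ty n" and rb: "b \<in> roots ty n" using W(1) ab(1) pos_rootsD(1) by auto
        note na = neg_root[OF ra]
        consider "e (- a) $$ (i, j) \<noteq> 0" "e b $$ (k, l) \<noteq> 0" | "e b $$ (i, j) \<noteq> 0" "e (- a) $$ (k, l) \<noteq> 0"
          using ab(2) by force
        thus ?thesis
        proof cases
          case 1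
          from r ab(1) have "d j / d i = d k / d l"
            using allowed_sym[OF al[OF 1(1) na lt(1,2)]] al[OF 1(2) rb lt(3,4)]
              e_neg_matches[OF ra lt(1,2) 1(1)] e_matches[OF rb lt(3,4) 1(2)] by blast
          thus ?thesis using nz lt by (simp add: field_simps)
        next
          case 2
          from r ab(1) have "d l / d k = d i / d j"
            using allowed_sym[OF al[OF 2(2) na lt(3,4)]] al[OF 2(1) rb lt(1,2)]
              e_neg_matches[OF ra lt(3,4) 2(2)] e_matches[OF rb lt(1,2) 2(1)] by blast
          thus ?thesis using nz lt by (simp add: field_simps)
        qed
      qed
    qed
  qed
qed

end

section \<open>The triples of type D\<close>

lemma tensor_entry:
  "a \<in> carrier_mat m m \<Longrightarrow> b \<in> carrier_mat m m \<Longrightarrow> i < m \<Longrightarrow> j < m \<Longrightarrow> k < m \<Longrightarrow> l < m \<Longrightarrow>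
    tensor a b $$ (i, j) $$ (k, l) = a $$ (i, j) * b $$ (k, l)"
  by (simp add: tensor_def)

lemma wedge_entry:
  "a \<in> carrier_mat m m \<Longrightarrow> b \<in> carrier_mat m m \<Longrightarrow> i < m \<Longrightarrow> j < m \<Longrightarrow> k < m \<Longrightarrow> l < m \<Longrightarrow>
    wedge a b $$ (i, j) $$ (k, l) = a $$ (i, j) * b $$ (k, l) - b $$ (i, j) * a $$ (k, l)"
  by (simp add: wedge_def tensor_def)

lemma tensor_sum_carrier: "tensor_sum m f A \<in> tensor_carrier m"
  by (simp add: tensor_sum_def tensor_carrier_def)

lemma tensor_sum_entry: "i < m \<Longrightarrow> j < m \<Longrightarrow> k < m \<Longrightarrow> l < m \<Longrightarrow>
    tensor_sum m f A $$ (i, j) $$ (k, l) = (\<Sum>x\<in>A. f x $$ (i, j) $$ (k, l))"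
  by (simp add: tensor_sum_def)

lemma tensor_carrier_add:
  assumes "s \<in> tensor_carrier m" "t \<in> tensor_carrier m"
  shows "s + t \<in> tensor_carrier m"
    "i < m \<Longrightarrow> j < m \<Longrightarrow> k < m \<Longrightarrow> l < m \<Longrightarrow> (s + t) $$ (i, j) $$ (k, l) = s $$ (i, j) $$ (k, l) + t $$ (i, j) $$ (k, l)"
proof -
  note c = tensor_carrierD[OF assms(1)] tensor_carrierD[OF assms(2)]
  have st: "(s + t) $$ (i, j) = s $$ (i, j) + t $$ (i, j)" if "i < m" "j < m" for i j
    using c(1,3) that by (intro index_add_mat(1)) auto
  show "s + t \<in> tensor_carrier m"
    unfolding tensor_carrier_def using c st by auto
  assume lt: "i < m" "j < m" "k < m" "l < m"
  show "(s + t) $$ (i, j) $$ (k, l) = s $$ (i, j) $$ (k, l) + t $$ (i, j) $$ (k, l)"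
    unfolding st[OF lt(1,2)] using c(2)[OF lt(1,2)] c(4)[OF lt(1,2)] lt by (subst index_add_mat(1)) auto
qed

context classical
begin

lemma cartan_tensor:
  assumes "r0 \<in> tensor_space M (cartan_subalg ty n) (cartan_subalg ty n :: Kbar mat set)"
  shows "r0 \<in> tensor_carrier M"
    and "i < M \<Longrightarrow> j < M \<Longrightarrow> k < M \<Longrightarrow> l < M \<Longrightarrow> i \<noteq> j \<or> k \<noteq> l \<Longrightarrow> r0 $$ (i, j) $$ (k, l) = 0"
proof -
  obtain m :: nat and a b where r0: "r0 = tensor_sum M (\<lambda>p. tensor (a p) (b p)) {..<m}"
    and ab: "\<And>p. p < m \<Longrightarrow> a p \<in> cartan_subalg ty n \<and> b p \<in> cartan_subalg ty n"
    using assms unfolding tensor_space_def by blast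
  show "r0 \<in> tensor_carrier M" unfolding r0 by (rule tensor_sum_carrier)
  assume lt: "i < M" "j < M" "k < M" "l < M" "i \<noteq> j \<or> k \<noteq> l"
  show "r0 $$ (i, j) $$ (k, l) = 0" unfolding r0 tensor_sum_entry[OF lt(1-4)]
  proof (intro sum.neutral ballI)
    fix p assume "p \<in> {..<m}"
    hence p: "a p \<in> cartan_subalg ty n" "b p \<in> cartan_subalg ty n" using ab by auto
    hence "a p \<in> carrier_mat M M" "b p \<in> carrier_mat M M" by (auto simp: cartan_subalg_def lie_alg_def)
    from tensor_entry[OF this lt(1-4)] show "tensor (a p) (b p) $$ (i, j) $$ (k, l) = 0"
      using cartan_entry[OF p(1) lt(1,2)] cartan_entry[OF p(2) lt(3,4)] lt(5) by auto
  qed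
qed

text \<open>If \<tau> raises a rank, the iterates of a root are distinct. Then the set of exponents
  of a root is finite, and the double sum over roots and exponents becomes a sum over the set of
  pairs.\<close>

lemma bd_data_exists:
  fixes \<tau> :: "nat \<Rightarrow> nat" and \<Gamma>1 :: "nat set" and \<rho> :: "lattice_elt \<Rightarrow> int"
  defines "A \<equiv> pos_roots ty n \<inter> lattice_span \<Gamma>1"
  defines "t \<equiv> tau_lin \<Gamma>1 \<tau>"
  assumes bd: "bd_r_matrix ty n \<Gamma>1 \<Gamma>2 \<tau> r"
    and step: "\<And>\<alpha>. \<alpha> \<in> A \<Longrightarrow> t \<alpha> \<in> pos_roots ty n \<and> \<rho> \<alpha> < \<rho> (t \<alpha>)"
  shows "\<exists>e r0. bd_data ty n e {(\<alpha>, (t ^^ k) \<alpha>) |\<alpha> k. \<alpha> \<in> A \<and> k \<in> tau_exponents \<Gamma>1 \<tau> \<alpha>} \<rho> r0 r"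
proof -
  let ?P = "pos_roots ty n" and ?E = "tau_exponents \<Gamma>1 \<tau>"
  let ?W = "{(\<alpha>, (t ^^ k) \<alpha>) |\<alpha> k. \<alpha> \<in> A \<and> k \<in> ?E \<alpha>}"
  obtain e r0 where e: "root_vectors ty n \<Gamma>1 \<Gamma>2 \<tau> e" and c: "cartan_part ty n \<Gamma>1 \<tau> r0" and
    r: "r = r0 + tensor_sum M (\<lambda>\<alpha>. tensor (e (- \<alpha>)) (e \<alpha>)) ?P
          + tensor_sum M (\<lambda>\<alpha>. tensor_sum M (\<lambda>k. wedge (e (- \<alpha>)) (e ((t ^^ k) \<alpha>))) (?E \<alpha>)) A"
    using bd unfolding bd_r_matrix_def A_def t_def by blast
  have e': "\<alpha> \<in> roots ty n \<Longrightarrow> e \<alpha> \<in> root_space ty n \<alpha>" "\<alpha> \<in> roots ty n \<Longrightarrow> e \<alpha> \<in> map_mat to_ac ` (lie_alg ty n :: K mat set)"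
    "\<alpha> \<in> roots ty n \<Longrightarrow> killing ty n (e \<alpha>) (e (- \<alpha>)) = 1" for \<alpha>
    using e unfolding root_vectors_def by blast+
  have ec: "e \<alpha> \<in> carrier_mat M M" if "\<alpha> \<in> roots ty n" for \<alpha>
    using lie_carrier[OF in_root_lie[OF e'(1)[OF that]]] .
  have r0: "r0 \<in> tensor_space M (cartan_subalg ty n) (cartan_subalg ty n)" using c by (simp add: cartan_part_def)
  note r0c = cartan_tensor[OF r0]
  have iter: "(t ^^ k) \<alpha> \<in> ?P \<and> (\<forall>m<k. \<rho> ((t ^^ m) \<alpha>) < \<rho> ((t ^^ k) \<alpha>))"
    if a: "\<alpha> \<in> A" and k: "\<And>m. m < k \<Longrightarrow> (t ^^ m) \<alpha> \<in> lattice_span \<Gamma>1" for \<alpha> k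
    using k
  proof (induction k)
    case 0
    thus ?case using a by (simp add: A_def)
  next
    case (Suc k)
    hence IH: "(t ^^ k) \<alpha> \<in> ?P" "\<And>m. m < k \<Longrightarrow> \<rho> ((t ^^ m) \<alpha>) < \<rho> ((t ^^ k) \<alpha>)" by auto
    have "(t ^^ k) \<alpha> \<in> A" using IH(1) Suc.prems[of k] by (simp add: A_def)
    from step[OF this] have s: "(t ^^ Suc k) \<alpha> \<in> ?P" "\<rho> ((t ^^ k) \<alpha>) < \<rho> ((t ^^ Suc k) \<alpha>)" by auto
    moreover have "\<rho> ((t ^^ m) \<alpha>) < \<rho> ((t ^^ Suc k) \<alpha>)" if "m < Suc k" for m
      using IH(2)[of m] s(2) that by (cases "m = k") auto
    ultimately show ?case by blast
  qed
  have E: "(t ^^ k) \<alpha> \<in> ?P" "\<And>m. m < k \<Longrightarrow> \<rho> ((t ^^ m) \<alpha>) < \<rho> ((t ^^ k) \<alpha>)" "1 \<le> k" if "\<alpha> \<in> A" "k \<in> ?E \<alpha>" for \<alpha> k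
    using iter[OF that(1), of k] that(2) unfolding tau_exponents_def t_def by auto
  have inj: "inj_on (\<lambda>k. (t ^^ k) \<alpha>) (?E \<alpha>)" if "\<alpha> \<in> A" for \<alpha>
    by (rule linorder_inj_onI') (use E(2)[OF that] in fastforce)
  have finE: "finite (?E \<alpha>)" if a: "\<alpha> \<in> A" for \<alpha>
    using inj[OF a] by (rule inj_on_finite[where B = "?P"]) (use E(1)[OF a] finite_pos_roots in auto)
  have finA: "finite A" using finite_pos_roots by (simp add: A_def)
  have rW: "a \<in> ?P \<and> b \<in> ?P \<and> \<rho> a < \<rho> b" if ab: "(a, b) \<in> ?W" for a b
  proof -
    obtain k where k: "a \<in> A" "k \<in> ?E a" "b = (t ^^ k) a" using ab by blast
    have "\<rho> ((t ^^ 0) a) < \<rho> b" unfolding k(3) using E(3)[OF k(1,2)] by (intro E(2)[OF k(1,2)]) simp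
    thus ?thesis using E(1)[OF k(1,2)] k by (simp add: A_def)
  qed
  let ?S1 = "tensor_sum M (\<lambda>\<alpha>. tensor (e (- \<alpha>)) (e \<alpha>)) ?P"
  let ?S2 = "tensor_sum M (\<lambda>\<alpha>. tensor_sum M (\<lambda>k. wedge (e (- \<alpha>)) (e ((t ^^ k) \<alpha>))) (?E \<alpha>)) A"
  note add = tensor_carrier_add[OF tensor_carrier_add(1)[OF r0c(1) tensor_sum_carrier] tensor_sum_carrier]
  have "bd_data ty n e ?W \<rho> r0 r"
  proof (unfold_locales)
    show "e \<alpha> \<in> root_space ty n \<alpha>" "e \<alpha> \<in> map_mat to_ac ` (lie_alg ty n :: K mat set)" "killing ty n (e \<alpha>) (e (- \<alpha>)) = 1"
      if "\<alpha> \<in> roots ty n" for \<alpha> using e'[OF that] .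
    show "?W \<subseteq> ?P \<times> ?P" using rW by blast
    show "\<rho> a < \<rho> b" if "(a, b) \<in> ?W" for a b using rW[OF that] by blast
    show "r \<in> tensor_carrier M" unfolding r by (rule add(1))
    show "r0 \<in> tensor_carrier M" by (rule r0c(1))
    show "r0 $$ (i, j) $$ (k, l) = 0" if "i < M" "j < M" "k < M" "l < M" "i \<noteq> j \<or> k \<noteq> l" for i j k l
      by (rule r0c(2)[OF that])
    fix i j k l assume lt: "i < M" "j < M" "k < M" "l < M"
    let ?w = "\<lambda>a b. e (- a) $$ (i, j) * e b $$ (k, l) - e b $$ (i, j) * e (- a) $$ (k, l)"
    have 1: "?S1 $$ (i, j) $$ (k, l) = (\<Sum>a\<in>?P. e (- a) $$ (i, j) * e a $$ (k, l))"
      unfolding tensor_sum_entry[OF lt]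
      by (intro sum.cong refl tensor_entry[OF _ _ lt] ec neg_root pos_rootsD(1))
    have "?S2 $$ (i, j) $$ (k, l) = (\<Sum>a\<in>A. \<Sum>m\<in>?E a. ?w a ((t ^^ m) a))"
      unfolding tensor_sum_entry[OF lt]
    proof (intro sum.cong refl wedge_entry[OF _ _ lt])
      fix a m assume a: "a \<in> A" and m: "m \<in> ?E a"
      show "e (- a) \<in> carrier_mat M M" using a by (intro ec neg_root pos_rootsD(1)) (simp add: A_def)
      show "e ((t ^^ m) a) \<in> carrier_mat M M" by (intro ec pos_rootsD(1) E(1)[OF a m])
    qed
    also have "\<dots> = (\<Sum>x\<in>Sigma A ?E. ?w (fst x) ((t ^^ snd x) (fst x)))"
      using sum.Sigma[OF finA, of ?E "\<lambda>a m. ?w a ((t ^^ m) a)"] finE by (simp add: split_def)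
    also have "\<dots> = (\<Sum>(a, b)\<in>?W. ?w a b)"
    proof (rule sum.reindex_cong[of "\<lambda>x. (fst x, (t ^^ snd x) (fst x))", symmetric])
      show "inj_on (\<lambda>x. (fst x, (t ^^ snd x) (fst x))) (Sigma A ?E)"
        using inj by (auto simp: inj_on_def)
      show "?W = (\<lambda>x. (fst x, (t ^^ snd x) (fst x))) ` Sigma A ?E" by force
    qed simp
    finally have 2: "?S2 $$ (i, j) $$ (k, l) = (\<Sum>(a, b)\<in>?W. ?w a b)" .
    show "r $$ (i, j) $$ (k, l) = r0 $$ (i, j) $$ (k, l) + (\<Sum>a\<in>?P. e (- a) $$ (i, j) * e a $$ (k, l)) + (\<Sum>(a, b)\<in>?W. ?w a b)"
      unfolding r add(2)[OF lt] tensor_carrier_add(2)[OF r0c(1) tensor_sum_carrier lt] 1 2 ..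
  qed
  thus ?thesis by blast
qed

lemma bd_data_empty:
  assumes "bd_r_matrix ty n {} \<Gamma>2 \<tau> r"
  shows "\<exists>e r0. bd_data ty n e {} (\<lambda>_. 0) r0 r"
proof -
  have "pos_roots ty n \<inter> lattice_span {} = {}"
    by (auto simp: pos_roots_def roots_def lattice_span_def)
  thus ?thesis using bd_data_exists[OF assms, of "\<lambda>_. 0"] by simp
qed

abbreviation ind :: "nat \<Rightarrow> nat \<Rightarrow> int" where "ind m p \<equiv> if p = m then 1 else 0"

lemma vv_ind: "m < n \<Longrightarrow> i < M \<Longrightarrow> vv (ind m) i = (if i = m then 1 else if i = rv m then - 1 else 0)"
  unfolding vv_def rv_def using M_simps(3) M_cases by auto

lemma simple_pos_root:
  assumes D: "ty = Type_D" and j: "j \<in> {1..n}"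
  shows "simple_elt j \<in> pos_roots ty n" "allowed (ra j) j"
proof -
  have "j < M" "ra j < j" using q_lt_M[OF j] ra_lt(1)[OF j] by auto
  moreover have "j \<noteq> rv (ra j)" unfolding rv_def ra_def using M_simps(2) D j n_D by auto
  ultimately show a: "allowed (ra j) j" by (simp add: allowed_def)
  show "simple_elt j \<in> pos_roots ty n"
    unfolding pos_roots_def roots_iff using a matches_simple[OF j] j by (auto simp: simple_elt_def)
qed

end

text \<open>The four triples are chains from p to q, either direct or through one further node k,
  where p and q are the two ends of the fork of D_n. The set \<open>S\<close> contains the
  intermediate node, if there is one.\<close>

locale type_D_case = classical +
  fixes p q :: nat and S :: "nat set" and \<Gamma>1 :: "nat set" and \<tau> :: "nat \<Rightarrow> nat"
  assumes D: "ty = Type_D" and pq: "p \<in> {n - 1, n}" "q \<in> {n - 1, n}" "p \<noteq> q"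
    and case_S: "(S = {} \<and> \<Gamma>1 = {p} \<and> \<tau> p = q) \<or>
      (\<exists>k\<in>{1..n - 2}. S = {k} \<and> \<Gamma>1 = {p, k} \<and> \<tau> p = k \<and> \<tau> k = q)"
begin

lemma n3: "3 \<le> n" using n_D D by simp

lemma M2n: "M = 2 * n" using M_simps(2) D by simp

lemma pq_range: "p \<in> {1..n}" "q \<in> {1..n}" using pq n3 by auto

lemma ra_pq: "ra p = n - 2" "ra q = n - 2" unfolding ra_def using pq D by auto

text \<open>A root involves at most two coordinates, each with coefficient 1 or -1. For combinations
  of \<alpha>_p and \<alpha>_k this bounds the coefficients by 1 and permits both of them only for
  adjacent nodes, that is for k = n-2.\<close>

lemma span_cases:
  assumes a: "\<alpha> \<in> pos_roots ty n" "\<alpha> \<in> lattice_span \<Gamma>1"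
  shows "\<alpha> = simple_elt p \<or> (\<exists>k\<in>S. \<alpha> = simple_elt k \<or> (k = n - 2 \<and> \<alpha> = (\<lambda>j. simple_elt k j + simple_elt p j)))"
proof -
  note ra = pos_rootsD(1)[OF a(1)] and nn = pos_rootsD(2)[OF a(1)]
  obtain i j where al: "allowed i j" and m: "matches \<alpha> i j" using ra unfolding roots_iff by blast
  have ij: "i < M" "j < M" "i \<noteq> j" "j \<noteq> rv i" using al D unfolding allowed_def by auto
  \<comment> \<open>The coefficient of coordinate m in the root, computed from its position.\<close>
  define w where "w m = vv (ind m) i - vv (ind m) j" for m
  have w: "w m = (if i = m then 1 else if i = rv m then - 1 else 0) - (if j = m then 1 else if j = rv m then - 1 else 0)" if "m < n" for m
    unfolding w_def using vv_ind[OF that] ij by simp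
  have mr: "m \<noteq> rv m" if "m < n" for m using that M2n unfolding rv_def by simp
  have b1: "\<bar>w m\<bar> \<le> 1" if m: "m < n" for m
    using w[OF m] ij m M2n by (auto split: if_splits)
  \<comment> \<open>Each coordinate that occurs accounts for one of the two indices i and j, so
    there is no room for a third.\<close>
  have b3: False if "m1 < n" "m2 < n" "m3 < n" "m1 \<noteq> m2" "m1 \<noteq> m3" "m2 \<noteq> m3" "w m1 \<noteq> 0" "w m2 \<noteq> 0" "w m3 \<noteq> 0" for m1 m2 m3
  proof -
    have k: "i \<in> {m, rv m} \<or> j \<in> {m, rv m}" if "m < n" "w m \<noteq> 0" for m
    proof (rule ccontr)
      assume "\<not> ?thesis"
      hence "i \<noteq> m" "i \<noteq> rv m" "j \<noteq> m" "j \<noteq> rv m" by auto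
      with w[OF that(1)] that(2) show False by simp
    qed
    have dis: "m = m'" if "x \<in> {m, rv m}" "x \<in> {m', rv m'}" "m < n" "m' < n" for x m m'
      using that M2n unfolding rv_def by auto
    show False using k[OF that(1,7)] k[OF that(2,8)] k[OF that(3,9)] dis that(1-6) by metis
  qed
  have wsum: "w m = (\<Sum>x\<in>{1..n}. \<alpha> x * (vv (ind m) (ra x) - vv (ind m) x))" for m
    unfolding w_def by (rule matches_int[OF m])
  have vp: "vv c (ra p) - vv c p = c (n - 2) - (if p = n - 1 then c (n - 1) else - c (n - 1))" for c
    unfolding vv_simps[OF pq_range(1)] unfolding ra_pq using pq n3 D by auto
  from case_S show ?thesis
  proof (elim disjE conjE bexE)
    assume S: "S = {}" "\<Gamma>1 = {p}"
    have z: "\<alpha> x = 0" if "x \<noteq> p" for x using a(2) S that by (auto simp: lattice_span_def)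
    have "w m = (\<Sum>x\<in>{p}. \<alpha> x * (vv (ind m) (ra x) - vv (ind m) x))" for m
      unfolding wsum using z pq_range by (intro sum.mono_neutral_right) auto
    hence "w (n - 1) = (if p = n - 1 then - \<alpha> p else \<alpha> p)" using vp n3 by auto
    hence "\<alpha> p \<le> 1" using b1[of "n - 1"] n3 by (auto split: if_splits)
    moreover have "\<alpha> p \<noteq> 0"
    proof
      assume "\<alpha> p = 0"
      hence "\<alpha> = (\<lambda>_. 0)" using z by fastforce
      thus False using ra by (simp add: roots_def)
    qed
    ultimately have "\<alpha> p = 1" using nn[of p] by simp
    hence "\<alpha> = simple_elt p" using z by (auto simp: simple_elt_def)
    thus ?thesis ..
  next
    fix k assume k: "k \<in> {1..n - 2}" and S: "S = {k}" "\<Gamma>1 = {p, k}"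
    have kp: "k \<noteq> p" "k \<in> {1..n}" using k pq n3 by auto
    have z: "\<alpha> x = 0" if "x \<noteq> p" "x \<noteq> k" for x using a(2) S that by (auto simp: lattice_span_def)
    have w2: "w m = \<alpha> p * (vv (ind m) (ra p) - vv (ind m) p) + \<alpha> k * (vv (ind m) (ra k) - vv (ind m) k)" for m
    proof -
      have "w m = (\<Sum>x\<in>{p, k}. \<alpha> x * (vv (ind m) (ra x) - vv (ind m) x))"
        unfolding wsum using z pq_range kp by (intro sum.mono_neutral_right) auto
      thus ?thesis using kp by simp
    qed
    have vk: "vv c (ra k) - vv c k = c (k - 1) - c k" for c
    proof -
      have "ra k = k - 1" unfolding ra_def using k n3 by auto
      thus ?thesis unfolding vv_simps[OF kp(2)] using k n3 by auto
    qed
    have kn: "k - 1 < n" "k - 1 \<noteq> n - 2" "k - 1 \<noteq> n - 1" "k \<noteq> n - 1" "k < n" "k - 1 \<noteq> k" "n - 1 \<noteq> n - 2" "n - 1 < n"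
      using k n3 by auto
    have wa: "w (n - 1) = (if p = n - 1 then - \<alpha> p else \<alpha> p)" unfolding w2 vp vk using kn by auto
    have wb: "w (k - 1) = \<alpha> k" unfolding w2 vp vk using kn by auto
    have wc: "w k = - \<alpha> k" if kn2: "k \<noteq> n - 2"
    proof -
      have "ind k (n - 2) = 0" "ind k (n - 1) = 0" "ind k (k - 1) = 0" using kn kn2 by auto
      thus ?thesis unfolding w2 vp vk by simp
    qed
    have ap: "\<alpha> p = 0 \<or> \<alpha> p = 1" using wa b1[OF kn(8)] nn[of p] by (auto split: if_splits)
    have ak: "\<alpha> k = 0 \<or> \<alpha> k = 1" using wb b1[OF kn(1)] nn[of k] by auto
    have "\<not> (\<alpha> p = 0 \<and> \<alpha> k = 0)"
    proof
      assume "\<alpha> p = 0 \<and> \<alpha> k = 0"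
      hence "\<alpha> = (\<lambda>_. 0)" using z by fastforce
      thus False using ra by (simp add: roots_def)
    qed
    \<comment> \<open>Otherwise the three coordinates k-1, k and n-1 would occur.\<close>
    moreover have "k = n - 2" if "\<alpha> p = 1" "\<alpha> k = 1"
    proof (rule ccontr)
      assume "k \<noteq> n - 2"
      hence "w k = - 1" using wc that by simp
      hence wk: "w k \<noteq> 0" "w (k - 1) \<noteq> 0" using wb that by simp_all
      have "w (n - 1) = 1 \<or> w (n - 1) = - 1" using wa that by (cases "p = n - 1") simp_all
      hence w1: "w (n - 1) \<noteq> 0" by auto
      show False
        by (rule b3[OF kn(8,1,5) kn(3)[symmetric] kn(4)[symmetric] kn(6) w1 wk(2,1)])
    qed
    moreover have "\<alpha> = (\<lambda>x. (if x = p then \<alpha> p else 0) + (if x = k then \<alpha> k else 0))" using z kp by auto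
    ultimately consider "\<alpha> p = 1" "\<alpha> k = 0" | "\<alpha> p = 0" "\<alpha> k = 1" | "\<alpha> p = 1" "\<alpha> k = 1" "k = n - 2"
      using ap ak by blast
    thus ?thesis
    proof cases
      case 1
      have "\<alpha> x = simple_elt p x" for x using 1 z[of x] by (cases "x = p"; cases "x = k") (simp_all add: simple_elt_def)
      thus ?thesis by blast
    next
      case 2
      have "\<alpha> x = simple_elt k x" for x using 2 z[of x] by (cases "x = p"; cases "x = k") (simp_all add: simple_elt_def)
      thus ?thesis using S by blast
    next
      case 3
      have "\<alpha> x = simple_elt k x + simple_elt p x" for x
        using 3(1,2) z[of x] kp by (cases "x = p"; cases "x = k") (simp_all add: simple_elt_def)
      hence "\<alpha> = (\<lambda>j. simple_elt k j + simple_elt p j)" by (rule ext)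
      thus ?thesis using S 3(3) by blast
    qed
  qed
qed

text \<open>Measures progress along the chain: \<alpha>_p has rank 0, the intermediate root rank 1
  and \<alpha>_q rank 2.\<close>

definition rk :: "lattice_elt \<Rightarrow> int" where "rk \<alpha> = (\<Sum>k\<in>S. \<alpha> k) + 2 * \<alpha> q"

lemma tau_lin_simple: "j \<in> \<Gamma>1 \<Longrightarrow> tau_lin \<Gamma>1 \<tau> (simple_elt j) = simple_elt (\<tau> j)"
proof -
  assume j: "j \<in> \<Gamma>1"
  have fin: "finite \<Gamma>1" using case_S by auto
  have "(\<Sum>i\<in>\<Gamma>1. simple_elt j i * simple_elt (\<tau> i) x) = (\<Sum>i\<in>\<Gamma>1. if i = j then simple_elt (\<tau> j) x else 0)" for x
    by (intro sum.cong refl) (auto simp: simple_elt_def)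
  thus ?thesis using j fin by (simp add: tau_lin_def)
qed

lemma tau_lin_add: "tau_lin \<Gamma>1 \<tau> (\<lambda>j. \<alpha> j + \<beta> j) = (\<lambda>j. tau_lin \<Gamma>1 \<tau> \<alpha> j + tau_lin \<Gamma>1 \<tau> \<beta> j)"
  by (rule ext) (simp add: tau_lin_def algebra_simps sum.distrib)

text \<open>For k = n-2 the root \<alpha>_k + \<alpha>_p lies in the span of
  \<open>\<Gamma>1\<close>, and \<tau> sends it to \<alpha>_q + \<alpha>_k.\<close>

lemma long_root:
  assumes x: "x \<in> {n - 1, n}"
  shows "(\<lambda>j. simple_elt (n - 2) j + simple_elt x j) \<in> pos_roots ty n"
    "matches (\<lambda>j. simple_elt (n - 2) j + simple_elt x j) (n - 3) x" "allowed (n - 3) x"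
proof -
  have r: "ra (n - 2) = n - 3" "ra x = n - 2" "n - 2 \<in> {1..n}" "x \<in> {1..n}"
    unfolding ra_def using x n3 D by auto
  show m: "matches (\<lambda>j. simple_elt (n - 2) j + simple_elt x j) (n - 3) x"
    using matches_arith(1)[OF matches_simple[OF r(3)], of "simple_elt x" x] matches_simple[OF r(4)] r by simp
  show al: "allowed (n - 3) x" unfolding allowed_def rv_def M2n using x n3 by auto
  show "(\<lambda>j. simple_elt (n - 2) j + simple_elt x j) \<in> pos_roots ty n"
    unfolding pos_roots_def roots_iff using m al r by (auto simp: simple_elt_def)
qed

lemma tau_step:
  assumes a: "\<alpha> \<in> pos_roots ty n \<inter> lattice_span \<Gamma>1"
  shows "tau_lin \<Gamma>1 \<tau> \<alpha> \<in> pos_roots ty n \<and> rk \<alpha> < rk (tau_lin \<Gamma>1 \<tau> \<alpha>)"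
proof -
  from case_S show ?thesis
  proof (elim disjE conjE bexE)
    assume S: "S = {}" "\<Gamma>1 = {p}" "\<tau> p = q"
    have rk: "rk \<beta> = 2 * \<beta> q" for \<beta> unfolding rk_def unfolding S by simp
    have "\<alpha> = simple_elt p" using span_cases[of \<alpha>] a S(1) by auto
    moreover have "tau_lin \<Gamma>1 \<tau> (simple_elt p) = simple_elt q" using tau_lin_simple[of p] S(2,3) by simp
    ultimately show ?thesis using simple_pos_root(1)[OF D pq_range(2)] pq(3)
      unfolding rk by (simp add: simple_elt_def)
  next
    fix k assume k: "k \<in> {1..n - 2}" and S: "S = {k}" "\<Gamma>1 = {p, k}" "\<tau> p = k" "\<tau> k = q"
    have rk: "rk \<beta> = \<beta> k + 2 * \<beta> q" for \<beta> unfolding rk_def unfolding S by simp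
    have kk: "k \<in> {1..n}" "k \<noteq> p" "k \<noteq> q" using k pq n3 by auto
    have tp: "tau_lin \<Gamma>1 \<tau> (simple_elt p) = simple_elt k" "tau_lin \<Gamma>1 \<tau> (simple_elt k) = simple_elt q"
      using tau_lin_simple[of p] tau_lin_simple[of k] S(2-4) by simp_all
    have "\<alpha> = simple_elt p \<or> \<alpha> = simple_elt k \<or> (k = n - 2 \<and> \<alpha> = (\<lambda>j. simple_elt k j + simple_elt p j))"
      using span_cases[of \<alpha>] a S(1) by auto
    thus ?thesis
    proof (elim disjE conjE)
      assume "\<alpha> = simple_elt p"
      thus ?thesis using tp simple_pos_root(1)[OF D kk(1)] kk pq(3)
        unfolding rk by (simp add: simple_elt_def)
    next
      assume "\<alpha> = simple_elt k"
      thus ?thesis using tp simple_pos_root(1)[OF D pq_range(2)] kk pq(3)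
        unfolding rk by (simp add: simple_elt_def)
    next
      assume kn: "k = n - 2" and al: "\<alpha> = (\<lambda>j. simple_elt k j + simple_elt p j)"
      have t: "tau_lin \<Gamma>1 \<tau> \<alpha> = (\<lambda>j. simple_elt k j + simple_elt q j)"
        unfolding al tau_lin_add tp by (simp add: add.commute)
      have "(\<lambda>j. simple_elt k j + simple_elt q j) \<in> pos_roots ty n" unfolding kn by (rule long_root(1)[OF pq(2)])
      moreover have "rk \<alpha> < rk (\<lambda>j. simple_elt k j + simple_elt q j)"
        unfolding rk al using kk pq(3) by (simp add: simple_elt_def)
      ultimately show ?thesis unfolding t ..
    qed
  qed
qed

lemma Gamma1_facts: "p \<in> \<Gamma>1" "\<tau> p \<in> {1..n}" "\<And>k. k \<in> S \<Longrightarrow> k \<in> \<Gamma>1 \<and> k \<in> {1..n - 2} \<and> \<tau> p = k \<and> \<tau> k = q" "S = {} \<Longrightarrow> \<tau> p = q"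
  using case_S pq_range n3 by auto

abbreviation wedges :: "(lattice_elt \<times> lattice_elt) set" where
  "wedges \<equiv> {(\<alpha>, (tau_lin \<Gamma>1 \<tau> ^^ k) \<alpha>) |\<alpha> k. \<alpha> \<in> pos_roots ty n \<inter> lattice_span \<Gamma>1 \<and> k \<in> tau_exponents \<Gamma>1 \<tau> \<alpha>}"

lemma wedge_simple: "j \<in> \<Gamma>1 \<Longrightarrow> (simple_elt j, simple_elt (\<tau> j)) \<in> wedges"
proof -
  assume j: "j \<in> \<Gamma>1"
  have jn: "j \<in> {1..n}" using j case_S pq_range n3 by auto
  have "simple_elt j \<in> lattice_span \<Gamma>1" using j by (auto simp: lattice_span_def simple_elt_def)
  moreover from this have "1 \<in> tau_exponents \<Gamma>1 \<tau> (simple_elt j)" by (simp add: tau_exponents_def)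
  moreover have "(tau_lin \<Gamma>1 \<tau> ^^ 1) (simple_elt j) = simple_elt (\<tau> j)" using tau_lin_simple[OF j] by simp
  ultimately show ?thesis using simple_pos_root(1)[OF D jn] by (metis (mono_tags, lifting) IntI mem_Collect_eq)
qed

end

section \<open>Torus conditions and flipping elements for these triples\<close>

context type_D_case
begin

lemma wedge_pq: "(simple_elt p, simple_elt q) \<in> wedges"
proof (cases "S = {}")
  case True
  thus ?thesis using wedge_simple[OF Gamma1_facts(1)] Gamma1_facts(4) by simp
next
  case False
  then obtain k where k: "k \<in> S" by blast
  note G = Gamma1_facts(3)[OF k]
  have t: "tau_lin \<Gamma>1 \<tau> (simple_elt p) = simple_elt k" "tau_lin \<Gamma>1 \<tau> (simple_elt k) = simple_elt q"
    using tau_lin_simple[OF Gamma1_facts(1)] tau_lin_simple[of k] G by auto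
  have sp: "simple_elt j \<in> lattice_span \<Gamma>1" if "j \<in> \<Gamma>1" for j
    using that by (auto simp: lattice_span_def simple_elt_def)
  \<comment> \<open>With an intermediate node the pair (\<alpha>_p, \<alpha>_q) arises from the
    second iterate of \<tau>.\<close>
  have "2 \<in> tau_exponents \<Gamma>1 \<tau> (simple_elt p)"
    using sp[OF Gamma1_facts(1)] sp[of k] G t by (auto simp: tau_exponents_def less_2_cases_iff)
  moreover have "(tau_lin \<Gamma>1 \<tau> ^^ 2) (simple_elt p) = simple_elt q" by (simp add: numeral_2_eq_2 t)
  ultimately show ?thesis
    using sp[OF Gamma1_facts(1)] simple_pos_root(1)[OF D pq_range(1)] by (metis (mono_tags, lifting) IntI mem_Collect_eq)
qed

lemma wedge_pk: "k \<in> S \<Longrightarrow> (simple_elt p, simple_elt k) \<in> wedges"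
  and wedge_kq: "k \<in> S \<Longrightarrow> (simple_elt k, simple_elt q) \<in> wedges"
  using wedge_simple[OF Gamma1_facts(1)] wedge_simple[of k] Gamma1_facts(3)[of k] by auto

lemma simple_pos: "x \<in> {n - 1, n} \<Longrightarrow> matches (simple_elt x) (n - 2) x" "x \<in> {n - 1, n} \<Longrightarrow> allowed (n - 2) x"
proof -
  assume x: "x \<in> {n - 1, n}"
  have r: "x \<in> {1..n}" "ra x = n - 2" unfolding ra_def using x n3 D by auto
  show "matches (simple_elt x) (n - 2) x" "allowed (n - 2) x"
    using matches_simple[OF r(1)] simple_pos_root(2)[OF D r(1)] unfolding r(2) .
qed

lemma simple_pos_S:
  assumes k: "k \<in> S" shows "matches (simple_elt k) (k - 1) k" "allowed (k - 1) k" "k - 1 < n - 1" "k < n - 1"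
proof -
  have k': "k \<in> {1..n - 2}" using Gamma1_facts(3)[OF k] by blast
  hence r: "k \<in> {1..n}" "ra k = k - 1" unfolding ra_def using n3 D by auto
  show "matches (simple_elt k) (k - 1) k" "allowed (k - 1) k"
    using matches_simple[OF r(1)] simple_pos_root(2)[OF D r(1)] unfolding r(2) .
  show "k - 1 < n - 1" "k < n - 1" using k' n3 by auto
qed

lemma rv_mid: "rv (n - 1) = n" "rv n = n - 1" "rv p = q" "rv q = p" "n - 1 < M" "n < M" "p < M" "q < M" "rv (n - 2) = n + 1" "n + 1 < M" "n - 2 < M"
  unfolding rv_def M2n using n3 pq by auto

lemma torus_D: "torus d \<Longrightarrow> d n = 1 / d (n - 1)" for d :: "nat \<Rightarrow> 'a :: field"
proof -
  assume d: "torus d"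
  have "d (n - 1) * d n = 1" using d rv_mid unfolding torus_def by metis
  moreover have "d (n - 1) \<noteq> 0" using calculation by auto
  ultimately show ?thesis by (simp add: field_simps)
qed

text \<open>Agreement of the characters of \<alpha>_p and \<alpha>_q means
  \<open>d (n - 1) = d n\<close>, and these entries are inverse to each other; agreement with the
  character of the intermediate root is the second condition. Since agreement is transitive, single
  applications of \<tau> suffice for the converse.\<close>

lemma centralizes_iff:
  assumes bd: "bd_data ty n e wedges \<rho> r0 r" and d: "torus d"
  shows "Ad_tensor (diag_of d) r = r \<longleftrightarrow>
    d (n - 1) * d (n - 1) = 1 \<and> (\<forall>k\<in>S. d (k - 1) / d k = d (n - 2) * d (n - 1))"
proof -
  interpret b: bd_data ty n e wedges \<rho> r0 r by fact
  have nz: "d i \<noteq> 0" if "i < M" for i using b.torus_nz[OF d that] .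
  note dn = torus_D[OF d]
  define eq where "eq \<alpha> \<beta> \<longleftrightarrow> (\<forall>i j k l. allowed i j \<longrightarrow> allowed k l \<longrightarrow> matches \<alpha> i j \<longrightarrow> matches \<beta> k l \<longrightarrow> d i / d j = d k / d l)" for \<alpha> \<beta>
  have eqI: "eq \<alpha> \<beta>" if "matches \<alpha> i j" "matches \<beta> k l" "allowed i j" "allowed k l" "d i / d j = d k / d l" for \<alpha> \<beta> i j k l
    unfolding eq_def
  proof (intro allI impI)
    fix i' j' k' l' assume a: "allowed i' j'" "allowed k' l'" and m: "matches \<alpha> i' j'" "matches \<beta> k' l'"
    have "d i' / d j' = d i / d j"
      using allowedD[OF a(1)] allowedD[OF that(3)] by (intro b.torus_ratio[OF d m(1) that(1)])
    moreover have "d k' / d l' = d k / d l"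
      using allowedD[OF a(2)] allowedD[OF that(4)] by (intro b.torus_ratio[OF d m(2) that(2)])
    ultimately show "d i' / d j' = d k' / d l'" using that(5) by simp
  qed
  \<comment> \<open>Transitivity passes through an actual position of \<beta>, so \<beta> has to be
    a root.\<close>
  have eq_trans: "eq \<alpha> \<gamma>" if ab: "eq \<alpha> \<beta>" "eq \<beta> \<gamma>" and b: "\<beta> \<in> pos_roots ty n" for \<alpha> \<beta> \<gamma>
  proof -
    obtain a c where ac: "allowed a c" "matches \<beta> a c" using pos_rootsD(1)[OF b] unfolding roots_iff by blast
    show ?thesis unfolding eq_def
    proof (intro allI impI)
      fix i j k l assume *: "allowed i j" "allowed k l" "matches \<alpha> i j" "matches \<gamma> k l"
      have "d i / d j = d a / d c" using ab(1) ac * unfolding eq_def by blast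
      also have "\<dots> = d k / d l" using ab(2) ac * unfolding eq_def by blast
      finally show "d i / d j = d k / d l" .
    qed
  qed
  have iff: "Ad_tensor (diag_of d) r = r \<longleftrightarrow> (\<forall>(\<alpha>, \<beta>)\<in>wedges. eq \<alpha> \<beta>)"
    unfolding b.torus_centralizes_iff[OF d] eq_def ..
  have dpq: "d (n - 2) / d p = d (n - 2) / d q \<longleftrightarrow> d (n - 1) * d (n - 1) = 1"
  proof -
    have "d (n - 2) / d p = d (n - 2) / d q \<longleftrightarrow> d p = d q" using nz rv_mid by (auto simp: field_simps)
    also have "\<dots> \<longleftrightarrow> d (n - 1) = d n" using pq by auto
    also have "\<dots> \<longleftrightarrow> d (n - 1) * d (n - 1) = 1" unfolding dn using nz[of "n - 1"] rv_mid by (auto simp: field_simps)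
    finally show ?thesis .
  qed
  have dq: "d (n - 2) / d x = d (n - 2) * d (n - 1)" if "d (n - 1) * d (n - 1) = 1" "x \<in> {n - 1, n}" for x
  proof -
    have "1 / d (n - 1) = d (n - 1)" using that(1) nz[of "n - 1"] rv_mid by (simp add: field_simps)
    thus ?thesis using that(2) dn by (auto simp: divide_inverse)
  qed
  show ?thesis
  proof
    assume "Ad_tensor (diag_of d) r = r"
    hence w: "eq \<alpha> \<beta>" if "(\<alpha>, \<beta>) \<in> wedges" for \<alpha> \<beta> using that unfolding iff by blast
    have 1: "d (n - 1) * d (n - 1) = 1"
      using w[OF wedge_pq] simple_pos[OF pq(1)] simple_pos[OF pq(2)] unfolding eq_def dpq[symmetric] by blast
    moreover have "d (k - 1) / d k = d (n - 2) * d (n - 1)" if k: "k \<in> S" for k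
      using w[OF wedge_pk[OF k]] simple_pos[OF pq(1)] simple_pos_S(1,2)[OF k] dq[OF 1 pq(1)] unfolding eq_def by metis
    ultimately show "d (n - 1) * d (n - 1) = 1 \<and> (\<forall>k\<in>S. d (k - 1) / d k = d (n - 2) * d (n - 1))" by blast
  next
    assume c: "d (n - 1) * d (n - 1) = 1 \<and> (\<forall>k\<in>S. d (k - 1) / d k = d (n - 2) * d (n - 1))"
    hence c1: "d (n - 1) * d (n - 1) = 1" by blast
    have step: "eq \<alpha> (tau_lin \<Gamma>1 \<tau> \<alpha>)" if a: "\<alpha> \<in> pos_roots ty n" "\<alpha> \<in> lattice_span \<Gamma>1" for \<alpha>
    proof -
      consider "\<alpha> = simple_elt p" "S = {}" | k where "k \<in> S" "\<alpha> = simple_elt p" | k where "k \<in> S" "\<alpha> = simple_elt k"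
        | k where "k \<in> S" "k = n - 2" "\<alpha> = (\<lambda>j. simple_elt k j + simple_elt p j)"
        using span_cases[OF a] by blast
      thus ?thesis
      proof cases
        case 1
        have "tau_lin \<Gamma>1 \<tau> \<alpha> = simple_elt q" using tau_lin_simple[OF Gamma1_facts(1)] Gamma1_facts(4) 1 by simp
        thus ?thesis using eqI[OF simple_pos(1)[OF pq(1)] simple_pos(1)[OF pq(2)] simple_pos(2)[OF pq(1)] simple_pos(2)[OF pq(2)]]
          dpq c1 1 by simp
      next
        case (2 k)
        have "tau_lin \<Gamma>1 \<tau> \<alpha> = simple_elt k" using tau_lin_simple[OF Gamma1_facts(1)] Gamma1_facts(3)[OF 2(1)] 2 by simp
        moreover have "d (n - 2) / d p = d (k - 1) / d k" using c 2(1) dq[OF c1 pq(1)] by simp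
        ultimately show ?thesis
          using eqI[OF simple_pos(1)[OF pq(1)] simple_pos_S(1)[OF 2(1)] simple_pos(2)[OF pq(1)] simple_pos_S(2)[OF 2(1)]] 2(2) by simp
      next
        case (3 k)
        have "tau_lin \<Gamma>1 \<tau> \<alpha> = simple_elt q" using tau_lin_simple[of k] Gamma1_facts(3)[OF 3(1)] 3 by simp
        moreover have "d (k - 1) / d k = d (n - 2) / d q" using c 3(1) dq[OF c1 pq(2)] by simp
        ultimately show ?thesis
          using eqI[OF simple_pos_S(1)[OF 3(1)] simple_pos(1)[OF pq(2)] simple_pos_S(2)[OF 3(1)] simple_pos(2)[OF pq(2)]] 3(2) by simp
      next
        \<comment> \<open>The root and its image share row n-3 and differ only in the columns p and
          q, where d agrees, so no new condition arises.\<close>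
        case (4 k)
        have kG: "k \<in> \<Gamma>1" "\<tau> p = k" "\<tau> k = q" using Gamma1_facts(3)[OF 4(1)] by auto
        have t: "tau_lin \<Gamma>1 \<tau> \<alpha> = (\<lambda>j. simple_elt (n - 2) j + simple_elt q j)"
          unfolding 4(3) tau_lin_add tau_lin_simple[OF kG(1)] tau_lin_simple[OF Gamma1_facts(1)] kG
          by (simp add: 4(2) add.commute)
        have "d p = d q" using dpq c1 nz rv_mid by (simp add: field_simps)
        hence r: "d (n - 3) / d p = d (n - 3) / d q" by simp
        have al: "\<alpha> = (\<lambda>j. simple_elt (n - 2) j + simple_elt p j)" using 4 by simp
        show ?thesis unfolding t
          by (subst al) (rule eqI[OF long_root(2)[OF pq(1)] long_root(2)[OF pq(2)] long_root(3)[OF pq(1)] long_root(3)[OF pq(2)] r])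
      qed
    qed
    have "eq \<alpha> ((tau_lin \<Gamma>1 \<tau> ^^ k) \<alpha>) \<and> (tau_lin \<Gamma>1 \<tau> ^^ k) \<alpha> \<in> pos_roots ty n"
      if a: "\<alpha> \<in> pos_roots ty n" and k: "\<And>m. m < k \<Longrightarrow> (tau_lin \<Gamma>1 \<tau> ^^ m) \<alpha> \<in> lattice_span \<Gamma>1" for \<alpha> k
      using k
    proof (induction k)
      case 0
      obtain i j where "allowed i j" "matches \<alpha> i j" using pos_rootsD(1)[OF a] unfolding roots_iff by blast
      thus ?case using a eqI by fastforce
    next
      case (Suc k)
      hence IH: "eq \<alpha> ((tau_lin \<Gamma>1 \<tau> ^^ k) \<alpha>)" "(tau_lin \<Gamma>1 \<tau> ^^ k) \<alpha> \<in> pos_roots ty n" by auto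
      have sp: "(tau_lin \<Gamma>1 \<tau> ^^ k) \<alpha> \<in> lattice_span \<Gamma>1" using Suc.prems[of k] by simp
      show ?case using eq_trans[OF IH(1) step[OF IH(2) sp] IH(2)] tau_step[of "(tau_lin \<Gamma>1 \<tau> ^^ k) \<alpha>"] IH(2) sp by simp
    qed
    thus "Ad_tensor (diag_of d) r = r" unfolding iff by (auto simp: tau_exponents_def)
  qed
qed

definition rvD :: "nat \<Rightarrow> nat" where "rvD j = (if j \<in> {n - 1, n} then j else rv j)"

lemma rvD: "j < M \<Longrightarrow> rvD j < M" "j < M \<Longrightarrow> rvD (rvD j) = j"
proof -
  assume j: "j < M"
  show "rvD j < M" using j by (simp add: rvD_def)
  have "rv j \<in> {n - 1, n} \<longleftrightarrow> j \<in> {n - 1, n}" using j rv_mid by (metis insert_iff rv_rv singletonD)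
  thus "rvD (rvD j) = j" using j by (auto simp: rvD_def)
qed

text \<open>The coordinate of the wedge (\<alpha>_p, \<alpha>_q) is carried to its own mirror image.
  The two coordinates are equal, because each of the two root vectors contributes a sign, and this
  gives equal factors in the middle. The coordinate of (\<alpha>_p, \<alpha>_k) is carried to one of
  (\<alpha>_k, \<alpha>_q); both are nonzero elements of K or products of such, so the quotient lies
  in K.\<close>

lemma flipping_entries:
  assumes bd: "bd_data ty n e wedges \<rho> r0 r" and a: "\<And>j. j < M \<Longrightarrow> a j \<noteq> 0"
    and x: "Ad_tensor (monomial_mat M rvD a) r = flip r"
  shows "a (n - 1) = a n" "k \<in> S \<Longrightarrow> a p * a (k - 1) / (a (n - 2) * a k) \<in> range to_ac"
proof -
  interpret b: bd_data ty n e wedges \<rho> r0 r by fact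
  have E: "r $$ (rvD k, rvD l) $$ (rvD i, rvD j) = (a i * a k) / (a j * a l) * r $$ (i, j) $$ (k, l)"
    if lt: "i < M" "j < M" "k < M" "l < M" for i j k l
  proof -
    have "flip r $$ (rvD i, rvD j) $$ (rvD k, rvD l) = (a i * a k) / (a j * a l) * r $$ (i, j) $$ (k, l)"
    proof -
      have "Ad_tensor (monomial_mat M rvD a) r = flip r \<longleftrightarrow> (\<forall>i<M. \<forall>j<M. \<forall>k<M. \<forall>l<M.
        flip r $$ (rvD i, rvD j) $$ (rvD k, rvD l) = (a i * a k) / (a j * a l) * r $$ (i, j) $$ (k, l))"
        by (rule Ad_tensor_monomial_eq_iff) (use rvD a b.r_carrier flip_carrier in auto)
      thus ?thesis using x lt by blast
    qed
    thus ?thesis using flip_entry[OF b.r_carrier] rvD lt by simp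
  qed
  have mid: "rvD p = p" "rvD q = q" "rvD (n - 2) = n + 1"
    using pq n3 rv_mid by (auto simp: rvD_def)
  note m = matches_arith(2)
  have mp: "matches (simple_elt p) q (n + 1)" "matches (simple_elt q) p (n + 1)"
    using m[OF simple_pos(1)[OF pq(1)]] m[OF simple_pos(1)[OF pq(2)]] rv_mid by auto
  have al: "allowed q (n + 1)" "allowed p (n + 1)"
    using pq n3 rv_mid D unfolding allowed_def by (auto simp: rv_def M2n)
  have r1: "r $$ (p, n - 2) $$ (n - 2, q) = e (- simple_elt p) $$ (p, n - 2) * e (simple_elt q) $$ (n - 2, q)"
    "r $$ (p, n - 2) $$ (n - 2, q) \<noteq> 0"
    by (rule b.r_W_entry[OF wedge_pq simple_pos(1)[OF pq(1)] simple_pos(1)[OF pq(2)] simple_pos(2)[OF pq(1)] simple_pos(2)[OF pq(2)]])+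
  have r2: "r $$ (n + 1, q) $$ (p, n + 1) = e (- simple_elt p) $$ (n + 1, q) * e (simple_elt q) $$ (p, n + 1)"
    by (rule b.r_W_entry(1)[OF wedge_pq mp al])
  have rt: "simple_elt p \<in> roots ty n" "simple_elt q \<in> roots ty n"
    using simple_pos_root(1)[OF D pq_range(1)] simple_pos_root(1)[OF D pq_range(2)] pos_rootsD(1) by auto
  have sg1: "sg i = (1 :: Kbar)" for i unfolding sg_def using D by simp
  have "e (- simple_elt p) $$ (rv (n - 2), rv p) = - e (- simple_elt p) $$ (p, n - 2)"
    using lie_entry[OF b.e_lie[OF neg_root[OF rt(1)]], of p "n - 2"] rv_mid sg1 by simp
  moreover have "e (simple_elt q) $$ (rv q, rv (n - 2)) = - e (simple_elt q) $$ (n - 2, q)"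
    using lie_entry[OF b.e_lie[OF rt(2)], of "n - 2" q] rv_mid sg1 by simp
  ultimately have "r $$ (n + 1, q) $$ (p, n + 1) = r $$ (p, n - 2) $$ (n - 2, q)"
    unfolding r1(1) r2 using rv_mid by simp
  with E[of p "n - 2" "n - 2" q] mid rv_mid r1(2) have "(a p * a (n - 2)) / (a (n - 2) * a q) = 1" by simp
  hence "a p = a q" using a rv_mid by (simp add: field_simps)
  thus "a (n - 1) = a n" using pq by auto
  assume k: "k \<in> S"
  note sk = simple_pos_S[OF k]
  have kM: "k - 1 < M" "k < M" using sk M2n by auto
  have r3: "r $$ (p, n - 2) $$ (k - 1, k) \<noteq> 0" "r $$ (p, n - 2) $$ (k - 1, k) \<in> range to_ac"
    by (rule b.r_W_entry(2,3)[OF wedge_pk[OF k] simple_pos(1)[OF pq(1)] sk(1) simple_pos(2)[OF pq(1)] sk(2)])+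
  have mk: "matches (simple_elt k) (rv k) (rv (k - 1))" by (rule m[OF sk(1) kM])
  have ak: "allowed (rv k) (rv (k - 1))" using sk(2) unfolding allowed_def by (auto simp: rv_eq_flip)
  have r4: "r $$ (rv (k - 1), rv k) $$ (p, n + 1) \<in> range to_ac"
    by (rule b.r_W_entry(3)[OF wedge_kq[OF k] mk mp(2) ak al(2)])
  have "rvD (k - 1) = rv (k - 1)" "rvD k = rv k" using sk(3,4) by (auto simp: rvD_def)
  with E[of p "n - 2" "k - 1" k] mid rv_mid kM have
    "r $$ (rv (k - 1), rv k) $$ (p, n + 1) = a p * a (k - 1) / (a (n - 2) * a k) * r $$ (p, n - 2) $$ (k - 1, k)" by simp
  hence "a p * a (k - 1) / (a (n - 2) * a k) = r $$ (rv (k - 1), rv k) $$ (p, n + 1) / r $$ (p, n - 2) $$ (k - 1, k)"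
    using r3(1) by (simp add: field_simps)
  thus "a p * a (k - 1) / (a (n - 2) * a k) \<in> range to_ac" using r3(2) r4 by (auto simp flip: to_ac_divide)
qed

end

section \<open>A cocycle over the quadratic extension\<close>

context classical
begin

lemma form_mat_orthogonal:
  "form_mat ty n * transpose_mat (form_mat ty n) = (1\<^sub>m M :: 'a :: comm_ring_1 mat)"
  "transpose_mat (form_mat ty n) * form_mat ty n = (1\<^sub>m M :: 'a :: comm_ring_1 mat)"
proof -
  let ?B = "form_mat ty n :: 'a mat"
  show "?B * transpose_mat ?B = 1\<^sub>m M"
  proof (rule eq_matI)
    fix i j assume "i < dim_row (1\<^sub>m M :: 'a mat)" "j < dim_col (1\<^sub>m M :: 'a mat)"
    hence ij: "i < M" "j < M" by auto
    have "(?B * transpose_mat ?B) $$ (i, j) = (\<Sum>k<M. ?B $$ (i, k) * ?B $$ (j, k))"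
      using ij by (subst mult_mat_entry[of _ M]) auto
    also have "\<dots> = (\<Sum>k<M. if k = rv i then (if i = j then 1 else 0) else 0)"
      using ij by (intro sum.cong refl) (auto simp: form_mat_entry)
    finally show "(?B * transpose_mat ?B) $$ (i, j) = 1\<^sub>m M $$ (i, j)" using ij by simp
  qed auto
  show "transpose_mat ?B * ?B = 1\<^sub>m M"
  proof (rule eq_matI)
    fix i j assume "i < dim_row (1\<^sub>m M :: 'a mat)" "j < dim_col (1\<^sub>m M :: 'a mat)"
    hence ij: "i < M" "j < M" by auto
    have "(transpose_mat ?B * ?B) $$ (i, j) = (\<Sum>k<M. ?B $$ (k, i) * ?B $$ (k, j))"
      using ij by (subst mult_mat_entry[of _ M]) auto
    also have "\<dots> = (\<Sum>k<M. if k = rv i then (if i = j then 1 else 0) else 0)"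
      using ij by (intro sum.cong refl) (auto simp: form_mat_entry rv_eq_flip)
    finally show "(transpose_mat ?B * ?B) $$ (i, j) = 1\<^sub>m M $$ (i, j)" using ij by simp
  qed auto
qed

text \<open>The form matrix is orthogonal, so inverting X B X^T = B gives the relation for the
  transpose. This is used because the isotropic vectors are conveniently listed as rows, while
  \<sigma>0 has to act on J by a factor on the right.\<close>

lemma group_transpose:
  assumes x: "(x :: 'a :: field mat) \<in> classical_group ty n"
  shows "transpose_mat x \<in> classical_group ty n"
proof -
  let ?B = "form_mat ty n :: 'a mat" and ?t = transpose_mat
  note xc = groupD(1)[OF x] and o = form_mat_orthogonal[where 'a='a]
  let ?y = "?B * (?t x * ?t ?B)"
  have c: "?t x \<in> carrier_mat M M" "?t ?B \<in> carrier_mat M M" using xc by auto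
  have yc: "?y \<in> carrier_mat M M" using c by (auto intro!: mult_carrier_mat[of _ M M _ M])
  have "x * ?y = (x * ?B * ?t x) * ?t ?B" using xc c by (simp add: mat_assoc)
  hence "x * ?y = 1\<^sub>m M" using groupD(3)[OF x] o by simp
  from mat_inverse_eqI(2)[OF xc yc this] have "?B * (?t x * (?t ?B * x)) = 1\<^sub>m M"
    using xc c by (simp add: mat_assoc)
  hence "?t ?B * (?B * (?t x * (?t ?B * x))) = ?t ?B" using c by simp
  moreover have "?t ?B * (?B * (?t x * (?t ?B * x))) = ?t x * (?t ?B * x)"
    using xc c o by (intro mult_cancel_mat[of _ M]) (auto simp: mat_assoc)
  ultimately have "?t (?t x * (?t ?B * x)) = ?B" by simp
  moreover have "?t (?t x * (?t ?B * x)) = ?t x * ?B * x"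
    using xc c by (subst transpose_mult[of _ M M _ M]) (auto simp: transpose_mult[of _ M M _ M] mat_assoc)
  ultimately show ?thesis
    using xc groupD(2)[OF x] by (simp add: classical_group_def det_transpose[OF xc])
qed

lemma group_sum_cols:
  assumes x: "(x :: 'a :: field mat) \<in> classical_group ty n" and ij: "i < M" "j < M"
  shows "(\<Sum>k<M. x $$ (k, i) * sg k * x $$ (rv k, j)) = (if j = rv i then sg i else 0)"
  using group_sum[OF group_transpose[OF x] ij] groupD(1)[OF x] ij by simp

end

locale twisted_setting = classical ty n + quadratic s \<sigma>0
  for ty :: classical_type and n :: nat and s :: Kbar and \<sigma>0 :: "Kbar \<Rightarrow> Kbar"
begin

text \<open>The permutation that the longest Weyl group element induces on the indices. For odd n in
  type D the fixed middle indices keep the determinant equal to 1.\<close>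

definition cpi :: "nat \<Rightarrow> nat" where
  "cpi j = (if ty = Type_D \<and> odd n \<and> j \<in> {n - 1, n} then j else rv j)"

lemma L_simps: "to_ac x \<in> L" "a \<in> L \<Longrightarrow> - a \<in> L" "a \<in> L \<Longrightarrow> inverse a \<in> L" "a \<in> L \<Longrightarrow> b \<in> L \<Longrightarrow> a / b \<in> L"
  "0 \<in> L" "1 \<in> L" "numeral w \<in> L" "a \<in> L \<Longrightarrow> b \<in> L \<Longrightarrow> a - b \<in> L"
proof -
  show K: "to_ac x \<in> L" for x using L_base by blast
  show m: "- a \<in> L" if "a \<in> L" for a using L_arith(2)[OF K[of "- 1"] that] by simp
  show i: "inverse a \<in> L" if "a \<in> L" for a
  proof (rule fixed_in_L)
    fix \<sigma> assume "\<sigma> \<in> Gal L"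
    thus "\<sigma> (inverse a) = inverse a" using Gal_field_hom(5)[OF _ L_base] GalD(4) that by metis
  qed
  show "a / b \<in> L" if "a \<in> L" "b \<in> L" for a b unfolding divide_inverse using L_arith(2) i that by blast
  show "0 \<in> L" "1 \<in> L" using K[of 0] K[of 1] by simp_all
  show "numeral w \<in> L" using K[of "numeral w"] by simp
  show "a - b \<in> L" if "a \<in> L" "b \<in> L" for a b using L_arith(1)[OF that(1) m[OF that(2)]] by simp
qed

text \<open>Row \<open>i\<close> of the matrix with rows \<open>V i\<close> is an isotropic vector over \<open>L\<close> that is conjugate, up
  to the factor \<open>m i\<close>, to row \<open>cpi i\<close>.\<close>

definition good_rows :: "(nat \<Rightarrow> nat \<Rightarrow> Kbar) \<Rightarrow> (nat \<Rightarrow> Kbar) \<Rightarrow> bool" where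
  "good_rows V m \<longleftrightarrow>
     (\<forall>i<M. \<forall>j<M. (\<Sum>k<M. V i k * sg k * V j (rv k)) = (if j = rv i then sg i else 0)) \<and>
     (\<forall>i<M. \<forall>k<M. V i k \<in> L \<and> \<sigma>0 (V i k) = m i * V (cpi i) k) \<and>
     (\<forall>i<M. m i \<noteq> 0) \<and> (ty = Type_D \<and> odd n \<longrightarrow> m (n - 1) = 1 \<and> m n = 1)"

definition row_mat :: "(nat \<Rightarrow> nat \<Rightarrow> 'a) \<Rightarrow> 'a mat" where
  "row_mat V = mat M M (\<lambda>(i, k). V i k)"

lemma row_mat_carrier [simp]: "row_mat V \<in> carrier_mat M M" by (simp add: row_mat_def)

lemma cpi_lt: "j < M \<Longrightarrow> cpi j < M" "j < M \<Longrightarrow> cpi (cpi j) = j"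
proof -
  assume j: "j < M"
  show "cpi j < M" unfolding cpi_def using j rv_lt[OF j] by (rule if_split[THEN iffD2, OF conjI[OF impI impI]])
  have "rv j \<in> {n - 1, n} \<longleftrightarrow> j \<in> {n - 1, n}" if "ty = Type_D"
    using j M_simps(2) that n_pos unfolding rv_def by auto
  thus "cpi (cpi j) = j" unfolding cpi_def using rv_rv[OF j] by auto
qed

lemma form_rows:
  "good_rows V m \<Longrightarrow> row_mat V * form_mat ty n * transpose_mat (row_mat V) = form_mat ty n"
  by (rule eq_matI) (auto simp: form_entry form_mat_entry row_mat_def good_rows_def simp del: index_mult_mat(1))

lemma det_rows: "good_rows V m \<Longrightarrow> det (row_mat V) = 1 \<or> det (row_mat V) = - 1"
proof -
  assume g: "good_rows V m"
  let ?Z = "row_mat V" and ?B = "form_mat ty n :: Kbar mat"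
  have c: "?Z * ?B \<in> carrier_mat M M" by (rule mult_carrier_mat[of _ M M]) auto
  have "det ?B * (det ?Z * det ?Z) = det (?Z * ?B * transpose_mat ?Z)"
    by (subst det_mult[OF c]) (auto simp: det_mult[of _ M] det_transpose[of _ M])
  also have "\<dots> = det ?B" unfolding form_rows[OF g] ..
  finally have "det ?B * (det ?Z * det ?Z - 1) = 0" by (simp add: algebra_simps)
  moreover have "det ?B \<noteq> 0" using mat_inverse_eqI(3)[of ?B M "transpose_mat ?B"] form_mat_orthogonal(1)[where 'a=Kbar] by auto
  ultimately have "(det ?Z - 1) * (det ?Z + 1) = 0" by (simp add: algebra_simps)
  thus ?thesis by (auto simp: eq_neg_iff_add_eq_0)
qed

definition swap_mid :: "nat \<Rightarrow> nat" where
  "swap_mid k = (if k = n - 1 then n else if k = n then n - 1 else k)"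

text \<open>Both corrections are rational over K and act on columns or by a scalar, so the
  conjugation relation between rows persists: a sign in type B, where the size is odd, and the
  exchange of the two middle columns in type D, which preserves the form.\<close>

lemma fix_det:
  assumes g: "good_rows V m" and ty: "ty \<noteq> Type_C"
  shows "\<exists>V m. good_rows V m \<and> det (row_mat V) = 1"
proof (cases "det (row_mat V) = 1")
  case True
  thus ?thesis using g by blast
next
  case False
  hence d: "det (row_mat V) = - 1" using det_rows[OF g] by blast
  show ?thesis
  proof (cases "ty = Type_B")
    case True
    let ?V = "\<lambda>i k. - V i k"
    have gn: "good_rows ?V m"
      using g L_simps(2) unfolding good_rows_def by (auto simp: \<sigma>0_hom)
    have "row_mat ?V = (- 1) \<cdot>\<^sub>m row_mat V" by (intro eq_matI) (auto simp: row_mat_def)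
    hence "det (row_mat ?V) = (- 1) ^ M * det (row_mat V)" using det_smult[of "- 1" "row_mat V"] by (simp add: row_mat_def)
    also have "\<dots> = 1" using d M_simps(1)[OF True] by simp
    finally show ?thesis using gn by blast
  next
    case False
    have D: "ty = Type_D" using False ty by (cases ty) auto
    have M: "M = 2 * n" using M_simps(2) D by simp
    have sw: "swap_mid k < M" "swap_mid (swap_mid k) = k" "swap_mid (rv k) = rv (swap_mid k)" if "k < M" for k
      using that n_pos M by (auto simp: swap_mid_def rv_def)
    have sg1: "sg k = (1 :: 'z :: comm_ring_1)" for k unfolding sg_def using D by simp
    let ?V = "\<lambda>i k. V i (swap_mid k)"
    have "(\<Sum>k<M. ?V i k * sg k * ?V j (rv k)) = (\<Sum>k<M. V i k * sg k * V j (rv k))" for i j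
      by (rule sum.reindex_bij_witness[of _ swap_mid swap_mid]) (auto simp: sw sg1)
    hence gn: "good_rows ?V m" using g sw unfolding good_rows_def by auto
    have uv: "n - 1 < M" "n < M" "n - 1 \<noteq> n" using M n_pos by auto
    have "transpose_mat (row_mat ?V) = swaprows (n - 1) n (transpose_mat (row_mat V))"
      using uv by (intro eq_matI) (auto simp: row_mat_def swap_mid_def)
    hence "det (transpose_mat (row_mat ?V)) = - det (transpose_mat (row_mat V))"
      using det_swaprows[OF uv, of "transpose_mat (row_mat V)"] by simp
    hence "det (row_mat ?V) = 1" using d by (simp add: det_transpose[of _ M])
    thus ?thesis using gn by blast
  qed
qed

text \<open>Rows 0 and 1 are points (ac, ad, bc, -bd) of the quadric x_0 x_3 + x_1 x_2 = 0, with (c,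
  d) = (1, s) and (a, b) = (1, s) or (1, -s). Rows 3 and 2 are their conjugates, divided by the
  pairing of the vector with its conjugate, which is -4 s^2 and 4 s^2.\<close>

definition T4 :: "nat \<Rightarrow> nat \<Rightarrow> Kbar" where
  "T4 p q = [[1, s, s, - (s * s)], [1, s, - s, s * s],
     [1 / (4 * (s * s)), - 1 / (4 * s), 1 / (4 * s), 1 / 4],
     [- 1 / (4 * (s * s)), 1 / (4 * s), 1 / (4 * s), 1 / 4]] ! p ! q"

definition m4 :: "nat \<Rightarrow> Kbar" where
  "m4 p = [- 4 * (s * s), 4 * (s * s), 1 / (4 * (s * s)), - 1 / (4 * (s * s))] ! p"

text \<open>The isotropic vector (1, s, -s^2/2); a vector orthogonal to it and to its conjugate on
  which the form is 1 and which \<sigma>0 negates; and the conjugate of the first row divided by the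
  pairing -2 s^2.\<close>

definition T3 :: "nat \<Rightarrow> nat \<Rightarrow> Kbar" where
  "T3 p q = [[1, s, - (s * s) / 2], [1 / s, 0, s / 2], [- 1 / (2 * (s * s)), 1 / (2 * s), 1 / 4]] ! p ! q"

definition m3 :: "nat \<Rightarrow> Kbar" where
  "m3 p = [- 2 * (s * s), - 1, - 1 / (2 * (s * s))] ! p"

lemma less_4: "p < 4 \<longleftrightarrow> p = 0 \<or> p = 1 \<or> p = 2 \<or> p = (3 :: nat)" by auto
lemma less_3: "p < 3 \<longleftrightarrow> p = 0 \<or> p = 1 \<or> p = (2 :: nat)" by auto

lemma sum_4: "(\<Sum>q<4. f q) = f 0 + f 1 + f 2 + f (3 :: nat)" for f :: "nat \<Rightarrow> Kbar"
  by (simp add: eval_nat_numeral)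
lemma sum_3: "(\<Sum>q<3. f q) = f 0 + f 1 + f (2 :: nat)" for f :: "nat \<Rightarrow> Kbar"
  by (simp add: eval_nat_numeral)

lemma T4_form: "p < 4 \<Longrightarrow> p' < 4 \<Longrightarrow> (\<Sum>q<4. T4 p q * T4 p' (3 - q)) = (if p' = 3 - p then 1 else 0)"
  unfolding sum_4 less_4 T4_def by (elim disjE) (simp_all add: field_simps del: ss)

lemma T3_form: "p < 3 \<Longrightarrow> p' < 3 \<Longrightarrow> (\<Sum>q<3. T3 p q * T3 p' (2 - q)) = (if p' = 2 - p then 1 else 0)"
  unfolding sum_3 less_3 T3_def by (elim disjE) (simp_all add: field_simps del: ss)

lemma \<sigma>0_numeral: "\<sigma>0 (numeral w) = numeral w"
  using \<sigma>0_to_ac[of "numeral w"] by simp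

lemma T4_conj: "p < 4 \<Longrightarrow> q < 4 \<Longrightarrow> \<sigma>0 (T4 p q) = m4 p * T4 (3 - p) q"
  unfolding less_4 T4_def m4_def
  by (elim disjE) (simp_all add: \<sigma>0_hom \<sigma>0_s \<sigma>0_numeral field_simps del: ss)

lemma T3_conj: "p < 3 \<Longrightarrow> q < 3 \<Longrightarrow> \<sigma>0 (T3 p q) = m3 p * T3 (2 - p) q"
  unfolding less_3 T3_def m3_def
  by (elim disjE) (simp_all add: \<sigma>0_hom \<sigma>0_s \<sigma>0_numeral field_simps del: ss)

lemma T4_L: "p < 4 \<Longrightarrow> q < 4 \<Longrightarrow> T4 p q \<in> L" "p < 4 \<Longrightarrow> m4 p \<noteq> 0"
  unfolding less_4 T4_def m4_def by (elim disjE; simp add: L_simps L_arith s_in_L del: ss)+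

lemma T3_L: "p < 3 \<Longrightarrow> q < 3 \<Longrightarrow> T3 p q \<in> L" "p < 3 \<Longrightarrow> m3 p \<noteq> 0"
  unfolding less_3 T3_def m3_def by (elim disjE; simp add: L_simps L_arith s_in_L del: ss)+

text \<open>For types B and D the indices are cut into blocks \<open>{2t, 2t + 1, rv (2t + 1), rv (2t)}\<close> and a
  middle block.\<close>

definition blk :: "nat \<Rightarrow> nat" where "blk i = min i (rv i) div 2"
definition pos :: "nat \<Rightarrow> nat" where "pos i = (if i < n then i mod 2 else 3 - rv i mod 2)"

text \<open>The middle block is \<open>T3\<close> in type B with n odd. Otherwise it is an identity
  matrix: on index n in type B with n even and on n-1 and n in type D with n odd.\<close>

definition VBD :: "nat \<Rightarrow> nat \<Rightarrow> Kbar" where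
  "VBD i k = (if blk i = blk k then
     (if blk i < n div 2 then T4 (pos i) (pos k)
      else if ty = Type_B \<and> odd n then T3 (i - (n - 1)) (k - (n - 1)) else if i = k then 1 else 0) else 0)"

definition mBD :: "nat \<Rightarrow> Kbar" where
  "mBD i = (if blk i < n div 2 then m4 (pos i)
      else if ty = Type_B \<and> odd n then m3 (i - (n - 1)) else 1)"

definition block :: "nat \<Rightarrow> nat \<Rightarrow> nat" where
  "block t q = (if q = 0 then 2 * t else if q = 1 then 2 * t + 1 else if q = 2 then rv (2 * t + 1) else rv (2 * t))"

lemma VBD_zero: "blk i \<noteq> blk k \<Longrightarrow> VBD i k = 0" by (simp add: VBD_def)

lemma VBD_4: "blk i < n div 2 \<Longrightarrow> blk k = blk i \<Longrightarrow> VBD i k = T4 (pos i) (pos k)"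
  unfolding VBD_def by simp

lemma VBD_3: "\<not> blk i < n div 2 \<Longrightarrow> ty = Type_B \<and> odd n \<Longrightarrow> blk k = blk i \<Longrightarrow> VBD i k = T3 (i - (n - 1)) (k - (n - 1))"
  unfolding VBD_def by simp

lemma VBD_1: "\<not> blk i < n div 2 \<Longrightarrow> \<not> (ty = Type_B \<and> odd n) \<Longrightarrow> VBD i k = (if i = k then 1 else 0)"
  unfolding VBD_def by auto

lemma mBD_simps: "blk i < n div 2 \<Longrightarrow> mBD i = m4 (pos i)"
  "\<not> blk i < n div 2 \<Longrightarrow> ty = Type_B \<and> odd n \<Longrightarrow> mBD i = m3 (i - (n - 1))"
  "\<not> blk i < n div 2 \<Longrightarrow> \<not> (ty = Type_B \<and> odd n) \<Longrightarrow> mBD i = 1"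
  unfolding mBD_def by auto

lemma cpi_simps: "ty = Type_D \<and> odd n \<and> i \<in> {n - 1, n} \<Longrightarrow> cpi i = i"
  "\<not> (ty = Type_D \<and> odd n \<and> i \<in> {n - 1, n}) \<Longrightarrow> cpi i = rv i"
  unfolding cpi_def by auto

lemma blk_rv: "i < M \<Longrightarrow> blk (rv i) = blk i" by (simp add: blk_def min.commute)

lemma pos_block:
  assumes t: "t < n div 2" and q: "q < 4"
  shows "block t q < M" "blk (block t q) = t" "pos (block t q) = q" "rv (block t q) = block t (3 - q)"
proof -
  have "2 * t + 1 < n" "2 * n \<le> M" using t M_simps(3) by auto
  thus "block t q < M" "blk (block t q) = t" "pos (block t q) = q" "rv (block t q) = block t (3 - q)"
    using q unfolding less_4 by (auto simp: block_def blk_def pos_def rv_def min_def)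
qed

lemma block_pos:
  assumes i: "i < M" and b: "blk i < n div 2"
  shows "block (blk i) (pos i) = i" "pos i < 4" "pos (rv i) = 3 - pos i"
proof -
  have "min i (rv i) < n" using b unfolding blk_def by (meson div_le_mono leD leI)
  hence c: "i < n \<or> rv i < n" "\<not> (i < n \<and> rv i < n)" using i M_simps(3) by (auto simp: rv_def min_def split: if_splits)
  show p4: "pos i < 4" by (auto simp: pos_def)
  show "block (blk i) (pos i) = i"
  proof (cases "i < n")
    case True
    hence "blk i = i div 2" using c by (simp add: blk_def min_def)
    thus ?thesis using True by (simp add: block_def pos_def) presburger
  next
    case False
    hence r: "rv i < n" using c by simp
    hence "blk i = rv i div 2" using False by (simp add: blk_def min_def)
    moreover have "rv i = 2 * (rv i div 2) + rv i mod 2" by simp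
    moreover have "rv i mod 2 = 0 \<or> rv i mod 2 = 1" by presburger
    ultimately have "block (blk i) (pos i) = rv (rv i)"
      using False unfolding block_def pos_def by (elim disjE) simp_all
    thus ?thesis using i by simp
  qed
  have "i mod 2 = 0 \<or> i mod 2 = 1" "rv i mod 2 = 0 \<or> rv i mod 2 = 1" by presburger+
  thus "pos (rv i) = 3 - pos i" using c i by (auto simp: pos_def)
qed

lemma good_rows_BD:
  assumes ty: "ty \<noteq> Type_C"
  shows "good_rows VBD mBD"
proof -
  have sg1: "sg k = (1 :: Kbar)" for k unfolding sg_def using ty by simp
  \<comment> \<open>The indices left over when as many pairs as possible are taken from both ends:
    three in type B and two in type D if n is odd, one in type B and none in type D if n is
    even.\<close>
  have mid: "n div 2 \<le> blk i \<longleftrightarrow> i \<in> (if odd n then {n - 1..M - n} else if ty = Type_B then {n} else {})" if "i < M" for i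
  proof -
    have "n div 2 \<le> blk i \<longleftrightarrow> 2 * (n div 2) \<le> i \<and> 2 * (n div 2) \<le> rv i"
      unfolding blk_def by (auto simp: min_def)
    also have "\<dots> \<longleftrightarrow> i \<in> (if odd n then {n - 1..M - n} else if ty = Type_B then {n} else {})"
    proof (cases "odd n")
      case True
      hence "2 * (n div 2) = n - 1" by simp
      thus ?thesis using True that M_simps(3) n_pos unfolding rv_def by auto
    next
      case False
      hence "2 * (n div 2) = n" by simp
      thus ?thesis using False that M_simps ty unfolding rv_def by (cases ty) auto
    qed
    finally show ?thesis .
  qed
  have form: "(\<Sum>k<M. VBD i k * VBD j (rv k)) = (if j = rv i then 1 else 0)" if ij: "i < M" "j < M" for i j
  proof (cases "blk i = blk j")
    case False
    have "VBD i k * VBD j (rv k) = 0" if "k < M" for k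
      using False blk_rv[OF that] by (auto simp: VBD_def)
    moreover have "j \<noteq> rv i" using False blk_rv[OF ij(1)] by metis
    ultimately show ?thesis by (simp add: sum.neutral)
  next
    case bij: True
    show ?thesis
    proof (cases "blk i < n div 2")
      case t: True
      let ?t = "blk i"
      note bp = block_pos[OF ij(1) t] and bpj = block_pos[OF ij(2) t[unfolded bij]]
      have "(\<Sum>k<M. VBD i k * VBD j (rv k)) = (\<Sum>k\<in>{k. k < M \<and> blk k = ?t}. VBD i k * VBD j (rv k))"
      proof (intro sum.mono_neutral_right ballI)
        fix k assume "k \<in> {..<M} - {k. k < M \<and> blk k = ?t}"
        hence "blk i \<noteq> blk k" by auto
        thus "VBD i k * VBD j (rv k) = 0" by (simp add: VBD_zero)
      qed auto
      also have "\<dots> = (\<Sum>q<4. T4 (pos i) q * T4 (pos j) (3 - q))"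
      proof (rule sum.reindex_bij_witness[of _ "block ?t" pos])
        fix k assume k: "k \<in> {k. k < M \<and> blk k = ?t}"
        hence bk: "k < M" "blk k < n div 2" using t by auto
        note bpk = block_pos[OF bk]
        show "block ?t (pos k) = k" "pos k \<in> {..<4}" using bpk k by auto
        show "T4 (pos i) (pos k) * T4 (pos j) (3 - pos k) = VBD i k * VBD j (rv k)"
          using VBD_4[OF t, of k] VBD_4[OF t[unfolded bij], of "rv k"] k bij bpk(3) blk_rv[OF bk(1)] by simp
      next
        fix q :: nat assume "q \<in> {..<4}"
        hence q: "q < 4" by simp
        show "pos (block ?t q) = q" "block ?t q \<in> {k. k < M \<and> blk k = ?t}" using pos_block[OF t q] by auto
      qed
      also have "\<dots> = (if pos j = 3 - pos i then 1 else 0)" by (rule T4_form[OF bp(2) bpj(2)])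
      also have "pos j = 3 - pos i \<longleftrightarrow> j = rv i"
      proof
        assume "pos j = 3 - pos i"
        hence "block ?t (pos j) = block ?t (3 - pos i)" by simp
        also have "\<dots> = rv (block ?t (pos i))" by (rule pos_block(4)[OF t bp(2), symmetric])
        finally show "j = rv i" using bp(1) bpj(1) bij by simp
      next
        assume "j = rv i" thus "pos j = 3 - pos i" using bp(3) by simp
      qed
      finally show ?thesis .
    next
      case t: False
      hence mi: "n div 2 \<le> blk i" "n div 2 \<le> blk j" using bij by auto
      show ?thesis
      proof (cases "ty = Type_B \<and> odd n")
        case B: True
        have M: "M = 2 * n + 1" using M_simps(1) B by simp
        have ijm: "i \<in> {n - 1..n + 1}" "j \<in> {n - 1..n + 1}" using mi mid[OF ij(1)] mid[OF ij(2)] B M by auto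
        have bm: "blk k = blk i" if "k \<in> {n - 1..n + 1}" for k
        proof -
          have "blk l = (n - 1) div 2" if "l \<in> {n - 1..n + 1}" for l
          proof -
            from that n_pos have "l = n - 1 \<or> l = n \<or> l = n + 1" by auto
            hence "min l (rv l) = n - 1 \<or> min l (rv l) = n" using M n_pos unfolding rv_def by auto
            moreover have "n div 2 = (n - 1) div 2" using B by (auto elim: oddE)
            ultimately show ?thesis unfolding blk_def by metis
          qed
          thus ?thesis using that ijm(1) by simp
        qed
        have "(\<Sum>k<M. VBD i k * VBD j (rv k)) = (\<Sum>k\<in>{n - 1..n + 1}. VBD i k * VBD j (rv k))"
        proof (intro sum.mono_neutral_right ballI)
          fix k assume k: "k \<in> {..<M} - {n - 1..n + 1}"
          hence "\<not> n div 2 \<le> blk k" using mid[of k] B M by auto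
          hence "blk i \<noteq> blk k" using mi by auto
          thus "VBD i k * VBD j (rv k) = 0" by (simp add: VBD_zero)
        qed (use M n_pos in auto)
        also have "\<dots> = (\<Sum>q<3. T3 (i - (n - 1)) q * T3 (j - (n - 1)) (2 - q))"
        proof (rule sum.reindex_bij_witness[of _ "\<lambda>q. q + (n - 1)" "\<lambda>k. k - (n - 1)"])
          fix k assume k: "k \<in> {n - 1..n + 1}"
          have r: "rv k \<in> {n - 1..n + 1}" "rv k - (n - 1) = 2 - (k - (n - 1))" using k M n_pos unfolding rv_def by auto
          show "T3 (i - (n - 1)) (k - (n - 1)) * T3 (j - (n - 1)) (2 - (k - (n - 1))) = VBD i k * VBD j (rv k)"
            using VBD_3[OF t B bm[OF k]] VBD_3[OF t[unfolded bij] B, of "rv k"] bm[OF r(1)] bij r(2) by simp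
        qed (use n_pos in auto)
        also have "\<dots> = (if j - (n - 1) = 2 - (i - (n - 1)) then 1 else 0)" using ijm by (intro T3_form) auto
        also have "j - (n - 1) = 2 - (i - (n - 1)) \<longleftrightarrow> j = rv i" using ijm M n_pos unfolding rv_def by auto
        finally show ?thesis .
      next
        case nB: False
        have V: "VBD i k = (if i = k then 1 else 0)" "VBD j k = (if j = k then 1 else 0)" for k
          using VBD_1[OF t nB] VBD_1[OF t[unfolded bij] nB] by auto
        have "(\<Sum>k<M. VBD i k * VBD j (rv k)) = (\<Sum>k<M. if k = i then if j = rv i then 1 else 0 else 0)"
          unfolding V by (intro sum.cong refl) auto
        thus ?thesis using ij by simp
      qed
    qed
  qed
  have conj: "VBD i k \<in> L \<and> \<sigma>0 (VBD i k) = mBD i * VBD (cpi i) k" if ik: "i < M" "k < M" for i k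
  proof (cases "blk i < n div 2")
    case t: True
    have "cpi i = rv i"
    proof -
      have "\<not> (ty = Type_D \<and> odd n \<and> i \<in> {n - 1, n})"
      proof
        assume D: "ty = Type_D \<and> odd n \<and> i \<in> {n - 1, n}"
        hence "n div 2 \<le> blk i" unfolding mid[OF ik(1)] using M_simps(2) by auto
        with t show False by simp
      qed
      thus ?thesis by (rule cpi_simps(2))
    qed
    note bp = block_pos[OF ik(1) t]
    have pk: "pos k < 4" by (auto simp: pos_def)
    show ?thesis
    proof (cases "blk k = blk i")
      case True
      have tr: "blk (rv i) < n div 2" "blk k = blk (rv i)" using t True blk_rv[OF ik(1)] by simp_all
      show ?thesis unfolding \<open>cpi i = rv i\<close> VBD_4[OF t True] VBD_4[OF tr] mBD_simps(1)[OF t] bp(3)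
        using T4_conj[OF bp(2) pk] T4_L(1)[OF bp(2) pk] by simp
    next
      case False
      thus ?thesis using \<open>cpi i = rv i\<close> blk_rv[OF ik(1)] L_simps(5) by (simp add: VBD_zero \<sigma>0_hom)
    qed
  next
    case t: False
    show ?thesis
    proof (cases "ty = Type_B \<and> odd n")
      case B: True
      have M: "M = 2 * n + 1" using M_simps(1) B by simp
      have im: "i \<in> {n - 1..n + 1}" using t mid[OF ik(1)] B M by auto
      have cpi: "cpi i = rv i" by (rule cpi_simps(2)) (use B in auto)
      have ri: "rv i - (n - 1) = 2 - (i - (n - 1))" using im M n_pos unfolding rv_def by auto
      show ?thesis
      proof (cases "blk i = blk k")
        case True
        hence "k \<in> {n - 1..n + 1}" using t mid[OF ik(2)] B M by auto
        hence k3: "k - (n - 1) < 3" "i - (n - 1) < 3" using im by auto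
        hence "\<sigma>0 (T3 (i - (n - 1)) (k - (n - 1))) = m3 (i - (n - 1)) * T3 (2 - (i - (n - 1))) (k - (n - 1))"
          "T3 (i - (n - 1)) (k - (n - 1)) \<in> L" using T3_conj[OF k3(2,1)] T3_L(1)[OF k3(2,1)] by blast+
        moreover have "\<not> blk (rv i) < n div 2" "blk k = blk (rv i)" using t True blk_rv[OF ik(1)] by simp_all
        ultimately show ?thesis using VBD_3[OF t B True[symmetric]] VBD_3[of "rv i" k] B mBD_simps(2)[OF t B] cpi ri by simp
      next
        case False
        thus ?thesis using cpi blk_rv[OF ik(1)] L_simps(5) by (simp add: VBD_zero \<sigma>0_hom)
      qed
    next
      case nB: False
      have cpi: "cpi i = i"
      proof (cases "odd n")
        case True
        hence D: "ty = Type_D" using nB ty by (cases ty) auto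
        have "i \<in> {n - 1, n}" using t mid[OF ik(1)] True M_simps(2) D n_pos by auto
        thus ?thesis using True D by (intro cpi_simps(1)) auto
      next
        case False
        hence B: "ty = Type_B" "i = n" using t mid[OF ik(1)] by (auto split: if_splits)
        have "rv n = n" using M_simps(1)[OF B(1)] unfolding rv_def by simp
        moreover have "cpi i = rv i" by (rule cpi_simps(2)) (use B in auto)
        ultimately show ?thesis using B(2) by simp
      qed
      thus ?thesis using VBD_1[OF t nB] mBD_simps(3)[OF t nB] L_simps(5,6) by (simp add: \<sigma>0_hom)
    qed
  qed
  have mnz: "mBD i \<noteq> 0" if i: "i < M" for i
  proof (cases "blk i < n div 2")
    case True
    thus ?thesis using T4_L(2)[OF block_pos(2)[OF i True]] by (simp add: mBD_simps)
  next
    case t: False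
    show ?thesis
    proof (cases "ty = Type_B \<and> odd n")
      case B: True
      have "i - (n - 1) < 3" using t mid[OF i] B M_simps(1) by auto
      thus ?thesis using T3_L(2) mBD_simps(2)[OF t B] by simp
    next
      case False thus ?thesis using mBD_simps(3)[OF t False] by simp
    qed
  qed
  have "mBD (n - 1) = 1 \<and> mBD n = 1" if D: "ty = Type_D \<and> odd n"
  proof -
    have M: "M = 2 * n" using M_simps(2) D by simp
    have "n div 2 \<le> blk (n - 1)" "n div 2 \<le> blk n"
      using mid[of "n - 1"] mid[of n] D M n_pos by auto
    thus ?thesis using D by (intro conjI mBD_simps(3)) auto
  qed
  thus ?thesis unfolding good_rows_def using form conj mnz by (simp add: sg1)
qed

end

section \<open>The symplectic rows, the matrix J, and Galois descent\<close>

context twisted_setting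
begin

lemma cpi_rv: assumes j: "j < M" shows "cpi (rv j) = rv (cpi j)"
proof (cases "ty = Type_D \<and> odd n")
  case True
  hence "rv j \<in> {n - 1, n} \<longleftrightarrow> j \<in> {n - 1, n}"
    using j M_simps(2) n_pos unfolding rv_def by auto
  thus ?thesis using True cpi_simps[of j] cpi_simps[of "rv j"] j by (cases "j \<in> {n - 1, n}") auto
next
  case False thus ?thesis using cpi_simps(2)[of j] cpi_simps(2)[of "rv j"] j by auto
qed

text \<open>Every vector is isotropic for an alternating form, so planes suffice: row i < n is e_i +
  s e_{rv i}, and row \<open>rv i\<close> is its conjugate divided by -2 s.\<close>

definition VC :: "nat \<Rightarrow> nat \<Rightarrow> Kbar" where
  "VC i k = (if i < n then (if k = i then 1 else if k = rv i then s else 0)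
     else (if k = i then 1 / 2 else if k = rv i then - 1 / (2 * s) else 0))"

definition mC :: "nat \<Rightarrow> Kbar" where "mC i = (if i < n then - 2 * s else 1 / (2 * s))"

lemma rv_C:
  assumes "ty = Type_C" "i < M"
  shows "rv i \<noteq> i" "rv i < n \<longleftrightarrow> \<not> i < n" "cpi i = rv i"
proof -
  have "M = 2 * n" using M_simps(2) assms(1) by simp
  thus "rv i \<noteq> i" "rv i < n \<longleftrightarrow> \<not> i < n" using assms(2) unfolding rv_def by presburger+
  show "cpi i = rv i" by (rule cpi_simps(2)) (use assms in auto)
qed

lemma good_rows_C:
  assumes C: "ty = Type_C"
  shows "good_rows VC mC"
  unfolding good_rows_def
proof (intro conjI allI impI)
  note r = rv_C[OF C]
  have sg: "sg k = (if k < n then 1 else - 1 :: Kbar)" for k unfolding sg_def using C by auto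
  fix i k assume ik: "i < M" "k < M"
  show "VC i k \<in> L"
    unfolding VC_def using L_simps L_arith s_in_L by (auto intro!: L_simps L_arith)
  have cases: "k = i \<or> k = rv i \<or> (k \<noteq> i \<and> k \<noteq> rv i)" by blast
  show "\<sigma>0 (VC i k) = mC i * VC (cpi i) k"
    using cases r[OF ik(1)] ik unfolding VC_def mC_def
    by (cases "i < n"; elim disjE) (simp_all add: \<sigma>0_hom \<sigma>0_s \<sigma>0_numeral field_simps del: ss)
  show "(\<Sum>l<M. VC i l * sg l * VC k (rv l)) = (if k = rv i then sg i else 0)"
  proof -
    have "(\<Sum>l<M. VC i l * sg l * VC k (rv l)) = (\<Sum>l\<in>{i, rv i}. VC i l * sg l * VC k (rv l))"
      using ik by (intro sum.mono_neutral_right) (auto simp: VC_def)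
    also have "\<dots> = VC i i * sg i * VC k (rv i) + VC i (rv i) * sg (rv i) * VC k i"
      using r(1)[OF ik(1)] ik(1) by simp
    also have "\<dots> = (if k = rv i then sg i else 0)"
    proof -
      have v: "VC i i = (if i < n then 1 else 1 / 2)" "VC i (rv i) = (if i < n then s else - 1 / (2 * s))"
        "VC (rv i) (rv i) = (if i < n then 1 / 2 else 1)" "VC (rv i) i = (if i < n then - 1 / (2 * s) else s)"
        using r[OF ik(1)] ik(1) by (auto simp: VC_def)
      have sr: "sg (rv i) = - (sg i :: Kbar)" using r(2)[OF ik(1)] by (simp add: sg)
      show ?thesis using cases
      proof (elim disjE conjE)
        assume k: "k = i"
        show ?thesis unfolding k sr using r(1)[OF ik(1)] by (auto simp: algebra_simps)
      next
        assume k: "k = rv i"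
        show ?thesis unfolding k v sr by (simp add: sg)
      next
        assume "k \<noteq> i" "k \<noteq> rv i"
        moreover from this have "rv i \<noteq> rv k" "i \<noteq> rv k" using ik by (auto simp: rv_eq_flip)
        ultimately have "VC k (rv i) = 0" "VC k i = 0" by (auto simp: VC_def)
        thus ?thesis using \<open>k \<noteq> rv i\<close> by simp
      qed
    qed
    finally show ?thesis .
  qed
qed (use s_nz C in \<open>auto simp: mC_def\<close>)

lemma det_rows_C:
  assumes C: "ty = Type_C"
  shows "det (row_mat VC) = 1"
proof -
  have M: "M = 2 * n" using M_simps(2) C by simp
  note r = rv_C[OF C]
  \<comment> \<open>Each block of size 2 is a product of a lower and an upper unitriangular matrix,
    which yields the determinant.\<close>
  define A where "A = row_mat (\<lambda>i k. if k = i then 1 else if n \<le> i \<and> k = rv i then - 1 / (2 * s) else 0 :: Kbar)"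
  define B where "B = row_mat (\<lambda>i k. if k = i then 1 else if i < n \<and> k = rv i then s else 0 :: Kbar)"
  have c: "A \<in> carrier_mat M M" "B \<in> carrier_mat M M" by (simp_all add: A_def B_def)
  have "det A = prod_list (diag_mat A)"
    by (rule det_lower_triangular[OF _ c(1)]) (use M in \<open>auto simp: A_def row_mat_def rv_def\<close>)
  also have "\<dots> = 1" using c(1) by (simp add: prod_list_diag_prod A_def row_mat_def)
  finally have dA: "det A = 1" .
  have "upper_triangular B" using M by (auto simp: B_def row_mat_def rv_def upper_triangular_def)
  hence "det B = prod_list (diag_mat B)" using c(2) by (rule det_upper_triangular)
  also have "\<dots> = 1" using c(2) by (simp add: prod_list_diag_prod B_def row_mat_def)
  finally have dB: "det B = 1" .
  have "row_mat VC = A * B"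
  proof (rule eq_matI)
    fix i k assume "i < dim_row (A * B)" "k < dim_col (A * B)"
    hence ik: "i < M" "k < M" using c by auto
    have "(A * B) $$ (i, k) = (\<Sum>l<M. A $$ (i, l) * B $$ (l, k))" by (rule mult_mat_entry[OF c ik])
    also have "\<dots> = (\<Sum>l\<in>{i, rv i}. A $$ (i, l) * B $$ (l, k))"
      using ik by (intro sum.mono_neutral_right) (auto simp: A_def row_mat_def)
    also have "\<dots> = A $$ (i, i) * B $$ (i, k) + A $$ (i, rv i) * B $$ (rv i, k)"
      using r(1)[OF ik(1)] ik(1) by simp
    also have "\<dots> = VC i k"
    proof -
      have cases: "k = i \<or> k = rv i \<or> (k \<noteq> i \<and> k \<noteq> rv i)" by blast
      show ?thesis using cases r[OF ik(1)] ik unfolding VC_def A_def B_def row_mat_def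
        by (cases "i < n"; elim disjE) (simp_all add: field_simps)
    qed
    finally show "row_mat VC $$ (i, k) = (A * B) $$ (i, k)" using ik by (simp add: row_mat_def)
  qed (use c in \<open>auto simp: row_mat_def\<close>)
  thus ?thesis using det_mult[OF c] dA dB by simp
qed

lemma good_rows_exist: "\<exists>V m. good_rows V m \<and> det (row_mat V) = 1"
proof (cases "ty = Type_C")
  case True
  thus ?thesis using good_rows_C det_rows_C by blast
next
  case False
  thus ?thesis using fix_det[OF good_rows_BD] by blast
qed

lemma base_cocycle_exists:
  "\<exists>J m. J \<in> classical_group ty n \<and> (\<forall>i<M. \<forall>j<M. J $$ (i, j) \<in> L) \<and>
     map_mat \<sigma>0 J = J * monomial_mat M cpi m \<and> (\<forall>j<M. m j \<noteq> 0) \<and>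
     (ty = Type_D \<and> odd n \<longrightarrow> m (n - 1) = 1 \<and> m n = 1)"
proof -
  obtain V m where g: "good_rows V m" and d: "det (row_mat V) = 1" using good_rows_exist by blast
  have "row_mat V \<in> classical_group ty n" using form_rows[OF g] d by (simp add: classical_group_def)
  hence "transpose_mat (row_mat V) \<in> classical_group ty n" by (rule group_transpose)
  moreover have "map_mat \<sigma>0 (transpose_mat (row_mat V)) = transpose_mat (row_mat V) * monomial_mat M cpi m"
  proof (rule eq_matI)
    fix i j assume "i < dim_row (transpose_mat (row_mat V) * monomial_mat M cpi m)"
      "j < dim_col (transpose_mat (row_mat V) * monomial_mat M cpi m)"
    hence ij: "i < M" "j < M" by (auto simp: row_mat_def monomial_mat_def)
    have "(transpose_mat (row_mat V) * monomial_mat M cpi m) $$ (i, j) = transpose_mat (row_mat V) $$ (i, cpi j) * m j"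
      using ij cpi_lt by (intro mult_monomial) auto
    thus "map_mat \<sigma>0 (transpose_mat (row_mat V)) $$ (i, j) = (transpose_mat (row_mat V) * monomial_mat M cpi m) $$ (i, j)"
      using ij g cpi_lt(1)[OF ij(2)] by (simp add: row_mat_def good_rows_def mult.commute del: index_mult_mat(1))
  qed (auto simp: row_mat_def monomial_mat_def)
  ultimately show ?thesis using g
    by (intro exI[of _ "transpose_mat (row_mat V)"] exI[of _ m]) (auto simp: good_rows_def row_mat_def)
qed

lemma Gal_hom: "\<sigma> \<in> Gal F \<Longrightarrow> range to_ac \<subseteq> F \<Longrightarrow> comm_ring_hom \<sigma>"
  using Gal_field_hom GalD by unfold_locales auto

lemma \<sigma>0_ring_hom: "comm_ring_hom \<sigma>0" using Gal_hom[OF \<sigma>0] by blast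

lemma Gal_L_hom: "\<sigma> \<in> Gal L \<Longrightarrow> comm_ring_hom \<sigma>" using Gal_hom L_base by blast

lemma map_mult:
  assumes "comm_ring_hom f" "a \<in> carrier_mat M M" "b \<in> carrier_mat M M"
  shows "map_mat f (a * b) = map_mat f a * map_mat f (b :: Kbar mat)"
proof -
  interpret comm_ring_hom f by fact
  show ?thesis using assms by (intro mat_hom_mult)
qed

lemma to_ac_inj_hom: "inj_comm_ring_hom (to_ac :: K \<Rightarrow> Kbar)"
  by unfold_locales auto

lemma fixed_in_group_K:
  assumes Q: "Q \<in> classical_group ty n" and L: "\<And>\<sigma>. \<sigma> \<in> Gal L \<Longrightarrow> map_mat \<sigma> Q = Q" and 0: "map_mat \<sigma>0 Q = Q"
  shows "Q \<in> map_mat to_ac ` (classical_group ty n :: K mat set)"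
proof -
  note Qc = groupD(1)[OF Q]
  have ent: "Q $$ (i, j) \<in> range to_ac" if ij: "i < M" "j < M" for i j
  proof (rule fixed_in_K)
    show "Q $$ (i, j) \<in> L"
    proof (rule fixed_in_L)
      fix \<sigma> assume "\<sigma> \<in> Gal L"
      from L[OF this] have "map_mat \<sigma> Q $$ (i, j) = Q $$ (i, j)" by simp
      thus "\<sigma> (Q $$ (i, j)) = Q $$ (i, j)" using Qc ij by simp
    qed
    have "map_mat \<sigma>0 Q $$ (i, j) = Q $$ (i, j)" using 0 by simp
    thus "\<sigma>0 (Q $$ (i, j)) = Q $$ (i, j)" using Qc ij by simp
  qed
  define q where "q = map_mat of_ac Q"
  have q: "map_mat to_ac q = Q"
    using Qc ent by (intro eq_matI) (auto simp: q_def to_ac_of_ac)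
  moreover have "q \<in> classical_group ty n"
    using group_hom_iff[OF to_ac_inj_hom, of q] Q q Qc by (simp add: q_def)
  ultimately show ?thesis by blast
qed

text \<open>If the automorphisms multiply both elements by the same factor on the right, they fix
  the quotient Y1 Y2^{-1}, which therefore has entries in K.\<close>

lemma same_transform:
  assumes Y: "Y1 \<in> classical_group ty n" "Y2 \<in> classical_group ty n"
    and L: "\<And>\<sigma>. \<sigma> \<in> Gal L \<Longrightarrow> \<exists>u\<in>carrier_mat M M. map_mat \<sigma> Y1 = Y1 * u \<and> map_mat \<sigma> Y2 = Y2 * u"
    and 0: "\<exists>u\<in>carrier_mat M M. map_mat \<sigma>0 Y1 = Y1 * u \<and> map_mat \<sigma>0 Y2 = Y2 * u"
  shows "\<exists>Q\<in>map_mat to_ac ` (classical_group ty n :: K mat set). Y1 = Q * Y2"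
proof -
  let ?Q = "Y1 * the (mat_inverse Y2)"
  note c = groupD(1)[OF Y(1)] groupD(1)[OF Y(2)] and i = group_inverse[OF Y(2)]
  have Q: "?Q \<in> classical_group ty n" by (rule group_mult[OF Y(1) group_inverse_in[OF Y(2)]])
  note Qc = groupD(1)[OF Q]
  have QY: "?Q * Y2 = Y1" using c i by (simp add: mat_assoc)
  have fixed: "map_mat f ?Q = ?Q" if f: "comm_ring_hom f" and u: "u \<in> carrier_mat M M" "map_mat f Y1 = Y1 * u" "map_mat f Y2 = Y2 * u" for f u
  proof -
    have g2: "map_mat f Y2 \<in> classical_group ty n" by (rule group_hom[OF Y(2) f])
    note i2 = group_inverse[OF g2] and c2 = groupD(1)[OF g2]
    have fQ: "map_mat f ?Q \<in> carrier_mat M M" using Qc by simp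
    have "map_mat f ?Q * map_mat f Y2 = map_mat f Y1" using map_mult[OF f Qc c(2)] QY by simp
    also have "\<dots> = ?Q * Y2 * u" unfolding QY u(2) ..
    also have "\<dots> = ?Q * map_mat f Y2" unfolding u(3) using Qc c u(1) by (simp add: assoc_mult_mat[of _ M M _ M _ M])
    finally have "map_mat f ?Q * map_mat f Y2 * the (mat_inverse (map_mat f Y2)) = ?Q * map_mat f Y2 * the (mat_inverse (map_mat f Y2))"
      by simp
    moreover have "x * map_mat f Y2 * the (mat_inverse (map_mat f Y2)) = x" if "x \<in> carrier_mat M M" for x
      using that i2 c2 by (simp add: assoc_mult_mat[of _ M M _ M _ M])
    ultimately show ?thesis using fQ Qc by simp
  qed
  have "?Q \<in> map_mat to_ac ` (classical_group ty n :: K mat set)"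
  proof (rule fixed_in_group_K[OF Q])
    show "map_mat \<sigma> ?Q = ?Q" if s: "\<sigma> \<in> Gal L" for \<sigma>
      using L[OF s] fixed[OF Gal_L_hom[OF s]] by blast
    show "map_mat \<sigma>0 ?Q = ?Q" using 0 fixed[OF \<sigma>0_ring_hom] by blast
  qed
  thus ?thesis using QY by metis
qed

lemma sg_K: "sg i \<in> L" "\<sigma>0 (sg i) = sg i"
  using sg_cases[of i, where 'a=Kbar] L_simps(2,6) by (auto simp: \<sigma>0_hom)

lemma hom_sum: "\<sigma>0 (sum f A) = (\<Sum>x\<in>A. \<sigma>0 (f x))"
  by (induction A rule: infinite_finite_induct) (auto simp: \<sigma>0_hom)

lemma L_sum: "(\<And>x. x \<in> A \<Longrightarrow> f x \<in> L) \<Longrightarrow> sum f A \<in> L"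
  by (induction A rule: infinite_finite_induct) (auto simp: L_simps L_arith)

text \<open>The sesquilinear form of L over K made from the bilinear form and \<sigma>0, at (v, v).
  It is Hermitian in types B and D and skew-Hermitian in type C.\<close>

definition herm :: "(nat \<Rightarrow> Kbar) \<Rightarrow> Kbar" where
  "herm v = (\<Sum>k<M. v k * sg k * \<sigma>0 (v (rv k)))"

lemma herm_L:
  assumes v: "\<And>k. k < M \<Longrightarrow> v k \<in> L"
  shows "herm v \<in> L" "\<sigma>0 (herm v) = (if ty = Type_C then - herm v else herm v)"
proof -
  show "herm v \<in> L" unfolding herm_def using v \<sigma>0_\<sigma>0_L(2) sg_K
    by (intro L_sum L_arith(2)) auto
  have "\<sigma>0 (herm v) = (\<Sum>k<M. \<sigma>0 (v k) * sg k * v (rv k))"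
    unfolding herm_def hom_sum using v \<sigma>0_\<sigma>0_L(1) sg_K by (intro sum.cong refl) (simp add: \<sigma>0_hom)
  also have "\<dots> = (\<Sum>k<M. \<sigma>0 (v (rv k)) * sg (rv k) * v (rv (rv k)))" by (rule sum_rv[symmetric])
  also have "\<dots> = (\<Sum>k<M. (if ty = Type_C then - 1 else 1) * (v k * sg k * \<sigma>0 (v (rv k))))"
    by (intro sum.cong refl) (auto simp: sg_rv)
  also have "\<dots> = (if ty = Type_C then - 1 else 1) * herm v" unfolding herm_def by (rule sum_distrib_left[symmetric])
  finally show "\<sigma>0 (herm v) = (if ty = Type_C then - herm v else herm v)" by auto
qed

end

locale base_cocycle = twisted_setting +
  fixes J :: "Kbar mat" and m :: "nat \<Rightarrow> Kbar"
  assumes J: "J \<in> classical_group ty n" and J_L: "\<And>i j. i < M \<Longrightarrow> j < M \<Longrightarrow> J $$ (i, j) \<in> L"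
    and J_conj: "map_mat \<sigma>0 J = J * monomial_mat M cpi m"
    and m_nz: "\<And>j. j < M \<Longrightarrow> m j \<noteq> 0"
    and m_mid: "ty = Type_D \<Longrightarrow> odd n \<Longrightarrow> m (n - 1) = 1 \<and> m n = 1"
begin

lemma J_fixed: "\<sigma> \<in> Gal L \<Longrightarrow> map_mat \<sigma> J = J"
  using J_L groupD(1)[OF J] GalD(4) by (intro eq_matI) auto

lemma col_nonzero:
  assumes U: "(U :: Kbar mat) \<in> classical_group ty n" and j: "j < M"
  shows "\<exists>i<M. U $$ (i, j) \<noteq> 0"
proof (rule ccontr)
  assume "\<not> ?thesis"
  hence "(\<Sum>k<M. U $$ (k, j) * sg k * U $$ (rv k, rv j)) = 0" by (intro sum.neutral) auto
  with group_sum_cols[OF U j rv_lt[OF j]] show False by simp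
qed

lemma mult_diag:
  "U \<in> carrier_mat M M \<Longrightarrow> i < M \<Longrightarrow> j < M \<Longrightarrow> (U * diag_of d) $$ (i, j) = U $$ (i, j) * (d j :: Kbar)"
  unfolding diag_of_def by (rule mult_monomial) auto

lemma mult_cpi:
  "U \<in> carrier_mat M M \<Longrightarrow> i < M \<Longrightarrow> j < M \<Longrightarrow> (U * monomial_mat M cpi d) $$ (i, j) = U $$ (i, cpi j) * (d j :: Kbar)"
  using cpi_lt(1) by (intro mult_monomial) auto

text \<open>The conjugate of column j is \<open>c j\<close> times column \<open>rv j\<close>, so the
  value is \<open>c j\<close> times the bilinear pairing of these two columns, rescaled by the
  division by p.\<close>

lemma herm_col:
  assumes U: "U \<in> classical_group ty n" and j: "j < M" "cpi j = rv j"
    and 0: "map_mat \<sigma>0 U = U * monomial_mat M cpi c" and p: "p \<noteq> 0"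
  shows "herm (\<lambda>k. U $$ (k, j) / p) = c j * sg j / (p * \<sigma>0 p)"
proof -
  note Xc = groupD(1)[OF U]
  have e: "\<sigma>0 (U $$ (i, j)) = U $$ (i, rv j) * c j" if i: "i < M" for i
  proof -
    have "\<sigma>0 (U $$ (i, j)) = map_mat \<sigma>0 U $$ (i, j)" using Xc i j by simp
    thus ?thesis unfolding 0 mult_cpi[OF Xc i j(1)] j(2) .
  qed
  have "herm (\<lambda>k. U $$ (k, j) / p) = (\<Sum>k<M. (c j / (p * \<sigma>0 p)) * (U $$ (k, j) * sg k * U $$ (rv k, rv j)))"
    unfolding herm_def by (intro sum.cong refl) (simp add: \<sigma>0_hom e)
  also have "\<dots> = (c j / (p * \<sigma>0 p)) * sg j"
    unfolding sum_distrib_left[symmetric] group_sum_cols[OF U j(1) rv_lt[OF j(1)]] using j(1) by simp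
  finally show ?thesis by simp
qed

text \<open>A column of U divided by one of its entries p has coordinates in L. Comparing its
  Hermitian value with that of the column of J shows that d / (p \<sigma>0(p)) lies in K, so it is
  the norm of some l. Then D = p l satisfies D \<sigma>0(D) = d, and U with its columns divided by D
  transforms under all automorphisms exactly like J.\<close>

lemma normal_form:
  assumes U: "U \<in> classical_group ty n"
    and L: "\<And>\<sigma>. \<sigma> \<in> Gal L \<Longrightarrow> \<exists>d. torus d \<and> map_mat \<sigma> U = U * diag_of d"
    and 0: "\<exists>d. torus d \<and> map_mat \<sigma>0 U = U * monomial_mat M cpi (\<lambda>j. m j * d j)"
  shows "\<exists>Q\<in>map_mat to_ac ` (classical_group ty n :: K mat set). \<exists>D. torus D \<and> U = Q * J * diag_of D"
proof -
  note Xc = groupD(1)[OF U] and Jc = groupD(1)[OF J]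
  obtain d where d: "torus d" and d0: "map_mat \<sigma>0 U = U * monomial_mat M cpi (\<lambda>j. m j * d j)" using 0 by blast
  obtain c where c: "\<And>\<sigma>. \<sigma> \<in> Gal L \<Longrightarrow> torus (c \<sigma>) \<and> map_mat \<sigma> U = U * diag_of (c \<sigma>)" using L by metis
  obtain r where r: "\<And>j. j < M \<Longrightarrow> r j < M \<and> U $$ (r j, j) \<noteq> 0" using col_nonzero[OF U] by metis
  define p where "p j = U $$ (r j, j)" for j
  have p: "p j \<noteq> 0" if "j < M" for j using r[OF that] by (simp add: p_def)
  have eL: "\<sigma> (U $$ (i, j)) = U $$ (i, j) * c \<sigma> j" if "\<sigma> \<in> Gal L" "i < M" "j < M" for \<sigma> i j
  proof -
    have "\<sigma> (U $$ (i, j)) = map_mat \<sigma> U $$ (i, j)" using Xc that by simp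
    thus ?thesis using c[OF that(1)] mult_diag[OF Xc that(2,3)] by simp
  qed
  have e0: "\<sigma>0 (U $$ (i, j)) = U $$ (i, cpi j) * (m j * d j)" if "i < M" "j < M" for i j
  proof -
    have "\<sigma>0 (U $$ (i, j)) = map_mat \<sigma>0 U $$ (i, j)" using Xc that by simp
    thus ?thesis unfolding d0 mult_cpi[OF Xc that] .
  qed
  have nz: "d j \<noteq> 0" "\<sigma> \<in> Gal L \<Longrightarrow> c \<sigma> j \<noteq> 0" if "j < M" for j \<sigma>
    using d c that unfolding torus_def by force+
  have pL: "\<sigma> (p j) = p j * c \<sigma> j" if "\<sigma> \<in> Gal L" "j < M" for \<sigma> j
    unfolding p_def using eL that r by blast
  have VL: "U $$ (i, j) / p j \<in> L" if "i < M" "j < M" for i j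
  proof (rule fixed_in_L)
    fix \<sigma> assume s: "\<sigma> \<in> Gal L"
    show "\<sigma> (U $$ (i, j) / p j) = U $$ (i, j) / p j"
      unfolding Gal_field_hom(6)[OF s L_base] eL[OF s that] pL[OF s that(2)] using nz(2)[OF that(2) s] by simp
  qed
  \<comment> \<open>Only the indices below n are solved for; the torus relation determines the
    others. At an index fixed by \<open>cpi\<close> the equation is linear and p itself solves it,
    so l = 1.\<close>
  have "\<exists>l. l \<in> L \<and> l \<noteq> 0 \<and> (if cpi j = rv j then (p j * l) * \<sigma>0 (p j * l) = d j else \<sigma>0 (p j * l) = d j * (p j * l))"
    if j: "j < n" for j
  proof -
    have jM: "j < M" using j M_simps(3) by simp
    show ?thesis
    proof (cases "cpi j = rv j")
      case True
      let ?b = "herm (\<lambda>k. U $$ (k, j) / p j)" and ?b' = "herm (\<lambda>k. J $$ (k, j) / 1)"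
      have b: "?b = (m j * d j) * sg j / (p j * \<sigma>0 (p j))" by (rule herm_col[OF U jM True d0 p[OF jM]])
      have b': "?b' = m j * sg j / (1 * \<sigma>0 1)" by (rule herm_col[OF J jM True J_conj]) simp
      have sp: "\<sigma>0 (p j) \<noteq> 0" using p[OF jM] \<sigma>0_hom by simp
      have q: "?b / ?b' = d j / (p j * \<sigma>0 (p j))" unfolding b b' using m_nz[OF jM] by (simp add: \<sigma>0_hom)
      have hL: "?b \<in> L" "?b' \<in> L" using VL[OF _ jM] J_L[OF _ jM] by (auto intro!: herm_L(1))
      \<comment> \<open>In type C both values change sign under \<sigma>0, so the quotient is fixed
        in all types.\<close>
      have "\<sigma>0 ?b = (if ty = Type_C then - ?b else ?b)" "\<sigma>0 ?b' = (if ty = Type_C then - ?b' else ?b')"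
        by (rule herm_L(2), use VL[OF _ jM] J_L[OF _ jM] in simp)+
      hence "\<sigma>0 (?b / ?b') = ?b / ?b'" unfolding \<sigma>0_hom by simp
      hence K: "?b / ?b' \<in> range to_ac" using fixed_in_K L_simps(4)[OF hL] by blast
      have "?b / ?b' \<noteq> 0" unfolding q using nz(1)[OF jM] p[OF jM] sp by simp
      then obtain l where l: "l \<in> L" "l \<noteq> 0" "l * \<sigma>0 l = ?b / ?b'" using norm_surj[OF K] by blast
      have "(p j * l) * \<sigma>0 (p j * l) = p j * \<sigma>0 (p j) * (l * \<sigma>0 l)" by (simp add: \<sigma>0_hom)
      also have "\<dots> = d j" unfolding l(3) q using p[OF jM] sp by simp
      finally show ?thesis using l True by auto
    next
      case False
      hence D: "ty = Type_D" "odd n" "j \<in> {n - 1, n}" using cpi_simps(2)[of j] by auto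
      hence cj: "cpi j = j" by (intro cpi_simps(1)) simp
      have "m j = 1" using m_mid[OF D(1,2)] D(3) by auto
      hence "\<sigma>0 (p j) = d j * p j" using e0[of "r j" j] r[OF jM] jM cj by (simp add: p_def mult.commute)
      thus ?thesis using False L_simps(6) by (intro exI[of _ 1]) simp
    qed
  qed
  then obtain l where l: "\<And>j. j < n \<Longrightarrow> l j \<in> L \<and> l j \<noteq> 0 \<and>
    (if cpi j = rv j then (p j * l j) * \<sigma>0 (p j * l j) = d j else \<sigma>0 (p j * l j) = d j * (p j * l j))" by metis
  \<comment> \<open>The last alternative, 1, is the middle index of type B.\<close>
  define D where "D j = (if j < n then p j * l j else if M - n \<le> j then 1 / (p (rv j) * l (rv j)) else 1)" for j
  have jc: "j < n \<or> (M - n \<le> j \<and> rv j < n \<and> \<not> j < n) \<or> (ty = Type_B \<and> j = n)" if "j < M" for j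
    using that M_cases unfolding rv_def by auto
  have Dlo: "D j = p j * l j" "D j \<noteq> 0" "D (rv j) = 1 / D j" if j: "j < n" for j
  proof -
    have jM: "j < M" "\<not> rv j < n" "M - n \<le> rv j" using j M_simps(3) unfolding rv_def by auto
    show 1: "D j = p j * l j" using j by (simp add: D_def)
    thus "D j \<noteq> 0" using p[OF jM(1)] l[OF j] by simp
    show "D (rv j) = 1 / D j" using jM 1 by (simp add: D_def)
  qed
  have rvn: "rv n = n" "D n = 1" "cpi n = n" if B: "ty = Type_B"
  proof -
    have M: "M = 2 * n + 1" by (rule M_simps(1)[OF B])
    show 1: "rv n = n" unfolding rv_def M by simp
    show "D n = 1" unfolding D_def M by simp
    show "cpi n = n" using cpi_simps(2)[of n] B 1 by simp
  qed
  have torusD: "torus D" unfolding torus_def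
  proof (intro conjI allI impI)
    fix j assume j: "j < M"
    show "D j * D (rv j) = 1" using jc[OF j]
    proof (elim disjE conjE)
      assume "j < n" thus ?thesis using Dlo by simp
    next
      assume "rv j < n" thus ?thesis using Dlo(2,3)[of "rv j"] j by simp
    next
      assume "ty = Type_B" "j = n" thus ?thesis using rvn by simp
    qed
  qed (use rvn in simp)
  have Dnz: "D j \<noteq> 0" if "j < M" for j using torusD that unfolding torus_def by force
  have DL: "\<sigma> (D j) = D j * c \<sigma> j" if s: "\<sigma> \<in> Gal L" and j: "j < M" for \<sigma> j
  proof -
    note h = Gal_field_hom[OF s L_base] GalD(2-4)[OF s]
    have t: "torus (c \<sigma>)" using c[OF s] by blast
    have lo: "\<sigma> (D i) = D i * c \<sigma> i" if "i < n" for i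
    proof -
      have iM: "i < M" using that M_simps(3) by simp
      show ?thesis unfolding Dlo(1)[OF that] h pL[OF s iM] using h(11)[of "l i"] l[OF that] by simp
    qed
    show ?thesis using jc[OF j]
    proof (elim disjE conjE)
      assume "j < n" thus ?thesis by (rule lo)
    next
      assume i: "rv j < n"
      have "c \<sigma> j * c \<sigma> (rv j) = 1" using t j by (simp add: torus_def)
      hence "c \<sigma> j = 1 / c \<sigma> (rv j)" using nz(2)[OF rv_lt[OF j] s] by (simp add: field_simps)
      moreover have "D j = 1 / D (rv j)" using Dlo(3)[OF i] j by simp
      ultimately show ?thesis using lo[OF i] by (simp add: h)
    next
      assume B: "ty = Type_B" "j = n"
      have "c \<sigma> n = 1" using t B(1) unfolding torus_def by blast
      thus ?thesis unfolding B(2) rvn(2)[OF B(1)] by (simp add: h)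
    qed
  qed
  have D0: "\<sigma>0 (D j) = d j * D (cpi j)" if j: "j < M" for j
  proof -
    have lo: "\<sigma>0 (D i) = d i * D (cpi i)" if i: "i < n" for i
    proof (cases "cpi i = rv i")
      case True
      have "D i * \<sigma>0 (D i) = d i" using l[OF i] True by (simp add: Dlo(1)[OF i])
      thus ?thesis unfolding True Dlo(3)[OF i] using Dlo(2)[OF i] by (simp add: field_simps)
    next
      case False
      hence "cpi i = i" using cpi_simps[of i] by blast
      thus ?thesis using l[OF i] False by (simp add: Dlo(1)[OF i])
    qed
    show ?thesis using jc[OF j]
    proof (elim disjE conjE)
      assume "j < n" thus ?thesis by (rule lo)
    next
      assume i: "rv j < n"
      have "d j * d (rv j) = 1" using d j by (simp add: torus_def)
      hence dj: "d j = 1 / d (rv j)" using nz(1)[OF rv_lt[OF j]] by (simp add: field_simps)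
      have Dj: "D j = 1 / D (rv j)" using Dlo(3)[OF i] j by simp
      have "D (cpi (rv j)) * D (cpi j) = 1" using torusD cpi_lt(1)[OF j] unfolding cpi_rv[OF j] torus_def by (metis mult.commute)
      hence "D (cpi (rv j)) = 1 / D (cpi j)" using Dnz[OF cpi_lt(1)[OF j]] by (simp add: field_simps)
      thus ?thesis using lo[OF i] by (simp add: Dj dj \<sigma>0_hom)
    next
      assume B: "ty = Type_B" "j = n"
      have "d n = 1" using d B(1) unfolding torus_def by blast
      thus ?thesis unfolding B(2) rvn(3)[OF B(1)] rvn(2)[OF B(1)] by (simp add: \<sigma>0_hom)
    qed
  qed
  define D' where "D' j = 1 / D j" for j
  have torusD': "torus D'" using torusD unfolding torus_def D'_def by (auto simp: field_simps)
  let ?Y = "U * diag_of D'"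
  have Y: "?Y \<in> classical_group ty n" using torusD' by (intro group_mult[OF U]) (simp add: diag_of_group_iff)
  have Yc: "?Y \<in> carrier_mat M M" by (rule groupD(1)[OF Y])
  have Ye: "?Y $$ (i, j) = U $$ (i, j) / D j" if "i < M" "j < M" for i j
    using mult_diag[OF Xc that] by (simp add: D'_def)
  have mapY: "map_mat f ?Y $$ (i, j) = f (U $$ (i, j) / D j)" if "i < M" "j < M" for f i j
    unfolding Ye[OF that, symmetric] using Yc that by (intro index_map_mat(1)) auto
  have YL: "map_mat \<sigma> ?Y = ?Y" if s: "\<sigma> \<in> Gal L" for \<sigma>
  proof (rule eq_matI)
    fix i j assume "i < dim_row ?Y" "j < dim_col ?Y"
    hence ij: "i < M" "j < M" using Yc by auto
    have "\<sigma> (U $$ (i, j) / D j) = U $$ (i, j) / D j"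
      unfolding Gal_field_hom(6)[OF s L_base] eL[OF s ij] DL[OF s ij(2)] using nz(2)[OF ij(2) s] by simp
    thus "map_mat \<sigma> ?Y $$ (i, j) = ?Y $$ (i, j)" unfolding mapY[OF ij] Ye[OF ij] .
  qed auto
  have Y0: "map_mat \<sigma>0 ?Y = ?Y * monomial_mat M cpi m"
  proof (rule eq_matI)
    fix i j assume "i < dim_row (?Y * monomial_mat M cpi m)" "j < dim_col (?Y * monomial_mat M cpi m)"
    hence ij: "i < M" "j < M" using Yc by (auto simp: monomial_mat_def)
    have "map_mat \<sigma>0 ?Y $$ (i, j) = \<sigma>0 (U $$ (i, j) / D j)" by (rule mapY[OF ij])
    also have "\<dots> = U $$ (i, cpi j) * (m j * d j) / (d j * D (cpi j))"
      unfolding \<sigma>0_hom e0[OF ij] D0[OF ij(2)] ..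
    also have "\<dots> = U $$ (i, cpi j) / D (cpi j) * m j" using nz(1)[OF ij(2)] by simp
    finally show "map_mat \<sigma>0 ?Y $$ (i, j) = (?Y * monomial_mat M cpi m) $$ (i, j)"
      unfolding mult_cpi[OF Yc ij] Ye[OF ij(1) cpi_lt(1)[OF ij(2)]] .
  qed (use Yc in \<open>auto simp: monomial_mat_def\<close>)
  have "\<exists>Q\<in>map_mat to_ac ` (classical_group ty n :: K mat set). ?Y = Q * J"
  proof (rule same_transform[OF Y J])
    show "\<exists>u\<in>carrier_mat M M. map_mat \<sigma> ?Y = ?Y * u \<and> map_mat \<sigma> J = J * u" if "\<sigma> \<in> Gal L" for \<sigma>
      using YL[OF that] J_fixed[OF that] Yc Jc by (intro bexI[of _ "1\<^sub>m M"]) auto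
    show "\<exists>u\<in>carrier_mat M M. map_mat \<sigma>0 ?Y = ?Y * u \<and> map_mat \<sigma>0 J = J * u"
      using Y0 J_conj by (intro bexI[of _ "monomial_mat M cpi m"]) auto
  qed
  then obtain Q where Q: "Q \<in> map_mat to_ac ` (classical_group ty n :: K mat set)" "?Y = Q * J" by blast
  have "U = ?Y * diag_of D"
  proof (rule eq_matI)
    fix i j assume "i < dim_row (?Y * diag_of D)" "j < dim_col (?Y * diag_of D)"
    hence ij: "i < M" "j < M" using Yc by (auto simp: diag_of_def monomial_mat_def)
    show "U $$ (i, j) = (?Y * diag_of D) $$ (i, j)"
      unfolding mult_diag[OF Yc ij] Ye[OF ij] using Dnz[OF ij(2)] by simp
  qed (use Xc Yc in \<open>auto simp: diag_of_def monomial_mat_def\<close>)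
  thus ?thesis using Q torusD by metis
qed

end

section \<open>Counting the classes\<close>

context twisted_setting
begin

abbreviation GK :: "Kbar mat set" where
  "GK \<equiv> map_mat to_ac ` (classical_group ty n :: K mat set)"

lemma GK_group: "Q \<in> GK \<Longrightarrow> Q \<in> classical_group ty n"
  using group_hom[OF _ inj_comm_ring_hom.axioms(1)[OF to_ac_inj_hom]] by blast

lemma to_ac_hom: "comm_ring_hom (to_ac :: K \<Rightarrow> Kbar)"
  by (rule inj_comm_ring_hom.axioms(1)[OF to_ac_inj_hom])

lemma map_to_ac_mult:
  assumes "a \<in> carrier_mat M M" "b \<in> carrier_mat M M"
  shows "map_mat to_ac (a * b) = map_mat to_ac a * map_mat to_ac (b :: K mat)"
proof -
  interpret comm_ring_hom "to_ac :: K \<Rightarrow> Kbar" by (rule to_ac_hom)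
  show ?thesis using assms by (intro mat_hom_mult)
qed

lemma GK_mult: assumes "Q \<in> GK" "Q' \<in> GK" shows "Q * Q' \<in> GK"
proof -
  obtain a b where ab: "a \<in> classical_group ty n" "b \<in> classical_group ty n" "Q = map_mat to_ac a" "Q' = map_mat to_ac b"
    using assms by blast
  show ?thesis unfolding ab(3,4) map_to_ac_mult[OF groupD(1)[OF ab(1)] groupD(1)[OF ab(2)], symmetric]
    by (rule imageI[OF group_mult[OF ab(1,2)]])
qed

lemma map_one: "comm_ring_hom f \<Longrightarrow> map_mat f (1\<^sub>m M) = 1\<^sub>m M"
proof -
  assume "comm_ring_hom f"
  then interpret comm_ring_hom f .
  show "map_mat f (1\<^sub>m M) = 1\<^sub>m M" by (rule eq_matI) auto
qed

lemma one_in_group: "(1\<^sub>m M :: 'a :: field mat) \<in> classical_group ty n"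
proof -
  have "(diag_of (\<lambda>_. 1) :: 'a mat) \<in> classical_group ty n" by (simp add: diag_of_group_iff torus_def)
  moreover have "(diag_of (\<lambda>_. 1) :: 'a mat) = 1\<^sub>m M" by (rule eq_matI) (auto simp: diag_of_entry diag_of_def monomial_mat_def)
  ultimately show ?thesis by simp
qed

lemma GK_one: "1\<^sub>m M \<in> GK"
  using one_in_group map_one[OF to_ac_hom] by (metis image_eqI)

lemma GK_inverse: assumes "Q \<in> GK" shows "\<exists>Q'\<in>GK. Q' * Q = 1\<^sub>m M"
proof -
  obtain a where a: "a \<in> classical_group ty n" "Q = map_mat to_ac a" using assms by blast
  note c = groupD(1)[OF a(1)] groupD(1)[OF group_inverse_in[OF a(1)]]
  have "map_mat to_ac (the (mat_inverse a)) * Q = 1\<^sub>m M"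
    unfolding a(2) using map_to_ac_mult[OF c(2,1)] group_inverse[OF a(1)] map_one[OF to_ac_hom] by simp
  thus ?thesis using group_inverse_in[OF a(1)] by blast
qed

lemma map_GK: "Q \<in> GK \<Longrightarrow> \<sigma> \<in> Gal (range to_ac) \<Longrightarrow> map_mat \<sigma> Q = Q"
  using Gal_K_to_ac by (auto intro!: eq_matI)

lemma inverse_mult_map:
  assumes x: "x \<in> classical_group ty n" and u: "u \<in> carrier_mat M M" "y = x * u"
  shows "the (mat_inverse x) * y = (u :: 'a :: field mat)"
  unfolding u(2) using group_inverse[OF x] groupD(1)[OF x] u(1) by (intro mult_cancel_mat) auto

lemma cpi_B: "ty = Type_B \<Longrightarrow> cpi n = n"
proof -
  assume B: "ty = Type_B"
  have "rv n = n" unfolding rv_def M_simps(1)[OF B] by simp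
  thus ?thesis unfolding cpi_def by simp
qed

lemma torus_cpi: "torus d \<Longrightarrow> torus (\<lambda>j. d (cpi j))"
  unfolding torus_def using cpi_lt(1) cpi_rv cpi_B by auto

lemma torus_mult: "torus d \<Longrightarrow> torus d' \<Longrightarrow> torus (\<lambda>j. d j * d' j :: 'a :: field)"
proof -
  assume d: "torus d" "torus d'"
  have "d i * d' i * (d (rv i) * d' (rv i)) = d i * d (rv i) * (d' i * d' (rv i))" for i by (simp only: ac_simps)
  thus ?thesis using d unfolding torus_def by (simp only:) simp
qed

lemma torus_inverse: "torus d \<Longrightarrow> torus (\<lambda>j. 1 / d j :: 'a :: field)"
  unfolding torus_def by (auto simp: field_simps)

lemma torus_div: "torus d \<Longrightarrow> torus d' \<Longrightarrow> torus (\<lambda>j. d j / d' j :: 'a :: field)"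
  using torus_mult[OF _ torus_inverse, of d d'] by simp

lemma torus_Gal: assumes "torus d" "\<sigma> \<in> Gal F" "range to_ac \<subseteq> F" shows "torus (\<lambda>j. \<sigma> (d j))"
  using assms(1) GalD(3)[OF assms(2), symmetric] Gal_field_hom(2)[OF assms(2,3)] unfolding torus_def by simp

lemma torus_one: "torus (\<lambda>_. 1)" by (simp add: torus_def)

lemma torus_nonzero: "torus d \<Longrightarrow> j < M \<Longrightarrow> d j \<noteq> (0 :: 'a :: field)"
  unfolding torus_def by force

end

locale cocycle_setting = base_cocycle ty n s \<sigma>0 J m + bd_data ty n e W \<rho> r0 r
  for ty :: classical_type and n :: nat and s :: Kbar and \<sigma>0 :: "Kbar \<Rightarrow> Kbar" and J :: "Kbar mat"
    and m :: "nat \<Rightarrow> Kbar" and e :: "lattice_elt \<Rightarrow> Kbar mat" and W :: "(lattice_elt \<times> lattice_elt) set"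
    and \<rho> :: "lattice_elt \<Rightarrow> int" and r0 r :: "Kbar tensor" +
  assumes conj: "\<exists>x\<in>classical_group ty n. Ad_tensor x r = flip r"
begin

abbreviation mono :: "(nat \<Rightarrow> Kbar) \<Rightarrow> Kbar mat" where "mono \<equiv> monomial_mat M cpi"
abbreviation A where "A \<equiv> twisted_cocycles ty n s \<sigma>0 r"
abbreviation R where "R \<equiv> twisted_equiv ty n s \<sigma>0 r"

text \<open>The matrix \<open>mono m\<close> is the quotient of \<sigma>0(J) by J and lies in the
  group. Multiplying x by its inverse moves the antidiagonal to the diagonal and keeps the middle
  block, so that \<open>block_diag_diagonal\<close> applies.\<close>

lemma flip_form:
  assumes x: "x \<in> classical_group ty n" and Ad: "Ad_tensor x r = flip r"
  shows "\<exists>d. torus d \<and> x = mono (\<lambda>j. m j * d j)"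
proof -
  note Jc = groupD(1)[OF J] and xc = groupD(1)[OF x]
  have "the (mat_inverse J) * map_mat \<sigma>0 J = mono m" by (rule inverse_mult_map[OF J _ J_conj]) simp
  hence P: "mono m \<in> classical_group ty n"
    using group_mult[OF group_inverse_in[OF J] group_hom[OF J \<sigma>0_ring_hom]] by simp
  let ?i = "the (mat_inverse (mono m))"
  have i: "?i = mono (\<lambda>j. 1 / m (cpi j))" using cpi_lt m_nz by (intro monomial_inverse(1)) auto
  have xi: "x * ?i \<in> classical_group ty n" by (rule group_mult[OF x group_inverse_in[OF P]])
  have "\<exists>d. torus d \<and> x * ?i = diag_of d"
  proof (rule block_diag_diagonal[OF xi])
    fix a b assume ab: "a < M" "b < M" "a \<noteq> b" "\<not> in_block a b"
    have "cpi b \<noteq> rv a \<and> \<not> in_block a (cpi b)"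
    proof (cases "cpi b = rv b")
      case True thus ?thesis using ab in_block_rv(2) by simp
    next
      case False
      hence b: "cpi b = b" "ty = Type_D" "b \<in> {n - 1, n}" using cpi_simps[of b] by blast+
      have "in_block b b" unfolding in_block_def using b by blast
      hence "in_block (rv b) b" using in_block_rv(1)[OF ab(2)] by blast
      hence "b \<noteq> rv a" using ab by (metis rv_rv)
      thus ?thesis using b(1) ab(4) by simp
    qed
    hence "x $$ (a, cpi b) = 0" using flipping_shape[OF x Ad ab(1) cpi_lt(1)[OF ab(2)]] by blast
    thus "(x * ?i) $$ (a, b) = 0" unfolding i mult_cpi[OF xc ab(1,2)] by simp
  qed
  then obtain d where d: "torus d" "x * ?i = diag_of d" by blast
  have "x = x * ?i * mono m" using xc group_inverse[OF P] groupD(1)[OF P] by (simp add: assoc_mult_mat[of _ M M _ M _ M])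
  also have "\<dots> = mono (\<lambda>j. m j * d (cpi j))" unfolding d(2)
  proof (rule eq_matI)
    fix i j assume "i < dim_row (mono (\<lambda>j. m j * d (cpi j)))" "j < dim_col (mono (\<lambda>j. m j * d (cpi j)))"
    hence ij: "i < M" "j < M" by (auto simp: monomial_mat_def)
    show "(diag_of d * mono m) $$ (i, j) = mono (\<lambda>j. m j * d (cpi j)) $$ (i, j)"
      unfolding mult_cpi[OF diag_of_carrier ij] using ij cpi_lt(1)[OF ij(2)]
      by (simp add: diag_of_entry monomial_mat_def)
  qed (auto simp: monomial_mat_def diag_of_def)
  finally show ?thesis using torus_cpi[OF d(1)] by blast
qed

text \<open>The flipping elements form one coset of C(r), so a single one of them reduces the
  condition at \<sigma>0 to membership in C(r).\<close>

lemma flip_mult: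
  assumes a: "\<And>j. j < M \<Longrightarrow> a j \<noteq> 0" and d: "torus d" and fa: "Ad_tensor (mono a) r = flip r"
  shows "Ad_tensor (mono (\<lambda>j. a j * d j)) r = flip r \<longleftrightarrow> Ad_tensor (diag_of d) r = r"
proof -
  have ratio: "(a * d * (a' * d')) / (b * e * (b' * e')) * x = (a * a') / (b * b') * ((d * d') / (e * e') * x)"
    for a a' b b' d d' e e' x :: Kbar by (simp add: divide_inverse)
  note nz = torus_nonzero[OF d] and fr = flip_carrier[OF r_carrier]
  have ia: "Ad_tensor (mono a) r = flip r \<longleftrightarrow> (\<forall>i<M. \<forall>j<M. \<forall>k<M. \<forall>l<M.
    flip r $$ (cpi i, cpi j) $$ (cpi k, cpi l) = (a i * a k) / (a j * a l) * r $$ (i, j) $$ (k, l))"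
    by (rule Ad_tensor_monomial_eq_iff[OF _ _ _ r_carrier fr]) (use cpi_lt a in auto)
  have iad: "Ad_tensor (mono (\<lambda>j. a j * d j)) r = flip r \<longleftrightarrow> (\<forall>i<M. \<forall>j<M. \<forall>k<M. \<forall>l<M.
    flip r $$ (cpi i, cpi j) $$ (cpi k, cpi l) = (a i * d i * (a k * d k)) / (a j * d j * (a l * d l)) * r $$ (i, j) $$ (k, l))"
    by (rule Ad_tensor_monomial_eq_iff[OF _ _ _ r_carrier fr]) (use cpi_lt a nz in auto)
  have id: "Ad_tensor (diag_of d) r = r \<longleftrightarrow> (\<forall>i<M. \<forall>j<M. \<forall>k<M. \<forall>l<M.
    r $$ (i, j) $$ (k, l) = (d i * d k) / (d j * d l) * r $$ (i, j) $$ (k, l))"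
    unfolding diag_of_def by (rule Ad_tensor_monomial_eq_iff[OF _ _ _ r_carrier r_carrier]) (use nz in auto)
  have eq: "flip r $$ (cpi i, cpi j) $$ (cpi k, cpi l) = (a i * d i * (a k * d k)) / (a j * d j * (a l * d l)) * r $$ (i, j) $$ (k, l)
    \<longleftrightarrow> r $$ (i, j) $$ (k, l) = (d i * d k) / (d j * d l) * r $$ (i, j) $$ (k, l)"
    if "i < M" "j < M" "k < M" "l < M" for i j k l
  proof -
    have f: "flip r $$ (cpi i, cpi j) $$ (cpi k, cpi l) = (a i * a k) / (a j * a l) * r $$ (i, j) $$ (k, l)"
      using fa that unfolding ia by blast
    have q: "(a i * d i * (a k * d k)) / (a j * d j * (a l * d l)) * r $$ (i, j) $$ (k, l) =
      (a i * a k) / (a j * a l) * ((d i * d k) / (d j * d l) * r $$ (i, j) $$ (k, l))"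
      by (rule ratio)
    have "(a i * a k) / (a j * a l) \<noteq> 0" using a that by simp
    thus ?thesis unfolding f q by (rule mult_left_cancel)
  qed
  show ?thesis unfolding iad id by (simp only: eq cong: imp_cong)
qed

lemma normal_maps:
  assumes Q: "Q \<in> GK"
  shows "Q * J \<in> classical_group ty n" "\<sigma> \<in> Gal L \<Longrightarrow> map_mat \<sigma> (Q * J) = Q * J"
    "map_mat \<sigma>0 (Q * J) = Q * J * mono m"
proof -
  note Jc = groupD(1)[OF J] and Qc = groupD(1)[OF GK_group[OF Q]]
  show "Q * J \<in> classical_group ty n" by (rule group_mult[OF GK_group[OF Q] J])
  show "map_mat \<sigma> (Q * J) = Q * J" if "\<sigma> \<in> Gal L"
    unfolding map_mult[OF Gal_L_hom[OF that] Qc Jc] J_fixed[OF that] using map_GK[OF Q] Gal_L_K that by auto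
  show "map_mat \<sigma>0 (Q * J) = Q * J * mono m"
    unfolding map_mult[OF \<sigma>0_ring_hom Qc Jc] J_conj map_GK[OF Q \<sigma>0]
    by (rule assoc_mult_mat[symmetric, OF Qc Jc monomial_carrier])
qed

lemma normal_entry:
  assumes "Q \<in> GK" "i < M" "j < M"
  shows "(Q * J * diag_of D) $$ (i, j) = (Q * J) $$ (i, j) * D j"
    "\<sigma> \<in> Gal L \<Longrightarrow> \<sigma> ((Q * J) $$ (i, j)) = (Q * J) $$ (i, j)"
    "\<sigma>0 ((Q * J) $$ (i, j)) = (Q * J) $$ (i, cpi j) * m j"
proof -
  note N = normal_maps[OF assms(1)] and Nc = groupD(1)[OF normal_maps(1)[OF assms(1)]]
  show "(Q * J * diag_of D) $$ (i, j) = (Q * J) $$ (i, j) * D j" by (rule mult_diag[OF Nc assms(2,3)])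
  have e: "map_mat f (Q * J) $$ (i, j) = f ((Q * J) $$ (i, j))" for f
    using Nc assms(2,3) by (intro index_map_mat(1)) auto
  show "\<sigma> ((Q * J) $$ (i, j)) = (Q * J) $$ (i, j)" if "\<sigma> \<in> Gal L"
    unfolding e[of \<sigma>, symmetric] N(2)[OF that] ..
  show "\<sigma>0 ((Q * J) $$ (i, j)) = (Q * J) $$ (i, cpi j) * m j"
    unfolding e[of \<sigma>0, symmetric] N(3) by (rule mult_cpi[OF Nc assms(2,3)])
qed

lemma normal_group: "Q \<in> GK \<Longrightarrow> torus D \<Longrightarrow> Q * J * diag_of D \<in> classical_group ty n"
  by (intro group_mult[OF normal_maps(1)]) (simp_all add: diag_of_group_iff)

text \<open>The factor Q is fixed by all automorphisms involved and cancels, and J only contributes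
  \<open>mono m\<close>. Both cocycle conditions thereby become conditions on the diagonal
  factor.\<close>

lemma cocycle_iff:
  assumes Q: "Q \<in> GK" and D: "torus D"
  shows "Q * J * diag_of D \<in> A \<longleftrightarrow> (\<forall>\<sigma>\<in>Gal L. Ad_tensor (diag_of (\<lambda>j. \<sigma> (D j) / D j)) r = r) \<and>
    Ad_tensor (mono (\<lambda>j. m j * (\<sigma>0 (D j) / D (cpi j)))) r = flip r"
proof -
  let ?X = "Q * J * diag_of D"
  note X = normal_group[OF Q D] and nz = torus_nonzero[OF D]
  note Xc = groupD(1)[OF X]
  have mapX: "map_mat f ?X $$ (i, j) = f ((Q * J) $$ (i, j) * D j)" if "i < M" "j < M" for f i j
    unfolding normal_entry(1)[OF Q that, symmetric] using Xc that by (intro index_map_mat(1)) auto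
  have L: "the (mat_inverse ?X) * map_mat \<sigma> ?X = diag_of (\<lambda>j. \<sigma> (D j) / D j)" if s: "\<sigma> \<in> Gal L" for \<sigma>
  proof (rule inverse_mult_map[OF X diag_of_carrier], rule eq_matI)
    fix i j assume "i < dim_row (?X * diag_of (\<lambda>j. \<sigma> (D j) / D j))" "j < dim_col (?X * diag_of (\<lambda>j. \<sigma> (D j) / D j))"
    hence ij: "i < M" "j < M" using Xc by (auto simp: diag_of_def monomial_mat_def)
    show "map_mat \<sigma> ?X $$ (i, j) = (?X * diag_of (\<lambda>j. \<sigma> (D j) / D j)) $$ (i, j)"
      unfolding mapX[OF ij] mult_diag[OF Xc ij] normal_entry(1)[OF Q ij] GalD(3)[OF s] normal_entry(2)[OF Q ij s]
      using nz[OF ij(2)] by simp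
  qed (use Xc in \<open>auto simp: diag_of_def monomial_mat_def\<close>)
  have 0: "the (mat_inverse ?X) * map_mat \<sigma>0 ?X = mono (\<lambda>j. m j * (\<sigma>0 (D j) / D (cpi j)))" (is "_ = mono ?u")
  proof (rule inverse_mult_map[OF X monomial_carrier], rule eq_matI)
    fix i j assume "i < dim_row (?X * mono ?u)" "j < dim_col (?X * mono ?u)"
    hence ij: "i < M" "j < M" using Xc by (auto simp: monomial_mat_def)
    show "map_mat \<sigma>0 ?X $$ (i, j) = (?X * mono ?u) $$ (i, j)"
      unfolding mapX[OF ij] mult_cpi[OF Xc ij] normal_entry(1)[OF Q ij(1) cpi_lt(1)[OF ij(2)]] \<sigma>0_hom normal_entry(3)[OF Q ij]
      using nz[OF cpi_lt(1)[OF ij(2)]] by simp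
  qed (use Xc in \<open>auto simp: monomial_mat_def\<close>)
  have "torus (\<lambda>j. \<sigma> (D j) / D j)" if "\<sigma> \<in> Gal L" for \<sigma>
    by (rule torus_div[OF torus_Gal[OF D that L_base] D])
  thus ?thesis using X L 0 by (auto simp: twisted_cocycles_def bd_centralizer_def diag_of_group_iff)
qed

lemma cocycle_form:
  assumes x: "x \<in> A"
  shows "\<exists>Q\<in>GK. \<exists>D. torus D \<and> x = Q * J * diag_of D"
proof (rule normal_form)
  show xG: "x \<in> classical_group ty n" using x by (simp add: twisted_cocycles_def)
  have c: "x * (the (mat_inverse x) * y) = y" if "y \<in> carrier_mat M M" for y
    using group_inverse[OF xG] groupD(1)[OF xG] that by (simp add: assoc_mult_mat[of _ M M _ M _ M, symmetric])
  note xc = groupD(1)[OF xG]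
  show "\<exists>d. torus d \<and> map_mat \<sigma> x = x * diag_of d" if "\<sigma> \<in> Gal L" for \<sigma>
  proof -
    have "the (mat_inverse x) * map_mat \<sigma> x \<in> bd_centralizer ty n r" using x that by (simp add: twisted_cocycles_def)
    then obtain d where "torus d" "the (mat_inverse x) * map_mat \<sigma> x = diag_of d"
      using centralizer_torus unfolding bd_centralizer_def by blast
    thus ?thesis using c[of "map_mat \<sigma> x"] xc by auto
  qed
  have "the (mat_inverse x) * map_mat \<sigma>0 x \<in> classical_group ty n"
    by (rule group_mult[OF group_inverse_in[OF xG] group_hom[OF xG \<sigma>0_ring_hom]])
  moreover have "Ad_tensor (the (mat_inverse x) * map_mat \<sigma>0 x) r = flip r" using x by (simp add: twisted_cocycles_def)
  ultimately obtain d where "torus d" "the (mat_inverse x) * map_mat \<sigma>0 x = mono (\<lambda>j. m j * d j)" using flip_form by blast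
  thus "\<exists>d. torus d \<and> map_mat \<sigma>0 x = x * mono (\<lambda>j. m j * d j)" using c[of "map_mat \<sigma>0 x"] xc by auto
qed

text \<open>The diagonal matrices E are those for which J E = P J with P in G(K), that is, the
  K-points of the torus twisted by J. Equivalence means that D1 / D2 is a product of such an E and
  an element of C(r).\<close>

lemma equiv_iff:
  assumes Q: "Q1 \<in> GK" "Q2 \<in> GK" and D: "torus D1" "torus D2"
    and A: "Q1 * J * diag_of D1 \<in> A" "Q2 * J * diag_of D2 \<in> A"
  shows "(Q1 * J * diag_of D1, Q2 * J * diag_of D2) \<in> R \<longleftrightarrow>
    (\<exists>E. torus E \<and> (\<forall>j<M. E j \<in> L \<and> \<sigma>0 (E j) = E (cpi j)) \<and>
      Ad_tensor (diag_of (\<lambda>j. D1 j / D2 j / E j)) r = r)" (is "?l \<longleftrightarrow> ?r")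
proof
  assume ?l
  then obtain q c where q: "q \<in> GK" and c: "c \<in> bd_centralizer ty n r"
    and eq: "Q1 * J * diag_of D1 = q * (Q2 * J * diag_of D2) * c"
    unfolding twisted_equiv_def by auto
  obtain d where d: "torus d" "c = diag_of d" using centralizer_torus c unfolding bd_centralizer_def by blast
  define E where "E j = D1 j / D2 j / d j" for j
  have tE: "torus E" unfolding E_def using torus_div[OF torus_div[OF D] d(1)] .
  have nz: "D1 j \<noteq> 0" "D2 j \<noteq> 0" "d j \<noteq> 0" "E j \<noteq> 0" if "j < M" for j using torus_nonzero that D d(1) tE by blast+
  define P where "P = q * Q2"
  have P: "P \<in> GK" unfolding P_def by (rule GK_mult[OF q Q(2)])
  note Jc = groupD(1)[OF J] and qc = groupD(1)[OF GK_group[OF q]] and Q2c = groupD(1)[OF GK_group[OF Q(2)]]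
  have "q * (Q2 * J * diag_of D2) = P * J * diag_of D2"
    unfolding P_def using Jc qc Q2c by (simp add: assoc_mult_mat[of _ M M _ M _ M])
  hence eq': "Q1 * J * diag_of D1 = P * J * diag_of D2 * diag_of d" using eq d(2) by simp
  have PE: "(P * J) $$ (i, j) = (Q1 * J) $$ (i, j) * E j" if ij: "i < M" "j < M" for i j
  proof -
    have "(Q1 * J * diag_of D1) $$ (i, j) = (P * J * diag_of D2 * diag_of d) $$ (i, j)" unfolding eq' ..
    hence "(Q1 * J) $$ (i, j) * D1 j = (P * J) $$ (i, j) * D2 j * d j"
      unfolding mult_diag[OF groupD(1)[OF normal_group[OF P D(2)]] ij] normal_entry(1)[OF Q(1) ij] normal_entry(1)[OF P ij] .
    thus ?thesis using nz[OF ij(2)] by (simp add: E_def field_simps)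
  qed
  have EL: "E j \<in> L" if j: "j < M" for j
  proof (rule fixed_in_L)
    fix \<sigma> assume s: "\<sigma> \<in> Gal L"
    obtain i where i: "i < M" "(Q1 * J) $$ (i, j) \<noteq> 0" using col_nonzero[OF normal_maps(1)[OF Q(1)] j] by blast
    have "\<sigma> ((P * J) $$ (i, j)) = (P * J) $$ (i, j)" by (rule normal_entry(2)[OF P i(1) j s])
    hence "(Q1 * J) $$ (i, j) * \<sigma> (E j) = (Q1 * J) $$ (i, j) * E j"
      unfolding PE[OF i(1) j] GalD(3)[OF s] normal_entry(2)[OF Q(1) i(1) j s] .
    thus "\<sigma> (E j) = E j" using i(2) by simp
  qed
  have E0: "\<sigma>0 (E j) = E (cpi j)" if j: "j < M" for j
  proof -
    note cj = cpi_lt(1)[OF j]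
    obtain i where i: "i < M" "(Q1 * J) $$ (i, cpi j) \<noteq> 0" using col_nonzero[OF normal_maps(1)[OF Q(1)] cj] by blast
    have "\<sigma>0 ((P * J) $$ (i, j)) = (P * J) $$ (i, cpi j) * m j" by (rule normal_entry(3)[OF P i(1) j])
    hence "(Q1 * J) $$ (i, cpi j) * m j * \<sigma>0 (E j) = (Q1 * J) $$ (i, cpi j) * E (cpi j) * m j"
      unfolding PE[OF i(1) j] PE[OF i(1) cj] \<sigma>0_hom normal_entry(3)[OF Q(1) i(1) j] .
    thus ?thesis using i(2) m_nz[OF j] by simp
  qed
  have "diag_of (\<lambda>j. D1 j / D2 j / E j) = diag_of d"
    by (rule eq_matI) (use nz in \<open>auto simp: diag_of_def monomial_mat_def E_def\<close>)
  hence "Ad_tensor (diag_of (\<lambda>j. D1 j / D2 j / E j)) r = r" using c d(2) by (simp add: bd_centralizer_def)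
  thus ?r using tE EL E0 by blast
next
  assume ?r
  then obtain E where E: "torus E" "\<And>j. j < M \<Longrightarrow> E j \<in> L \<and> \<sigma>0 (E j) = E (cpi j)"
    and c: "Ad_tensor (diag_of (\<lambda>j. D1 j / D2 j / E j)) r = r" by blast
  define d where "d j = D1 j / D2 j / E j" for j
  have td: "torus d" unfolding d_def using torus_div[OF torus_div[OF D] E(1)] .
  have nz: "D1 j \<noteq> 0" "D2 j \<noteq> 0" "E j \<noteq> 0" if "j < M" for j using torus_nonzero that D E(1) by blast+
  note Jc = groupD(1)[OF J]
  let ?Y = "J * diag_of E"
  have Y: "?Y \<in> classical_group ty n" using E(1) by (intro group_mult[OF J]) (simp add: diag_of_group_iff)
  note Yc = groupD(1)[OF Y]
  have mapY: "map_mat f ?Y $$ (i, j) = f (J $$ (i, j) * E j)" if "i < M" "j < M" for f i j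
    unfolding mult_diag[OF Jc that, symmetric] using Yc that by (intro index_map_mat(1)) auto
  have "\<exists>P\<in>GK. ?Y = P * J"
  proof (rule same_transform[OF Y J])
    fix \<sigma> assume s: "\<sigma> \<in> Gal L"
    have "map_mat \<sigma> ?Y = ?Y"
    proof (rule eq_matI)
      fix i j assume "i < dim_row ?Y" "j < dim_col ?Y"
      hence ij: "i < M" "j < M" using Yc by auto
      show "map_mat \<sigma> ?Y $$ (i, j) = ?Y $$ (i, j)"
        unfolding mapY[OF ij] mult_diag[OF Jc ij] using GalD(3,4)[OF s] E(2)[OF ij(2)] J_L[OF ij] by simp
    qed auto
    thus "\<exists>u\<in>carrier_mat M M. map_mat \<sigma> ?Y = ?Y * u \<and> map_mat \<sigma> J = J * u"
      using J_fixed[OF s] right_mult_one_mat[OF Yc] right_mult_one_mat[OF Jc] one_carrier_mat by metis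
  next
    have "map_mat \<sigma>0 ?Y = ?Y * mono m"
    proof (rule eq_matI)
      fix i j assume "i < dim_row (?Y * mono m)" "j < dim_col (?Y * mono m)"
      hence ij: "i < M" "j < M" using Yc by (auto simp: monomial_mat_def)
      have "\<sigma>0 (J $$ (i, j)) = map_mat \<sigma>0 J $$ (i, j)" using Jc ij by simp
      also have "\<dots> = J $$ (i, cpi j) * m j" unfolding J_conj by (rule mult_cpi[OF Jc ij])
      finally show "map_mat \<sigma>0 ?Y $$ (i, j) = (?Y * mono m) $$ (i, j)"
        unfolding mapY[OF ij] mult_cpi[OF Yc ij] mult_diag[OF Jc ij(1) cpi_lt(1)[OF ij(2)]] \<sigma>0_hom
        using E(2)[OF ij(2)] by simp
    qed (use Yc in \<open>auto simp: monomial_mat_def\<close>)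
    thus "\<exists>u\<in>carrier_mat M M. map_mat \<sigma>0 ?Y = ?Y * u \<and> map_mat \<sigma>0 J = J * u"
      using J_conj by (intro bexI[of _ "mono m"]) auto
  qed
  then obtain P where P: "P \<in> GK" "?Y = P * J" by blast
  obtain Q' where Q': "Q' \<in> GK" "Q' * Q2 = 1\<^sub>m M" using GK_inverse[OF Q(2)] by blast
  note cs = Jc groupD(1)[OF GK_group[OF P(1)]] groupD(1)[OF GK_group[OF Q(1)]] groupD(1)[OF GK_group[OF Q(2)]]
    groupD(1)[OF GK_group[OF Q'(1)]] diag_of_carrier
  have "Q1 * P * Q' * (Q2 * J * diag_of D2) * diag_of d = Q1 * P * (Q' * Q2) * J * diag_of D2 * diag_of d"
    using cs by (simp add: assoc_mult_mat[of _ M M _ M _ M])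
  also have "\<dots> = Q1 * ?Y * diag_of D2 * diag_of d"
    unfolding Q'(2) P(2) using cs by (simp add: assoc_mult_mat[of _ M M _ M _ M])
  also have "\<dots> = Q1 * J * diag_of E * diag_of D2 * diag_of d"
    using cs by (simp add: assoc_mult_mat[of _ M M _ M _ M])
  also have "\<dots> = Q1 * J * diag_of D1"
  proof (rule eq_matI)
    fix i j assume "i < dim_row (Q1 * J * diag_of D1)" "j < dim_col (Q1 * J * diag_of D1)"
    hence ij: "i < M" "j < M" using cs by (auto simp: diag_of_def monomial_mat_def)
    have c1: "Q1 * J \<in> carrier_mat M M" "Q1 * J * diag_of E \<in> carrier_mat M M" "Q1 * J * diag_of E * diag_of D2 \<in> carrier_mat M M"
      by (rule mult_carrier_mat[OF mult_carrier_mat[OF cs(3,1)] diag_of_carrier]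
          mult_carrier_mat[OF cs(3,1)]
          mult_carrier_mat[OF mult_carrier_mat[OF mult_carrier_mat[OF cs(3,1)] diag_of_carrier] diag_of_carrier])+
    show "(Q1 * J * diag_of E * diag_of D2 * diag_of d) $$ (i, j) = (Q1 * J * diag_of D1) $$ (i, j)"
      unfolding mult_diag[OF c1(1) ij] mult_diag[OF c1(2) ij] mult_diag[OF c1(3) ij]
      using nz[OF ij(2)] by (simp add: d_def)
  qed (use cs in \<open>auto simp: diag_of_def monomial_mat_def\<close>)
  finally have eq: "Q1 * J * diag_of D1 = Q1 * P * Q' * (Q2 * J * diag_of D2) * diag_of d" ..
  have "Q1 * P * Q' \<in> GK" by (intro GK_mult Q P Q')
  moreover have "diag_of d \<in> bd_centralizer ty n r" using td c unfolding bd_centralizer_def diag_of_group_iff[symmetric] d_def by blast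
  ultimately show ?l unfolding twisted_equiv_def using A eq by blast
qed

lemma card_empty:
  assumes W: "W = {}"
  shows "card (twisted_cohomology ty n s \<sigma>0 r) = 1"
proof -
  have cent: "Ad_tensor (diag_of d) r = r" if "torus d" for d using torus_centralizes_iff[OF that] W by simp
  obtain x where x: "x \<in> classical_group ty n" "Ad_tensor x r = flip r" using conj by blast
  obtain d where d: "torus d" "x = mono (\<lambda>j. m j * d j)" using flip_form[OF x] by blast
  have nz: "m j * d j \<noteq> 0" "d j \<noteq> 0" if "j < M" for j using torus_nonzero[OF d(1) that] m_nz[OF that] by simp_all
  \<comment> \<open>Every diagonal group element fixes r, so the given flipping element may be
    changed into \<open>mono m\<close>, and J itself is a cocycle.\<close>
  have "Ad_tensor (mono (\<lambda>j. m j * d j * (1 / d j))) r = flip r"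
    using flip_mult[of "\<lambda>j. m j * d j", OF nz(1) torus_inverse[OF d(1)]] x(2) d(2) cent[OF torus_inverse[OF d(1)]] by blast
  moreover have "mono (\<lambda>j. m j * d j * (1 / d j)) = mono (\<lambda>j. m j * (\<sigma>0 1 / 1))"
    by (rule eq_matI) (use nz(2) in \<open>auto simp: monomial_mat_def \<sigma>0_hom\<close>)
  moreover have "Ad_tensor (diag_of (\<lambda>j. \<sigma> 1 / 1)) r = r" if "\<sigma> \<in> Gal L" for \<sigma>
    by (rule cent) (simp add: Gal_field_hom[OF that L_base] torus_one)
  ultimately have "1\<^sub>m M * J * diag_of (\<lambda>_. 1) \<in> A"
    using cocycle_iff[OF GK_one torus_one] by simp
  then obtain x0 where x0: "x0 \<in> A" by blast
  have all: "(x, y) \<in> R" if xy: "x \<in> A" "y \<in> A" for x y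
  proof -
    obtain Q1 D1 where 1: "Q1 \<in> GK" "torus D1" "x = Q1 * J * diag_of D1" using cocycle_form[OF xy(1)] by blast
    obtain Q2 D2 where 2: "Q2 \<in> GK" "torus D2" "y = Q2 * J * diag_of D2" using cocycle_form[OF xy(2)] by blast
    have "Ad_tensor (diag_of (\<lambda>j. D1 j / D2 j / 1)) r = r" by (rule cent) (simp add: torus_div 1 2)
    thus ?thesis unfolding 1(3) 2(3) using xy 1 2 torus_one L_simps(6)
      by (subst equiv_iff) (auto intro!: exI[of _ "\<lambda>_. 1"] simp: \<sigma>0_hom)
  qed
  have "R `` {x} = A" if "x \<in> A" for x using all[OF that] by (auto simp: twisted_equiv_def)
  hence "A // R = {A}" using x0 by (auto simp: quotient_def)
  thus ?thesis by (simp add: twisted_cohomology_def)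
qed

end

lemma card_two_classes:
  assumes R: "\<And>x y. (x, y) \<in> R \<longleftrightarrow> (x \<in> A0 \<and> y \<in> A0) \<or> (x \<in> A1 \<and> y \<in> A1)"
    and A: "A = A0 \<union> A1" "A0 \<inter> A1 = {}" "A0 \<noteq> {}" "A1 \<noteq> {}"
  shows "card (A // R) = 2"
proof -
  have "R `` {x} = A0" if "x \<in> A0" for x using that R A(2) by blast
  moreover have "R `` {x} = A1" if "x \<in> A1" for x using that R A(2) by blast
  ultimately have "A // R = {A0, A1}" using A(1,3,4) unfolding quotient_def by blast
  moreover have "A0 \<noteq> A1" using A(2,3) by auto
  ultimately show ?thesis by simp
qed

locale odd_D_setting = cocycle_setting ty n s \<sigma>0 J m e W \<rho> r0 r + type_D_case ty n p q S \<Gamma>1 \<tau>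
  for ty :: classical_type and n :: nat and s :: Kbar and \<sigma>0 :: "Kbar \<Rightarrow> Kbar" and J :: "Kbar mat"
    and m :: "nat \<Rightarrow> Kbar" and e :: "lattice_elt \<Rightarrow> Kbar mat" and W :: "(lattice_elt \<times> lattice_elt) set"
    and \<rho> :: "lattice_elt \<Rightarrow> int" and r0 r :: "Kbar tensor" and p q :: nat and S :: "nat set"
    and \<Gamma>1 :: "nat set" and \<tau> :: "nat \<Rightarrow> nat" +
  assumes odd_n: "odd n" and W_wedges: "W = wedges"
begin

lemma cpi_rvD: "cpi = rvD"
  unfolding cpi_def rvD_def using D odd_n by metis

lemma K_closed: "x \<in> range to_ac \<Longrightarrow> y \<in> range to_ac \<Longrightarrow> x * y \<in> range (to_ac :: K \<Rightarrow> Kbar)"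
  "x \<in> range to_ac \<Longrightarrow> y \<in> range to_ac \<Longrightarrow> x / y \<in> range (to_ac :: K \<Rightarrow> Kbar)"
  by (auto simp flip: to_ac_mult to_ac_divide)

lemma S_unique: "k \<in> S \<Longrightarrow> 1 \<le> k \<and> k \<le> n - 2" "k \<in> S \<Longrightarrow> k' \<in> S \<Longrightarrow> k = k'"
  using case_S by auto

lemma cent_iff: "torus d \<Longrightarrow> Ad_tensor (diag_of d) r = r \<longleftrightarrow>
    d (n - 1) * d (n - 1) = 1 \<and> (\<forall>k\<in>S. d (k - 1) / d k = d (n - 2) * d (n - 1))"
  using centralizes_iff bd_data_axioms unfolding W_wedges by blast

lemma cpi_mid: "cpi (n - 1) = n - 1" "cpi n = n" "j \<noteq> n - 1 \<Longrightarrow> j \<noteq> n \<Longrightarrow> cpi j = rv j"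
  unfolding cpi_rvD rvD_def by simp_all

text \<open>The factor \<open>m j\<close> is the Hermitian value of column j of J, and in type D
  such values are fixed by \<sigma>0.\<close>

lemma m_in_K:
  assumes j: "j < M" "j \<noteq> n - 1" "j \<noteq> n"
  shows "m j \<in> range to_ac"
proof -
  have h: "herm (\<lambda>k. J $$ (k, j) / 1) = m j * sg j / (1 * \<sigma>0 1)"
    by (rule herm_col[OF J j(1) cpi_mid(3)[OF j(2,3)] J_conj]) simp
  have sg: "(sg j :: Kbar) = 1" unfolding sg_def using D by simp
  have v: "\<And>k. k < M \<Longrightarrow> J $$ (k, j) / 1 \<in> L" using J_L j(1) by simp
  have nC: "ty \<noteq> Type_C" unfolding D by simp
  have hm: "herm (\<lambda>k. J $$ (k, j) / 1) = m j" unfolding h sg by (simp add: \<sigma>0_hom)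
  show ?thesis using fixed_in_K[of "m j"] herm_L(1)[of "\<lambda>k. J $$ (k, j) / 1", OF v]
      herm_L(2)[of "\<lambda>k. J $$ (k, j) / 1", OF v] nC unfolding hm by simp
qed

lemma S_index: assumes "k \<in> S"
  shows "k - 1 < M" "k < M" "k - 1 \<noteq> n - 1" "k - 1 \<noteq> n" "k \<noteq> n - 1" "k \<noteq> n" "n - 2 \<noteq> n - 1" "n - 2 \<noteq> n" "n - 2 < M"
    "k - 1 \<noteq> k" "k - 1 \<noteq> n - 2" "Suc (k - 1) = k" "Suc k \<notin> S" "Suc (rv (k - 1)) \<notin> S" "Suc (rv k) \<notin> S"
proof -
  have k: "1 \<le> k" "k \<le> n - 2" using S_unique(1)[OF assms] by auto
  show "k - 1 < M" "k < M" "k - 1 \<noteq> n - 1" "k - 1 \<noteq> n" "k \<noteq> n - 1" "k \<noteq> n" "n - 2 \<noteq> n - 1" "n - 2 \<noteq> n" "n - 2 < M"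
    "k - 1 \<noteq> k" "k - 1 \<noteq> n - 2" "Suc (k - 1) = k"
    using k n3 M2n by linarith+
  show "Suc k \<notin> S" using S_unique(2)[OF assms, of "Suc k"] by auto
  show "Suc (rv (k - 1)) \<notin> S" "Suc (rv k) \<notin> S"
    using k n3 S_unique(1) unfolding rv_def M2n by force+
qed

text \<open>The character of \<alpha>_k divided by the coordinate of index n-2. It separates the
  condition for C(r) at the intermediate node from the entry at n-1, and it is multiplicative in
  d.\<close>

definition ratio :: "(nat \<Rightarrow> Kbar) \<Rightarrow> nat \<Rightarrow> Kbar" where
  "ratio d k = d (k - 1) / (d k * d (n - 2))"

lemma ratio_div: "ratio (\<lambda>j. f j / g j) k = ratio f k / ratio g k"
  by (simp add: ratio_def)

lemma cent_ratio:
  assumes d: "torus d"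
  shows "Ad_tensor (diag_of d) r = r \<longleftrightarrow> d (n - 1) * d (n - 1) = 1 \<and> (\<forall>k\<in>S. ratio d k = d (n - 1))"
proof -
  have "d (k - 1) / d k = d (n - 2) * d (n - 1) \<longleftrightarrow> ratio d k = d (n - 1)" if k: "k \<in> S" for k
    using torus_nonzero[OF d S_index(2)[OF k]] torus_nonzero[OF d S_index(9)[OF k]]
    by (simp add: ratio_def field_simps)
  thus ?thesis unfolding cent_iff[OF d] by blast
qed

text \<open>The constant \<open>\<kappa>\<close> is what a fixed flipping element contributes at the
  intermediate node. It lies in K because the coordinates of r compared in
  \<open>flipping_entries\<close> and the factors \<open>m j\<close> do.\<close>

lemma flip_element:
  "\<exists>d \<kappa>. torus d \<and> Ad_tensor (mono (\<lambda>j. m j * d j)) r = flip r \<and> d (n - 1) * d (n - 1) = 1 \<and>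
     (\<forall>k\<in>S. \<kappa> \<in> range to_ac \<and> \<kappa> \<noteq> 0 \<and> d (n - 1) * ratio d k = \<kappa>)"
proof -
  obtain x where x: "x \<in> classical_group ty n" "Ad_tensor x r = flip r" using conj by blast
  obtain d where d: "torus d" "x = mono (\<lambda>j. m j * d j)" using flip_form[OF x] by blast
  let ?a = "\<lambda>j. m j * d j"
  have nz: "?a j \<noteq> 0" if "j < M" for j using m_nz[OF that] torus_nonzero[OF d(1) that] by simp
  have f: "Ad_tensor (monomial_mat M rvD ?a) r = flip r" using x d(2) unfolding cpi_rvD by simp
  have bd: "bd_data ty n e wedges \<rho> r0 r" using bd_data_axioms unfolding W_wedges .
  have mm: "m (n - 1) = 1" "m n = 1" using m_mid[OF D odd_n] by auto
  have nd: "d (n - 1) \<noteq> 0" using torus_nonzero[OF d(1)] n3 M2n by simp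
  have "?a (n - 1) = ?a n" by (rule flipping_entries(1)[OF bd nz f])
  hence dn: "d (n - 1) = d n" using mm by simp
  hence sq: "d (n - 1) * d (n - 1) = 1" using torus_D[OF d(1)] nd by (metis nonzero_eq_divide_eq)
  have dp: "m p * d p = d (n - 1)" using pq(1) mm dn by auto
  have "d (n - 1) * ratio d k \<in> range to_ac \<and> d (n - 1) * ratio d k \<noteq> 0" if k: "k \<in> S" for k
  proof -
    note i = S_index[OF k]
    have K: "m p * d p * (m (k - 1) * d (k - 1)) / (m (n - 2) * d (n - 2) * (m k * d k)) \<in> range to_ac"
      by (rule flipping_entries(2)[OF bd nz f k])
    have mK: "m (k - 1) \<in> range to_ac" "m k \<in> range to_ac" "m (n - 2) \<in> range to_ac"
      using m_in_K i by blast+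
    have mz: "m (k - 1) \<noteq> 0" "m k \<noteq> 0" "m (n - 2) \<noteq> 0" using m_nz i by blast+
    have dz: "d (k - 1) \<noteq> 0" "d k \<noteq> 0" "d (n - 2) \<noteq> 0" using torus_nonzero[OF d(1)] i by blast+
    have eq: "d (n - 1) * ratio d k = m p * d p * (m (k - 1) * d (k - 1)) / (m (n - 2) * d (n - 2) * (m k * d k)) * (m (n - 2) * m k / m (k - 1))"
      unfolding dp ratio_def using mz dz by (simp add: field_simps)
    have "d (n - 1) * ratio d k \<in> range to_ac"
      unfolding eq by (rule K_closed(1)[OF K K_closed(2)[OF K_closed(1)[OF mK(3,2)] mK(1)]])
    moreover have "d (n - 1) * ratio d k \<noteq> 0" using nd dz by (simp add: ratio_def)
    ultimately show ?thesis by blast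
  qed
  hence "\<exists>\<kappa>. \<forall>k\<in>S. \<kappa> \<in> range to_ac \<and> \<kappa> \<noteq> 0 \<and> d (n - 1) * ratio d k = \<kappa>"
    using S_unique(2) by metis
  thus ?thesis using d(1) x(2) sq unfolding d(2) by blast
qed

text \<open>Off the middle \<open>cpi\<close> inverts the entries of D, so that in \<sigma>0(D j) /
  D (cpi j) the ratio enters through its product with its conjugate. The two middle entries are
  kept, so w = D (n-1) enters through \<sigma>0(w) / w. Comparison with a fixed flipping element d
  produces \<open>\<kappa>\<close>.\<close>

lemma cocycle_condition:
  "\<exists>\<kappa>. (\<forall>k\<in>S. \<kappa> \<in> range to_ac \<and> \<kappa> \<noteq> 0) \<and> (\<forall>Q\<in>GK. \<forall>D. torus D \<longrightarrow>
     (Q * J * diag_of D \<in> A \<longleftrightarrow> D (n - 1) * D (n - 1) \<in> range to_ac \<and>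
       (\<forall>k\<in>S. ratio D k / D (n - 1) \<in> L \<and> ratio D k * \<sigma>0 (ratio D k) * D (n - 1) = \<kappa> * \<sigma>0 (D (n - 1)))))"
proof -
  obtain d \<kappa> where d: "torus d" and fd: "Ad_tensor (mono (\<lambda>j. m j * d j)) r = flip r"
    and sq: "d (n - 1) * d (n - 1) = 1"
    and \<kappa>: "\<And>k. k \<in> S \<Longrightarrow> \<kappa> \<in> range to_ac \<and> \<kappa> \<noteq> 0 \<and> d (n - 1) * ratio d k = \<kappa>"
    using flip_element by blast
  have n1: "n - 1 < M" using n3 M2n by simp
  have "Q * J * diag_of D \<in> A \<longleftrightarrow> D (n - 1) * D (n - 1) \<in> range to_ac \<and>
       (\<forall>k\<in>S. ratio D k / D (n - 1) \<in> L \<and> ratio D k * \<sigma>0 (ratio D k) * D (n - 1) = \<kappa> * \<sigma>0 (D (n - 1)))"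
    if Q: "Q \<in> GK" and D: "torus D" for Q D
  proof -
    let ?w = "D (n - 1)"
    have nz: "D j \<noteq> 0" "d j \<noteq> 0" "\<sigma>0 (D j) \<noteq> 0" if "j < M" for j
      using torus_nonzero[OF D that] torus_nonzero[OF d that] \<sigma>0_hom by simp_all
    have sq_iff: "x / y * (x / y) = 1 \<longleftrightarrow> x * x = y * y" if "y \<noteq> 0" for x y :: Kbar
      using that by (simp add: field_simps)
    have GL: "Ad_tensor (diag_of (\<lambda>j. \<sigma> (D j) / D j)) r = r \<longleftrightarrow>
      \<sigma> (?w * ?w) = ?w * ?w \<and> (\<forall>k\<in>S. \<sigma> (ratio D k / ?w) = ratio D k / ?w)" if s: "\<sigma> \<in> Gal L" for \<sigma>
    proof -
      note h = GalD(3)[OF s] Gal_field_hom[OF s L_base]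
      have t: "torus (\<lambda>j. \<sigma> (D j) / D j)" by (rule torus_div[OF torus_Gal[OF D s L_base] D])
      have "ratio (\<lambda>j. \<sigma> (D j) / D j) k = \<sigma> ?w / ?w \<longleftrightarrow> \<sigma> (ratio D k / ?w) = ratio D k / ?w" if k: "k \<in> S" for k
      proof -
        note i = S_index[OF k]
        have r: "ratio D k \<noteq> 0" "\<sigma> ?w \<noteq> 0" using nz i(1,2,9) n1 h by (simp_all add: ratio_def)
        have "ratio (\<lambda>j. \<sigma> (D j) / D j) k = \<sigma> (ratio D k) / ratio D k"
          using nz i(1,2,9) by (simp add: ratio_def h)
        thus ?thesis using r nz(1)[OF n1] by (simp add: h frac_eq_eq mult.commute)
      qed
      thus ?thesis unfolding cent_ratio[OF t] sq_iff[OF nz(1)[OF n1]] h by blast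
    qed
    \<comment> \<open>The factor by which the cocycle at \<sigma>0 differs from the fixed flipping
      element; the condition is that it lies in C(r).\<close>
    define u where "u j = \<sigma>0 (D j) / D (cpi j) / d j" for j
    have u: "torus u" unfolding u_def
      by (rule torus_div[OF torus_div[OF torus_Gal[OF D \<sigma>0 subset_refl] torus_cpi[OF D]] d])
    have "mono (\<lambda>j. m j * (\<sigma>0 (D j) / D (cpi j))) = mono (\<lambda>j. m j * d j * u j)"
      by (rule eq_matI) (use nz in \<open>auto simp: monomial_mat_def u_def\<close>)
    hence "Ad_tensor (mono (\<lambda>j. m j * (\<sigma>0 (D j) / D (cpi j)))) r = flip r \<longleftrightarrow> Ad_tensor (diag_of u) r = r"
      using flip_mult[of "\<lambda>j. m j * d j", OF _ u fd] m_nz nz(2) by simp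
    also have "\<dots> \<longleftrightarrow> \<sigma>0 (?w * ?w) = ?w * ?w \<and>
      (\<forall>k\<in>S. ratio D k * \<sigma>0 (ratio D k) * ?w = \<kappa> * \<sigma>0 ?w)"
    proof -
      have u1: "u (n - 1) = \<sigma>0 ?w / (?w * d (n - 1))" unfolding u_def cpi_mid by simp
      have dd: "y * d (n - 1) * (y * d (n - 1)) = y * y" for y
        using sq by (metis mult.assoc mult.left_commute mult.right_neutral)
      have "u (n - 1) * u (n - 1) = 1 \<longleftrightarrow> \<sigma>0 (?w * ?w) = ?w * ?w"
      proof -
        have "?w * d (n - 1) \<noteq> 0" using nz(1,2)[OF n1] by simp
        from sq_iff[OF this] show ?thesis unfolding u1 \<sigma>0_hom dd .
      qed
      moreover have "ratio u k = u (n - 1) \<longleftrightarrow> ratio D k * \<sigma>0 (ratio D k) * ?w = \<kappa> * \<sigma>0 ?w" if k: "k \<in> S" for k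
      proof -
        note i = S_index[OF k]
        have c: "D (cpi j) = 1 / D j" if "j < M" "j \<noteq> n - 1" "j \<noteq> n" for j
        proof -
          have "D j * D (rv j) = 1" using D that by (simp add: torus_def)
          thus ?thesis unfolding cpi_mid(3)[OF that(2,3)] using nz(1)[OF that(1)] by (simp add: field_simps)
        qed
        have uj: "u j = D j * \<sigma>0 (D j) / d j" if "j < M" "j \<noteq> n - 1" "j \<noteq> n" for j
          unfolding u_def c[OF that] by simp
        have ru: "ratio u k = ratio D k * \<sigma>0 (ratio D k) / ratio d k"
          unfolding ratio_def uj[OF i(1,3,4)] uj[OF i(2,5,6)] uj[OF i(9,7,8)] \<sigma>0_hom
          using nz i(1,2,9) by simp
        have rd: "ratio d k \<noteq> 0" using nz(2) i(1,2,9) by (simp add: ratio_def)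
        have k': "\<kappa> = d (n - 1) * ratio d k" using \<kappa>[OF k] by simp
        have di: "1 / d (n - 1) = d (n - 1)" using sq nz(2)[OF n1] by (simp add: field_simps)
        have "\<sigma>0 ?w / (?w * d (n - 1)) = \<sigma>0 ?w / ?w * (1 / d (n - 1))" by simp
        hence u1': "u (n - 1) = \<sigma>0 ?w / ?w * d (n - 1)" unfolding u1 di .
        show ?thesis unfolding ru u1' k' using rd nz(1)[OF n1] by (simp add: field_simps)
      qed
      ultimately show ?thesis unfolding cent_ratio[OF u] by blast
    qed
    finally have 0: "Ad_tensor (mono (\<lambda>j. m j * (\<sigma>0 (D j) / D (cpi j)))) r = flip r \<longleftrightarrow>
      \<sigma>0 (?w * ?w) = ?w * ?w \<and> (\<forall>k\<in>S. ratio D k * \<sigma>0 (ratio D k) * ?w = \<kappa> * \<sigma>0 ?w)" .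
    have LK: "(\<forall>\<sigma>\<in>Gal L. \<sigma> x = x) \<longleftrightarrow> x \<in> L" for x using fixed_in_L GalD(4) by blast
    have K: "x \<in> range to_ac \<longleftrightarrow> x \<in> L \<and> \<sigma>0 x = x" for x using fixed_in_K L_base by auto
    have "(\<forall>\<sigma>\<in>Gal L. Ad_tensor (diag_of (\<lambda>j. \<sigma> (D j) / D j)) r = r) \<longleftrightarrow>
      (\<forall>\<sigma>\<in>Gal L. \<sigma> (?w * ?w) = ?w * ?w) \<and> (\<forall>k\<in>S. \<forall>\<sigma>\<in>Gal L. \<sigma> (ratio D k / ?w) = ratio D k / ?w)"
      using GL by blast
    thus ?thesis unfolding cocycle_iff[OF Q D] 0 LK K[of "?w * ?w"] by blast
  qed
  thus ?thesis using \<kappa> by blast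
qed

text \<open>A torus element with prescribed entry w at n-1 and prescribed ratio f. The ratio uses
  the indices k-1, k and n-2, so it suffices to put f at k-1, where \<open>Suc j\<close> is in
  \<open>S\<close>, and 1/f at the mirror index.\<close>

definition two_torus :: "Kbar \<Rightarrow> Kbar \<Rightarrow> nat \<Rightarrow> Kbar" where
  "two_torus w f j = (if j = n - 1 then w else if j = n then 1 / w
     else if Suc j \<in> S then f else if Suc (rv j) \<in> S then 1 / f else 1)"

lemma two_torus_rv:
  assumes j: "j < M" "j \<noteq> n - 1" "j \<noteq> n"
  shows "two_torus w f (rv j) = 1 / two_torus w f j"
proof -
  have rn: "rv j \<noteq> n - 1" "rv j \<noteq> n" using j rv_mid by (metis rv_rv)+
  have "\<not> (Suc j \<in> S \<and> Suc (rv j) \<in> S)" using S_index(14)[of "Suc j"] by auto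
  thus ?thesis unfolding two_torus_def using rn j by auto
qed

lemma two_torus:
  assumes "w \<noteq> 0" "f \<noteq> 0"
  shows "torus (two_torus w f)" "two_torus w f (n - 1) = w" "k \<in> S \<Longrightarrow> ratio (two_torus w f) k = f"
proof -
  have n1: "n - 1 \<noteq> n" using n3 by simp
  have nzz: "two_torus w f j \<noteq> 0" for j using assms by (simp add: two_torus_def)
  show w: "two_torus w f (n - 1) = w" by (simp add: two_torus_def)
  have wn: "two_torus w f n = 1 / w" using n1 by (simp add: two_torus_def)
  show "torus (two_torus w f)" unfolding torus_def
  proof (intro conjI allI impI)
    fix j assume j: "j < M"
    have "j = n - 1 \<or> j = n \<or> (j \<noteq> n - 1 \<and> j \<noteq> n)" by blast
    thus "two_torus w f j * two_torus w f (rv j) = 1"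
    proof (elim disjE conjE)
      assume j: "j = n - 1" show ?thesis unfolding j rv_mid w wn using assms by simp
    next
      assume j: "j = n" show ?thesis unfolding j rv_mid w wn using assms by simp
    next
      assume "j \<noteq> n - 1" "j \<noteq> n" thus ?thesis using two_torus_rv[OF j] nzz[of j] by simp
    qed
  qed (simp add: D)
  assume k: "k \<in> S"
  note i = S_index[OF k]
  have 1: "two_torus w f (k - 1) = f" unfolding two_torus_def by (simp only: i(3,4,12) k if_True if_False)
  have 2: "two_torus w f k = 1" unfolding two_torus_def by (simp only: i(5,6,13,15) if_False)
  have "Suc (n - 2) \<notin> S" "Suc (rv (n - 2)) \<notin> S" using S_unique(1)[of "Suc (n - 2)"] S_unique(1)[of "Suc (n + 1)"] unfolding rv_mid(9) by force+
  hence 3: "two_torus w f (n - 2) = 1" unfolding two_torus_def by (simp only: i(7,8) if_False)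
  show "ratio (two_torus w f) k = f" unfolding ratio_def 1 2 3 by simp
qed

lemma two_torus_fixed:
  assumes w: "w \<in> range to_ac" and f: "f \<in> L" "f * \<sigma>0 f = 1" and j: "j < M"
  shows "two_torus w f j \<in> L \<and> \<sigma>0 (two_torus w f j) = two_torus w f (cpi j)"
proof -
  have wL: "w \<in> L" "\<sigma>0 w = w" using w L_base by auto
  have f0: "f \<noteq> 0" using f(2) by auto
  hence f1: "\<sigma>0 f = 1 / f" using f(2) by (metis nonzero_eq_divide_eq mult.commute)
  have L: "two_torus w f j \<in> L" unfolding two_torus_def using wL f L_simps by auto
  have n1: "n - 1 \<noteq> n" using n3 by simp
  have "j = n - 1 \<or> j = n \<or> (j \<noteq> n - 1 \<and> j \<noteq> n)" by blast
  hence "\<sigma>0 (two_torus w f j) = two_torus w f (cpi j)"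
  proof (elim disjE conjE)
    assume j: "j = n - 1" show ?thesis unfolding j cpi_mid using wL by (simp add: two_torus_def)
  next
    assume j: "j = n" show ?thesis unfolding j cpi_mid using wL n1 by (simp add: two_torus_def \<sigma>0_hom)
  next
    assume jn: "j \<noteq> n - 1" "j \<noteq> n"
    show ?thesis unfolding cpi_mid(3)[OF jn] two_torus_rv[OF j jn]
      unfolding two_torus_def using jn f0 f1 by (auto simp: \<sigma>0_hom)
  qed
  thus ?thesis using L by blast
qed

lemma card_odd_D: "card (twisted_cohomology ty n s \<sigma>0 r) = 2"
proof -
  have n1: "n - 1 < M" using n3 M2n by simp
  obtain \<kappa> where \<kappa>: "\<And>k. k \<in> S \<Longrightarrow> \<kappa> \<in> range to_ac \<and> \<kappa> \<noteq> 0" and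
    coc: "\<And>Q D. Q \<in> GK \<Longrightarrow> torus D \<Longrightarrow> Q * J * diag_of D \<in> A \<longleftrightarrow> D (n - 1) * D (n - 1) \<in> range to_ac \<and>
       (\<forall>k\<in>S. ratio D k / D (n - 1) \<in> L \<and> ratio D k * \<sigma>0 (ratio D k) * D (n - 1) = \<kappa> * \<sigma>0 (D (n - 1)))"
    using cocycle_condition by blast
  \<comment> \<open>With N(g) = \<kappa> / w^2 the element f = g w satisfies f \<sigma>0(f) w =
    \<kappa> \<sigma>0(w), as the condition at \<sigma>0 demands.\<close>
  have ex: "\<exists>D. torus D \<and> D (n - 1) = w \<and> 1\<^sub>m M * J * diag_of D \<in> A"
    if w: "w \<noteq> 0" "w \<in> L" "w * w \<in> range to_ac" for w
  proof -
    have "\<exists>f. f \<in> L \<and> f \<noteq> 0 \<and> (S \<noteq> {} \<longrightarrow> f * \<sigma>0 f * w = \<kappa> * \<sigma>0 w)"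
    proof (cases "S = {}")
      case True thus ?thesis using L_simps(6) by (intro exI[of _ 1]) simp
    next
      case False
      hence "\<kappa> / (w * w) \<in> range to_ac" "\<kappa> / (w * w) \<noteq> 0" using \<kappa> K_closed w by auto
      then obtain g where g: "g \<in> L" "g \<noteq> 0" "g * \<sigma>0 g = \<kappa> / (w * w)" using norm_surj by blast
      have "g * w * \<sigma>0 (g * w) * w = (g * \<sigma>0 g) * (w * w) * \<sigma>0 w" by (simp add: \<sigma>0_hom)
      also have "\<dots> = \<kappa> * \<sigma>0 w" unfolding g(3) using w(1) by simp
      finally show ?thesis using g w L_arith(2)[OF g(1) w(2)] by (intro exI[of _ "g * w"]) simp
    qed
    then obtain f where f: "f \<in> L" "f \<noteq> 0" "S \<noteq> {} \<Longrightarrow> f * \<sigma>0 f * w = \<kappa> * \<sigma>0 w" by blast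
    note t = two_torus[OF w(1) f(2)]
    have "1\<^sub>m M * J * diag_of (two_torus w f) \<in> A"
      unfolding coc[OF GK_one t(1)] t(2) using t(3) f(1) f(3) w L_simps(4) by auto
    thus ?thesis using t by blast
  qed
  \<comment> \<open>At index n-1 the group C(r) contributes only a sign and E an element of K, so
    this entry modulo K is an invariant of the class. It is the only one, since the remaining
    freedom is absorbed by a suitable \<open>two_torus\<close>.\<close>
  have equiv: "(Q1 * J * diag_of D1, Q2 * J * diag_of D2) \<in> R \<longleftrightarrow> D1 (n - 1) / D2 (n - 1) \<in> range to_ac"
    if Q: "Q1 \<in> GK" "Q2 \<in> GK" and D: "torus D1" "torus D2"
      and A: "Q1 * J * diag_of D1 \<in> A" "Q2 * J * diag_of D2 \<in> A" for Q1 Q2 D1 D2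
    unfolding equiv_iff[OF Q D A]
  proof
    let ?D = "\<lambda>j. D1 j / D2 j" and ?w = "D1 (n - 1) / D2 (n - 1)"
    have tD: "torus ?D" by (rule torus_div[OF D])
    have nz: "D1 j \<noteq> 0" "D2 j \<noteq> 0" "\<sigma>0 (D1 j) \<noteq> 0" "\<sigma>0 (D2 j) \<noteq> 0" if "j < M" for j
      using torus_nonzero[OF D(1) that] torus_nonzero[OF D(2) that] \<sigma>0_hom by simp_all
    {
      assume "\<exists>E. torus E \<and> (\<forall>j<M. E j \<in> L \<and> \<sigma>0 (E j) = E (cpi j)) \<and> Ad_tensor (diag_of (\<lambda>j. ?D j / E j)) r = r"
      then obtain E where E: "torus E" "E (n - 1) \<in> L" "\<sigma>0 (E (n - 1)) = E (cpi (n - 1))"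
        and c: "Ad_tensor (diag_of (\<lambda>j. ?D j / E j)) r = r" using n1 by blast
      have EK: "E (n - 1) \<in> range to_ac" using fixed_in_K[OF E(2)] E(3) unfolding cpi_mid by blast
      have "?w / E (n - 1) * (?w / E (n - 1)) = 1" using c unfolding cent_iff[OF torus_div[OF tD E(1)]] by blast
      hence "?w / E (n - 1) = 1 \<or> ?w / E (n - 1) = - 1" unfolding square_eq_1_iff .
      moreover have "v = b \<or> v = - b" if "v / b = 1 \<or> v / b = - 1" "b \<noteq> 0" for v b :: Kbar
        using that by (auto simp: divide_eq_eq)
      ultimately have "?w = E (n - 1) \<or> ?w = - E (n - 1)" using torus_nonzero[OF E(1) n1] by blast
      thus "?w \<in> range to_ac" using EK by (metis imageE rangeI to_ac_minus)
    next
      assume w: "?w \<in> range to_ac"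
      have w0: "?w \<noteq> 0" using nz[OF n1] by simp
      have rr: "ratio ?D k = ratio D1 k / ratio D2 k" if "k \<in> S" for k
        by (rule ratio_div)
      \<comment> \<open>Here f is the quotient of the two ratios. Dividing the two norm equations
        cancels \<kappa>, and the rest cancels because the quotient of the entries at n-1 is fixed
        by \<sigma>0.\<close>
      have "\<exists>f. f \<in> L \<and> f * \<sigma>0 f = 1 \<and> (\<forall>k\<in>S. f = ratio ?D k)"
      proof (cases "S = {}")
        case True thus ?thesis using L_simps(6) by (intro exI[of _ 1]) (simp add: \<sigma>0_hom)
      next
        case False
        then obtain k where k: "k \<in> S" by blast
        note i = S_index[OF k]
        have c1: "ratio D1 k / D1 (n - 1) \<in> L" "ratio D1 k * \<sigma>0 (ratio D1 k) * D1 (n - 1) = \<kappa> * \<sigma>0 (D1 (n - 1))"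
          using A(1) k unfolding coc[OF Q(1) D(1)] by blast+
        have c2: "ratio D2 k / D2 (n - 1) \<in> L" "ratio D2 k * \<sigma>0 (ratio D2 k) * D2 (n - 1) = \<kappa> * \<sigma>0 (D2 (n - 1))"
          using A(2) k unfolding coc[OF Q(2) D(2)] by blast+
        have r: "ratio D1 k \<noteq> 0" "ratio D2 k \<noteq> 0" using nz i(1,2,9) by (simp_all add: ratio_def)
        have fr: "ratio ?D k = (ratio D1 k / D1 (n - 1)) / (ratio D2 k / D2 (n - 1)) * ?w"
          unfolding rr[OF k] using r nz[OF n1] by (simp add: field_simps)
        have fL: "ratio ?D k \<in> L"
          unfolding fr by (rule L_arith(2)[OF L_simps(4)[OF c1(1) c2(1)] subsetD[OF L_base w]])
        have sw: "\<sigma>0 (D1 (n - 1)) / \<sigma>0 (D2 (n - 1)) = D1 (n - 1) / D2 (n - 1)"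
          using w by (auto simp flip: \<sigma>0_hom(8))
        have e: "ratio D1 k * \<sigma>0 (ratio D1 k) = \<kappa> * (\<sigma>0 (D1 (n - 1)) / D1 (n - 1))"
          "ratio D2 k * \<sigma>0 (ratio D2 k) = \<kappa> * (\<sigma>0 (D2 (n - 1)) / D2 (n - 1))"
          using c1(2) c2(2) nz[OF n1] by (simp_all add: field_simps)
        have "ratio ?D k * \<sigma>0 (ratio ?D k) = (ratio D1 k * \<sigma>0 (ratio D1 k)) / (ratio D2 k * \<sigma>0 (ratio D2 k))"
          unfolding rr[OF k] by (simp add: \<sigma>0_hom)
        also have "\<dots> = (\<sigma>0 (D1 (n - 1)) / \<sigma>0 (D2 (n - 1))) / (D1 (n - 1) / D2 (n - 1))"
        proof -
          have "x * (a / b) / (x * (c / d)) = a / c / (b / d)" if "x \<noteq> 0" for x a b c d :: Kbar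
            using that by simp
          thus ?thesis unfolding e using \<kappa>[OF k] by blast
        qed
        also have "\<dots> = 1" unfolding sw using w0 by simp
        finally have norm: "ratio ?D k * \<sigma>0 (ratio ?D k) = 1" .
        have "\<forall>k'\<in>S. ratio ?D k = ratio ?D k'"
        proof
          fix k' assume "k' \<in> S"
          hence "k = k'" by (rule S_unique(2)[OF k])
          thus "ratio ?D k = ratio ?D k'" by (rule arg_cong)
        qed
        thus ?thesis using fL norm by blast
      qed
      then obtain f where f: "f \<in> L" "f * \<sigma>0 f = 1" "\<And>k. k \<in> S \<Longrightarrow> f = ratio ?D k" by blast
      have f0: "f \<noteq> 0" using f(2) by auto
      let ?E = "two_torus ?w f"
      note t = two_torus[OF w0 f0]
      note tE = torus_div[OF tD t(1)]
      have "ratio (\<lambda>j. ?D j / ?E j) k = ?D (n - 1) / ?E (n - 1)" if k: "k \<in> S" for k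
      proof -
        have "ratio (\<lambda>j. ?D j / ?E j) k = ratio ?D k / ratio ?E k" by (rule ratio_div)
        also have "\<dots> = 1" unfolding t(3)[OF k] using f(3)[OF k] f0 by simp
        finally show ?thesis unfolding t(2) using w0 by simp
      qed
      hence "Ad_tensor (diag_of (\<lambda>j. ?D j / ?E j)) r = r"
        unfolding cent_ratio[OF tE] using t(2) w0 by simp
      thus "\<exists>E. torus E \<and> (\<forall>j<M. E j \<in> L \<and> \<sigma>0 (E j) = E (cpi j)) \<and> Ad_tensor (diag_of (\<lambda>j. ?D j / E j)) r = r"
        using t(1) two_torus_fixed[OF w f(1,2)] by blast
    }
  qed
  \<comment> \<open>The cocycles whose entry at n-1 is c times an element of K. The values c = 1 and
    c = s give the two classes, and they differ because s is not in K.\<close>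
  define B where "B c = {x \<in> A. \<exists>Q\<in>GK. \<exists>D. torus D \<and> x = Q * J * diag_of D \<and> D (n - 1) / c \<in> range to_ac}" for c
  have nz: "D (n - 1) \<noteq> 0" if "torus D" for D :: "nat \<Rightarrow> Kbar" by (rule torus_nonzero[OF that n1])
  have sB: "(x, y) \<in> R" if xB: "x \<in> B c" and yB: "y \<in> B c" and c: "c \<noteq> 0" for x y c
  proof -
    obtain Q1 D1 where 1: "x \<in> A" "Q1 \<in> GK" "torus D1" "x = Q1 * J * diag_of D1" "D1 (n - 1) / c \<in> range to_ac"
      using xB unfolding B_def by blast
    obtain Q2 D2 where 2: "y \<in> A" "Q2 \<in> GK" "torus D2" "y = Q2 * J * diag_of D2" "D2 (n - 1) / c \<in> range to_ac"
      using yB unfolding B_def by blast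
    have eq: "D1 (n - 1) / D2 (n - 1) = D1 (n - 1) / c / (D2 (n - 1) / c)" using c by simp
    have "D1 (n - 1) / D2 (n - 1) \<in> range to_ac" unfolding eq by (rule K_closed(2)[OF 1(5) 2(5)])
    thus ?thesis using equiv[OF 1(2) 2(2) 1(3) 2(3)] 1 2 by simp
  qed
  have diff: "(x, y) \<notin> R" if xB: "x \<in> B 1" and yB: "y \<in> B s" for x y
  proof
    assume xy: "(x, y) \<in> R"
    obtain Q1 D1 where 1: "x \<in> A" "Q1 \<in> GK" "torus D1" "x = Q1 * J * diag_of D1" "D1 (n - 1) / 1 \<in> range to_ac"
      using xB unfolding B_def by blast
    obtain Q2 D2 where 2: "y \<in> A" "Q2 \<in> GK" "torus D2" "y = Q2 * J * diag_of D2" "D2 (n - 1) / s \<in> range to_ac"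
      using yB unfolding B_def by blast
    have "D1 (n - 1) / D2 (n - 1) \<in> range to_ac" using equiv[OF 1(2) 2(2) 1(3) 2(3)] 1 2 xy by simp
    moreover have "s = D1 (n - 1) / 1 / (D1 (n - 1) / D2 (n - 1)) / (D2 (n - 1) / s)"
      using nz[OF 1(3)] nz[OF 2(3)] by (simp add: field_simps)
    ultimately have "s \<in> range to_ac" using K_closed(2) 1(5) 2(5) by metis
    thus False using s_notin_K by blast
  qed
  have cover: "A = B 1 \<union> B s"
  proof
    show "A \<subseteq> B 1 \<union> B s"
    proof
      fix x assume x: "x \<in> A"
      obtain Q D where QD: "Q \<in> GK" "torus D" "x = Q * J * diag_of D" using cocycle_form[OF x] by blast
      have "D (n - 1) * D (n - 1) \<in> range to_ac" using x coc[OF QD(1,2)] QD(3) by blast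
      hence "D (n - 1) / 1 \<in> range to_ac \<or> D (n - 1) / s \<in> range to_ac" using sqrt_of_K by simp
      thus "x \<in> B 1 \<union> B s" unfolding B_def using x QD by blast
    qed
  qed (auto simp: B_def)
  have refl: "(x, x) \<in> R" if "x \<in> A" for x using that cover sB[of x 1 x] sB[of x s x] by auto
  have disj: "B 1 \<inter> B s = {}" using diff refl cover by blast
  have sym: "(x, y) \<notin> R" if xB: "x \<in> B s" and yB: "y \<in> B 1" for x y
  proof
    assume xy: "(x, y) \<in> R"
    obtain Q1 D1 where 1: "x \<in> A" "Q1 \<in> GK" "torus D1" "x = Q1 * J * diag_of D1"
      using xB unfolding B_def by blast
    obtain Q2 D2 where 2: "y \<in> A" "Q2 \<in> GK" "torus D2" "y = Q2 * J * diag_of D2"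
      using yB unfolding B_def by blast
    have "D1 (n - 1) / D2 (n - 1) \<in> range to_ac" using equiv[OF 1(2) 2(2) 1(3) 2(3)] 1 2 xy by simp
    hence "1 / (D1 (n - 1) / D2 (n - 1)) \<in> range to_ac" using K_closed(2)[of 1] by (metis rangeI to_ac_1)
    hence "(y, x) \<in> R" using equiv[OF 2(2) 1(2) 2(3) 1(3)] 1 2 by simp
    thus False using diff xB yB by blast
  qed
  have RA: "(x, y) \<in> R \<Longrightarrow> x \<in> A \<and> y \<in> A" for x y by (auto simp: twisted_equiv_def)
  have ne: "B c \<noteq> {}" if "c \<in> {1, s}" for c
  proof -
    have c: "c \<noteq> 0" "c \<in> L" "c * c \<in> range to_ac"
      using that s_in_L L_simps(6) to_ac_1[symmetric] by (auto intro: rangeI)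
    obtain D where D: "torus D" "D (n - 1) = c" "1\<^sub>m M * J * diag_of D \<in> A" using ex[OF c] by blast
    have "D (n - 1) / c = to_ac 1" using D(2) c(1) by simp
    hence "1\<^sub>m M * J * diag_of D \<in> B c" unfolding B_def using D GK_one by blast
    thus ?thesis by blast
  qed
  have "(x, y) \<in> R \<longleftrightarrow> (x \<in> B 1 \<and> y \<in> B 1) \<or> (x \<in> B s \<and> y \<in> B s)" for x y
  proof
    assume xy: "(x, y) \<in> R"
    have "x \<in> B 1 \<or> x \<in> B s" "y \<in> B 1 \<or> y \<in> B s" using RA[OF xy] cover by blast+
    thus "(x \<in> B 1 \<and> y \<in> B 1) \<or> (x \<in> B s \<and> y \<in> B s)" using diff[of x y] sym[of x y] xy by blast
  qed (use sB[of x 1 y] sB[of x s y] in auto)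
  thus ?thesis unfolding twisted_cohomology_def
    by (rule card_two_classes[OF _ cover disj]) (use ne in auto)
qed

end

theorem theorem4p9:
  fixes ty :: classical_type and n :: nat
    and \<Gamma>1 \<Gamma>2 :: "nat set" and \<tau> :: "nat \<Rightarrow> nat" and r :: "Kbar tensor"
    and sqrt_h :: Kbar and \<sigma>0 :: "Kbar \<Rightarrow> Kbar"
  assumes n: "1 \<le> n" "ty = Type_D \<Longrightarrow> 3 \<le> n"
    and r: "bd_r_matrix ty n \<Gamma>1 \<Gamma>2 \<tau> r"
    and conj: "\<exists>x \<in> classical_group ty n. Ad_tensor x r = flip r"
    and triple: "(\<Gamma>1 = {} \<and> \<Gamma>2 = {}) \<or>
      (ty = Type_D \<and> odd n \<and>
        ((\<Gamma>1 = {n - 1} \<and> \<tau> (n - 1) = n) \<or>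
         (\<Gamma>1 = {n} \<and> \<tau> n = n - 1) \<or>
         (\<exists>k \<in> {1..n} - {n - 1, n}. \<Gamma>1 = {n - 1, k} \<and> \<tau> (n - 1) = k \<and> \<tau> k = n) \<or>
         (\<exists>k \<in> {1..n} - {n - 1, n}. \<Gamma>1 = {n, k} \<and> \<tau> n = k \<and> \<tau> k = n - 1)))"
    and sqrt_h: "sqrt_h ^ 2 = to_ac fls_X"
    and \<sigma>0: "\<sigma>0 \<in> Gal (range to_ac)" "\<sigma>0 sqrt_h = - sqrt_h"
  shows "(\<Gamma>1 = {} \<and> \<Gamma>2 = {} \<longrightarrow> card (twisted_cohomology ty n sqrt_h \<sigma>0 r) = 1) \<and>
         (\<not> (\<Gamma>1 = {} \<and> \<Gamma>2 = {}) \<longrightarrow> card (twisted_cohomology ty n sqrt_h \<sigma>0 r) = 2)"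
proof -
  interpret twisted_setting ty n sqrt_h \<sigma>0 using n sqrt_h \<sigma>0 by unfold_locales
  obtain J m where J: "J \<in> classical_group ty n" "\<forall>i<M. \<forall>j<M. J $$ (i, j) \<in> L"
    "map_mat \<sigma>0 J = J * monomial_mat M cpi m" "\<forall>j<M. m j \<noteq> 0"
    "ty = Type_D \<and> odd n \<longrightarrow> m (n - 1) = 1 \<and> m n = 1" using base_cocycle_exists by blast
  interpret base_cocycle ty n sqrt_h \<sigma>0 J m using J by unfold_locales blast+
  show ?thesis
  proof (cases "\<Gamma>1 = {} \<and> \<Gamma>2 = {}")
    case True
    then obtain e r0 where e: "bd_data ty n e {} (\<lambda>_. 0) r0 r" using bd_data_empty r by blast
    interpret bd_data ty n e "{}" "\<lambda>_. 0" r0 r by (rule e)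
    interpret cocycle_setting ty n sqrt_h \<sigma>0 J m e "{}" "\<lambda>_. 0" r0 r using conj by unfold_locales
    show ?thesis using True card_empty by simp
  next
    case False
    hence odd_D: "ty = Type_D" "odd n" using triple by blast+
    \<comment> \<open>Each of the four triples is written as a chain from one end of the fork to the
      other.\<close>
    have "\<exists>p q S. p \<in> {n - 1, n} \<and> q \<in> {n - 1, n} \<and> p \<noteq> q \<and> ((S = {} \<and> \<Gamma>1 = {p} \<and> \<tau> p = q) \<or>
      (\<exists>k\<in>{1..n - 2}. S = {k} \<and> \<Gamma>1 = {p, k} \<and> \<tau> p = k \<and> \<tau> k = q))"
    proof -
      have n1: "n - 1 \<noteq> n" "n \<noteq> n - 1" using n(1) by auto
      from triple False show ?thesis
      proof (elim disjE conjE bexE)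
        fix k assume k: "k \<in> {1..n} - {n - 1, n}" and 1: "\<Gamma>1 = {n - 1, k}" "\<tau> (n - 1) = k" "\<tau> k = n"
        have "k \<in> {1..n - 2}" using k by auto
        thus ?thesis
          by (intro exI[of _ "n - 1"] exI[of _ n] exI[of _ "{k}"] conjI disjI2 bexI[of _ k] 1 n1 refl insertI1 insertI2)
      next
        fix k assume k: "k \<in> {1..n} - {n - 1, n}" and 1: "\<Gamma>1 = {n, k}" "\<tau> n = k" "\<tau> k = n - 1"
        have "k \<in> {1..n - 2}" using k by auto
        thus ?thesis
          by (intro exI[of _ n] exI[of _ "n - 1"] exI[of _ "{k}"] conjI disjI2 bexI[of _ k] 1 n1 refl insertI1 insertI2)
      next
        assume "\<Gamma>1 = {n - 1}" "\<tau> (n - 1) = n"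
        thus ?thesis using n1 by (intro exI[of _ "n - 1"] exI[of _ n] exI[of _ "{}"] conjI disjI1) simp_all
      next
        assume "\<Gamma>1 = {n}" "\<tau> n = n - 1"
        thus ?thesis using n1 by (intro exI[of _ n] exI[of _ "n - 1"] exI[of _ "{}"] conjI disjI1) simp_all
      qed simp
    qed
    then obtain p q S where pqS: "p \<in> {n - 1, n}" "q \<in> {n - 1, n}" "p \<noteq> q" "(S = {} \<and> \<Gamma>1 = {p} \<and> \<tau> p = q) \<or>
      (\<exists>k\<in>{1..n - 2}. S = {k} \<and> \<Gamma>1 = {p, k} \<and> \<tau> p = k \<and> \<tau> k = q)" by blast
    interpret type_D_case ty n p q S \<Gamma>1 \<tau> using odd_D(1) pqS by unfold_locales
    obtain e r0 where e: "bd_data ty n e wedges rk r0 r"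
      using bd_data_exists[OF r, of rk] tau_step by blast
    interpret bd_data ty n e wedges rk r0 r by (rule e)
    interpret odd_D_setting ty n sqrt_h \<sigma>0 J m e wedges rk r0 r p q S \<Gamma>1 \<tau>
      by unfold_locales (use conj odd_D(2) in auto)
    show ?thesis using False card_odd_D by simp
  qed
qed

end
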